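(* Let $R\subset\mathbb R^N$ be a root system with multiplicity function $k\ge0$, and let $(X_t)_{t\ge0}$ be a Dunkl process on $\mathbb R^N$ of type $R$ with multiplicity $k$ and drift $\lambda\in\mathbb R^N$ such that its initial distribution $P_{X_0}$ is Dunkl-$\lambda$-radial. Then for all $t\ge0$ the distribution $P_{X_t}$ is Dunkl-$\lambda$-radial, and $(\|X_t\|)_{t\ge0}$ is a one-dimensional Bessel process on $[0,\infty)$ with multiplicity $\gamma+N/2-1/2$ and drift $\|\lambda\|$.
   Context: $\mathbb R^N$ carries the usual scalar product $\langle\cdot,\cdot\rangle$ (extended bilinearly to $\mathbb C^N$) and norm $\|\cdot\|$. A root system $R\subset\mathbb R^N\setminus\{0\}$ is a finite set with $\sigma_\alpha(R)=R$ for all $\alpha\in R$, where $\sigma_\alpha$ is the orthogonal reflection in the hyperplane $\alpha^\perp$; $W$ is the finite group generated by the $\sigma_\alpha$; $R_+\subset R$ is a fixed positive subsystem; $k:R\to[0,\infty)$ is a $W$-invariant multiplicity function; $\gamma=\sum_{\alpha\in R_+}k(\alpha)$. Dunkl operators: $T_\xi(k)f(x)=\partial_\xi f(x)+\sum_{\alpha\in R_+}k(\alpha)\langle\alpha,\xi\rangle\frac{f(x)-f(\sigma_\alpha x)}{\langle\alpha,x\rangle}$. For $w\in\mathbb C^N$ the Dunkl kernel $E_k(\cdot,w)$ is the unique holomorphic $f$ on $\mathbb C^N$ with $T_\xi(k)f=\langle\xi,w\rangle f$ for all $\xi\in\mathbb C^N$ and $f(0)=1$. Let $w_k(x)=\prod_{\alpha\in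 R_+}|\langle\alpha,x\rangle|^{2k(\alpha)}$ and $c_k>0$ with $c_k\int_{\mathbb R^N}e^{-\|y\|^2/2}w_k(y)\,dy=1$. A Dunkl process with drift $\lambda$ is a time-homogeneous Feller process on $\mathbb R^N$ with RCLL paths and transition kernels $$K_t^{\lambda,k,Dunkl}(x,A)=\frac{c_k\,e^{-\|\lambda\|^2t/2}}{t^{\gamma+N/2}}\int_Ae^{-(\|x\|^2+\|y\|^2)/(2t)}\,\frac{E_k(\frac x{\sqrt t},\frac y{\sqrt t})E_k(y,\lambda)}{E_k(x,\lambda)}\,w_k(y)\,dy\quad(t>0).$$ Spherical Bessel functions: $j_\alpha(z)=\Gamma(\alpha+1)\sum_{n=0}^\infty\frac{(-1)^n(z/2)^{2n}}{n!\,\Gamma(n+\alpha+1)}$ for $\alpha\ge-1/2$, $z\in\mathbb C$. Let $\sigma$ be the surface measure on the unit sphere $S^{N-1}$ and $d_k=\int_{S^{N-1}}w_k\,d\sigma$. A probability measure $\mu$ on $\mathbb R^N$ is Dunkl-$\lambda$-radial if there is a probability measure $\nu$ on $[0,\infty)$ such that for all bounded measurable $f$ on $\mathbb R^N$ $$\int_{\mathbb R^N}f\,d\mu=\frac1{d_k}\int_0^\infty\int_{S^{N-1}}\frac{f(rz)E_k(\lambda,rz)}{j_{\gamma+N/2-1}(i\|\lambda\|r)}\,w_k(z)\,d\sigma(z)\,d\nu(r).$$ A one-dimensional Bessel process on $[0,\infty)$ with multiplicity $\kappa\ge0$ and drift $\rho\ge0$ is a diffusion on $[0,\infty)$ with continuous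 paths (up to modification) and transition kernels, for $t>0$, $x\ge0$ and Borel $A\subset[0,\infty)$, $$\frac{e^{-\rho^2t/2}}{2^{\kappa-1/2}\Gamma(\kappa+1/2)\,t^{\kappa+1/2}}\int_Ae^{-(x^2+y^2)/(2t)}\,\frac{j_{\kappa-1/2}(ixy/t)\,j_{\kappa-1/2}(iy\rho)}{j_{\kappa-1/2}(ix\rho)}\,y^{2\kappa}\,dy.$$ *)

theory Defs
  imports "HOL-Probability.Probability"
begin

section \<open>Root systems and multiplicities\<close>

definition refl_root :: "real^'n \<Rightarrow> real^'n \<Rightarrow> real^'n" where
  "refl_root \<alpha> x = x - (2 * (\<alpha> \<bullet> x) / (\<alpha> \<bullet> \<alpha>)) *\<^sub>R \<alpha>"

text \<open>Root systems are neither required to be reduced, nor crystallographic, nor spanning.\<close>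

definition root_system :: "(real^'n) set \<Rightarrow> bool" where
  "root_system R \<longleftrightarrow> finite R \<and> 0 \<notin> R \<and> (\<forall>\<alpha>\<in>R. refl_root \<alpha> ` R = R)"

definition positive_subsystem :: "(real^'n) set \<Rightarrow> (real^'n) set \<Rightarrow> bool" where
  "positive_subsystem R Rp \<longleftrightarrow>
     (\<exists>\<beta>. (\<forall>\<alpha>\<in>R. \<alpha> \<bullet> \<beta> \<noteq> 0) \<and> Rp = {\<alpha>\<in>R. \<alpha> \<bullet> \<beta> > 0})"

text \<open>Since reflections are involutions, closing under composition with reflections already gives
  the generated group.\<close>

inductive_set reflection_group :: "(real^'n) set \<Rightarrow> (real^'n \<Rightarrow> real^'n) set"
  for R :: "(real^'n) set" where
  "id \<in> reflection_group R"
| "\<lbrakk>\<alpha> \<in> R; g \<in> reflection_group R\<rbrakk> \<Longrightarrow> refl_root \<alpha> \<circ> g \<in> reflection_group R"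

definition multiplicity_fun :: "(real^'n) set \<Rightarrow> (real^'n \<Rightarrow> real) \<Rightarrow> bool" where
  "multiplicity_fun R k \<longleftrightarrow>
     (\<forall>\<alpha>\<in>R. k \<alpha> \<ge> 0) \<and> (\<forall>g\<in>reflection_group R. \<forall>\<alpha>\<in>R. k (g \<alpha>) = k \<alpha>)"

definition mult_gamma :: "(real^'n) set \<Rightarrow> (real^'n \<Rightarrow> real) \<Rightarrow> real" where
  "mult_gamma Rp k = (\<Sum>\<alpha>\<in>Rp. k \<alpha>)"

section \<open>Dunkl operators and the Dunkl kernel\<close>

text \<open>The bilinear (not sesquilinear) extension of the scalar product to complex vectors.\<close>

definition cdot :: "complex^'n \<Rightarrow> complex^'n \<Rightarrow> complex" where
  "cdot x y = (\<Sum>i\<in>UNIV. x $ i * y $ i)"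

definition cvec :: "real^'n \<Rightarrow> complex^'n" where
  "cvec x = (\<chi> i. complex_of_real (x $ i))"

definition crefl_root :: "real^'n \<Rightarrow> complex^'n \<Rightarrow> complex^'n" where
  "crefl_root \<alpha> x = x - (2 * cdot (cvec \<alpha>) x / cdot (cvec \<alpha>) (cvec \<alpha>)) *s cvec \<alpha>"

definition entire_on_CN :: "(complex^'n \<Rightarrow> complex) \<Rightarrow> bool" where
  "entire_on_CN f \<longleftrightarrow>
     (\<forall>x. \<exists>D. (f has_derivative D) (at x) \<and> (\<forall>c v. D (c *s v) = c * D v))"

text \<open>The difference quotient of a Dunkl operator has a removable singularity along the
  hyperplane orthogonal to the root; there its value is the continuous extension.\<close>

definition dunkl_quotient :: "real^'n \<Rightarrow> (complex^'n \<Rightarrow> complex) \<Rightarrow> complex^'n \<Rightarrow> complex" where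
  "dunkl_quotient \<alpha> f x =
     (let q = (\<lambda>y. (f y - f (crefl_root \<alpha> y)) / cdot (cvec \<alpha>) y)
      in if cdot (cvec \<alpha>) x \<noteq> 0 then q x
         else Lim (at x within {y. cdot (cvec \<alpha>) y \<noteq> 0}) q)"

definition dunkl_op ::
    "(real^'n) set \<Rightarrow> (real^'n \<Rightarrow> real) \<Rightarrow> complex^'n \<Rightarrow> (complex^'n \<Rightarrow> complex)
     \<Rightarrow> complex^'n \<Rightarrow> complex" where
  "dunkl_op Rp k \<xi> f x =
     frechet_derivative f (at x) \<xi> +
     (\<Sum>\<alpha>\<in>Rp. complex_of_real (k \<alpha>) * cdot (cvec \<alpha>) \<xi> * dunkl_quotient \<alpha> f x)"

definition dunkl_kernel ::
    "(real^'n) set \<Rightarrow> (real^'n \<Rightarrow> real) \<Rightarrow> complex^'n \<Rightarrow> complex^'n \<Rightarrow> complex" where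
  "dunkl_kernel Rp k z w =
     (THE f. entire_on_CN f \<and> (\<forall>\<xi> x. dunkl_op Rp k \<xi> f x = cdot \<xi> w * f x) \<and> f 0 = 1) z"

text \<open>The Dunkl kernel at real arguments; it is kept complex-valued.\<close>

abbreviation dunkl_E ::
    "(real^'n) set \<Rightarrow> (real^'n \<Rightarrow> real) \<Rightarrow> real^'n \<Rightarrow> real^'n \<Rightarrow> complex" where
  "dunkl_E Rp k x y \<equiv> dunkl_kernel Rp k (cvec x) (cvec y)"

text \<open>Real powers with \<open>0\<^sup>0 = 1\<close>; note that \<^term>\<open>(0::real) powr 0 = 0\<close>.\<close>

definition rpow :: "real \<Rightarrow> real \<Rightarrow> real" where
  "rpow x a = (if a = 0 then 1 else x powr a)"

definition dunkl_weight :: "(real^'n) set \<Rightarrow> (real^'n \<Rightarrow> real) \<Rightarrow> real^'n \<Rightarrow> real" where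
  "dunkl_weight Rp k x = (\<Prod>\<alpha>\<in>Rp. rpow \<bar>\<alpha> \<bullet> x\<bar> (2 * k \<alpha>))"

definition dunkl_c :: "(real^'n) set \<Rightarrow> (real^'n \<Rightarrow> real) \<Rightarrow> real" where
  "dunkl_c Rp k = 1 / (LINT y|lborel. exp (- (norm y)\<^sup>2 / 2) * dunkl_weight Rp k y)"

section \<open>Spherical Bessel functions and the surface measure\<close>

definition bessel_j :: "real \<Rightarrow> complex \<Rightarrow> complex" where
  "bessel_j a z = complex_of_real (Gamma (a + 1)) *
     (\<Sum>n. (-1) ^ n * (z / 2) ^ (2 * n) / complex_of_real (fact n * Gamma (real n + a + 1)))"

text \<open>Surface measure of \<open>A\<close> is \<open>N\<close> times the volume of the cone
  \<open>{r z | 0 < r \<le> 1, z \<in> A}\<close>. For \<open>N = 1\<close> this is the counting measure on \<open>{-1, 1}\<close>.\<close>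

definition sphere_measure :: "(real^'n) measure" where
  "sphere_measure = scale_measure (of_nat CARD('n))
     (distr (restrict_space lborel (cball 0 1 - {0})) (restrict_space borel (sphere 0 1)) sgn)"

definition dunkl_d :: "(real^'n) set \<Rightarrow> (real^'n \<Rightarrow> real) \<Rightarrow> real" where
  "dunkl_d Rp k = (LINT z|sphere_measure. dunkl_weight Rp k z)"

definition dunkl_radial ::
    "(real^'n) set \<Rightarrow> (real^'n \<Rightarrow> real) \<Rightarrow> real^'n \<Rightarrow> (real^'n) measure \<Rightarrow> bool" where
  "dunkl_radial Rp k lam \<mu> \<longleftrightarrow>
     prob_space \<mu> \<and> sets \<mu> = sets borel \<and>
     (\<exists>\<nu> :: real measure. prob_space \<nu> \<and> sets \<nu> = sets (restrict_space borel {0..}) \<and>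
        (\<forall>f :: real^'n \<Rightarrow> real. f \<in> borel_measurable borel \<longrightarrow> bounded (range f) \<longrightarrow>
           complex_of_real (LINT x|\<mu>. f x) =
           1 / complex_of_real (dunkl_d Rp k) *
           (LINT r|\<nu>. LINT z|sphere_measure.
              complex_of_real (f (r *\<^sub>R z)) * dunkl_E Rp k lam (r *\<^sub>R z) /
              bessel_j (mult_gamma Rp k + real CARD('n) / 2 - 1)
                (\<i> * complex_of_real (norm lam * r)) *
              complex_of_real (dunkl_weight Rp k z))))"

section \<open>Feller processes\<close>

text \<open>Continuous functions on a closed state space \<open>S\<close> that vanish at infinity.\<close>

definition C0 :: "'a::euclidean_space set \<Rightarrow> ('a \<Rightarrow> real) set" where
  "C0 S = {f. continuous_on S f \<and> (f \<longlongrightarrow> 0) (inf at_infinity (principal S))}"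

definition feller_semigroup ::
    "'a::euclidean_space set \<Rightarrow> (real \<Rightarrow> 'a \<Rightarrow> 'a measure) \<Rightarrow> bool" where
  "feller_semigroup S K \<longleftrightarrow>
     (\<forall>t\<ge>0. K t \<in> restrict_space borel S \<rightarrow>\<^sub>M prob_algebra (restrict_space borel S)) \<and>
     (\<forall>x\<in>S. K 0 x = return (restrict_space borel S) x) \<and>
     (\<forall>s\<ge>0. \<forall>t\<ge>0. \<forall>x\<in>S. K (s + t) x = K s x \<bind> K t) \<and>
     (\<forall>f\<in>C0 S. \<forall>t\<ge>0. (\<lambda>x. LINT y|K t x. f y) \<in> C0 S) \<and>
     (\<forall>f\<in>C0 S. uniform_limit S (\<lambda>t x. LINT y|K t x. f y) f (at_right 0))"

definition natural_filtration ::
    "'w measure \<Rightarrow> 'a::euclidean_space set \<Rightarrow> (real \<Rightarrow> 'w \<Rightarrow> 'a) \<Rightarrow> real \<Rightarrow> 'w measure" where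
  "natural_filtration M S X s = sigma (space M)
     {X u -` A \<inter> space M | u A. 0 \<le> u \<and> u \<le> s \<and> A \<in> sets (restrict_space borel S)}"

text \<open>Time-homogeneous Markov process with state space \<open>S\<close> and transition kernels \<open>K\<close>.\<close>

definition markov_process ::
    "'w measure \<Rightarrow> 'a::euclidean_space set \<Rightarrow> (real \<Rightarrow> 'a \<Rightarrow> 'a measure) \<Rightarrow> (real \<Rightarrow> 'w \<Rightarrow> 'a)
     \<Rightarrow> bool" where
  "markov_process M S K X \<longleftrightarrow>
     prob_space M \<and>
     (\<forall>t\<ge>0. X t \<in> M \<rightarrow>\<^sub>M restrict_space borel S) \<and>
     (\<forall>s\<ge>0. \<forall>t\<ge>0. \<forall>A\<in>sets (restrict_space borel S).
        AE \<omega> in M.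
          real_cond_exp M (natural_filtration M S X s) (indicator (X (s + t) -` A \<inter> space M)) \<omega>
          = measure (K t (X s \<omega>)) A)"

definition feller_process ::
    "'w measure \<Rightarrow> 'a::euclidean_space set \<Rightarrow> (real \<Rightarrow> 'a \<Rightarrow> 'a measure) \<Rightarrow> (real \<Rightarrow> 'w \<Rightarrow> 'a)
     \<Rightarrow> bool" where
  "feller_process M S K X \<longleftrightarrow> feller_semigroup S K \<and> markov_process M S K X"

definition rcll_paths :: "'w measure \<Rightarrow> (real \<Rightarrow> 'w \<Rightarrow> 'a::topological_space) \<Rightarrow> bool" where
  "rcll_paths M X \<longleftrightarrow> (\<forall>\<omega>\<in>space M.
     (\<forall>t\<ge>0. continuous (at_right t) (\<lambda>s. X s \<omega>)) \<and>
     (\<forall>t>0. \<exists>l. ((\<lambda>s. X s \<omega>) \<longlongrightarrow> l) (at_left t)))"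

definition has_continuous_modification ::
    "'w measure \<Rightarrow> 'a::euclidean_space set \<Rightarrow> (real \<Rightarrow> 'w \<Rightarrow> 'a) \<Rightarrow> bool" where
  "has_continuous_modification M S X \<longleftrightarrow>
     (\<exists>Y. (\<forall>t\<ge>0. Y t \<in> M \<rightarrow>\<^sub>M restrict_space borel S \<and> (AE \<omega> in M. Y t \<omega> = X t \<omega>)) \<and>
          (\<forall>\<omega>\<in>space M. continuous_on {0..} (\<lambda>t. Y t \<omega>)))"

section \<open>Dunkl processes and Bessel processes with drift\<close>

definition dunkl_transition ::
    "(real^'n) set \<Rightarrow> (real^'n \<Rightarrow> real) \<Rightarrow> real^'n \<Rightarrow> real \<Rightarrow> real^'n \<Rightarrow> (real^'n) set
     \<Rightarrow> complex" where
  "dunkl_transition Rp k lam t x A =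
     complex_of_real (dunkl_c Rp k * exp (- (norm lam)\<^sup>2 * t / 2) /
        t powr (mult_gamma Rp k + real CARD('n) / 2)) *
     (LINT y:A|lborel.
        complex_of_real (exp (- ((norm x)\<^sup>2 + (norm y)\<^sup>2) / (2 * t))) *
        (dunkl_E Rp k ((1 / sqrt t) *\<^sub>R x) ((1 / sqrt t) *\<^sub>R y) * dunkl_E Rp k y lam /
           dunkl_E Rp k x lam) *
        complex_of_real (dunkl_weight Rp k y))"

definition dunkl_process ::
    "(real^'n) set \<Rightarrow> (real^'n \<Rightarrow> real) \<Rightarrow> real^'n \<Rightarrow> 'w measure \<Rightarrow> (real \<Rightarrow> 'w \<Rightarrow> real^'n)
     \<Rightarrow> bool" where
  "dunkl_process Rp k lam M X \<longleftrightarrow>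
     (\<exists>K. feller_process M UNIV K X \<and>
        (\<forall>t>0. \<forall>x. \<forall>A\<in>sets borel.
           complex_of_real (measure (K t x) A) = dunkl_transition Rp k lam t x A)) \<and>
     rcll_paths M X"

definition bessel_transition ::
    "real \<Rightarrow> real \<Rightarrow> real \<Rightarrow> real \<Rightarrow> real set \<Rightarrow> complex" where
  "bessel_transition \<kappa> \<rho> t x A =
     complex_of_real (exp (- \<rho>\<^sup>2 * t / 2) /
        (2 powr (\<kappa> - 1/2) * Gamma (\<kappa> + 1/2) * t powr (\<kappa> + 1/2))) *
     (LINT y:A|lborel.
        complex_of_real (exp (- (x\<^sup>2 + y\<^sup>2) / (2 * t))) *
        (bessel_j (\<kappa> - 1/2) (\<i> * complex_of_real (x * y / t)) *
           bessel_j (\<kappa> - 1/2) (\<i> * complex_of_real (y * \<rho>)) /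
           bessel_j (\<kappa> - 1/2) (\<i> * complex_of_real (x * \<rho>))) *
        complex_of_real (rpow y (2 * \<kappa>)))"

text \<open>A diffusion is understood as a (necessarily strong Markov) Feller process with continuous
  paths; path continuity is required up to modification.\<close>

definition bessel_process ::
    "real \<Rightarrow> real \<Rightarrow> 'w measure \<Rightarrow> (real \<Rightarrow> 'w \<Rightarrow> real) \<Rightarrow> bool" where
  "bessel_process \<kappa> \<rho> M X \<longleftrightarrow>
     \<kappa> \<ge> 0 \<and> \<rho> \<ge> 0 \<and>
     (\<exists>K. feller_process M {0..} K X \<and>
        (\<forall>t>0. \<forall>x\<ge>0. \<forall>A\<in>sets (restrict_space borel {0..}).
           complex_of_real (measure (K t x) A) = bessel_transition \<kappa> \<rho> t x A)) \<and>
     has_continuous_modification M {0..} X"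

end

theory Submission
  imports Defs "HOL-Complex_Analysis.Complex_Analysis" "HOL-Real_Asymp.Real_Asymp"
begin

text \<open>The proof rests on one identity. Averaged over the unit sphere against the weight, the Dunkl
  kernel in its first argument becomes a Bessel function of the norm of the second
  (\<open>spherical_mean\<close>). Let \<open>L r\<close> be the law on the sphere of radius \<open>r\<close> that occurs in the definition
  of Dunkl radial measures. If the initial point has law \<open>L r\<close>, the factor \<open>E(x, \<lambda>)\<close> in the density of
  \<open>L r\<close> cancels the denominator of the transition density, and the spherical mean turns the remaining
  integral over the sphere into a function of the norm of the endpoint. Hence, given its norm \<open>s\<close>, the
  endpoint again has law \<open>L s\<close> (\<open>intertwining\<close>). The criterion of Rogers and Pitman now gives both
  that all laws stay mixtures of the \<open>L r\<close> and that the norm is a Markov process (\<open>markov_image\<close>),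
  whose kernels have the Bessel density. The Chapman-Kolmogorov equation and the Feller property of
  the Bessel kernels need no Bessel function identities, since they are inherited from the Dunkl
  semigroup through \<open>L\<close>.

  The kernel is constructed as a power series. Contracting the eigenvalue equations with the point
  itself removes the singular denominators and leaves, for the component of degree \<open>n\<close>, the equation
  \<open>n E\<^sub>n(x) + \<Sum>k(\<alpha>) (E\<^sub>n(x) - E\<^sub>n(\<sigma>\<^sub>\<alpha> x)) = \<langle>x, w\<rangle> E\<^sub>n\<^sub>-\<^sub>1(x)\<close>. The operator on the left is invertible in
  the group algebra, because the reflections carry the total weight \<open>\<gamma>\<close>, smaller than \<open>n + \<gamma>\<close>. A
  maximum principle on finite orbits gives uniqueness and the bound \<open>(\<parallel>x\<parallel> \<parallel>w\<parallel>)\<^sup>n / n!\<close>. That the solutions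
  satisfy the full system of eigenvalue equations (\<open>T_En\<close>) is where the commutativity of the Dunkl
  operators enters: it forces the defect of the system to satisfy a homogeneous equation of the same kind.

  For the spherical mean, integration by parts against the Gaussian and the weight
  (\<open>dunkl_by_parts\<close>) gives a two step recursion for the Gaussian moments of the components. In polar
  coordinates these moments are Gamma factors times the moments over the sphere, which are thereby
  identified with the Bessel coefficients.

  The kernel is nonnegative at real arguments because the transition
  kernels are given to be probability measures: their densities are nonnegative almost everywhere, and
  the kernel is continuous. Continuity of the radial paths comes from the right-continuous
  paths with left limits of the process: a jump of the norm would show up as a step
  between separated sets on every sufficiently fine time grid, whereas the Bessel density makes
  such a step exponentially unlikely in the number of grid points (\<open>B_escape\<close>, \<open>jump_persistent\<close>).\<close>


section \<open>Complex vectors and complexified real maps\<close>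

lemma cdot_add_left: "cdot (x + y) z = cdot x z + cdot y z"
  by (simp add: cdot_def algebra_simps sum.distrib)

lemma cdot_add_right: "cdot z (x + y) = cdot z x + cdot z y"
  by (simp add: cdot_def algebra_simps sum.distrib)

lemma cdot_diff_left: "cdot (x - y) z = cdot x z - cdot y z"
  by (simp add: cdot_def algebra_simps sum_subtractf)

lemma cdot_diff_right: "cdot z (x - y) = cdot z x - cdot z y"
  by (simp add: cdot_def algebra_simps sum_subtractf)

lemma cdot_scale_left: "cdot (c *s x) z = c * cdot x z"
  by (simp add: cdot_def sum_distrib_left algebra_simps)

lemma cdot_scale_right: "cdot z (c *s x) = c * cdot z x"
  by (simp add: cdot_def sum_distrib_left algebra_simps)

lemma cdot_commute: "cdot x y = cdot y x"
  by (simp add: cdot_def algebra_simps)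

lemma cdot_minus_left: "cdot (- x) y = - cdot x y"
  by (simp add: cdot_def sum_negf)

lemma cdot_minus_right: "cdot x (- y) = - cdot x y"
  by (simp add: cdot_def sum_negf)

lemma cdot_zero_right [simp]: "cdot x 0 = 0"
  by (simp add: cdot_def)

lemmas cdot_bilinear = cdot_add_left cdot_add_right cdot_diff_left cdot_diff_right
  cdot_scale_left cdot_scale_right cdot_minus_left cdot_minus_right

lemma cdot_axis: "cdot x (axis i 1) = x $ i"
  by (simp add: cdot_def axis_def if_distrib cong: if_cong)

lemma norm_cdot_le: "cmod (cdot x y) \<le> norm x * norm y"
proof -
  have "cmod (cdot x y) \<le> (\<Sum>i\<in>UNIV. \<bar>cmod (x $ i)\<bar> * \<bar>cmod (y $ i)\<bar>)"
    unfolding cdot_def by (rule order_trans[OF norm_sum]) (simp add: norm_mult)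
  also have "\<dots> \<le> L2_set (\<lambda>i. cmod (x $ i)) UNIV * L2_set (\<lambda>i. cmod (y $ i)) UNIV"
    by (rule L2_set_mult_ineq)
  finally show ?thesis by (simp add: norm_vec_def)
qed

lemma norm_vector_scalar: "norm (c *s x) = cmod c * norm (x :: complex^'n)"
  by (simp add: norm_vec_def norm_mult L2_set_right_distrib)

lemma scaleR_eq_vector_scalar: "r *\<^sub>R (x :: complex^'n) = complex_of_real r *s x"
  by (simp add: vec_eq_iff complex_eq_iff)

lemma bounded_bilinear_cdot: "bounded_bilinear cdot"
proof
  show "cdot (r *\<^sub>R a) b = r *\<^sub>R cdot a b" "cdot a (r *\<^sub>R b) = r *\<^sub>R cdot a b" for r a b
    by (simp_all add: cdot_def scaleR_sum_right)
  show "\<exists>K. \<forall>a b. norm (cdot a b) \<le> norm a * norm b * K"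
    by (rule exI[of _ 1]) (simp add: norm_cdot_le)
qed (simp_all add: cdot_bilinear)

lemmas continuous_on_cdot [continuous_intros] = bounded_bilinear.continuous_on[OF bounded_bilinear_cdot]

lemma bounded_linear_vector_scalar: "bounded_linear (\<lambda>c. c *s (x :: complex^'n))"
proof (rule bounded_linear_intro[where K = "norm x"])
  show "norm (c *s x) \<le> norm c * norm x" for c by (simp add: norm_vector_scalar)
qed (simp_all add: vec_eq_iff algebra_simps)

lemma bounded_linear_vector_scalar_right: "bounded_linear (\<lambda>x. c *s (x :: complex^'n))"
proof (rule bounded_linear_intro[where K = "cmod c"])
  show "norm (c *s x) \<le> norm x * cmod c" for x :: "complex^'n" by (simp add: norm_vector_scalar)
qed (simp_all add: vec_eq_iff algebra_simps)

lemma cvec_add: "cvec (x + y) = cvec x + cvec y"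
  and cvec_diff: "cvec (x - y) = cvec x - cvec y"
  and cvec_minus: "cvec (- x) = - cvec x"
  and cvec_scaleR: "cvec (r *\<^sub>R x) = complex_of_real r *s cvec x"
  and cvec_zero [simp]: "cvec 0 = 0"
  by (simp_all add: cvec_def vec_eq_iff)

lemma cdot_cvec: "cdot (cvec x) (cvec y) = complex_of_real (x \<bullet> y)"
  by (simp add: cdot_def cvec_def inner_vec_def)

lemma norm_cvec [simp]: "norm (cvec x) = norm x"
  by (simp add: norm_vec_def cvec_def)

lemma bounded_linear_cvec: "bounded_linear cvec"
  by (rule bounded_linear_intro[where K = 1])
     (simp_all add: cvec_add cvec_scaleR scaleR_eq_vector_scalar)

definition re_vec :: "complex^'n \<Rightarrow> real^'n" where "re_vec z = (\<chi> i. Re (z $ i))"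
definition im_vec :: "complex^'n \<Rightarrow> real^'n" where "im_vec z = (\<chi> i. Im (z $ i))"

text \<open>For a linear map this is its complex linear extension; it carries the reflection group to
  complex vectors without a complex counterpart of the group.\<close>

definition cplx_map :: "(real^'n \<Rightarrow> real^'n) \<Rightarrow> complex^'n \<Rightarrow> complex^'n" where
  "cplx_map g z = cvec (g (re_vec z)) + \<i> *s cvec (g (im_vec z))"

lemma complex_vec_eq: "z = cvec (re_vec z) + \<i> *s cvec (im_vec z)"
  by (simp add: vec_eq_iff cvec_def re_vec_def im_vec_def complex_eq)

lemma re_im_vec_cvec [simp]: "re_vec (cvec a + \<i> *s cvec b) = a" "im_vec (cvec a + \<i> *s cvec b) = b"
  "re_vec (cvec a) = a" "im_vec (cvec a) = 0"
  by (simp_all add: vec_eq_iff cvec_def re_vec_def im_vec_def)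

lemma cplx_map_comp: "cplx_map (g \<circ> h) z = cplx_map g (cplx_map h z)"
  by (simp add: cplx_map_def)

lemma cplx_map_id [simp]: "cplx_map id z = z"
  using complex_vec_eq[of z] by (simp add: cplx_map_def)

lemma cplx_map_cvec: "linear g \<Longrightarrow> cplx_map g (cvec x) = cvec (g x)"
  by (simp add: cplx_map_def linear_0)

lemma re_vec_add: "re_vec (z + w) = re_vec z + re_vec w"
  and im_vec_add: "im_vec (z + w) = im_vec z + im_vec w"
  and re_vec_scale: "re_vec (c *s z) = Re c *\<^sub>R re_vec z - Im c *\<^sub>R im_vec z"
  and im_vec_scale: "im_vec (c *s z) = Re c *\<^sub>R im_vec z + Im c *\<^sub>R re_vec z"
  by (simp_all add: re_vec_def im_vec_def vec_eq_iff)

lemma cplx_map_add: "linear g \<Longrightarrow> cplx_map g (z + w) = cplx_map g z + cplx_map g w"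
  by (simp add: cplx_map_def re_vec_add im_vec_add linear_add cvec_add algebra_simps vec_eq_iff)

lemma cplx_map_scale: "linear g \<Longrightarrow> cplx_map g (c *s z) = c *s cplx_map g z"
  by (simp add: cplx_map_def re_vec_scale im_vec_scale linear_add linear_diff linear_scale
      cvec_add cvec_diff cvec_scaleR vec_eq_iff complex_eq_iff cvec_def algebra_simps)

lemma cdot_re_im: "cdot z w = Complex (re_vec z \<bullet> re_vec w - im_vec z \<bullet> im_vec w)
    (re_vec z \<bullet> im_vec w + im_vec z \<bullet> re_vec w)"
  by (simp add: cdot_def complex_eq_iff re_vec_def im_vec_def inner_vec_def sum.distrib sum_subtractf)

lemma norm_re_im: "(norm (z :: complex^'n))\<^sup>2 = (norm (re_vec z))\<^sup>2 + (norm (im_vec z))\<^sup>2"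
proof -
  have "(norm z)\<^sup>2 = (\<Sum>i\<in>UNIV. (cmod (z $ i))\<^sup>2)"
    by (simp add: norm_vec_def L2_set_def sum_nonneg)
  also have "\<dots> = (norm (re_vec z))\<^sup>2 + (norm (im_vec z))\<^sup>2"
    by (simp add: norm_vec_def L2_set_def sum_nonneg cmod_power2 re_vec_def im_vec_def sum.distrib)
  finally show ?thesis .
qed

lemma norm_cplx_map: "orthogonal_transformation g \<Longrightarrow> norm (cplx_map g z) = norm z"
proof -
  assume "orthogonal_transformation g"
  then have "(norm (cplx_map g z))\<^sup>2 = (norm z)\<^sup>2"
    unfolding norm_re_im[of "cplx_map g z"] norm_re_im[of z]
    by (simp add: cplx_map_def orthogonal_transformation_norm)
  then show ?thesis by simp
qed

lemma cdot_cplx_map: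
  "orthogonal_transformation g \<Longrightarrow> cdot (cplx_map g z) (cplx_map g w) = cdot z w"
  by (simp add: cdot_re_im cplx_map_def orthogonal_transformation_def)

lemma bounded_linear_cplx_map:
  assumes "orthogonal_transformation g" shows "bounded_linear (cplx_map g)"
  using assms orthogonal_transformation_linear[OF assms]
  by (intro bounded_linear_intro[where K = 1])
     (simp_all add: cplx_map_add cplx_map_scale scaleR_eq_vector_scalar norm_cplx_map)

section \<open>Reflections\<close>

lemma linear_refl_root: "linear (refl_root \<alpha>)"
  by (rule linearI) (simp_all add: refl_root_def inner_add_right algebra_simps add_divide_distrib scaleR_add_left)

lemma inner_refl_root: "\<alpha> \<noteq> 0 \<Longrightarrow> refl_root \<alpha> x \<bullet> refl_root \<alpha> y = x \<bullet> y"
  by (simp add: refl_root_def inner_diff_left inner_diff_right field_simps inner_commute)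

lemma orthogonal_refl_root: "\<alpha> \<noteq> 0 \<Longrightarrow> orthogonal_transformation (refl_root \<alpha>)"
  by (simp add: orthogonal_transformation_def linear_refl_root inner_refl_root)

lemma refl_root_invol: "\<alpha> \<noteq> 0 \<Longrightarrow> refl_root \<alpha> (refl_root \<alpha> x) = x"
  by (simp add: refl_root_def inner_diff_right algebra_simps flip: scaleR_add_left)

lemma refl_root_self: "\<alpha> \<noteq> 0 \<Longrightarrow> refl_root \<alpha> \<alpha> = - \<alpha>"
  by (simp add: refl_root_def scaleR_2)

lemma refl_root_minus: "refl_root (- \<alpha>) = refl_root \<alpha>"
  by (simp add: refl_root_def fun_eq_iff)

lemma refl_root_conj:
  assumes "\<beta> \<noteq> 0"
  shows "refl_root \<beta> (refl_root \<alpha> x) = refl_root (refl_root \<beta> \<alpha>) (refl_root \<beta> x)"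
proof -
  have "refl_root \<beta> (refl_root \<alpha> x)
      = refl_root \<beta> x - (2 * (\<alpha> \<bullet> x) / (\<alpha> \<bullet> \<alpha>)) *\<^sub>R refl_root \<beta> \<alpha>"
    unfolding refl_root_def[of \<alpha>]
    by (simp only: linear_diff[OF linear_refl_root] linear_scale[OF linear_refl_root])
  also have "\<dots> = refl_root (refl_root \<beta> \<alpha>) (refl_root \<beta> x)"
    unfolding refl_root_def[of "refl_root \<beta> \<alpha>"] by (simp add: inner_refl_root assms)
  finally show ?thesis .
qed

lemma crefl_root_eq: "crefl_root \<alpha> z = cplx_map (refl_root \<alpha>) z"
proof -
  have "crefl_root \<alpha> (cvec a + \<i> *s cvec b) = cvec (refl_root \<alpha> a) + \<i> *s cvec (refl_root \<alpha> b)" for a b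
    by (simp add: crefl_root_def refl_root_def cdot_bilinear cdot_cvec cvec_diff cvec_scaleR
        vec_eq_iff algebra_simps add_divide_distrib)
  from this[of "re_vec z" "im_vec z"] show ?thesis
    by (simp add: cplx_map_def flip: complex_vec_eq)
qed

lemma crefl_root_cvec: "crefl_root \<alpha> (cvec x) = cvec (refl_root \<alpha> x)"
  by (simp add: crefl_root_eq cplx_map_cvec linear_refl_root)

lemma crefl_root_minus: "crefl_root (- \<alpha>) = crefl_root \<alpha>"
  by (simp add: fun_eq_iff crefl_root_eq refl_root_minus)

lemma crefl_root_scale: "crefl_root \<alpha> (c *s x) = c *s crefl_root \<alpha> x"
  by (simp add: crefl_root_eq cplx_map_scale linear_refl_root)

lemma crefl_root_invol: "\<alpha> \<noteq> 0 \<Longrightarrow> crefl_root \<alpha> (crefl_root \<alpha> x) = x"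
  by (simp add: crefl_root_eq flip: cplx_map_comp)
     (metis cplx_map_id comp_apply eq_id_iff refl_root_invol)

lemma crefl_root_conj:
  "\<beta> \<noteq> 0 \<Longrightarrow> crefl_root \<beta> (crefl_root \<alpha> x) = crefl_root (refl_root \<beta> \<alpha>) (crefl_root \<beta> x)"
  by (simp add: crefl_root_eq refl_root_conj comp_def flip: cplx_map_comp)

lemma norm_crefl_root: "\<alpha> \<noteq> 0 \<Longrightarrow> norm (crefl_root \<alpha> x) = norm x"
  by (simp add: crefl_root_eq norm_cplx_map orthogonal_refl_root)

lemma cdot_crefl_root: "\<alpha> \<noteq> 0 \<Longrightarrow> cdot (crefl_root \<alpha> x) (crefl_root \<alpha> y) = cdot x y"
  by (simp add: crefl_root_eq cdot_cplx_map orthogonal_refl_root)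

lemma bounded_linear_crefl_root: "\<alpha> \<noteq> 0 \<Longrightarrow> bounded_linear (crefl_root \<alpha>)"
  using bounded_linear_cplx_map[OF orthogonal_refl_root]
  by (simp add: crefl_root_eq[abs_def])

lemma cdot_crefl_swap: "\<alpha> \<noteq> 0 \<Longrightarrow> cdot (crefl_root \<alpha> x) y = cdot x (crefl_root \<alpha> y)"
  by (metis cdot_crefl_root crefl_root_invol)

lemma crefl_root_fixed: "cdot (cvec \<alpha>) x = 0 \<Longrightarrow> crefl_root \<alpha> x = x"
  by (simp add: crefl_root_def)

section \<open>Root systems and their reflection groups\<close>

locale dunkl_data =
  fixes R Rp :: "(real^'n) set" and k :: "real^'n \<Rightarrow> real"
  assumes root_system: "root_system R"
    and positive: "positive_subsystem R Rp"
    and mult: "multiplicity_fun R k"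
begin

abbreviation "W \<equiv> reflection_group R"
abbreviation "\<gamma> \<equiv> mult_gamma Rp k"

lemma finite_R [simp]: "finite R" using root_system by (simp add: root_system_def)

lemma root_nonzero: "\<alpha> \<in> R \<Longrightarrow> \<alpha> \<noteq> 0" using root_system by (auto simp: root_system_def)

lemma refl_root_mem: "\<alpha> \<in> R \<Longrightarrow> \<beta> \<in> R \<Longrightarrow> refl_root \<alpha> \<beta> \<in> R"
  using root_system unfolding root_system_def by blast

lemma minus_root: "\<alpha> \<in> R \<Longrightarrow> - \<alpha> \<in> R"
  using refl_root_mem[of \<alpha> \<alpha>] by (simp add: refl_root_self root_nonzero)

lemma Rp_subset: "Rp \<subseteq> R" using positive by (auto simp: positive_subsystem_def)

lemma finite_Rp [simp]: "finite Rp" by (rule finite_subset[OF Rp_subset finite_R])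

lemma Rp_R: "\<alpha> \<in> Rp \<Longrightarrow> \<alpha> \<in> R" using Rp_subset by blast

lemma Rp_nonzero: "\<alpha> \<in> Rp \<Longrightarrow> \<alpha> \<noteq> 0" using Rp_R root_nonzero by blast

lemma Rp_pos_neg: "\<alpha> \<in> R \<Longrightarrow> \<alpha> \<in> Rp \<or> - \<alpha> \<in> Rp"
  and Rp_not_both: "\<alpha> \<in> Rp \<Longrightarrow> - \<alpha> \<notin> Rp"
proof -
  obtain \<beta> where b: "\<forall>\<alpha>\<in>R. \<alpha> \<bullet> \<beta> \<noteq> 0" "Rp = {\<alpha>\<in>R. \<alpha> \<bullet> \<beta> > 0}"
    using positive by (auto simp: positive_subsystem_def)
  show "\<alpha> \<in> R \<Longrightarrow> \<alpha> \<in> Rp \<or> - \<alpha> \<in> Rp"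
    using b minus_root[of \<alpha>] by (cases "\<alpha> \<bullet> \<beta> > 0") (auto simp: not_less less_le)
  show "\<alpha> \<in> Rp \<Longrightarrow> - \<alpha> \<notin> Rp" using b by auto
qed

lemma k_nonneg: "\<alpha> \<in> Rp \<Longrightarrow> k \<alpha> \<ge> 0"
  using mult Rp_subset by (auto simp: multiplicity_fun_def)

lemma gamma_nonneg: "\<gamma> \<ge> 0"
  unfolding mult_gamma_def by (rule sum_nonneg) (rule k_nonneg)

lemma k_refl: "\<beta> \<in> R \<Longrightarrow> \<alpha> \<in> R \<Longrightarrow> k (refl_root \<beta> \<alpha>) = k \<alpha>"
proof -
  assume a: "\<beta> \<in> R" "\<alpha> \<in> R"
  have "refl_root \<beta> \<circ> id \<in> W"
    by (intro reflection_group.intros a)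
  then show ?thesis using mult a by (fastforce simp: multiplicity_fun_def)
qed

lemma k_minus: "\<alpha> \<in> R \<Longrightarrow> k (- \<alpha>) = k \<alpha>"
  using k_refl[of \<alpha> \<alpha>] by (simp add: refl_root_self root_nonzero)

text \<open>A reflection permutes the positive roots up to sign, so sums and products over positive
  roots of expressions that do not see the sign are invariant.\<close>

lemma positive_roots_permuted:
  assumes "\<beta> \<in> R"
  obtains \<tau> where "bij_betw \<tau> Rp Rp"
    "\<And>\<alpha>. \<alpha> \<in> Rp \<Longrightarrow> \<tau> \<alpha> = refl_root \<beta> \<alpha> \<or> \<tau> \<alpha> = - refl_root \<beta> \<alpha>"
    "\<And>\<alpha>. \<alpha> \<in> Rp \<Longrightarrow> k (\<tau> \<alpha>) = k \<alpha>"
proof -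
  define \<tau> where "\<tau> \<alpha> = (if refl_root \<beta> \<alpha> \<in> Rp then refl_root \<beta> \<alpha> else - refl_root \<beta> \<alpha>)" for \<alpha>
  have mem: "\<tau> \<alpha> \<in> Rp" if "\<alpha> \<in> Rp" for \<alpha>
    using Rp_pos_neg[OF refl_root_mem[OF assms Rp_R[OF that]]] by (auto simp: \<tau>_def)
  have sgn: "\<tau> \<alpha> = refl_root \<beta> \<alpha> \<or> \<tau> \<alpha> = - refl_root \<beta> \<alpha>" for \<alpha> by (simp add: \<tau>_def)
  have b0: "\<beta> \<noteq> 0" using assms root_nonzero by blast
  have "inj_on \<tau> Rp"
  proof (rule inj_onI)
    fix x y assume xy: "x \<in> Rp" "y \<in> Rp" "\<tau> x = \<tau> y"
    then have "refl_root \<beta> x = refl_root \<beta> y \<or> refl_root \<beta> x = refl_root \<beta> (- y)"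
      using sgn[of x] sgn[of y] linear_neg[OF linear_refl_root, of \<beta> y]
      by (metis add.inverse_inverse)
    then have "x = y \<or> x = - y" using refl_root_invol[OF b0] by metis
    then show "x = y" using xy Rp_not_both by blast
  qed
  then have "bij_betw \<tau> Rp Rp"
    using mem by (simp add: bij_betw_def endo_inj_surj image_subset_iff)
  moreover have "k (\<tau> \<alpha>) = k \<alpha>" if "\<alpha> \<in> Rp" for \<alpha>
    using sgn[of \<alpha>] k_refl[OF assms Rp_R[OF that]] k_minus refl_root_mem[OF assms Rp_R[OF that]]
    by metis
  ultimately show ?thesis using that sgn by blast
qed

lemma sum_Rp_refl:
  fixes F :: "real^'n \<Rightarrow> 'b::comm_monoid_add"
  assumes "\<beta> \<in> R" and even: "\<And>\<alpha>. F (- \<alpha>) = F \<alpha>"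
    and G: "\<And>\<alpha>. \<alpha> \<in> Rp \<Longrightarrow> G \<alpha> = F (refl_root \<beta> \<alpha>)"
  shows "(\<Sum>\<alpha>\<in>Rp. G \<alpha>) = (\<Sum>\<alpha>\<in>Rp. F \<alpha>)"
proof -
  obtain \<tau> where t: "bij_betw \<tau> Rp Rp"
    "\<And>\<alpha>. \<alpha> \<in> Rp \<Longrightarrow> \<tau> \<alpha> = refl_root \<beta> \<alpha> \<or> \<tau> \<alpha> = - refl_root \<beta> \<alpha>"
    using positive_roots_permuted[OF assms(1)] by metis
  have "(\<Sum>\<alpha>\<in>Rp. G \<alpha>) = (\<Sum>\<alpha>\<in>Rp. F (\<tau> \<alpha>))"
    by (rule sum.cong) (use t(2) even G in \<open>auto, metis\<close>)
  also have "\<dots> = (\<Sum>\<alpha>\<in>Rp. F \<alpha>)" by (rule sum.reindex_bij_betw[OF t(1)])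
  finally show ?thesis .
qed

lemma W_orthogonal: "g \<in> W \<Longrightarrow> orthogonal_transformation g"
  by (induction rule: reflection_group.induct)
     (simp_all add: id_def orthogonal_transformation_compose[unfolded comp_def] orthogonal_refl_root
       root_nonzero comp_def)

lemma W_right: "g \<in> W \<Longrightarrow> \<alpha> \<in> R \<Longrightarrow> g \<circ> refl_root \<alpha> \<in> W"
  by (induction rule: reflection_group.induct)
     (auto simp: comp_assoc intro: reflection_group.intros intro!: reflection_group.intros(2)[of _ _ id, simplified])

lemma W_R: "g \<in> W \<Longrightarrow> \<alpha> \<in> R \<Longrightarrow> g \<alpha> \<in> R"
  by (induction rule: reflection_group.induct) (auto simp: refl_root_mem)

text \<open>Roots need not span the space. The group moves points only along the span of the roots,
  so its elements are still determined by how they permute the roots, and there are finitely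
  many of them.\<close>

lemma W_displacement: "g \<in> W \<Longrightarrow> g x - x \<in> span R"
proof (induction rule: reflection_group.induct)
  case (2 \<alpha> g)
  have "(refl_root \<alpha> \<circ> g) x - x = (g x - x) - (2 * (\<alpha> \<bullet> g x) / (\<alpha> \<bullet> \<alpha>)) *\<^sub>R \<alpha>"
    by (simp add: refl_root_def)
  also have "\<dots> \<in> span R"
    using 2 by (intro span_diff[OF 2(3)] span_scale span_base)
  finally show ?case .
qed (simp add: span_zero)

lemma W_determined:
  assumes "g \<in> W" "h \<in> W" and eq: "\<And>\<alpha>. \<alpha> \<in> R \<Longrightarrow> g \<alpha> = h \<alpha>" shows "g = h"
proof
  fix x
  let ?v = "g x - h x"
  have og: "orthogonal_transformation g" and oh: "orthogonal_transformation h"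
    using assms W_orthogonal by auto
  have span: "?v \<in> span R"
    using span_diff[OF W_displacement[OF assms(1), of x] W_displacement[OF assms(2), of x]] by simp
  have surj: "g ` R = R"
    by (rule endo_inj_surj)
       (use W_R[OF assms(1)] orthogonal_transformation_inj[OF og] in \<open>auto intro: inj_on_subset\<close>)
  have "orthogonal ?v \<alpha>" if a: "\<alpha> \<in> R" for \<alpha>
  proof -
    obtain \<beta> where b: "\<beta> \<in> R" "\<alpha> = g \<beta>" using surj a by blast
    have "g x \<bullet> g \<beta> = h x \<bullet> h \<beta>" using og oh by (simp add: orthogonal_transformation_def)
    then show ?thesis using b eq by (simp add: orthogonal_def inner_diff_left)
  qed
  then have "orthogonal ?v ?v" using span orthogonal_to_span by blast
  then show "g x = h x" by (simp add: orthogonal_def)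
qed

lemma finite_W: "finite W"
proof (rule finite_imageD)
  show "inj_on (\<lambda>g. restrict g R) W"
    by (rule inj_onI) (metis W_determined restrict_apply')
  have "(\<lambda>g. restrict g R) ` W \<subseteq> (R \<rightarrow>\<^sub>E R)" using W_R by auto
  then show "finite ((\<lambda>g. restrict g R) ` W)"
    by (rule finite_subset) (simp add: finite_PiE)
qed

lemma W_id: "id \<in> W" by (rule reflection_group.intros)

end

section \<open>Dunkl operators on polynomials\<close>

text \<open>Generated by multiplication with single coordinates, so that induction over polynomials reduces
  to the commutator of an operator with a coordinate.\<close>

inductive cpoly :: "(complex^'n \<Rightarrow> complex) \<Rightarrow> bool" where
  cpoly_const: "cpoly (\<lambda>x. c)"
| cpoly_add: "cpoly p \<Longrightarrow> cpoly q \<Longrightarrow> cpoly (\<lambda>x. p x + q x)"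
| cpoly_coord: "cpoly p \<Longrightarrow> cpoly (\<lambda>x. x $ i * p x)"

lemma cpoly_scale: "cpoly p \<Longrightarrow> cpoly (\<lambda>x. c * p x)"
proof (induction rule: cpoly.induct)
  case (cpoly_const c')
  show ?case by (rule cpoly.cpoly_const)
next
  case (cpoly_add p q)
  then show ?case by (simp add: distrib_left cpoly.cpoly_add)
next
  case (cpoly_coord p i)
  have "(\<lambda>x. c * (x $ i * p x)) = (\<lambda>x. x $ i * (c * p x))" by (simp add: algebra_simps)
  then show ?case using cpoly.cpoly_coord[OF cpoly_coord.IH, of i] by simp
qed

lemma cpoly_sum: "finite I \<Longrightarrow> (\<And>i. i \<in> I \<Longrightarrow> cpoly (p i)) \<Longrightarrow> cpoly (\<lambda>x. \<Sum>i\<in>I. p i x)"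
  by (induction I rule: finite_induct) (auto intro: cpoly_const cpoly_add)

lemma cpoly_diff: "cpoly p \<Longrightarrow> cpoly q \<Longrightarrow> cpoly (\<lambda>x. p x - q x)"
  using cpoly_add[OF _ cpoly_scale[of q "-1"], of p] by simp

lemma cpoly_cdot: "cpoly p \<Longrightarrow> cpoly (\<lambda>x. cdot x a * p x)"
proof -
  assume p: "cpoly p"
  have "(\<lambda>x. cdot x a * p x) = (\<lambda>x. \<Sum>i\<in>UNIV. a $ i * (x $ i * p x))"
    by (simp add: cdot_def sum_distrib_left sum_distrib_right algebra_simps)
  then show ?thesis using p by (simp add: cpoly_sum cpoly_scale cpoly_coord)
qed

lemma cpoly_crefl: "cpoly p \<Longrightarrow> \<alpha> \<noteq> 0 \<Longrightarrow> cpoly (\<lambda>x. p (crefl_root \<alpha> x))"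
proof (induction rule: cpoly.induct)
  case (cpoly_coord p i)
  have "crefl_root \<alpha> x $ i = cdot x (crefl_root \<alpha> (axis i 1))" for x
    using cdot_axis[of "crefl_root \<alpha> x" i] cpoly_coord by (simp add: cdot_crefl_swap)
  then show ?case using cpoly_coord by (simp add: cpoly_cdot)
qed (auto intro: cpoly.intros)

lemma cpoly_derivative:
  "cpoly p \<Longrightarrow> \<exists>D. (\<forall>x. (p has_derivative D x) (at x)) \<and> (\<forall>x c v. D x (c *s v) = c * D x v)
      \<and> (\<forall>v. cpoly (\<lambda>x. D x v))"
proof (induction rule: cpoly.induct)
  case (cpoly_const c)
  show ?case by (rule exI[of _ "\<lambda>x v. 0"]) (auto intro: cpoly.cpoly_const)
next
  case (cpoly_add p q)
  then obtain D D' where D: "\<forall>x. (p has_derivative D x) (at x)" "\<forall>x c v. D x (c *s v) = c * D x v"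
      "\<forall>v. cpoly (\<lambda>x. D x v)"
    and D': "\<forall>x. (q has_derivative D' x) (at x)" "\<forall>x c v. D' x (c *s v) = c * D' x v"
      "\<forall>v. cpoly (\<lambda>x. D' x v)" by metis
  show ?case
    by (rule exI[of _ "\<lambda>x v. D x v + D' x v"])
       (use D D' in \<open>simp add: has_derivative_add cpoly.cpoly_add distrib_left\<close>)
next
  case (cpoly_coord p i)
  then obtain D where D: "\<forall>x. (p has_derivative D x) (at x)" "\<forall>x c v. D x (c *s v) = c * D x v"
      "\<forall>v. cpoly (\<lambda>x. D x v)" by metis
  have "((\<lambda>x. x $ i * p x) has_derivative (\<lambda>v. x $ i * D x v + v $ i * p x)) (at x)" for x
    using D(1) by (intro has_derivative_mult bounded_linear_imp_has_derivative bounded_linear_vec_nth) auto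
  moreover have "cpoly (\<lambda>x. x $ i * D x v + v $ i * p x)" for v
    using D(3) cpoly_coord.hyps by (intro cpoly.cpoly_add cpoly.cpoly_coord cpoly_scale) auto
  ultimately show ?case
    by (intro exI[of _ "\<lambda>x v. x $ i * D x v + v $ i * p x"]) (auto simp: D(2) algebra_simps)
qed

lemma cpoly_has_derivative:
  assumes "cpoly p" shows "(p has_derivative frechet_derivative p (at x)) (at x)"
  using cpoly_derivative[OF assms] frechet_derivative_works by (metis differentiableI)

lemma cpoly_derivative_props:
  assumes "cpoly p"
  shows "frechet_derivative p (at x) (c *s v) = c * frechet_derivative p (at x) v"
    and "cpoly (\<lambda>x. frechet_derivative p (at x) v)"
proof -
  obtain D where D: "\<forall>x. (p has_derivative D x) (at x)" "\<forall>x c v. D x (c *s v) = c * D x v"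
      "\<forall>v. cpoly (\<lambda>x. D x v)" using cpoly_derivative[OF assms] by metis
  have eq: "frechet_derivative p (at x) = D x" for x
    using D(1) frechet_derivative_at by metis
  show "frechet_derivative p (at x) (c *s v) = c * frechet_derivative p (at x) v"
    "cpoly (\<lambda>x. frechet_derivative p (at x) v)" using D by (simp_all add: eq)
qed

lemma cpoly_continuous: "cpoly p \<Longrightarrow> continuous_on S p"
  by (meson cpoly_has_derivative continuous_at_imp_continuous_on has_derivative_continuous)

lemma tendsto_off_hyperplane:
  assumes "\<alpha> \<noteq> 0" "cdot (cvec \<alpha>) x = 0"
  shows "(\<lambda>n. x + complex_of_real (1 / real (Suc n)) *s cvec \<alpha>) \<longlonglongrightarrow> x"
    and "cdot (cvec \<alpha>) (x + complex_of_real (1 / real (Suc n)) *s cvec \<alpha>) \<noteq> 0"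
proof -
  have "(\<lambda>n. x + (1 / real (Suc n)) *\<^sub>R cvec \<alpha>) \<longlonglongrightarrow> x + 0 *\<^sub>R cvec \<alpha>"
    by (intro tendsto_intros LIMSEQ_Suc[OF lim_1_over_n])
  then show "(\<lambda>n. x + complex_of_real (1 / real (Suc n)) *s cvec \<alpha>) \<longlonglongrightarrow> x"
    by (simp only: scaleR_eq_vector_scalar) simp
  show "cdot (cvec \<alpha>) (x + complex_of_real (1 / real (Suc n)) *s cvec \<alpha>) \<noteq> 0"
    using assms by (simp add: cdot_bilinear cdot_cvec del: of_nat_Suc)
qed

lemma hyperplane_complement_limpt:
  assumes "\<alpha> \<noteq> 0" "cdot (cvec \<alpha>) x = 0"
  shows "at x within {y. cdot (cvec \<alpha>) y \<noteq> 0} \<noteq> bot"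
proof -
  have "x islimpt {y. cdot (cvec \<alpha>) y \<noteq> 0}"
    unfolding islimpt_sequential
    using tendsto_off_hyperplane[OF assms] assms(2)
    by (intro exI[of _ "\<lambda>n. x + complex_of_real (1 / real (Suc n)) *s cvec \<alpha>"]) auto
  then show ?thesis using trivial_limit_within by blast
qed

text \<open>Any continuous solution of the quotient equation is the continuous extension chosen in the
  definition, so that all identities for difference quotients can be checked after multiplying
  by the linear form.\<close>

lemma dunkl_quotient_eqI:
  assumes "\<alpha> \<noteq> 0" and cont: "continuous_on UNIV q"
    and eq: "\<And>x. f x - f (crefl_root \<alpha> x) = cdot (cvec \<alpha>) x * q x"
  shows "dunkl_quotient \<alpha> f = q"
proof
  fix x
  show "dunkl_quotient \<alpha> f x = q x"
  proof (cases "cdot (cvec \<alpha>) x = 0")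
    case True
    let ?S = "{y. cdot (cvec \<alpha>) y \<noteq> 0}"
    have "(q \<longlongrightarrow> q x) (at x within ?S)"
      using cont by (meson continuous_on_eq_continuous_at continuous_within open_UNIV
          UNIV_I continuous_at_imp_continuous_at_within)
    then have "((\<lambda>y. (f y - f (crefl_root \<alpha> y)) / cdot (cvec \<alpha>) y) \<longlongrightarrow> q x) (at x within ?S)"
      by (rule Lim_transform_eventually) (auto simp: eventually_at_filter eq)
    then have "Lim (at x within ?S) (\<lambda>y. (f y - f (crefl_root \<alpha> y)) / cdot (cvec \<alpha>) y) = q x"
      by (rule tendsto_Lim[OF hyperplane_complement_limpt[OF assms(1) True]])
    then show ?thesis using True by (simp add: dunkl_quotient_def Let_def)
  qed (simp add: dunkl_quotient_def Let_def eq)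
qed

lemma cpoly_quotient_ex:
  assumes "\<alpha> \<noteq> 0"
  shows "cpoly p \<Longrightarrow> \<exists>q. cpoly q \<and> (\<forall>x. p x - p (crefl_root \<alpha> x) = cdot (cvec \<alpha>) x * q x)"
proof (induction rule: cpoly.induct)
  case (cpoly_const c)
  show ?case by (rule exI[of _ "\<lambda>x. 0"]) (auto intro: cpoly.cpoly_const)
next
  case (cpoly_add p q)
  then obtain p' q' where "cpoly p'" "cpoly q'"
    and e: "\<And>x. p x - p (crefl_root \<alpha> x) = cdot (cvec \<alpha>) x * p' x"
    "\<And>x. q x - q (crefl_root \<alpha> x) = cdot (cvec \<alpha>) x * q' x" by metis
  have "p x + q x - (p (crefl_root \<alpha> x) + q (crefl_root \<alpha> x)) = cdot (cvec \<alpha>) x * (p' x + q' x)" for x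
    unfolding distrib_left e[symmetric] by simp
  then show ?case
    using \<open>cpoly p'\<close> \<open>cpoly q'\<close> by (intro exI[of _ "\<lambda>x. p' x + q' x"]) (auto intro: cpoly.cpoly_add)
next
  case (cpoly_coord p i)
  then obtain q where q: "cpoly q"
    and e: "\<And>x. p x - p (crefl_root \<alpha> x) = cdot (cvec \<alpha>) x * q x" by metis
  let ?q = "\<lambda>x. x $ i * q x + (2 / cdot (cvec \<alpha>) (cvec \<alpha>) * cvec \<alpha> $ i) * p (crefl_root \<alpha> x)"
  have "x $ i * p x - crefl_root \<alpha> x $ i * p (crefl_root \<alpha> x) = cdot (cvec \<alpha>) x * ?q x" for x
  proof -
    have "x $ i * p x - crefl_root \<alpha> x $ i * p (crefl_root \<alpha> x)
      = x $ i * (p x - p (crefl_root \<alpha> x)) + (x $ i - crefl_root \<alpha> x $ i) * p (crefl_root \<alpha> x)"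
      by (simp add: algebra_simps)
    also have "x $ i - crefl_root \<alpha> x $ i = cdot (cvec \<alpha>) x * (2 / cdot (cvec \<alpha>) (cvec \<alpha>) * cvec \<alpha> $ i)"
      by (simp add: crefl_root_def)
    finally show ?thesis unfolding e by (simp add: algebra_simps)
  qed
  moreover have "cpoly ?q"
    using q cpoly_coord.hyps assms by (intro cpoly.cpoly_add cpoly.cpoly_coord cpoly_scale cpoly_crefl)
  ultimately show ?case by blast
qed

lemma cpoly_quotient:
  assumes "\<alpha> \<noteq> 0" "cpoly p"
  shows "cpoly (dunkl_quotient \<alpha> p)"
    and "p x - p (crefl_root \<alpha> x) = cdot (cvec \<alpha>) x * dunkl_quotient \<alpha> p x"
proof -
  obtain q where q: "cpoly q" "\<forall>x. p x - p (crefl_root \<alpha> x) = cdot (cvec \<alpha>) x * q x"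
    using cpoly_quotient_ex[OF assms] by blast
  then have "dunkl_quotient \<alpha> p = q"
    by (intro dunkl_quotient_eqI assms cpoly_continuous) auto
  then show "cpoly (dunkl_quotient \<alpha> p)"
    "p x - p (crefl_root \<alpha> x) = cdot (cvec \<alpha>) x * dunkl_quotient \<alpha> p x" using q by auto
qed

lemma dunkl_quotient_const: "\<alpha> \<noteq> 0 \<Longrightarrow> dunkl_quotient \<alpha> (\<lambda>x. c) = (\<lambda>x. 0)"
  by (rule dunkl_quotient_eqI) auto

lemma dunkl_quotient_add:
  assumes "\<alpha> \<noteq> 0" "cpoly p" "cpoly q"
  shows "dunkl_quotient \<alpha> (\<lambda>x. p x + q x) = (\<lambda>x. dunkl_quotient \<alpha> p x + dunkl_quotient \<alpha> q x)"
proof (rule dunkl_quotient_eqI[OF assms(1)])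
  show "continuous_on UNIV (\<lambda>x. dunkl_quotient \<alpha> p x + dunkl_quotient \<alpha> q x)"
    using assms by (intro cpoly_continuous cpoly_add cpoly_quotient)
  show "p x + q x - (p (crefl_root \<alpha> x) + q (crefl_root \<alpha> x))
      = cdot (cvec \<alpha>) x * (dunkl_quotient \<alpha> p x + dunkl_quotient \<alpha> q x)" for x
    unfolding distrib_left cpoly_quotient(2)[OF assms(1,2), symmetric]
      cpoly_quotient(2)[OF assms(1,3), symmetric] by simp
qed

lemma dunkl_quotient_scale:
  assumes "\<alpha> \<noteq> 0" "cpoly p"
  shows "dunkl_quotient \<alpha> (\<lambda>x. c * p x) = (\<lambda>x. c * dunkl_quotient \<alpha> p x)"
proof (rule dunkl_quotient_eqI[OF assms(1)])
  show "continuous_on UNIV (\<lambda>x. c * dunkl_quotient \<alpha> p x)"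
    using assms by (intro cpoly_continuous cpoly_scale cpoly_quotient)
  show "c * p x - c * p (crefl_root \<alpha> x) = cdot (cvec \<alpha>) x * (c * dunkl_quotient \<alpha> p x)" for x
    using cpoly_quotient(2)[OF assms, of x] by (simp add: algebra_simps)
qed

lemma dunkl_quotient_coord:
  assumes "\<alpha> \<noteq> 0" "cpoly p"
  shows "dunkl_quotient \<alpha> (\<lambda>x. x $ i * p x) = (\<lambda>x. x $ i * dunkl_quotient \<alpha> p x
     + (2 / cdot (cvec \<alpha>) (cvec \<alpha>) * cvec \<alpha> $ i) * p (crefl_root \<alpha> x))"
proof (rule dunkl_quotient_eqI[OF assms(1)])
  show "continuous_on UNIV (\<lambda>x. x $ i * dunkl_quotient \<alpha> p x
     + (2 / cdot (cvec \<alpha>) (cvec \<alpha>) * cvec \<alpha> $ i) * p (crefl_root \<alpha> x))"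
    using assms by (intro cpoly_continuous cpoly_add cpoly_coord cpoly_scale cpoly_quotient cpoly_crefl)
  show "x $ i * p x - crefl_root \<alpha> x $ i * p (crefl_root \<alpha> x) = cdot (cvec \<alpha>) x *
      (x $ i * dunkl_quotient \<alpha> p x + (2 / cdot (cvec \<alpha>) (cvec \<alpha>) * cvec \<alpha> $ i) * p (crefl_root \<alpha> x))" for x
  proof -
    have "x $ i * p x - crefl_root \<alpha> x $ i * p (crefl_root \<alpha> x)
      = x $ i * (p x - p (crefl_root \<alpha> x)) + (x $ i - crefl_root \<alpha> x $ i) * p (crefl_root \<alpha> x)"
      by (simp add: algebra_simps)
    also have "x $ i - crefl_root \<alpha> x $ i = cdot (cvec \<alpha>) x * (2 / cdot (cvec \<alpha>) (cvec \<alpha>) * cvec \<alpha> $ i)"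
      by (simp add: crefl_root_def)
    finally show ?thesis unfolding cpoly_quotient(2)[OF assms] by (simp add: algebra_simps)
  qed
qed

lemma dunkl_quotient_minus:
  assumes "\<alpha> \<noteq> 0" "cpoly p"
  shows "dunkl_quotient (- \<alpha>) p = (\<lambda>x. - dunkl_quotient \<alpha> p x)"
proof (rule dunkl_quotient_eqI)
  show "continuous_on UNIV (\<lambda>x. - dunkl_quotient \<alpha> p x)"
    using assms by (intro continuous_on_minus cpoly_continuous cpoly_quotient)
  show "p x - p (crefl_root (- \<alpha>) x) = cdot (cvec (- \<alpha>)) x * - dunkl_quotient \<alpha> p x" for x
    using cpoly_quotient(2)[OF assms, of x] by (simp add: crefl_root_minus cvec_minus cdot_minus_left)
qed (use assms in simp)

lemma dunkl_quotient_crefl: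
  assumes "\<alpha> \<noteq> 0" "\<beta> \<noteq> 0" "cpoly p"
  shows "dunkl_quotient \<alpha> (\<lambda>x. p (crefl_root \<beta> x))
    = (\<lambda>x. dunkl_quotient (refl_root \<beta> \<alpha>) p (crefl_root \<beta> x))"
proof (rule dunkl_quotient_eqI[OF assms(1)])
  have nz: "refl_root \<beta> \<alpha> \<noteq> 0"
    using assms refl_root_invol[of \<beta> \<alpha>] linear_0[OF linear_refl_root, of \<beta>] by metis
  show "continuous_on UNIV (\<lambda>x. dunkl_quotient (refl_root \<beta> \<alpha>) p (crefl_root \<beta> x))"
    using assms nz by (intro cpoly_continuous cpoly_crefl cpoly_quotient)
  show "p (crefl_root \<beta> x) - p (crefl_root \<beta> (crefl_root \<alpha> x))
      = cdot (cvec \<alpha>) x * dunkl_quotient (refl_root \<beta> \<alpha>) p (crefl_root \<beta> x)" for x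
    using cpoly_quotient(2)[OF nz assms(3), of "crefl_root \<beta> x"]
    by (simp add: crefl_root_conj[OF assms(2)] cdot_crefl_root[OF assms(2)] flip: crefl_root_cvec)
qed

context dunkl_data
begin

abbreviation "T \<equiv> dunkl_op Rp k"

lemma T_const: "T \<xi> (\<lambda>x. c) x = 0"
  by (simp add: dunkl_op_def dunkl_quotient_const Rp_nonzero)

lemma T_add:
  assumes "cpoly p" "cpoly q"
  shows "T \<xi> (\<lambda>x. p x + q x) x = T \<xi> p x + T \<xi> q x"
proof -
  have "frechet_derivative (\<lambda>x. p x + q x) (at x)
      = (\<lambda>v. frechet_derivative p (at x) v + frechet_derivative q (at x) v)"
    using assms by (intro frechet_derivative_at[symmetric] has_derivative_add cpoly_has_derivative)
  then show ?thesis
    using assms by (simp add: dunkl_op_def dunkl_quotient_add Rp_nonzero algebra_simps sum.distrib)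
qed

lemma T_scale:
  assumes "cpoly p"
  shows "T \<xi> (\<lambda>x. c * p x) x = c * T \<xi> p x"
proof -
  have "frechet_derivative (\<lambda>x. c * p x) (at x) = (\<lambda>v. c * frechet_derivative p (at x) v)"
    using assms by (intro frechet_derivative_at[symmetric] has_derivative_mult_right cpoly_has_derivative)
  then show ?thesis
    using assms by (simp add: dunkl_op_def dunkl_quotient_scale Rp_nonzero algebra_simps sum_distrib_left)
qed

lemma T_diff:
  assumes "cpoly p" "cpoly q"
  shows "T \<xi> (\<lambda>x. p x - q x) x = T \<xi> p x - T \<xi> q x"
  using T_add[OF assms(1) cpoly_scale[OF assms(2), of "-1"], of \<xi> x] T_scale[OF assms(2), of \<xi> "-1" x]
  by simp

lemma T_sum:
  assumes "finite I" "\<And>i. i \<in> I \<Longrightarrow> cpoly (p i)"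
  shows "T \<xi> (\<lambda>x. \<Sum>i\<in>I. p i x) x = (\<Sum>i\<in>I. T \<xi> (p i) x)"
  using assms by (induction I rule: finite_induct) (simp_all add: T_const T_add cpoly_sum)

text \<open>The Leibniz rule of a Dunkl operator with a coordinate has a reflection term, because difference
  quotients evaluate one of the two factors at the reflected point. The coefficient of that
  term is symmetric in the direction and the coordinate vector.\<close>

lemma T_coord:
  assumes "cpoly p"
  shows "T \<xi> (\<lambda>x. x $ i * p x) x = \<xi> $ i * p x + x $ i * T \<xi> p x
    + (\<Sum>\<alpha>\<in>Rp. complex_of_real (k \<alpha>) * (2 / cdot (cvec \<alpha>) (cvec \<alpha>))
         * cdot (cvec \<alpha>) \<xi> * cvec \<alpha> $ i * p (crefl_root \<alpha> x))"
proof -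
  have "((\<lambda>x. x $ i * p x) has_derivative (\<lambda>v. x $ i * frechet_derivative p (at x) v + v $ i * p x)) (at x)"
    by (intro has_derivative_mult bounded_linear_imp_has_derivative bounded_linear_vec_nth
        cpoly_has_derivative assms)
  then have "frechet_derivative (\<lambda>x. x $ i * p x) (at x)
      = (\<lambda>v. x $ i * frechet_derivative p (at x) v + v $ i * p x)"
    by (rule frechet_derivative_at[symmetric])
  moreover have "(\<Sum>\<alpha>\<in>Rp. complex_of_real (k \<alpha>) * cdot (cvec \<alpha>) \<xi> * dunkl_quotient \<alpha> (\<lambda>x. x $ i * p x) x)
     = (\<Sum>\<alpha>\<in>Rp. complex_of_real (k \<alpha>) * cdot (cvec \<alpha>) \<xi> * (x $ i * dunkl_quotient \<alpha> p x
     + (2 / cdot (cvec \<alpha>) (cvec \<alpha>) * cvec \<alpha> $ i) * p (crefl_root \<alpha> x)))"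
    by (rule sum.cong) (simp_all add: dunkl_quotient_coord Rp_nonzero assms)
  ultimately show ?thesis
    by (simp add: dunkl_op_def algebra_simps sum_distrib_left sum.distrib)
qed

lemma T_cpoly: "cpoly p \<Longrightarrow> cpoly (T \<xi> p)"
  unfolding dunkl_op_def[abs_def]
  by (intro cpoly_add cpoly_sum cpoly_scale cpoly_derivative_props cpoly_quotient Rp_nonzero) auto

lemma T_direction:
  assumes "cpoly p"
  shows "T (\<xi> + c *s \<eta>) p x = T \<xi> p x + c * T \<eta> p x"
proof -
  have lin: "frechet_derivative p (at x) (\<xi> + c *s \<eta>)
      = frechet_derivative p (at x) \<xi> + c * frechet_derivative p (at x) \<eta>"
    using linear_add[OF has_derivative_linear[OF cpoly_has_derivative[OF assms]]]
      cpoly_derivative_props(1)[OF assms] by metis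
  show ?thesis
    by (simp add: dunkl_op_def lin cdot_bilinear algebra_simps sum.distrib sum_distrib_left)
qed

lemma T_direction_sum:
  assumes "cpoly p"
  shows "T \<xi> p x = (\<Sum>i\<in>UNIV. \<xi> $ i * T (axis i 1) p x)"
proof -
  have "T (\<Sum>i\<in>I. \<xi> $ i *s axis i 1) p x = (\<Sum>i\<in>I. \<xi> $ i * T (axis i 1) p x)" if "finite I" for I
    using that
  proof (induction I rule: finite_induct)
    case empty
    show ?case using T_direction[OF assms, of 0 "-1" 0 x] by simp
  next
    case (insert i I)
    have "(\<Sum>i\<in>insert i I. \<xi> $ i *s axis i 1) = (\<Sum>i\<in>I. \<xi> $ i *s axis i 1) + \<xi> $ i *s axis i 1"
      using insert by (simp add: add.commute)
    then show ?case using insert by (simp only: T_direction[OF assms]) simp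
  qed
  from this[of UNIV] show ?thesis by (simp add: basis_expansion)
qed

text \<open>Dunkl operators are equivariant: a reflection permutes the summands, where passing from a root to
  its negative changes two signs.\<close>

lemma T_crefl:
  assumes "\<beta> \<in> R" "cpoly p"
  shows "T \<xi> (\<lambda>x. p (crefl_root \<beta> x)) x = T (crefl_root \<beta> \<xi>) p (crefl_root \<beta> x)"
proof -
  have b0: "\<beta> \<noteq> 0" using assms root_nonzero by blast
  have "((\<lambda>x. p (crefl_root \<beta> x)) has_derivative
      (\<lambda>v. frechet_derivative p (at (crefl_root \<beta> x)) (crefl_root \<beta> v))) (at x)"
    by (rule has_derivative_compose[OF bounded_linear_imp_has_derivative[OF bounded_linear_crefl_root[OF b0]]
          cpoly_has_derivative[OF assms(2)]])
  then have D: "frechet_derivative (\<lambda>x. p (crefl_root \<beta> x)) (at x)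
      = (\<lambda>v. frechet_derivative p (at (crefl_root \<beta> x)) (crefl_root \<beta> v))"
    by (rule frechet_derivative_at[symmetric])
  define F where "F \<alpha> = complex_of_real (if \<alpha> \<in> R then k \<alpha> else 0) * cdot (cvec \<alpha>) (crefl_root \<beta> \<xi>)
    * (if \<alpha> \<in> R then dunkl_quotient \<alpha> p (crefl_root \<beta> x) else 0)" for \<alpha>
  have "F (- \<alpha>) = F \<alpha>" for \<alpha>
  proof (cases "\<alpha> \<in> R")
    case True
    then have "k (- \<alpha>) = k \<alpha>" "- \<alpha> \<in> R" "\<alpha> \<noteq> 0"
      using k_minus minus_root root_nonzero by blast+
    then show ?thesis using True
      by (simp add: F_def cvec_minus cdot_minus_left dunkl_quotient_minus assms)
  next
    case False
    then have "- \<alpha> \<notin> R" using minus_root[of "- \<alpha>"] by auto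
    with False show ?thesis by (simp add: F_def)
  qed
  then have "(\<Sum>\<alpha>\<in>Rp. complex_of_real (k \<alpha>) * cdot (cvec \<alpha>) \<xi>
        * dunkl_quotient \<alpha> (\<lambda>x. p (crefl_root \<beta> x)) x) = (\<Sum>\<alpha>\<in>Rp. F \<alpha>)"
    by (rule sum_Rp_refl[OF assms(1)])
       (simp add: F_def refl_root_mem assms Rp_R k_refl cdot_crefl_root b0 dunkl_quotient_crefl
         Rp_nonzero flip: crefl_root_cvec)
  also have "\<dots> = (\<Sum>\<alpha>\<in>Rp. complex_of_real (k \<alpha>) * cdot (cvec \<alpha>) (crefl_root \<beta> \<xi>)
        * dunkl_quotient \<alpha> p (crefl_root \<beta> x))"
    by (rule sum.cong) (auto simp: F_def Rp_R)
  finally show ?thesis by (simp add: dunkl_op_def D)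
qed

text \<open>The commutator of two Dunkl operators kills constants and commutes with multiplication by
  every coordinate, so it vanishes on polynomials. Commuting it with a coordinate yields reflection
  terms with the operators on one side; moving the reflection to the other side by
  equivariance makes them symmetric in the two directions. A separate study of the products
  of two reflections is thereby avoided.\<close>

theorem T_commute:
  assumes "cpoly p"
  shows "T \<xi> (T \<eta> p) x = T \<eta> (T \<xi> p) x"
  using assms
proof (induction arbitrary: x rule: cpoly.induct)
  case (cpoly_const c)
  have "T \<xi> (\<lambda>x. c) = (\<lambda>x. 0)" for \<xi> :: "complex^'n" by (rule ext) (rule T_const)
  then show ?case by (simp add: T_const)
next
  case (cpoly_add p q)
  have "T \<xi> (\<lambda>x. p x + q x) = (\<lambda>x. T \<xi> p x + T \<xi> q x)" for \<xi>
    by (rule ext) (rule T_add[OF cpoly_add.hyps])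
  then show ?case using cpoly_add by (simp add: T_add T_cpoly)
next
  case (cpoly_coord p i)
  let ?c = "\<lambda>\<alpha>. complex_of_real (k \<alpha>) * (2 / cdot (cvec \<alpha>) (cvec \<alpha>)) * cvec \<alpha> $ i"
  \<comment> \<open>Apart from the term with both operators, the right side is symmetric in the two directions.\<close>
  have main: "T \<xi> (T \<eta> (\<lambda>x. x $ i * p x)) x = \<eta> $ i * T \<xi> p x + \<xi> $ i * T \<eta> p x + x $ i * T \<xi> (T \<eta> p) x
    + (\<Sum>\<alpha>\<in>Rp. ?c \<alpha> * (cdot (cvec \<alpha>) \<xi> * T \<eta> p (crefl_root \<alpha> x) + cdot (cvec \<alpha>) \<eta> * T \<xi> p (crefl_root \<alpha> x)
      - 2 / cdot (cvec \<alpha>) (cvec \<alpha>) * cdot (cvec \<alpha>) \<xi> * cdot (cvec \<alpha>) \<eta> * T (cvec \<alpha>) p (crefl_root \<alpha> x)))"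
    for \<xi> \<eta>
  proof -
    note p = cpoly_coord.hyps
    define d where "d \<alpha> = ?c \<alpha> * cdot (cvec \<alpha>) \<eta>" for \<alpha>
    have "T \<eta> (\<lambda>x. x $ i * p x) = (\<lambda>x. \<eta> $ i * p x + x $ i * T \<eta> p x
      + (\<Sum>\<alpha>\<in>Rp. d \<alpha> * p (crefl_root \<alpha> x)))"
      unfolding T_coord[OF p] d_def by (simp add: algebra_simps)
    then have "T \<xi> (T \<eta> (\<lambda>x. x $ i * p x)) x = \<eta> $ i * T \<xi> p x + T \<xi> (\<lambda>x. x $ i * T \<eta> p x) x
      + (\<Sum>\<alpha>\<in>Rp. d \<alpha> * T \<xi> (\<lambda>x. p (crefl_root \<alpha> x)) x)"
      using p by (simp add: T_add T_sum T_scale cpoly_sum cpoly_scale cpoly_crefl cpoly_coord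
          cpoly.cpoly_add cpoly.cpoly_coord T_cpoly Rp_nonzero)
    also have "(\<Sum>\<alpha>\<in>Rp. d \<alpha> * T \<xi> (\<lambda>x. p (crefl_root \<alpha> x)) x)
       = (\<Sum>\<alpha>\<in>Rp. (?c \<alpha> * cdot (cvec \<alpha>) \<eta>) * (T \<xi> p (crefl_root \<alpha> x)
         - 2 / cdot (cvec \<alpha>) (cvec \<alpha>) * cdot (cvec \<alpha>) \<xi> * T (cvec \<alpha>) p (crefl_root \<alpha> x)))"
    proof (rule sum.cong)
      fix \<alpha> assume a: "\<alpha> \<in> Rp"
      have "crefl_root \<alpha> \<xi> = \<xi> + (- (2 / cdot (cvec \<alpha>) (cvec \<alpha>) * cdot (cvec \<alpha>) \<xi>)) *s cvec \<alpha>"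
        by (simp add: crefl_root_def vec_eq_iff)
      then have "T (crefl_root \<alpha> \<xi>) p y = T \<xi> p y
          - 2 / cdot (cvec \<alpha>) (cvec \<alpha>) * cdot (cvec \<alpha>) \<xi> * T (cvec \<alpha>) p y" for y
        by (simp only: T_direction[OF p]) simp
      then show "d \<alpha> * T \<xi> (\<lambda>x. p (crefl_root \<alpha> x)) x
         = (?c \<alpha> * cdot (cvec \<alpha>) \<eta>) * (T \<xi> p (crefl_root \<alpha> x)
         - 2 / cdot (cvec \<alpha>) (cvec \<alpha>) * cdot (cvec \<alpha>) \<xi> * T (cvec \<alpha>) p (crefl_root \<alpha> x))"
        by (simp only: T_crefl[OF Rp_R[OF a] p] d_def)
    qed simp
    finally show ?thesis
      by (simp add: T_coord T_cpoly p algebra_simps flip: sum.distrib)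
  qed
  show ?case unfolding main by (simp add: cpoly_coord.IH algebra_simps)
qed

end

section \<open>The homogeneous components of the Dunkl kernel\<close>

context dunkl_data
begin

lemma cpoly_cplx_map: "g \<in> W \<Longrightarrow> cpoly p \<Longrightarrow> cpoly (\<lambda>x. p (cplx_map g x))"
proof (induction arbitrary: p rule: reflection_group.induct)
  case (2 \<alpha> g)
  show ?case
    using 2(3)[OF cpoly_crefl[OF 2(4) root_nonzero[OF 2(1)]]]
    by (simp only: cplx_map_comp crefl_root_eq)
qed simp

text \<open>The action of \<open>\<Sum>x\<^sub>i T\<^sub>i\<close> on functions that are homogeneous of degree \<^term>\<open>n\<close>
  (see \<open>Euler_relation\<close> below).\<close>

definition euler_op :: "nat \<Rightarrow> (complex^'n \<Rightarrow> complex) \<Rightarrow> complex^'n \<Rightarrow> complex" where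
  "euler_op n f x = of_nat n * f x + (\<Sum>\<alpha>\<in>Rp. complex_of_real (k \<alpha>) * (f x - f (crefl_root \<alpha> x)))"

lemma sum_k: "(\<Sum>\<alpha>\<in>Rp. complex_of_real (k \<alpha>) * z) = complex_of_real \<gamma> * z"
  by (simp add: mult_gamma_def sum_distrib_right)

lemma euler_op_alt: "euler_op n f x = complex_of_real (real n + \<gamma>) * f x
    - (\<Sum>\<alpha>\<in>Rp. complex_of_real (k \<alpha>) * f (crefl_root \<alpha> x))"
  by (simp add: euler_op_def right_diff_distrib sum_subtractf sum_k distrib_right)

text \<open>Inverting the Euler operator in the group algebra: the Neumann series converges because
  the reflections together carry the weight \<^term>\<open>\<gamma>\<close>, less than \<^term>\<open>real n + \<gamma>\<close>.\<close>

lemma neumann_coeff_ex: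
  assumes "n > 0"
  shows "\<exists>h :: (real^'n \<Rightarrow> real^'n) \<Rightarrow> real. \<forall>g. (real n + \<gamma>) * h g
      - (\<Sum>\<alpha>\<in>Rp. k \<alpha> * h (g \<circ> refl_root \<alpha>)) = (if g = id then 1 else 0)"
proof -
  define d where "d = real n + \<gamma>"
  define q where "q = \<gamma> / d"
  have d: "d > 0" and q: "0 \<le> q" "q < 1"
    using assms gamma_nonneg by (simp_all add: d_def q_def)
  \<comment> \<open>The terms of the Neumann series, applied to the unit of the group algebra.\<close>
  define c where "c m = ((\<lambda>f g. (\<Sum>\<alpha>\<in>Rp. k \<alpha> * f (g \<circ> refl_root \<alpha>)) / d) ^^ m)
    (\<lambda>g. (if g = id then 1 else 0) / d)" for m
  have c0: "c 0 g = (if g = id then 1 else 0) / d" for g by (simp add: c_def)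
  have cS: "c (Suc m) g = (\<Sum>\<alpha>\<in>Rp. k \<alpha> * c m (g \<circ> refl_root \<alpha>)) / d" for m g by (simp add: c_def)
  have bound: "\<bar>c m g\<bar> \<le> q ^ m / d" for m g
  proof (induction m arbitrary: g)
    case 0
    show ?case using d by (simp add: c0)
  next
    case (Suc m)
    have "\<bar>\<Sum>\<alpha>\<in>Rp. k \<alpha> * c m (g \<circ> refl_root \<alpha>)\<bar> \<le> (\<Sum>\<alpha>\<in>Rp. k \<alpha> * (q ^ m / d))"
    proof (rule order_trans[OF sum_abs sum_mono])
      fix \<alpha> assume "\<alpha> \<in> Rp"
      then show "\<bar>k \<alpha> * c m (g \<circ> refl_root \<alpha>)\<bar> \<le> k \<alpha> * (q ^ m / d)"
        using Suc[of "g \<circ> refl_root \<alpha>"] k_nonneg[of \<alpha>] by (simp only: abs_mult abs_of_nonneg mult_left_mono)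
    qed
    also have "\<dots> = \<gamma> * (q ^ m / d)" by (simp only: mult_gamma_def sum_distrib_right)
    finally have le: "\<bar>\<Sum>\<alpha>\<in>Rp. k \<alpha> * c m (g \<circ> refl_root \<alpha>)\<bar> \<le> \<gamma> * (q ^ m / d)" .
    have "\<bar>c (Suc m) g\<bar> = \<bar>\<Sum>\<alpha>\<in>Rp. k \<alpha> * c m (g \<circ> refl_root \<alpha>)\<bar> / d"
      using d by (simp only: cS abs_divide abs_of_pos)
    also have "\<dots> \<le> \<gamma> * (q ^ m / d) / d"
      using d by (intro divide_right_mono le) simp
    finally show ?case by (simp add: q_def)
  qed
  have summ: "summable (\<lambda>m. c m g)" for g
    by (rule summable_comparison_test'[where g = "\<lambda>m. q ^ m / d" and N = 0])
       (use q bound in \<open>auto intro: summable_divide summable_geometric\<close>)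
  have "d * (\<Sum>m. c m g) - (\<Sum>\<alpha>\<in>Rp. k \<alpha> * (\<Sum>m. c m (g \<circ> refl_root \<alpha>))) = (if g = id then 1 else 0)" for g
  proof -
    have "(\<Sum>m. c (Suc m) g) = (\<Sum>m. c m g) - c 0 g"
      by (rule suminf_split_head[OF summ])
    moreover have "d * (\<Sum>m. c (Suc m) g) = (\<Sum>m. d * c (Suc m) g)"
      by (rule suminf_mult[symmetric]) (use summable_ignore_initial_segment[OF summ, of 1] in simp)
    moreover have "(\<Sum>m. d * c (Suc m) g) = (\<Sum>m. \<Sum>\<alpha>\<in>Rp. k \<alpha> * c m (g \<circ> refl_root \<alpha>))"
      using d by (simp add: cS)
    moreover have "\<dots> = (\<Sum>\<alpha>\<in>Rp. \<Sum>m. k \<alpha> * c m (g \<circ> refl_root \<alpha>))"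
      by (rule suminf_sum) (intro summable_mult summ)
    moreover have "\<dots> = (\<Sum>\<alpha>\<in>Rp. k \<alpha> * (\<Sum>m. c m (g \<circ> refl_root \<alpha>)))"
      by (simp add: suminf_mult summ)
    ultimately have "d * ((\<Sum>m. c m g) - c 0 g) = (\<Sum>\<alpha>\<in>Rp. k \<alpha> * (\<Sum>m. c m (g \<circ> refl_root \<alpha>)))"
      by metis
    then show ?thesis using d by (simp add: c0 algebra_simps split: if_splits)
  qed
  then show ?thesis unfolding d_def by (intro exI[of _ "\<lambda>g. \<Sum>m. c m g"]) simp
qed

definition neumann_coeff :: "nat \<Rightarrow> (real^'n \<Rightarrow> real^'n) \<Rightarrow> real" where
  "neumann_coeff n = (SOME h. \<forall>g. (real n + \<gamma>) * h g
      - (\<Sum>\<alpha>\<in>Rp. k \<alpha> * h (g \<circ> refl_root \<alpha>)) = (if g = id then 1 else 0))"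

lemma neumann_coeff: "n > 0 \<Longrightarrow> (real n + \<gamma>) * neumann_coeff n g
      - (\<Sum>\<alpha>\<in>Rp. k \<alpha> * neumann_coeff n (g \<circ> refl_root \<alpha>)) = (if g = id then 1 else 0)"
  unfolding neumann_coeff_def using someI_ex[OF neumann_coeff_ex] by blast

definition euler_inverse :: "nat \<Rightarrow> (complex^'n \<Rightarrow> complex) \<Rightarrow> complex^'n \<Rightarrow> complex" where
  "euler_inverse n f x = (\<Sum>g\<in>W. complex_of_real (neumann_coeff n g) * f (cplx_map g x))"

lemma euler_op_inverse:
  assumes "n > 0" shows "euler_op n (euler_inverse n f) x = f x"
proof -
  let ?h = "\<lambda>g. complex_of_real (neumann_coeff n g)"
  have refl: "euler_inverse n f (crefl_root \<alpha> x) = (\<Sum>g\<in>W. ?h (g \<circ> refl_root \<alpha>) * f (cplx_map g x))"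
    if a: "\<alpha> \<in> Rp" for \<alpha>
  proof -
    have inv: "(g \<circ> refl_root \<alpha>) \<circ> refl_root \<alpha> = g" for g
      by (simp add: fun_eq_iff refl_root_invol Rp_nonzero a)
    show ?thesis
      unfolding euler_inverse_def
      by (rule sum.reindex_bij_witness[where i = "\<lambda>g. g \<circ> refl_root \<alpha>" and j = "\<lambda>g. g \<circ> refl_root \<alpha>"])
         (simp_all only: inv W_right Rp_R a cplx_map_comp crefl_root_eq)
  qed
  have "euler_op n (euler_inverse n f) x = complex_of_real (real n + \<gamma>) * (\<Sum>g\<in>W. ?h g * f (cplx_map g x))
      - (\<Sum>\<alpha>\<in>Rp. complex_of_real (k \<alpha>) * (\<Sum>g\<in>W. ?h (g \<circ> refl_root \<alpha>) * f (cplx_map g x)))"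
    unfolding euler_op_alt using refl by (simp add: euler_inverse_def[of n f x])
  also have "(\<Sum>\<alpha>\<in>Rp. complex_of_real (k \<alpha>) * (\<Sum>g\<in>W. ?h (g \<circ> refl_root \<alpha>) * f (cplx_map g x)))
    = (\<Sum>g\<in>W. \<Sum>\<alpha>\<in>Rp. complex_of_real (k \<alpha>) * (?h (g \<circ> refl_root \<alpha>) * f (cplx_map g x)))"
    unfolding sum_distrib_left by (rule sum.swap)
  also have "complex_of_real (real n + \<gamma>) * (\<Sum>g\<in>W. ?h g * f (cplx_map g x)) - \<dots>
    = (\<Sum>g\<in>W. complex_of_real ((real n + \<gamma>) * neumann_coeff n g
        - (\<Sum>\<alpha>\<in>Rp. k \<alpha> * neumann_coeff n (g \<circ> refl_root \<alpha>))) * f (cplx_map g x))"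
    by (simp add: sum_distrib_left sum_distrib_right sum_subtractf algebra_simps)
  also have "\<dots> = (\<Sum>g\<in>W. if g = id then f x else 0)"
    by (rule sum.cong) (simp_all only: neumann_coeff[OF assms], simp)
  also have "\<dots> = f x" using W_id finite_W by simp
  finally show ?thesis .
qed

text \<open>At a point where the modulus is maximal, the reflected values cannot exceed the value itself,
  so the difference terms do not reduce the first term. The set and the action are kept abstract
  because the principle is applied to points and to pairs of a point and a direction.\<close>

lemma euler_max_principle:
  fixes f :: "'b \<Rightarrow> complex"
  assumes "finite S" "n > 0" and inv: "\<And>\<alpha> y. \<alpha> \<in> Rp \<Longrightarrow> y \<in> S \<Longrightarrow> s \<alpha> y \<in> S"
    and B: "\<And>y. y \<in> S \<Longrightarrow>
      cmod (of_nat n * f y + (\<Sum>\<alpha>\<in>Rp. complex_of_real (k \<alpha>) * (f y - f (s \<alpha> y)))) \<le> B"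
    and "x \<in> S"
  shows "cmod (f x) \<le> B / real n"
proof -
  obtain m where m: "m \<in> S" "\<And>y. y \<in> S \<Longrightarrow> cmod (f y) \<le> cmod (f m)"
  proof -
    have "Max ((\<lambda>y. cmod (f y)) ` S) \<in> (\<lambda>y. cmod (f y)) ` S"
      by (rule Max_in) (use \<open>x \<in> S\<close> \<open>finite S\<close> in auto)
    then obtain m where "m \<in> S" "cmod (f m) = Max ((\<lambda>y. cmod (f y)) ` S)" by auto
    then show ?thesis using that \<open>finite S\<close> by simp
  qed
  let ?F = "of_nat n * f m + (\<Sum>\<alpha>\<in>Rp. complex_of_real (k \<alpha>) * (f m - f (s \<alpha> m)))"
  have "complex_of_real (real n + \<gamma>) * f m = ?F + (\<Sum>\<alpha>\<in>Rp. complex_of_real (k \<alpha>) * f (s \<alpha> m))"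
    by (simp add: right_diff_distrib sum_subtractf sum_k distrib_right)
  then have "cmod (complex_of_real (real n + \<gamma>) * f m)
      \<le> cmod ?F + cmod (\<Sum>\<alpha>\<in>Rp. complex_of_real (k \<alpha>) * f (s \<alpha> m))"
    by (simp add: norm_triangle_ineq)
  also have "cmod (\<Sum>\<alpha>\<in>Rp. complex_of_real (k \<alpha>) * f (s \<alpha> m)) \<le> (\<Sum>\<alpha>\<in>Rp. k \<alpha> * cmod (f m))"
    by (rule order_trans[OF norm_sum sum_mono])
       (simp add: norm_mult k_nonneg mult_left_mono m inv)
  also have "\<dots> = \<gamma> * cmod (f m)" by (simp add: mult_gamma_def sum_distrib_right)
  also have "cmod ?F \<le> B" by (rule B[OF m(1)])
  also have "cmod (complex_of_real (real n + \<gamma>) * f m) = (real n + \<gamma>) * cmod (f m)"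
    using gamma_nonneg by (simp add: norm_mult del: of_real_add)
  finally have "real n * cmod (f m) \<le> B" by (simp add: algebra_simps)
  then have "cmod (f m) \<le> B / real n" using assms(2) by (simp add: field_simps)
  then show ?thesis using m(2)[OF \<open>x \<in> S\<close>] by linarith
qed

definition orbit :: "complex^'n \<Rightarrow> (complex^'n) set" where "orbit x = (\<lambda>g. cplx_map g x) ` W"

lemma finite_orbit: "finite (orbit x)" by (simp add: orbit_def finite_W)

lemma orbit_self: "x \<in> orbit x" unfolding orbit_def using W_id by (auto intro!: image_eqI[of _ _ id])

lemma orbit_closed: "\<alpha> \<in> Rp \<Longrightarrow> y \<in> orbit x \<Longrightarrow> crefl_root \<alpha> y \<in> orbit x"
  unfolding orbit_def crefl_root_eq
  using reflection_group.intros(2)[OF Rp_R] by (auto simp: image_iff simp flip: cplx_map_comp)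

lemma norm_orbit: "y \<in> orbit x \<Longrightarrow> norm y = norm x"
  by (auto simp: orbit_def norm_cplx_map W_orthogonal)

lemma euler_op_inj:
  assumes "n > 0" "\<And>y. euler_op n f y = euler_op n f' y" shows "f x = f' x"
proof -
  have "cmod (f x - f' x) \<le> 0 / real n"
  proof (rule euler_max_principle[OF finite_orbit assms(1) orbit_closed _ orbit_self])
    fix y
    have "of_nat n * (f y - f' y) + (\<Sum>\<alpha>\<in>Rp. complex_of_real (k \<alpha>) * (f y - f' y
        - (f (crefl_root \<alpha> y) - f' (crefl_root \<alpha> y)))) = euler_op n f y - euler_op n f' y"
      by (simp add: euler_op_def algebra_simps sum_subtractf sum.distrib)
    then show "cmod (of_nat n * (f y - f' y) + (\<Sum>\<alpha>\<in>Rp. complex_of_real (k \<alpha>) * (f y - f' y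
        - (f (crefl_root \<alpha> y) - f' (crefl_root \<alpha> y))))) \<le> 0" using assms(2)[of y] by simp
  qed auto
  then show ?thesis by simp
qed

text \<open>The components of the kernel, obtained by solving the Euler equation degree by degree.\<close>

primrec dunkl_En :: "nat \<Rightarrow> complex^'n \<Rightarrow> complex^'n \<Rightarrow> complex" where
  "dunkl_En 0 = (\<lambda>x w. 1)"
| "dunkl_En (Suc n) = (\<lambda>x w. euler_inverse (Suc n) (\<lambda>x. cdot x w * dunkl_En n x w) x)"

lemma euler_op_En: "euler_op (Suc n) (\<lambda>x. dunkl_En (Suc n) x w) x = cdot x w * dunkl_En n x w"
  by (simp add: euler_op_inverse)

lemma cpoly_euler_inverse: "cpoly p \<Longrightarrow> cpoly (euler_inverse n p)"
  unfolding euler_inverse_def[abs_def]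
  by (intro cpoly_sum cpoly_scale cpoly_cplx_map finite_W)

lemma cpoly_En: "cpoly (\<lambda>x. dunkl_En n x w)"
  by (induction n) (auto intro: cpoly_const cpoly_euler_inverse cpoly_cdot)

lemma En_homogeneous: "dunkl_En n (c *s x) w = c ^ n * dunkl_En n x w"
proof (induction n arbitrary: x)
  case (Suc n)
  have "cplx_map g (c *s x) = c *s cplx_map g x" if "g \<in> W" for g
    by (rule cplx_map_scale) (use that W_orthogonal orthogonal_transformation_linear in blast)
  then show ?case
    by (simp add: euler_inverse_def Suc cdot_bilinear sum_distrib_left algebra_simps)
qed simp

lemma En_norm_bound: "cmod (dunkl_En n x w) \<le> (norm x * norm w) ^ n / fact n"
proof (induction n arbitrary: x)
  case (Suc n)
  have "cmod (dunkl_En (Suc n) x w) \<le> (norm x * norm w) ^ Suc n / fact n / real (Suc n)"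
  proof (rule euler_max_principle[where f = "\<lambda>x. dunkl_En (Suc n) x w" and s = crefl_root,
        OF finite_orbit _ orbit_closed _ orbit_self])
    fix y assume y: "y \<in> orbit x"
    have "cmod (cdot y w * dunkl_En n y w) \<le> (norm y * norm w) * ((norm y * norm w) ^ n / fact n)"
      unfolding norm_mult by (intro mult_mono norm_cdot_le Suc) auto
    then have "cmod (euler_op (Suc n) (\<lambda>x. dunkl_En (Suc n) x w) y) \<le> (norm x * norm w) ^ Suc n / fact n"
      unfolding euler_op_En by (simp add: norm_orbit[OF y] algebra_simps)
    then show "cmod (of_nat (Suc n) * dunkl_En (Suc n) y w + (\<Sum>\<alpha>\<in>Rp. complex_of_real (k \<alpha>) *
        (dunkl_En (Suc n) y w - dunkl_En (Suc n) (crefl_root \<alpha> y) w))) \<le> (norm x * norm w) ^ Suc n / fact n"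
      unfolding euler_op_def .
  qed auto
  also have "\<dots> = (norm x * norm w) ^ Suc n / fact (Suc n)" by (simp add: field_simps)
  finally show ?case .
qed simp

text \<open>Both sides solve the same Euler equation, as reflections permute its summands.\<close>

lemma En_equivariant: "\<beta> \<in> R \<Longrightarrow> dunkl_En n (crefl_root \<beta> x) (crefl_root \<beta> w) = dunkl_En n x w"
proof (induction n arbitrary: x)
  case (Suc n)
  have b0: "\<beta> \<noteq> 0" using Suc root_nonzero by blast
  show ?case
  proof (rule euler_op_inj[of "Suc n" "\<lambda>x. dunkl_En (Suc n) (crefl_root \<beta> x) (crefl_root \<beta> w)"])
    fix y
    define f where "f = (\<lambda>x. dunkl_En (Suc n) x (crefl_root \<beta> w))"
    have "(\<Sum>\<alpha>\<in>Rp. complex_of_real (k \<alpha>) * (f (crefl_root \<beta> y) - f (crefl_root \<beta> (crefl_root \<alpha> y))))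
        = (\<Sum>\<alpha>\<in>Rp. complex_of_real (if \<alpha> \<in> R then k \<alpha> else 0)
            * (f (crefl_root \<beta> y) - f (crefl_root \<alpha> (crefl_root \<beta> y))))"
    proof (rule sum_Rp_refl[OF Suc.prems])
      fix \<alpha>
      show "complex_of_real (if - \<alpha> \<in> R then k (- \<alpha>) else 0) *
          (f (crefl_root \<beta> y) - f (crefl_root (- \<alpha>) (crefl_root \<beta> y))) =
         complex_of_real (if \<alpha> \<in> R then k \<alpha> else 0) *
          (f (crefl_root \<beta> y) - f (crefl_root \<alpha> (crefl_root \<beta> y)))"
        using minus_root[of \<alpha>] minus_root[of "- \<alpha>"] k_minus[of \<alpha>] by (auto simp: crefl_root_minus)
    qed (simp add: Suc.prems Rp_R refl_root_mem k_refl crefl_root_conj[OF b0])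
    also have "\<dots> = (\<Sum>\<alpha>\<in>Rp. complex_of_real (k \<alpha>)
            * (f (crefl_root \<beta> y) - f (crefl_root \<alpha> (crefl_root \<beta> y))))"
      by (rule sum.cong) (auto simp: Rp_R)
    finally have "euler_op (Suc n) (\<lambda>x. f (crefl_root \<beta> x)) y = euler_op (Suc n) f (crefl_root \<beta> y)"
      by (simp add: euler_op_def)
    also have "\<dots> = cdot y w * dunkl_En n y w"
      unfolding f_def euler_op_En by (simp add: Suc cdot_crefl_root b0)
    finally show "euler_op (Suc n) (\<lambda>x. dunkl_En (Suc n) (crefl_root \<beta> x) (crefl_root \<beta> w)) y =
         euler_op (Suc n) (\<lambda>a. dunkl_En (Suc n) a w) y"
      unfolding euler_op_En by (simp add: f_def)
  qed simp
qed simp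

text \<open>By equivariance a reflection of one argument can be moved to the other, so the Euler
  operators in the two arguments act alike, and both sides solve the same equation.\<close>

lemma En_symmetric: "dunkl_En n x w = dunkl_En n w x"
proof (induction n arbitrary: x w)
  case (Suc n)
  show ?case
  proof (rule euler_op_inj[of "Suc n" "\<lambda>x. dunkl_En (Suc n) x w"])
    fix y
    have "dunkl_En (Suc n) w (crefl_root \<alpha> y) = dunkl_En (Suc n) (crefl_root \<alpha> w) y" if "\<alpha> \<in> Rp" for \<alpha>
      using En_equivariant[OF Rp_R[OF that], of "Suc n" w "crefl_root \<alpha> y"] crefl_root_invol[OF Rp_nonzero[OF that]]
      by metis
    then have "euler_op (Suc n) (dunkl_En (Suc n) w) y = euler_op (Suc n) (\<lambda>x. dunkl_En (Suc n) x y) w"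
      unfolding euler_op_def by (simp cong: sum.cong del: dunkl_En.simps)
    then show "euler_op (Suc n) (\<lambda>x. dunkl_En (Suc n) x w) y = euler_op (Suc n) (dunkl_En (Suc n) w) y"
      unfolding euler_op_En by (simp add: Suc cdot_commute)
  qed simp
qed simp

lemma En_real: "dunkl_En n (cvec x) (cvec y) \<in> \<real>"
proof (induction n arbitrary: x)
  case (Suc n)
  have "complex_of_real (neumann_coeff (Suc n) g) * (cdot (cplx_map g (cvec x)) (cvec y)
      * dunkl_En n (cplx_map g (cvec x)) (cvec y)) \<in> \<real>" if "g \<in> W" for g
    using Suc[of "g x"] cplx_map_cvec[OF orthogonal_transformation_linear[OF W_orthogonal[OF that]]]
    by (simp add: cdot_cvec)
  then show ?case by (auto simp: euler_inverse_def intro!: sum_in_Reals)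
qed simp

lemma continuous_on_cplx_map:
  "g \<in> W \<Longrightarrow> continuous_on S f \<Longrightarrow> continuous_on S (\<lambda>x. cplx_map g (f x))"
  using bounded_linear.continuous_on[OF bounded_linear_cplx_map[OF W_orthogonal]] .

lemma En_continuous: "continuous_on UNIV (\<lambda>(x, w). dunkl_En n x w)"
proof (induction n)
  case (Suc n)
  have "continuous_on UNIV (\<lambda>z. dunkl_En n (cplx_map g (fst z)) (snd z))" if "g \<in> W" for g
    using continuous_on_compose2[OF Suc, of UNIV "\<lambda>z. (cplx_map g (fst z), snd z)"] that
    by (simp add: continuous_on_cplx_map continuous_intros)
  then show ?case
    by (auto simp: case_prod_beta euler_inverse_def intro!: continuous_intros continuous_on_cplx_map)
qed (simp add: case_prod_beta)

subsection \<open>Dunkl operators lower the components\<close>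

lemma Euler_relation:
  assumes p: "cpoly p" and hom: "\<And>c x. c \<noteq> 0 \<Longrightarrow> p (c *s x) = c ^ n * p x"
  shows "(\<Sum>i\<in>UNIV. x $ i * T (axis i 1) p x) = euler_op n p x"
proof -
  have "((\<lambda>c. p (c *s x)) has_derivative (\<lambda>h. frechet_derivative p (at (1 *s x)) (h *s x))) (at 1)"
    by (rule has_derivative_compose[OF bounded_linear_imp_has_derivative[OF bounded_linear_vector_scalar]
          cpoly_has_derivative[OF p]])
  then have "((\<lambda>c. p (c *s x)) has_derivative (\<lambda>h. frechet_derivative p (at x) (h *s x))) (at 1)"
    by simp
  then have 1: "((\<lambda>c. c ^ n * p x) has_derivative (\<lambda>h. frechet_derivative p (at x) (h *s x))) (at 1)"
    by (rule has_derivative_transform_within_open[where s = "- {0}"]) (auto simp: hom)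
  have 2: "((\<lambda>c. c ^ n * p x) has_derivative (*) (of_nat n * p x)) (at 1)"
    using has_field_derivative_imp_has_derivative[of "\<lambda>c. c ^ n * p x" "of_nat n * p x" "at 1"]
    by (auto intro!: derivative_eq_intros)
  have "(\<lambda>h. frechet_derivative p (at x) (h *s x)) = (*) (of_nat n * p x)"
    using has_derivative_unique[OF 1 2] .
  then have "frechet_derivative p (at x) (1 *s x) = of_nat n * p x * 1" by metis
  moreover have "(\<Sum>\<alpha>\<in>Rp. complex_of_real (k \<alpha>) * cdot (cvec \<alpha>) x * dunkl_quotient \<alpha> p x)
      = (\<Sum>\<alpha>\<in>Rp. complex_of_real (k \<alpha>) * (p x - p (crefl_root \<alpha> x)))"
    by (rule sum.cong) (simp_all add: cpoly_quotient(2)[OF Rp_nonzero p])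
  ultimately have "T x p x = euler_op n p x" by (simp add: dunkl_op_def euler_op_def)
  then show ?thesis using T_direction_sum[OF p] by metis
qed

lemma T_homogeneous:
  assumes p: "cpoly p" and hom: "\<And>c x. c \<noteq> 0 \<Longrightarrow> p (c *s x) = c ^ Suc n * p x" and c: "c \<noteq> 0"
  shows "T \<xi> p (c *s x) = c ^ n * T \<xi> p x"
proof -
  have "((\<lambda>x. p (c *s x)) has_derivative (\<lambda>v. frechet_derivative p (at (c *s x)) (c *s v))) (at x)"
    by (rule has_derivative_compose[OF bounded_linear_imp_has_derivative[OF bounded_linear_vector_scalar_right]
          cpoly_has_derivative[OF p]])
  moreover have "((\<lambda>x. p (c *s x)) has_derivative (\<lambda>v. c ^ Suc n * frechet_derivative p (at x) v)) (at x)"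
    unfolding hom[OF c] by (intro has_derivative_mult_right cpoly_has_derivative p)
  ultimately have "frechet_derivative p (at (c *s x)) (c *s \<xi>) = c ^ Suc n * frechet_derivative p (at x) \<xi>"
    using has_derivative_unique by metis
  then have D: "frechet_derivative p (at (c *s x)) \<xi> = c ^ n * frechet_derivative p (at x) \<xi>"
    using c by (simp add: cpoly_derivative_props[OF p])
  have Q: "dunkl_quotient \<alpha> p (c *s x) = c ^ n * dunkl_quotient \<alpha> p x" if a: "\<alpha> \<in> Rp" for \<alpha>
  proof -
    have "dunkl_quotient \<alpha> p = (\<lambda>x. dunkl_quotient \<alpha> p (c *s x) / c ^ n)"
    proof (rule dunkl_quotient_eqI[OF Rp_nonzero[OF a]])
      have "continuous_on UNIV (\<lambda>x. dunkl_quotient \<alpha> p (c *s x))"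
        by (rule continuous_on_compose2[OF cpoly_continuous[OF cpoly_quotient(1)[OF Rp_nonzero[OF a] p]]])
           (auto intro: bounded_linear.continuous_on[OF bounded_linear_vector_scalar_right])
      then show "continuous_on UNIV (\<lambda>x. dunkl_quotient \<alpha> p (c *s x) / c ^ n)"
        using c by (intro continuous_intros) auto
      fix x
      have "c ^ Suc n * (p x - p (crefl_root \<alpha> x)) = c * cdot (cvec \<alpha>) x * dunkl_quotient \<alpha> p (c *s x)"
        using cpoly_quotient(2)[OF Rp_nonzero[OF a] p, of "c *s x"]
        by (simp add: hom[OF c] crefl_root_scale cdot_bilinear algebra_simps)
      then have "c ^ n * (p x - p (crefl_root \<alpha> x)) = cdot (cvec \<alpha>) x * dunkl_quotient \<alpha> p (c *s x)"
        using c by (metis (no_types, lifting) mult.assoc mult_left_cancel power_Suc)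
      then show "p x - p (crefl_root \<alpha> x) = cdot (cvec \<alpha>) x * (dunkl_quotient \<alpha> p (c *s x) / c ^ n)"
        using c by (simp add: eq_divide_eq mult.commute)
    qed
    from fun_cong[OF this, of x] show ?thesis using c by (simp add: field_simps)
  qed
  show ?thesis by (simp add: dunkl_op_def D Q algebra_simps sum_distrib_left)
qed

text \<open>The components are built from the contraction of the eigenvalue equations with the point only.
  Let \<open>q \<eta>\<close> be the defect of the equation in direction \<open>\<eta>\<close>. Its contraction with the point vanishes by
  construction; applying a Dunkl operator to this identity, and using commutativity together with the
  induction hypothesis, produces an Euler equation without right-hand side for \<open>q\<close>, in which
  reflections act on point and direction simultaneously. The maximum principle then forces \<open>q = 0\<close>.\<close>

theorem T_En:
  "T \<xi> (\<lambda>x. dunkl_En n x w) x = (if n = 0 then 0 else cdot \<xi> w * dunkl_En (n - 1) x w)"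
proof (induction n arbitrary: \<xi> x)
  case 0
  show ?case by (simp add: T_const)
next
  case (Suc n)
  define p where "p = (\<lambda>x. dunkl_En (Suc n) x w)"
  define r where "r = (\<lambda>x. dunkl_En n x w)"
  define q where "q \<eta> = (\<lambda>x. T \<eta> p x - cdot \<eta> w * r x)" for \<eta>
  have p: "cpoly p" and r: "cpoly r" unfolding p_def r_def by (rule cpoly_En)+
  have q: "cpoly (q \<eta>)" for \<eta>
    unfolding q_def by (intro cpoly_diff cpoly_scale T_cpoly p r)
  have q_lin: "q (\<xi> + c *s \<eta>) x = q \<xi> x + c * q \<eta> x" for \<xi> \<eta> c x
    by (simp add: q_def T_direction[OF p] cdot_bilinear algebra_simps)
  have q_sum: "(\<Sum>i\<in>UNIV. v $ i * q (axis i 1) x) = q v x" for v x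
  proof -
    have "q v x = (\<Sum>i\<in>UNIV. v $ i * T (axis i 1) p x) - cdot v w * r x"
      unfolding q_def by (simp only: T_direction_sum[OF p, of v])
    also have "cdot v w = (\<Sum>i\<in>UNIV. v $ i * cdot (axis i 1) w)"
      by (simp only: cdot_commute[of _ w] cdot_axis) (simp add: cdot_def mult.commute)
    finally show ?thesis
      by (simp add: q_def right_diff_distrib sum_subtractf sum_distrib_right mult.assoc)
  qed
  \<comment> \<open>The defect is curl free, which is the point where commutativity enters.\<close>
  have q_comm: "T \<eta> (q \<xi>) x = T \<xi> (q \<eta>) x" for \<xi> \<eta> x
  proof -
    have "T \<eta> (q \<xi>) x = T \<eta> (T \<xi> p) x - cdot \<xi> w * T \<eta> r x" for \<xi> \<eta>
      unfolding q_def by (simp add: T_diff T_scale T_cpoly p r cpoly_scale)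
    then show ?thesis using T_commute[OF p] by (simp add: r_def Suc.IH)
  qed
  have q_hom: "q \<eta> (c *s x) = c ^ n * q \<eta> x" if "c \<noteq> 0" for \<eta> c x
    using that T_homogeneous[OF p, of n c] En_homogeneous[of "Suc n", folded p_def]
    by (simp add: q_def r_def En_homogeneous algebra_simps p_def del: dunkl_En.simps)
  have radial: "(\<Sum>i\<in>UNIV. x $ i * q (axis i 1) x) = 0" for x
  proof -
    have "T x p x = euler_op (Suc n) p x"
      using Euler_relation[OF p, of "Suc n" x] T_direction_sum[OF p, of x x]
        En_homogeneous[of "Suc n", folded p_def] by (simp add: p_def del: dunkl_En.simps)
    then show ?thesis unfolding q_sum by (simp add: q_def r_def p_def euler_op_En del: dunkl_En.simps)
  qed
  have key: "of_nat (Suc n) * q \<eta> x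
      + (\<Sum>\<alpha>\<in>Rp. complex_of_real (k \<alpha>) * (q \<eta> x - q (crefl_root \<alpha> \<eta>) (crefl_root \<alpha> x))) = 0" for \<eta> x
  proof -
    define d where "d \<alpha> = complex_of_real (k \<alpha>) * (2 / cdot (cvec \<alpha>) (cvec \<alpha>)) * cdot (cvec \<alpha>) \<eta>" for \<alpha>
    have "0 = T \<eta> (\<lambda>x. \<Sum>i\<in>UNIV. x $ i * q (axis i 1) x) x"
      by (simp add: radial T_const)
    also have "\<dots> = (\<Sum>i\<in>UNIV. T \<eta> (\<lambda>x. x $ i * q (axis i 1) x) x)"
      by (intro T_sum cpoly_coord q) simp
    also have "\<dots> = (\<Sum>i\<in>UNIV. \<eta> $ i * q (axis i 1) x + x $ i * T \<eta> (q (axis i 1)) x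
        + (\<Sum>\<alpha>\<in>Rp. d \<alpha> * (cvec \<alpha> $ i * q (axis i 1) (crefl_root \<alpha> x))))"
      by (simp add: T_coord q d_def mult.assoc)
    also have "\<dots> = q \<eta> x + (\<Sum>i\<in>UNIV. x $ i * T (axis i 1) (q \<eta>) x)
        + (\<Sum>i\<in>UNIV. \<Sum>\<alpha>\<in>Rp. d \<alpha> * (cvec \<alpha> $ i * q (axis i 1) (crefl_root \<alpha> x)))"
      by (simp add: sum.distrib q_sum q_comm[of \<eta>])
    also have "(\<Sum>i\<in>UNIV. \<Sum>\<alpha>\<in>Rp. d \<alpha> * (cvec \<alpha> $ i * q (axis i 1) (crefl_root \<alpha> x)))
        = (\<Sum>\<alpha>\<in>Rp. \<Sum>i\<in>UNIV. d \<alpha> * (cvec \<alpha> $ i * q (axis i 1) (crefl_root \<alpha> x)))"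
      by (rule sum.swap)
    also have "\<dots> = (\<Sum>\<alpha>\<in>Rp. d \<alpha> * q (cvec \<alpha>) (crefl_root \<alpha> x))"
      by (simp add: q_sum flip: sum_distrib_left)
    also have "(\<Sum>i\<in>UNIV. x $ i * T (axis i 1) (q \<eta>) x) = euler_op n (q \<eta>) x"
      by (rule Euler_relation[OF q q_hom])
    finally have "0 = q \<eta> x + euler_op n (q \<eta>) x + (\<Sum>\<alpha>\<in>Rp. d \<alpha> * q (cvec \<alpha>) (crefl_root \<alpha> x))" .
    also have "\<dots> = of_nat (Suc n) * q \<eta> x + (\<Sum>\<alpha>\<in>Rp. complex_of_real (k \<alpha>) * (q \<eta> x
        - q \<eta> (crefl_root \<alpha> x)) + d \<alpha> * q (cvec \<alpha>) (crefl_root \<alpha> x))"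
      by (simp add: euler_op_def distrib_right sum.distrib)
    also have "(\<Sum>\<alpha>\<in>Rp. complex_of_real (k \<alpha>) * (q \<eta> x
        - q \<eta> (crefl_root \<alpha> x)) + d \<alpha> * q (cvec \<alpha>) (crefl_root \<alpha> x))
      = (\<Sum>\<alpha>\<in>Rp. complex_of_real (k \<alpha>) * (q \<eta> x - q (crefl_root \<alpha> \<eta>) (crefl_root \<alpha> x)))"
    proof (rule sum.cong)
      fix \<alpha>
      have "crefl_root \<alpha> \<eta> = \<eta> + (- (2 / cdot (cvec \<alpha>) (cvec \<alpha>) * cdot (cvec \<alpha>) \<eta>)) *s cvec \<alpha>"
        by (simp add: crefl_root_def vec_eq_iff)
      then have refl: "q (crefl_root \<alpha> \<eta>) y = q \<eta> y
          - 2 / cdot (cvec \<alpha>) (cvec \<alpha>) * cdot (cvec \<alpha>) \<eta> * q (cvec \<alpha>) y" for y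
        by (simp only: q_lin) simp
      then show "complex_of_real (k \<alpha>) * (q \<eta> x - q \<eta> (crefl_root \<alpha> x)) + d \<alpha> * q (cvec \<alpha>) (crefl_root \<alpha> x)
        = complex_of_real (k \<alpha>) * (q \<eta> x - q (crefl_root \<alpha> \<eta>) (crefl_root \<alpha> x))"
        unfolding refl d_def by (simp add: algebra_simps)
    qed simp
    finally show ?thesis by simp
  qed
  \<comment> \<open>The maximum principle on the orbit of the pair of point and direction.\<close>
  let ?S = "(\<lambda>g. (cplx_map g x, cplx_map g \<xi>)) ` W"
  have "cmod (case (x, \<xi>) of (x, \<eta>) \<Rightarrow> q \<eta> x) \<le> 0 / real (Suc n)"
  proof (rule euler_max_principle[where S = ?S and s = "\<lambda>\<alpha> (x, \<eta>). (crefl_root \<alpha> x, crefl_root \<alpha> \<eta>)"])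
    show "finite ?S" by (simp add: finite_W)
    show "(case y of (x, \<eta>) \<Rightarrow> (crefl_root \<alpha> x, crefl_root \<alpha> \<eta>)) \<in> ?S" if "\<alpha> \<in> Rp" "y \<in> ?S" for \<alpha> y
      using that reflection_group.intros(2)[OF Rp_R] unfolding crefl_root_eq
      by (force simp: image_iff simp flip: cplx_map_comp)
    show "(x, \<xi>) \<in> ?S" using W_id by (auto intro!: image_eqI[of _ _ id])
  qed (auto simp: key simp del: of_nat_Suc)
  then have "q \<xi> x = 0" by simp
  then show ?case by (simp add: q_def p_def r_def)
qed

end

section \<open>Existence and uniqueness of the Dunkl kernel\<close>

lemma summable_power_fact: "summable (\<lambda>n. r ^ n / fact n :: real)"
  using summable_exp[of r] by (simp add: divide_inverse mult.commute)

lemma continuous_on_UNIV_balls: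
  fixes f :: "'a::real_normed_vector \<Rightarrow> 'b::topological_space"
  assumes "\<And>r. continuous_on (ball 0 r) f" shows "continuous_on UNIV f"
proof -
  have "continuous (at x) f" for x
    using assms[of "norm x + 1"] by (simp add: continuous_on_eq_continuous_at)
  then show ?thesis by (simp add: continuous_at_imp_continuous_on)
qed

lemma continuous_on_suminf_balls:
  fixes f :: "nat \<Rightarrow> 'a::real_normed_vector \<Rightarrow> 'b::banach"
  assumes cont: "\<And>n. continuous_on UNIV (f n)"
    and bound: "\<And>n x. norm x < r \<Longrightarrow> norm (f n x) \<le> M r n" and summ: "summable (M r)"
  shows "continuous_on (ball 0 r) (\<lambda>x. \<Sum>n. f n x)"
proof (rule uniform_limit_theorem)
  show "uniform_limit (ball 0 r) (\<lambda>n x. \<Sum>i<n. f i x) (\<lambda>x. \<Sum>n. f n x) sequentially"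
    by (rule Weierstrass_m_test[OF _ summ]) (simp add: bound)
  show "\<forall>\<^sub>F n in sequentially. continuous_on (ball 0 r) (\<lambda>x. \<Sum>i<n. f i x)"
    by (intro always_eventually allI continuous_on_sum continuous_on_subset[OF cont]) auto
qed simp

context dunkl_data
begin

definition dunkl_E_sum :: "complex^'n \<Rightarrow> complex^'n \<Rightarrow> complex" where
  "dunkl_E_sum x w = (\<Sum>n. dunkl_En n x w)"

lemma En_summable: "summable (\<lambda>n. dunkl_En n x w)"
  by (rule summable_comparison_test'[OF summable_power_fact]) (rule En_norm_bound)

text \<open>The bounds on derivatives and difference quotients make the operators applicable term by term
  to the series. They come from the Cauchy estimate on the complex line through \<^term>\<open>x\<close> in the direction \<^term>\<open>v\<close>.\<close>

lemma En_derivative_bound: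
  "cmod (frechet_derivative (\<lambda>x. dunkl_En n x w) (at x) v)
     \<le> ((norm x + 1) * norm w) ^ n / fact n * norm v"
proof (cases "v = 0")
  case True
  then show ?thesis
    using cpoly_derivative_props(1)[OF cpoly_En, of n w x 0 v] by simp
next
  case False
  define p where "p = (\<lambda>x. dunkl_En n x w)"
  have p: "cpoly p" unfolding p_def by (rule cpoly_En)
  define u where "u = complex_of_real (1 / norm v) *s v"
  have u: "norm u = 1" "v = complex_of_real (norm v) *s u"
    using False by (simp_all add: u_def norm_vector_scalar norm_divide vector_smult_assoc)
  have D: "((\<lambda>s. p (x + s *s u)) has_field_derivative frechet_derivative p (at (x + s *s u)) u) (at s)" for s
  proof -
    have "((\<lambda>s. x + s *s u) has_derivative (\<lambda>h. h *s u)) (at s)"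
      using has_derivative_add[OF has_derivative_const bounded_linear_imp_has_derivative[OF bounded_linear_vector_scalar]]
      by simp
    then have "((\<lambda>s. p (x + s *s u)) has_derivative (\<lambda>h. frechet_derivative p (at (x + s *s u)) (h *s u))) (at s)"
      by (rule has_derivative_compose[OF _ cpoly_has_derivative[OF p]])
    then show ?thesis
      by (simp add: has_field_derivative_def cpoly_derivative_props[OF p] mult.commute[of _ "frechet_derivative p _ _"])
  qed
  have hol: "(\<lambda>s. p (x + s *s u)) holomorphic_on A" for A
    unfolding holomorphic_on_def field_differentiable_def using D has_field_derivative_at_within by blast
  have "cmod ((deriv ^^ 1) (\<lambda>s. p (x + s *s u)) 0)
      \<le> fact 1 * (((norm x + 1) * norm w) ^ n / fact n) / 1 ^ 1"
  proof (rule Cauchy_inequality[OF hol holomorphic_on_imp_continuous_on[OF hol]])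
    fix s :: complex assume s: "cmod (0 - s) = 1"
    have "norm (x + s *s u) \<le> norm x + 1"
      using norm_triangle_ineq[of x "s *s u"] s u by (simp add: norm_vector_scalar)
    then have "(norm (x + s *s u) * norm w) ^ n / fact n \<le> ((norm x + 1) * norm w) ^ n / fact n"
      by (intro divide_right_mono power_mono mult_right_mono) auto
    then show "cmod (p (x + s *s u)) \<le> ((norm x + 1) * norm w) ^ n / fact n"
      unfolding p_def using En_norm_bound order_trans by blast
  qed simp
  moreover have "deriv (\<lambda>s. p (x + s *s u)) 0 = frechet_derivative p (at x) u"
    using DERIV_imp_deriv[OF D[of 0]] by simp
  ultimately have "cmod (frechet_derivative p (at x) u) \<le> ((norm x + 1) * norm w) ^ n / fact n"
    by simp
  moreover have "frechet_derivative p (at x) v = complex_of_real (norm v) * frechet_derivative p (at x) u"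
    by (subst u(2)) (rule cpoly_derivative_props[OF p])
  ultimately show ?thesis
    using mult_left_mono[of "cmod (frechet_derivative p (at x) u)" "((norm x + 1) * norm w) ^ n / fact n" "norm v"]
    by (simp add: norm_mult p_def mult.commute)
qed

text \<open>The mean value inequality bounds the difference by the distance of a point to its mirror image,
  which is proportional to the linear form in the denominator; points on the mirror are reached by
  continuity.\<close>

lemma En_quotient_bound:
  assumes a: "\<alpha> \<noteq> 0"
  shows "cmod (dunkl_quotient \<alpha> (\<lambda>x. dunkl_En n x w) x)
     \<le> 2 / norm \<alpha> * (((norm x + 1) * norm w) ^ n / fact n)"
proof -
  define p where "p = (\<lambda>x. dunkl_En n x w)"
  define b where "b x = ((norm x + 1) * norm w) ^ n / fact n" for x :: "complex^'n"
  have p: "cpoly p" unfolding p_def by (rule cpoly_En)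
  have off: "cmod (dunkl_quotient \<alpha> p x) \<le> 2 / norm \<alpha> * b x" if x: "cdot (cvec \<alpha>) x \<noteq> 0" for x
  proof -
    have "cmod (p x - p (crefl_root \<alpha> x)) \<le> b x * norm (x - crefl_root \<alpha> x)"
    proof (rule differentiable_bound[where S = "cball 0 (norm x)" and f' = "\<lambda>x. frechet_derivative p (at x)"])
      show "onorm (frechet_derivative p (at y)) \<le> b x" if "y \<in> cball 0 (norm x)" for y
      proof (rule onorm_le)
        fix v
        have "cmod (frechet_derivative p (at y) v) \<le> b y * norm v"
          unfolding p_def b_def by (rule En_derivative_bound)
        also have "\<dots> \<le> b x * norm v"
          using that unfolding b_def
          by (intro mult_right_mono divide_right_mono power_mono) auto
        finally show "cmod (frechet_derivative p (at y) v) \<le> b x * norm v" .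
      qed
    qed (auto intro: has_derivative_at_withinI cpoly_has_derivative p simp: norm_crefl_root a)
    also have "norm (x - crefl_root \<alpha> x) = 2 * cmod (cdot (cvec \<alpha>) x) / norm \<alpha>"
      using a by (simp add: crefl_root_def norm_vector_scalar norm_divide norm_mult cdot_cvec
          dot_square_norm power2_eq_square del: of_real_power)
    finally have "cmod (cdot (cvec \<alpha>) x) * cmod (dunkl_quotient \<alpha> p x)
        \<le> b x * (2 * cmod (cdot (cvec \<alpha>) x) / norm \<alpha>)"
      by (simp only: cpoly_quotient(2)[OF a p] norm_mult)
    then have "cmod (cdot (cvec \<alpha>) x) * cmod (dunkl_quotient \<alpha> p x)
        \<le> cmod (cdot (cvec \<alpha>) x) * (2 / norm \<alpha> * b x)" by (simp add: algebra_simps)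
    then show ?thesis by (rule mult_left_le_imp_le) (use x in simp)
  qed
  have "cmod (dunkl_quotient \<alpha> p x) \<le> 2 / norm \<alpha> * b x"
  proof (cases "cdot (cvec \<alpha>) x = 0")
    case True
    let ?s = "\<lambda>n. x + complex_of_real (1 / real (Suc n)) *s cvec \<alpha>"
    have s: "?s \<longlonglongrightarrow> x" by (rule tendsto_off_hyperplane[OF a True])
    show ?thesis
    proof (rule LIMSEQ_le)
      have "isCont (dunkl_quotient \<alpha> p) x"
        using cpoly_continuous[OF cpoly_quotient(1)[OF a p], of UNIV] by (simp add: continuous_on_eq_continuous_at)
      then show "(\<lambda>n. cmod (dunkl_quotient \<alpha> p (?s n))) \<longlonglongrightarrow> cmod (dunkl_quotient \<alpha> p x)"
        by (intro tendsto_norm isCont_tendsto_compose[OF _ s])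
      show "(\<lambda>n. 2 / norm \<alpha> * b (?s n)) \<longlonglongrightarrow> 2 / norm \<alpha> * b x"
        unfolding b_def by (intro tendsto_intros s) auto
      show "\<exists>N. \<forall>n\<ge>N. cmod (dunkl_quotient \<alpha> p (?s n)) \<le> 2 / norm \<alpha> * b (?s n)"
        using off tendsto_off_hyperplane(2)[OF a True] by blast
    qed
  qed (rule off)
  then show ?thesis by (simp add: p_def b_def)
qed

lemma summable_En_derivative: "summable (\<lambda>n. frechet_derivative (\<lambda>x. dunkl_En n x w) (at x) v)"
  by (rule summable_comparison_test'[OF summable_mult2[OF summable_power_fact]])
     (rule En_derivative_bound)

lemma summable_En_quotient: "\<alpha> \<noteq> 0 \<Longrightarrow> summable (\<lambda>n. dunkl_quotient \<alpha> (\<lambda>x. dunkl_En n x w) x)"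
  by (rule summable_comparison_test'[OF summable_mult[OF summable_power_fact]])
     (rule En_quotient_bound)

lemma E_sum_has_derivative:
  "((\<lambda>x. dunkl_E_sum x w) has_derivative
     (\<lambda>v. \<Sum>n. frechet_derivative (\<lambda>x. dunkl_En n x w) (at x) v)) (at x)"
proof -
  define r where "r = norm x + 1"
  define b where "b n = ((r + 1) * norm w) ^ n / fact n" for n :: nat
  let ?D = "\<lambda>n x v. frechet_derivative (\<lambda>x. dunkl_En n x w) (at x) v"
  have b: "summable b" unfolding b_def by (rule summable_power_fact)
  have bound: "cmod (?D n y v) \<le> b n * norm v" if "y \<in> ball 0 r" for n y v
  proof -
    have "((norm y + 1) * norm w) ^ n / fact n * norm v \<le> b n * norm v"
      unfolding b_def using that by (intro mult_right_mono divide_right_mono power_mono) auto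
    then show ?thesis using En_derivative_bound order_trans by blast
  qed
  have "\<exists>g. \<forall>y\<in>ball 0 r. (\<lambda>n. dunkl_En n y w) sums g y \<and>
      (g has_derivative (\<lambda>v. \<Sum>n. ?D n y v)) (at y within ball 0 r)"
  proof (rule has_derivative_series)
    show "\<forall>\<^sub>F n in sequentially. \<forall>y\<in>ball 0 r. \<forall>v. cmod ((\<Sum>i<n. ?D i y v) - (\<Sum>n. ?D n y v)) \<le> e * norm v"
      if e: "e > 0" for e
    proof -
      obtain N where N: "\<And>n. n \<ge> N \<Longrightarrow> norm (\<Sum>i. b (i + n)) < e"
        using suminf_exist_split[OF e b] by blast
      have "cmod ((\<Sum>i<n. ?D i y v) - (\<Sum>n. ?D n y v)) \<le> e * norm v"
        if n: "n \<ge> N" and y: "y \<in> ball 0 r" for n y v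
      proof -
        have "(\<Sum>n. ?D n y v) = (\<Sum>i. ?D (i + n) y v) + (\<Sum>i<n. ?D i y v)"
          by (rule suminf_split_initial_segment[OF summable_En_derivative])
        then have "cmod ((\<Sum>i<n. ?D i y v) - (\<Sum>n. ?D n y v)) = cmod (\<Sum>i. ?D (i + n) y v)"
          by (simp add: norm_minus_commute)
        also have "\<dots> \<le> (\<Sum>i. b (i + n) * norm v)"
          by (rule norm_suminf_le) (auto intro!: bound y summable_mult2 summable_ignore_initial_segment[OF b])
        also have "\<dots> = (\<Sum>i. b (i + n)) * norm v"
          by (rule suminf_mult2[symmetric]) (rule summable_ignore_initial_segment[OF b])
        also have "\<dots> \<le> e * norm v"
          using N[OF n] by (intro mult_right_mono) auto
        finally show ?thesis .
      qed
      then show ?thesis unfolding eventually_sequentially by blast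
    qed
    show "x \<in> ball 0 r" by (simp add: r_def)
    show "(\<lambda>n. dunkl_En n x w) sums (\<Sum>n. dunkl_En n x w)"
      using En_summable by (rule summable_sums)
  qed (auto intro: has_derivative_at_withinI cpoly_has_derivative cpoly_En)
  then obtain g where g0: "\<forall>y\<in>ball 0 r. (\<lambda>n. dunkl_En n y w) sums g y \<and>
      (g has_derivative (\<lambda>v. \<Sum>n. ?D n y v)) (at y within ball 0 r)" by blast
  have "x \<in> ball 0 r" by (simp add: r_def)
  with g0 have g: "\<And>y. y \<in> ball 0 r \<Longrightarrow> (\<lambda>n. dunkl_En n y w) sums g y"
    "(g has_derivative (\<lambda>v. \<Sum>n. ?D n x v)) (at x within ball 0 r)" by blast+
  have eq: "g y = dunkl_E_sum y w" if "y \<in> ball 0 r" for y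
    using sums_unique[OF g(1)[OF that]] by (simp add: dunkl_E_sum_def)
  have D: "(g has_derivative (\<lambda>v. \<Sum>n. ?D n x v)) (at x)"
    using g(2) by (simp add: at_within_open[OF _ open_ball] r_def)
  show ?thesis
    by (rule has_derivative_transform_within_open[OF D open_ball \<open>x \<in> ball 0 r\<close> eq])
qed

lemma E_sum_quotient:
  assumes a: "\<alpha> \<noteq> 0"
  shows "dunkl_quotient \<alpha> (\<lambda>x. dunkl_E_sum x w) = (\<lambda>x. \<Sum>n. dunkl_quotient \<alpha> (\<lambda>x. dunkl_En n x w) x)"
proof (rule dunkl_quotient_eqI[OF a])
  show "continuous_on UNIV (\<lambda>x. \<Sum>n. dunkl_quotient \<alpha> (\<lambda>x. dunkl_En n x w) x)"
  proof (rule continuous_on_UNIV_balls, rule continuous_on_suminf_balls)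
    show "continuous_on UNIV (dunkl_quotient \<alpha> (\<lambda>x. dunkl_En n x w))" for n
      by (intro cpoly_continuous cpoly_quotient cpoly_En a)
    show "cmod (dunkl_quotient \<alpha> (\<lambda>x. dunkl_En n x w) x)
        \<le> (\<lambda>r n. 2 / norm \<alpha> * (((r + 1) * norm w) ^ n / fact n)) r n" if "norm x < r" for r n x
    proof -
      have "2 / norm \<alpha> * (((norm x + 1) * norm w) ^ n / fact n)
          \<le> 2 / norm \<alpha> * (((r + 1) * norm w) ^ n / fact n)"
        using that by (intro mult_left_mono divide_right_mono power_mono mult_right_mono) auto
      then show ?thesis using En_quotient_bound[OF a] order_trans by blast
    qed
    show "summable (\<lambda>n. 2 / norm \<alpha> * (((r + 1) * norm w) ^ n / fact n))" for r
      by (intro summable_mult summable_power_fact)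
  qed
  fix x
  have "dunkl_E_sum x w - dunkl_E_sum (crefl_root \<alpha> x) w
      = (\<Sum>n. dunkl_En n x w - dunkl_En n (crefl_root \<alpha> x) w)"
    unfolding dunkl_E_sum_def by (rule suminf_diff[OF En_summable En_summable])
  also have "\<dots> = (\<Sum>n. cdot (cvec \<alpha>) x * dunkl_quotient \<alpha> (\<lambda>x. dunkl_En n x w) x)"
    using cpoly_quotient(2)[OF a cpoly_En] by simp
  also have "\<dots> = cdot (cvec \<alpha>) x * (\<Sum>n. dunkl_quotient \<alpha> (\<lambda>x. dunkl_En n x w) x)"
    by (rule suminf_mult[OF summable_En_quotient[OF a]])
  finally show "dunkl_E_sum x w - dunkl_E_sum (crefl_root \<alpha> x) w
     = cdot (cvec \<alpha>) x * (\<Sum>n. dunkl_quotient \<alpha> (\<lambda>x. dunkl_En n x w) x)" .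
qed

lemma T_E_sum: "T \<xi> (\<lambda>x. dunkl_E_sum x w) x = cdot \<xi> w * dunkl_E_sum x w"
proof -
  let ?D = "\<lambda>n. frechet_derivative (\<lambda>x. dunkl_En n x w) (at x) \<xi>"
  let ?Q = "\<lambda>\<alpha> n. dunkl_quotient \<alpha> (\<lambda>x. dunkl_En n x w) x"
  have Q: "summable (\<lambda>n. complex_of_real (k \<alpha>) * cdot (cvec \<alpha>) \<xi> * ?Q \<alpha> n)" if "\<alpha> \<in> Rp" for \<alpha>
    by (intro summable_mult summable_En_quotient Rp_nonzero that)
  have "T \<xi> (\<lambda>x. dunkl_E_sum x w) x
     = (\<Sum>n. ?D n) + (\<Sum>\<alpha>\<in>Rp. complex_of_real (k \<alpha>) * cdot (cvec \<alpha>) \<xi> * (\<Sum>n. ?Q \<alpha> n))"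
    by (simp add: dunkl_op_def frechet_derivative_at[OF E_sum_has_derivative, symmetric]
        E_sum_quotient Rp_nonzero)
  also have "(\<Sum>\<alpha>\<in>Rp. complex_of_real (k \<alpha>) * cdot (cvec \<alpha>) \<xi> * (\<Sum>n. ?Q \<alpha> n))
      = (\<Sum>\<alpha>\<in>Rp. \<Sum>n. complex_of_real (k \<alpha>) * cdot (cvec \<alpha>) \<xi> * ?Q \<alpha> n)"
    by (intro sum.cong suminf_mult[symmetric] summable_En_quotient Rp_nonzero) auto
  also have "\<dots> = (\<Sum>n. \<Sum>\<alpha>\<in>Rp. complex_of_real (k \<alpha>) * cdot (cvec \<alpha>) \<xi> * ?Q \<alpha> n)"
    by (rule suminf_sum[symmetric]) (rule Q)
  also have "(\<Sum>n. ?D n) + \<dots> = (\<Sum>n. ?D n + (\<Sum>\<alpha>\<in>Rp. complex_of_real (k \<alpha>) * cdot (cvec \<alpha>) \<xi> * ?Q \<alpha> n))"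
    by (intro suminf_add summable_En_derivative summable_sum Q)
  also have "\<dots> = (\<Sum>n. T \<xi> (\<lambda>x. dunkl_En n x w) x)" by (simp add: dunkl_op_def)
  also have "\<dots> = (\<Sum>n. if n = 0 then 0 else cdot \<xi> w * dunkl_En (n - 1) x w)" by (simp add: T_En)
  also have "\<dots> = (\<Sum>n. cdot \<xi> w * dunkl_En n x w)"
  proof -
    have "summable (\<lambda>n. if n = 0 then 0 else cdot \<xi> w * dunkl_En (n - 1) x w)"
      by (subst summable_Suc_iff[symmetric]) (simp add: summable_mult En_summable)
    from suminf_split_head[OF this] show ?thesis by simp
  qed
  also have "\<dots> = cdot \<xi> w * dunkl_E_sum x w"
    unfolding dunkl_E_sum_def by (rule suminf_mult[OF En_summable])
  finally show ?thesis .
qed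

lemma E_sum_0: "dunkl_E_sum 0 w = 1"
proof -
  have "dunkl_En n 0 w = (if n = 0 then 1 else 0)" for n
    using En_homogeneous[of n 0 0 w] by (cases n) (simp_all del: dunkl_En.simps(2))
  then show ?thesis using sums_single[of 0 "\<lambda>n. 1 :: complex"] by (simp add: dunkl_E_sum_def sums_iff)
qed

lemma E_sum_entire: "entire_on_CN (\<lambda>x. dunkl_E_sum x w)"
  unfolding entire_on_CN_def
proof (intro allI exI conjI)
  fix x :: "complex^'n" and c v
  show "((\<lambda>x. dunkl_E_sum x w) has_derivative
     (\<lambda>v. \<Sum>n. frechet_derivative (\<lambda>x. dunkl_En n x w) (at x) v)) (at x)"
    by (rule E_sum_has_derivative)
  show "(\<Sum>n. frechet_derivative (\<lambda>x. dunkl_En n x w) (at x) (c *s v))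
      = c * (\<Sum>n. frechet_derivative (\<lambda>x. dunkl_En n x w) (at x) v)"
    by (simp add: cpoly_derivative_props[OF cpoly_En] suminf_mult summable_En_derivative)
qed

text \<open>Taking the direction to be the point itself turns the eigenvalue equations into one Euler
  equation, which determines the expansion on every complex line through the origin.\<close>

lemma dunkl_eigenfunction_unique:
  assumes f: "entire_on_CN f" and eq: "\<And>\<xi> x. T \<xi> f x = cdot \<xi> w * f x" and f0: "f 0 = 1"
  shows "f y = dunkl_E_sum y w"
proof -
  have "\<forall>x. \<exists>D. (f has_derivative D) (at x) \<and> (\<forall>c v. D (c *s v) = c * D v)"
    using f by (simp add: entire_on_CN_def)
  then obtain D where D: "\<And>x. (f has_derivative D x) (at x)" "\<And>x c v. D x (c *s v) = c * D x v"
    by metis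
  define \<phi> where "\<phi> y s = f (s *s y)" for y s
  have d\<phi>: "(\<phi> y has_field_derivative D (s *s y) y) (at s)" for y s
  proof -
    have "(\<phi> y has_derivative (\<lambda>h. D (s *s y) (h *s y))) (at s)"
      unfolding \<phi>_def
      by (rule has_derivative_compose[OF bounded_linear_imp_has_derivative[OF bounded_linear_vector_scalar] D(1)])
    then show ?thesis
      by (simp add: has_field_derivative_def D(2) mult.commute[of _ "D _ _"])
  qed
  have hol: "\<phi> y holomorphic_on A" for y A
    unfolding holomorphic_on_def field_differentiable_def using d\<phi> has_field_derivative_at_within by blast
  define F where "F y = fps_expansion (\<phi> y) 0" for y
  have F: "\<phi> y has_fps_expansion F y" for y
    unfolding F_def by (rule has_fps_expansion_fps_expansion[OF open_UNIV _ hol]) simp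
  have euler: "s * deriv (\<phi> y) s + (\<Sum>\<alpha>\<in>Rp. complex_of_real (k \<alpha>) * (\<phi> y s - \<phi> (crefl_root \<alpha> y) s))
      = cdot y w * (s * \<phi> y s)" for y s
  proof -
    have "frechet_derivative f (at (s *s y)) = D (s *s y)"
      using frechet_derivative_at[OF D(1)] by simp
    then have "D (s *s y) (s *s y) + (\<Sum>\<alpha>\<in>Rp. complex_of_real (k \<alpha>) * cdot (cvec \<alpha>) (s *s y)
        * dunkl_quotient \<alpha> f (s *s y)) = cdot (s *s y) w * f (s *s y)"
      using eq[of "s *s y" "s *s y"] by (simp add: dunkl_op_def)
    also have "(\<Sum>\<alpha>\<in>Rp. complex_of_real (k \<alpha>) * cdot (cvec \<alpha>) (s *s y) * dunkl_quotient \<alpha> f (s *s y))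
      = (\<Sum>\<alpha>\<in>Rp. complex_of_real (k \<alpha>) * (\<phi> y s - \<phi> (crefl_root \<alpha> y) s))"
      by (rule sum.cong)
         (auto simp: \<phi>_def dunkl_quotient_def Let_def crefl_root_fixed simp flip: crefl_root_scale)
    finally show ?thesis
      by (simp add: D(2) DERIV_imp_deriv[OF d\<phi>] \<phi>_def cdot_bilinear)
  qed
  have fps: "fps_X * fps_deriv (F y) + (\<Sum>\<alpha>\<in>Rp. fps_const (complex_of_real (k \<alpha>)) * (F y - F (crefl_root \<alpha> y)))
      = fps_const (cdot y w) * (fps_X * F y)" for y
  proof -
    have "(\<lambda>s. s * deriv (\<phi> y) s + (\<Sum>\<alpha>\<in>Rp. complex_of_real (k \<alpha>) * (\<phi> y s - \<phi> (crefl_root \<alpha> y) s)))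
      has_fps_expansion fps_X * fps_deriv (F y)
        + (\<Sum>\<alpha>\<in>Rp. fps_const (complex_of_real (k \<alpha>)) * (F y - F (crefl_root \<alpha> y)))"
      by (intro fps_expansion_intros F)
    moreover have "(\<lambda>s. cdot y w * (s * \<phi> y s)) has_fps_expansion fps_const (cdot y w) * (fps_X * F y)"
      by (intro fps_expansion_intros F)
    ultimately show ?thesis unfolding euler by (rule fps_expansion_unique_complex)
  qed
  have coeff: "fps_nth (F y) n = dunkl_En n y w" for n y
  proof (induction n arbitrary: y)
    case 0
    show ?case using has_fps_expansion_imp_0_eq_fps_nth_0[OF F, of y] f0 by (simp add: \<phi>_def)
  next
    case (Suc n)
    show ?case
    proof (rule euler_op_inj[of "Suc n" "\<lambda>y. fps_nth (F y) (Suc n)"])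
      fix y
      have "fps_nth (fps_X * fps_deriv (F y) + (\<Sum>\<alpha>\<in>Rp. fps_const (complex_of_real (k \<alpha>)) * (F y - F (crefl_root \<alpha> y)))) (Suc n)
        = euler_op (Suc n) (\<lambda>y. fps_nth (F y) (Suc n)) y"
        by (simp add: euler_op_def fps_sum_nth del: of_nat_Suc)
      then show "euler_op (Suc n) (\<lambda>y. fps_nth (F y) (Suc n)) y = euler_op (Suc n) (\<lambda>y. dunkl_En (Suc n) y w) y"
        unfolding fps euler_op_En using Suc by simp
    qed simp
  qed
  have "(\<lambda>n. (deriv ^^ n) (\<phi> y) 0 / fact n * (1 - 0) ^ n) sums \<phi> y 1"
    by (rule holomorphic_power_series[where r = 2]) (simp_all add: hol)
  then have "(\<lambda>n. dunkl_En n y w) sums f y"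
    by (simp add: \<phi>_def F_def fps_expansion_def flip: coeff)
  then show ?thesis by (simp add: dunkl_E_sum_def sums_iff)
qed

theorem dunkl_kernel_eq: "dunkl_kernel Rp k x w = dunkl_E_sum x w"
proof -
  have "(THE f. entire_on_CN f \<and> (\<forall>\<xi> x. dunkl_op Rp k \<xi> f x = cdot \<xi> w * f x) \<and> f 0 = 1)
      = (\<lambda>x. dunkl_E_sum x w)"
    by (rule the_equality) (auto simp: E_sum_entire T_E_sum E_sum_0 intro: dunkl_eigenfunction_unique)
  then show ?thesis by (simp add: dunkl_kernel_def)
qed

section \<open>The Dunkl kernel at real arguments\<close>

definition real_En :: "nat \<Rightarrow> real^'n \<Rightarrow> real^'n \<Rightarrow> real" where
  "real_En n x y = Re (dunkl_En n (cvec x) (cvec y))"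

definition real_E :: "real^'n \<Rightarrow> real^'n \<Rightarrow> real" where
  "real_E x y = (\<Sum>n. real_En n x y)"

lemma of_real_En: "complex_of_real (real_En n x y) = dunkl_En n (cvec x) (cvec y)"
  using En_real by (simp add: real_En_def complex_is_Real_iff complex_eq_iff)

lemma real_En_bound: "\<bar>real_En n x y\<bar> \<le> (norm x * norm y) ^ n / fact n"
  using En_norm_bound[of n "cvec x" "cvec y"] by (simp flip: of_real_En)

lemma real_En_summable: "summable (\<lambda>n. \<bar>real_En n x y\<bar>)"
  by (rule summable_comparison_test'[OF summable_power_fact[of "norm x * norm y"], where N = 0])
     (simp add: real_En_bound)

lemma real_En_sums: "(\<lambda>n. real_En n x y) sums real_E x y"
  unfolding real_E_def by (rule summable_sums[OF summable_rabs_cancel[OF real_En_summable]])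

lemma dunkl_E_eq: "dunkl_E Rp k x y = complex_of_real (real_E x y)"
proof -
  have "(\<lambda>n. complex_of_real (real_En n x y)) sums complex_of_real (real_E x y)"
    by (rule sums_of_real[OF real_En_sums])
  then show ?thesis
    by (simp add: dunkl_kernel_eq dunkl_E_sum_def of_real_En sums_iff)
qed

lemma real_En_symmetric: "real_En n x y = real_En n y x"
  unfolding real_En_def by (simp add: En_symmetric)

lemma real_E_symmetric: "real_E x y = real_E y x"
  unfolding real_E_def by (simp add: real_En_symmetric)

lemma real_En_scale_left: "real_En n (c *\<^sub>R x) y = c ^ n * real_En n x y"
proof -
  have "complex_of_real (real_En n (c *\<^sub>R x) y) = complex_of_real (c ^ n * real_En n x y)"
    by (simp add: of_real_En cvec_scaleR En_homogeneous del: dunkl_En.simps)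
  then show ?thesis by (simp only: of_real_eq_iff)
qed

lemma real_En_scale_right: "real_En n x (c *\<^sub>R y) = c ^ n * real_En n x y"
  by (metis real_En_scale_left real_En_symmetric)

lemma real_E_scale: "real_E (c *\<^sub>R x) y = real_E x (c *\<^sub>R y)"
  by (simp add: real_E_def real_En_scale_left real_En_scale_right)

lemma real_E_0 [simp]: "real_E 0 y = 1" "real_E x 0 = 1"
proof -
  show "real_E 0 y = 1" for y
    using E_sum_0[of "cvec y"] dunkl_E_eq[of 0 y] by (simp add: dunkl_kernel_eq)
  then show "real_E x 0 = 1" using real_E_symmetric[of x 0] by metis
qed

lemma real_E_bound: "\<bar>real_E x y\<bar> \<le> exp (norm x * norm y)"
proof -
  have "\<bar>real_E x y\<bar> \<le> (\<Sum>n. \<bar>real_En n x y\<bar>)"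
    unfolding real_E_def by (rule summable_rabs[OF real_En_summable])
  also have "\<dots> \<le> (\<Sum>n. (norm x * norm y) ^ n / fact n)"
    by (intro suminf_le real_En_bound real_En_summable summable_power_fact)
  also have "\<dots> = exp (norm x * norm y)" by (simp add: exp_def divide_inverse mult.commute)
  finally show ?thesis .
qed

lemma real_En_continuous: "continuous_on UNIV (\<lambda>z. real_En n (fst z) (snd z))"
proof -
  have "continuous_on UNIV (\<lambda>z. (\<lambda>(x, w). dunkl_En n x w) (cvec (fst z), cvec (snd z)))"
    by (rule continuous_on_compose2[OF En_continuous])
       (auto intro!: continuous_intros bounded_linear.continuous_on[OF bounded_linear_cvec])
  then show ?thesis unfolding real_En_def by (intro continuous_intros) auto
qed

lemma real_E_continuous_pair: "continuous_on UNIV (\<lambda>z. real_E (fst z) (snd z))"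
proof -
  have "continuous_on UNIV (\<lambda>z. \<Sum>n. complex_of_real (real_En n (fst z) (snd z)))"
  proof (rule continuous_on_UNIV_balls, rule continuous_on_suminf_balls)
    show "continuous_on UNIV (\<lambda>z. complex_of_real (real_En n (fst z) (snd z)))" for n
      by (intro continuous_on_of_real real_En_continuous)
    show "cmod (complex_of_real (real_En n (fst z) (snd z))) \<le> (\<lambda>r n. (r * r) ^ n / fact n) r n"
      if "norm z < r" for r n and z :: "(real^'n) \<times> (real^'n)"
    proof -
      have "norm (fst z) \<le> r" "norm (snd z) \<le> r"
        using that norm_fst_le[of "fst z" "snd z"] norm_snd_le[of "snd z" "fst z"] by auto
      moreover have "0 \<le> r" using that norm_ge_zero[of z] by linarith
      ultimately have "(norm (fst z) * norm (snd z)) ^ n / fact n \<le> (r * r) ^ n / fact n"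
        by (intro divide_right_mono power_mono mult_mono) auto
      then show ?thesis using real_En_bound[of n "fst z" "snd z"] by simp
    qed
  qed (rule summable_power_fact)
  moreover have "(\<Sum>n. complex_of_real (real_En n (fst z) (snd z))) = complex_of_real (real_E (fst z) (snd z))" for z
    using sums_of_real[OF real_En_sums, where 'a = complex] by (simp add: sums_iff)
  ultimately have "continuous_on UNIV (\<lambda>z. Re (complex_of_real (real_E (fst z) (snd z))))"
    by (intro continuous_on_Re) simp
  then show ?thesis by simp
qed

lemma continuous_on_real_E [continuous_intros]:
  "continuous_on S f \<Longrightarrow> continuous_on S g \<Longrightarrow> continuous_on S (\<lambda>x. real_E (f x) (g x))"
  using continuous_on_compose2[OF real_E_continuous_pair, of S "\<lambda>x. (f x, g x)"]
  by (simp add: continuous_on_Pair)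

lemma borel_measurable_real_E [measurable]:
  "f \<in> borel_measurable M \<Longrightarrow> g \<in> borel_measurable M \<Longrightarrow> (\<lambda>x. real_E (f x) (g x)) \<in> borel_measurable M"
  by (rule borel_measurable_continuous_Pair[OF _ _ real_E_continuous_pair]) 

lemma borel_measurable_real_En [measurable]:
  "f \<in> borel_measurable M \<Longrightarrow> g \<in> borel_measurable M \<Longrightarrow> (\<lambda>x. real_En n (f x) (g x)) \<in> borel_measurable M"
  by (rule borel_measurable_continuous_Pair[OF _ _ real_En_continuous])

end

section \<open>Lebesgue measure: orthogonal invariance and polar coordinates\<close>

lemma nn_integral_lborel_translation:
  fixes c :: "'a::euclidean_space"
  assumes [measurable]: "g \<in> borel_measurable borel"
  shows "(\<integral>\<^sup>+x. g (c + x) \<partial>lborel) = (\<integral>\<^sup>+x. g x \<partial>lborel)"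
proof -
  have "(\<integral>\<^sup>+x. g x \<partial>lborel) = (\<integral>\<^sup>+x. g x \<partial>distr lborel borel ((+) c))"
    by (simp add: lborel_distr_plus)
  also have "\<dots> = (\<integral>\<^sup>+x. g (c + x) \<partial>lborel)" by (rule nn_integral_distr) simp_all
  finally show ?thesis by simp
qed

lemma nn_integral_lborel_scale:
  fixes g :: "'a::euclidean_space \<Rightarrow> ennreal"
  assumes [measurable]: "g \<in> borel_measurable borel" and "c \<noteq> 0"
  shows "(\<integral>\<^sup>+x. g x \<partial>lborel) = ennreal (\<bar>c\<bar> ^ DIM('a)) * (\<integral>\<^sup>+x. g (c *\<^sub>R x) \<partial>lborel)"
proof -
  have "(\<integral>\<^sup>+x. g x \<partial>lborel) = (\<integral>\<^sup>+x. g x \<partial>density (distr lborel borel (\<lambda>x. 0 + c *\<^sub>R x)) (\<lambda>_. \<bar>c\<bar>^DIM('a)))"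
    using lborel_affine[OF assms(2), where t = "0::'a"] by simp
  also have "\<dots> = (\<integral>\<^sup>+x. \<bar>c\<bar>^DIM('a) * g (c *\<^sub>R x) \<partial>lborel)"
    by (subst nn_integral_density) (simp_all add: nn_integral_distr)
  also have "\<dots> = \<bar>c\<bar>^DIM('a) * (\<integral>\<^sup>+x. g (c *\<^sub>R x) \<partial>lborel)" by (rule nn_integral_cmult) simp
  finally show ?thesis .
qed

text \<open>The image measure is again translation invariant. For two translation invariant measures
  Tonelli gives \<open>\<mu> A * \<nu> B = \<mu> B * \<nu> A\<close>, and the unit ball fixes the constant.\<close>

lemma distr_lborel_orthogonal:
  fixes f :: "'a::euclidean_space \<Rightarrow> 'a"
  assumes f: "orthogonal_transformation f"
  shows "distr lborel borel f = lborel"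
proof (rule measure_eqI)
  have lin: "linear f" using f by (rule orthogonal_transformation_linear)
  have [measurable]: "f \<in> borel_measurable borel"
    by (intro borel_measurable_continuous_onI linear_continuous_on linear_conv_bounded_linear[THEN iffD1] lin)
  fix A assume "A \<in> sets (distr lborel borel f)"
  then have A[measurable]: "A \<in> sets borel" by simp
  define B where "B = ball (0::'a) 1"
  have B[measurable]: "B \<in> sets borel" by (simp add: B_def)
  let ?I = "\<lambda>S x. indicator S x :: ennreal"
  have mu: "emeasure (distr lborel borel f) S = (\<integral>\<^sup>+x. ?I S (f x) \<partial>lborel)" if [measurable]: "S \<in> sets borel" for S
  proof -
    have "(\<integral>\<^sup>+x. ?I S (f x) \<partial>lborel) = (\<integral>\<^sup>+x. ?I S x \<partial>distr lborel borel f)"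
      by (rule nn_integral_distr[symmetric]) simp_all
    then show ?thesis by simp
  qed
  have "emeasure (distr lborel borel f) A * emeasure lborel B
      = (\<integral>\<^sup>+x. ?I A (f x) * (\<integral>\<^sup>+y. ?I B (f x + y) \<partial>lborel) \<partial>lborel)"
    by (simp add: mu nn_integral_lborel_translation nn_integral_multc)
  also have "\<dots> = (\<integral>\<^sup>+x. \<integral>\<^sup>+y. ?I A (f x) * ?I B (f x + y) \<partial>lborel \<partial>lborel)"
    by (simp add: nn_integral_cmult)
  also have "\<dots> = (\<integral>\<^sup>+y. \<integral>\<^sup>+x. ?I A (f x) * ?I B (f x + y) \<partial>lborel \<partial>lborel)"
    by (rule lborel_pair.Fubini'[symmetric]) measurable
  also have "\<dots> = (\<integral>\<^sup>+y. \<integral>\<^sup>+x. ?I A (f x - y) * ?I B (f x) \<partial>lborel \<partial>lborel)"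
  proof (rule nn_integral_cong)
    fix y
    obtain z where z: "f z = - y" using orthogonal_transformation_surj[OF f] by (metis surjD)
    have "(\<integral>\<^sup>+x. ?I A (f x) * ?I B (f x + y) \<partial>lborel)
        = (\<integral>\<^sup>+x. ?I A (f (z + x)) * ?I B (f (z + x) + y) \<partial>lborel)"
      by (rule nn_integral_lborel_translation[symmetric]) measurable
    then show "(\<integral>\<^sup>+x. ?I A (f x) * ?I B (f x + y) \<partial>lborel) = (\<integral>\<^sup>+x. ?I A (f x - y) * ?I B (f x) \<partial>lborel)"
      by (simp add: linear_add[OF lin] z)
  qed
  also have "\<dots> = (\<integral>\<^sup>+x. \<integral>\<^sup>+y. ?I A (f x - y) * ?I B (f x) \<partial>lborel \<partial>lborel)"
    by (rule lborel_pair.Fubini') measurable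
  also have "\<dots> = (\<integral>\<^sup>+x. (\<integral>\<^sup>+y. ?I A (f x - y) \<partial>lborel) * ?I B (f x) \<partial>lborel)"
    by (simp add: nn_integral_multc)
  also have "\<dots> = (\<integral>\<^sup>+x. emeasure lborel A * ?I B (f x) \<partial>lborel)"
  proof (rule nn_integral_cong)
    fix x
    have "(\<integral>\<^sup>+y. ?I A (f x - y) \<partial>lborel) = (\<integral>\<^sup>+y. ?I A (f x + (-1) *\<^sub>R y) \<partial>lborel)" by simp
    also have "\<dots> = (\<integral>\<^sup>+y. ?I A (f x + y) \<partial>lborel)"
      by (subst nn_integral_lborel_scale[where c = "-1" and g = "\<lambda>y. ?I A (f x + y)"]) simp_all
    also have "\<dots> = emeasure lborel A" by (simp add: nn_integral_lborel_translation)
    finally show "(\<integral>\<^sup>+y. ?I A (f x - y) \<partial>lborel) * ?I B (f x) = emeasure lborel A * ?I B (f x)" by simp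
  qed
  also have "\<dots> = emeasure lborel A * emeasure (distr lborel borel f) B"
    by (simp add: mu nn_integral_cmult)
  also have "emeasure (distr lborel borel f) B = emeasure lborel B"
  proof -
    have "?I B (f x) = ?I B x" for x
      using orthogonal_transformation_norm[OF f] by (simp add: B_def indicator_def)
    then show ?thesis by (simp add: mu)
  qed
  finally have eq: "emeasure (distr lborel borel f) A * emeasure lborel B = emeasure lborel A * emeasure lborel B" .
  have fin: "emeasure lborel B \<noteq> \<infinity>" unfolding B_def using emeasure_lborel_ball_finite by (metis less_irrefl)
  have "measure lborel B > 0" unfolding B_def by (rule content_ball_pos) simp
  then have "emeasure lborel B \<noteq> 0" by (auto simp: measure_def)
  then show "emeasure (distr lborel borel f) A = emeasure lborel A"
    using eq fin by (simp add: ennreal_mult_cancel_left mult.commute[of _ "emeasure lborel B"])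
qed simp

lemma sets_sphere_measure [measurable_cong]:
  "sets (sphere_measure :: (real^'n) measure) = sets (restrict_space borel (sphere 0 1))"
  by (simp add: sphere_measure_def)

lemma space_sphere_measure: "space (sphere_measure :: (real^'n) measure) = sphere 0 1"
  using sets_eq_imp_space_eq[OF sets_sphere_measure] by (simp add: space_restrict_space)

lemma sgn_measurable_sphere:
  assumes "0 \<notin> A"
  shows "(sgn :: real^'n \<Rightarrow> real^'n) \<in> restrict_space lborel A \<rightarrow>\<^sub>M restrict_space borel (sphere 0 1)"
proof (rule measurable_restrict_space2)
  show "sgn \<in> space (restrict_space lborel A) \<rightarrow> sphere 0 (1::real)"
    using assms by (auto simp: space_restrict_space norm_sgn)
  show "sgn \<in> restrict_space lborel A \<rightarrow>\<^sub>M (borel :: (real^'n) measure)"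
    by (rule measurable_restrict_space1) simp
qed

lemma emeasure_sphere_measure:
  fixes B :: "(real^'n) set"
  assumes B: "B \<in> sets (restrict_space borel (sphere 0 1))"
  shows "emeasure sphere_measure B
    = of_nat CARD('n) * emeasure lborel {x. x \<noteq> 0 \<and> norm x \<le> 1 \<and> sgn x \<in> B}"
proof -
  have "emeasure (distr (restrict_space lborel (cball 0 1 - {0})) (restrict_space borel (sphere 0 1)) sgn) B
      = emeasure (restrict_space lborel (cball 0 1 - {0}))
          (sgn -` B \<inter> space (restrict_space lborel (cball 0 1 - {0})))"
    by (rule emeasure_distr[OF sgn_measurable_sphere B]) simp
  also have "sgn -` B \<inter> space (restrict_space lborel (cball 0 1 - {0}))
      = {x. x \<noteq> 0 \<and> norm x \<le> 1 \<and> sgn x \<in> B}"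
    by (auto simp: space_restrict_space)
  also have "emeasure (restrict_space lborel (cball 0 1 - {0})) {x. x \<noteq> 0 \<and> norm x \<le> 1 \<and> sgn x \<in> B}
      = emeasure lborel {x. x \<noteq> 0 \<and> norm x \<le> 1 \<and> sgn x \<in> B}"
    by (rule emeasure_restrict_space) auto
  finally show ?thesis by (simp add: sphere_measure_def)
qed

lemma finite_sphere_measure: "finite_measure (sphere_measure :: (real^'n) measure)"
proof (rule finite_measureI)
  have eq: "emeasure (sphere_measure :: (real^'n) measure) (sphere 0 1)
      = of_nat CARD('n) * emeasure lborel {x :: real^'n. x \<noteq> 0 \<and> norm x \<le> 1 \<and> sgn x \<in> sphere 0 1}"
    by (rule emeasure_sphere_measure) (simp add: sets_restrict_space_iff)
  have "emeasure lborel {x :: real^'n. x \<noteq> 0 \<and> norm x \<le> 1 \<and> sgn x \<in> sphere 0 1}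
      \<le> emeasure lborel (cball (0 :: real^'n) 1)"
    by (rule emeasure_mono) auto
  also have "\<dots> < \<infinity>" by (rule emeasure_lborel_cball_finite)
  finally show "emeasure (sphere_measure :: (real^'n) measure) (space sphere_measure) \<noteq> \<infinity>"
    unfolding space_sphere_measure eq by (auto simp: ennreal_mult_eq_top_iff)
qed

lemma sphere_set_borel: "B \<in> sets (restrict_space borel (sphere (0::real^'n) 1)) \<Longrightarrow> B \<in> sets borel"
  by (simp add: sets_restrict_space_iff)

lemma emeasure_cone:
  fixes B :: "(real^'n) set"
  assumes B: "B \<in> sets (restrict_space borel (sphere 0 1))" and "b > 0"
  shows "of_nat CARD('n) * emeasure lborel {x. x \<noteq> 0 \<and> norm x \<le> b \<and> sgn x \<in> B}
    = ennreal (b ^ CARD('n)) * emeasure sphere_measure B"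
proof -
  have [measurable]: "B \<in> sets borel" by (rule sphere_set_borel[OF B])
  let ?C = "\<lambda>b. {x :: real^'n. x \<noteq> 0 \<and> norm x \<le> b \<and> sgn x \<in> B}"
  have "emeasure lborel (?C b) = (\<integral>\<^sup>+x. indicator (?C b) x \<partial>lborel)"
    by (subst nn_integral_indicator) simp_all
  also have "\<dots> = ennreal (\<bar>b\<bar> ^ DIM(real^'n)) * (\<integral>\<^sup>+x. indicator (?C b) (b *\<^sub>R x) \<partial>lborel)"
    using assms by (intro nn_integral_lborel_scale) auto
  also have "(\<integral>\<^sup>+x. indicator (?C b) (b *\<^sub>R x) \<partial>lborel) = (\<integral>\<^sup>+x. indicator (?C 1) x \<partial>lborel)"
    using assms by (intro nn_integral_cong) (auto simp: indicator_def sgn_scaleR)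
  also have "\<dots> = emeasure lborel (?C 1)" by (subst nn_integral_indicator) simp_all
  finally show ?thesis using assms by (simp add: emeasure_sphere_measure mult.left_commute)
qed

definition radial_measure :: "nat \<Rightarrow> real measure" where
  "radial_measure n = density lborel (\<lambda>r. ennreal (r ^ (n - 1)) * indicator {0<..} r)"

lemma sets_radial_measure [measurable_cong, simp]: "sets (radial_measure n) = sets borel"
  by (simp add: radial_measure_def)

text \<open>Stated with the factor \<^term>\<open>n\<close>, so that the constant of the power integral meets the dimension factor
  in the definition of the surface measure.\<close>

lemma emeasure_radial_measure:
  assumes "n > 0"
  shows "of_nat n * emeasure (radial_measure n) {..b} = ennreal (if b > 0 then b ^ n else 0)"
proof -
  have "emeasure (radial_measure n) {..b} = (\<integral>\<^sup>+r. ennreal (r ^ (n - 1)) * indicator {0..b} r \<partial>lborel)"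
    unfolding radial_measure_def
    by (subst emeasure_density, simp, simp, rule nn_integral_cong_AE)
       (use AE_lborel_singleton[of 0] in \<open>auto elim!: eventually_mono split: split_indicator\<close>)
  also have "\<dots> = ennreal (if b > 0 then b ^ n / n else 0)"
  proof (cases "b > 0")
    case True
    have "(\<integral>\<^sup>+r. ennreal (r ^ (n - 1)) * indicator {0..b} r \<partial>lborel) = ennreal (b ^ n / n - 0 ^ n / n)"
    proof (rule nn_integral_FTC_Icc)
      show "((\<lambda>r. r ^ n / real n) has_real_derivative x ^ (n - 1)) (at x)" for x
        using assms by (auto intro!: derivative_eq_intros)
    qed (use True in auto)
    then show ?thesis using True assms by (simp add: power_0_left)
  next
    case False
    have "(\<integral>\<^sup>+r. ennreal (r ^ (n - 1)) * indicator {0..b} r \<partial>lborel) = (\<integral>\<^sup>+r. 0 \<partial>(lborel :: real measure))"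
    proof (rule nn_integral_cong_AE)
      show "AE r in lborel. ennreal (r ^ (n - 1)) * indicator {0..b} r = 0"
        using AE_lborel_singleton[of "0::real"]
      proof eventually_elim
        case (elim r)
        then show ?case using False by (auto split: split_indicator)
      qed
    qed
    then show ?thesis using False by simp
  qed
  finally show ?thesis using assms
    by (simp add: ennreal_of_nat_eq_real_of_nat flip: ennreal_mult')
qed

lemma sigma_finite_radial_measure: "sigma_finite_measure (radial_measure n)"
  unfolding radial_measure_def
  by (subst sigma_finite_measure.sigma_finite_iff_density_finite[OF sigma_finite_lborel]) (auto simp: ennreal_mult_eq_top_iff indicator_def)

text \<open>Both sides are measures in the radial set, and they agree on half-lines by scaling.\<close>

lemma emeasure_polar_rectangle:
  fixes B :: "(real^'n) set"
  assumes A: "A \<in> sets borel" and B: "B \<in> sets (restrict_space borel (sphere 0 1))"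
  shows "emeasure (radial_measure CARD('n)) A * emeasure sphere_measure B
    = emeasure lborel {x. x \<noteq> 0 \<and> norm x \<in> A \<and> sgn x \<in> B}"
proof -
  have [measurable]: "B \<in> sets borel" by (rule sphere_set_borel[OF B])
  let ?n = "CARD('n)"
  define M where "M = density (radial_measure ?n) (\<lambda>_. emeasure sphere_measure B)"
  define C where "C = {x :: real^'n. x \<noteq> 0 \<and> sgn x \<in> B}"
  have [measurable]: "C \<in> sets borel" unfolding C_def by measurable
  define N where "N = distr (density lborel (indicator C)) borel (norm :: real^'n \<Rightarrow> real)"
  have eM: "emeasure M S = emeasure (radial_measure ?n) S * emeasure sphere_measure B" if "S \<in> sets borel" for S
    using that by (simp add: M_def emeasure_density_const mult.commute)
  have eN: "emeasure N S = emeasure lborel {x. x \<noteq> 0 \<and> norm x \<in> S \<and> sgn x \<in> B}" if [measurable]: "S \<in> sets borel" for S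
  proof -
    have S: "(norm :: real^'n \<Rightarrow> real) -` S \<in> sets lborel"
      using measurable_sets[of "norm :: real^'n \<Rightarrow> real" borel borel S] that by simp
    have "emeasure N S = emeasure (density lborel (indicator C)) (norm -` S)"
      unfolding N_def by (subst emeasure_distr) (simp_all add: that)
    also have "\<dots> = (\<integral>\<^sup>+x. indicator C x * indicator (norm -` S) x \<partial>lborel)"
      by (rule emeasure_density[OF _ S]) simp
    also have "\<dots> = (\<integral>\<^sup>+x. indicator {x. x \<noteq> 0 \<and> norm x \<in> S \<and> sgn x \<in> B} x \<partial>lborel)"
      by (rule nn_integral_cong) (auto simp: C_def indicator_def)
    also have "\<dots> = emeasure lborel {x. x \<noteq> 0 \<and> norm x \<in> S \<and> sgn x \<in> B}"
      by (rule nn_integral_indicator) simp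
    finally show ?thesis .
  qed
  have half: "emeasure M {..b} = emeasure N {..b}" for b
  proof -
    have "of_nat ?n * emeasure M {..b} = ennreal (if b > 0 then b ^ ?n else 0) * emeasure sphere_measure B"
      by (simp add: eM emeasure_radial_measure flip: mult.assoc)
    also have "\<dots> = of_nat ?n * emeasure N {..b}"
    proof (cases "b > 0")
      case True
      then show ?thesis by (simp add: eN emeasure_cone[OF B])
    next
      case False
      then have "{x :: real^'n. x \<noteq> 0 \<and> norm x \<in> {..b} \<and> sgn x \<in> B} = {}"
        using norm_ge_zero by (auto simp: not_less) (metis norm_le_zero_iff order_trans)
      then show ?thesis using False by (simp only: eN[OF atMost_borel]) simp
    qed
    finally show ?thesis
      by (simp add: ennreal_mult_cancel_left)
  qed
  have "M = N"
  proof (rule measure_eqI_generator_eq[where E = "range atMost" and \<Omega> = UNIV and A = "\<lambda>n. {..real n}"])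
    show "Int_stable (range (atMost :: real \<Rightarrow> real set))" by (auto simp: Int_stable_def)
    show "sets M = sigma_sets UNIV (range atMost)" "sets N = sigma_sets UNIV (range atMost)"
      unfolding M_def N_def by (simp_all add: borel_eq_atMost)
    show "(\<Union>i. {..real i}) = UNIV" by (auto intro: real_arch_simple)
    fix i
    have "emeasure N {..real i} \<le> emeasure lborel (cball (0::real^'n) (real i))"
      unfolding eN[OF atMost_borel] by (rule emeasure_mono) auto
    also have "\<dots> < \<infinity>" by (rule emeasure_lborel_cball_finite)
    finally show "emeasure M {..real i} \<noteq> \<infinity>" using half by simp
  qed (auto simp: half)
  then show ?thesis using eM[OF A] eN[OF A] by simp
qed

lemma polar_measure_eq:
  "radial_measure CARD('n) \<Otimes>\<^sub>M (sphere_measure :: (real^'n) measure)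
    = distr (restrict_space lborel (- {0})) (borel \<Otimes>\<^sub>M restrict_space borel (sphere 0 1)) (\<lambda>x. (norm x, sgn x))"
proof (rule pair_measure_eqI)
  have m: "(\<lambda>x. (norm x, sgn x)) \<in> restrict_space lborel (- {0::real^'n}) \<rightarrow>\<^sub>M borel \<Otimes>\<^sub>M restrict_space borel (sphere 0 1)"
    by (intro measurable_Pair sgn_measurable_sphere measurable_restrict_space1) auto
  fix A and B :: "(real^'n) set"
  assume "A \<in> sets (radial_measure CARD('n))" "B \<in> sets sphere_measure"
  then have AB: "A \<in> sets borel" "B \<in> sets (restrict_space borel (sphere 0 1))"
    by (simp_all add: sets_sphere_measure)
  have "emeasure (distr (restrict_space lborel (- {0})) (borel \<Otimes>\<^sub>M restrict_space borel (sphere 0 1)) (\<lambda>x. (norm x, sgn x))) (A \<times> B)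
    = emeasure (restrict_space lborel (- {0})) {x. x \<noteq> 0 \<and> norm x \<in> A \<and> sgn x \<in> B}"
    by (subst emeasure_distr[OF m]) (auto simp: AB space_restrict_space intro!: arg_cong2[where f = emeasure])
  also have "\<dots> = emeasure lborel {x. x \<noteq> 0 \<and> norm x \<in> A \<and> sgn x \<in> B}"
    by (rule emeasure_restrict_space) auto
  finally show "emeasure (radial_measure CARD('n)) A * emeasure sphere_measure B
    = emeasure (distr (restrict_space lborel (- {0})) (borel \<Otimes>\<^sub>M restrict_space borel (sphere 0 1)) (\<lambda>x. (norm x, sgn x))) (A \<times> B)"
    using emeasure_polar_rectangle[OF AB] by simp
qed (auto intro: sigma_finite_radial_measure finite_measure.sigma_finite_measure finite_sphere_measure
    simp: sets_sphere_measure cong: sets_pair_measure_cong)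

lemma pair_sigma_finite_polar: "pair_sigma_finite (radial_measure m) (sphere_measure :: (real^'n) measure)"
  by (intro pair_sigma_finite.intro sigma_finite_radial_measure finite_measure.sigma_finite_measure
      finite_sphere_measure)

lemma measurable_polar_map:
  "(\<lambda>(r, z). r *\<^sub>R z) \<in> borel \<Otimes>\<^sub>M restrict_space borel (sphere (0::real^'n) 1) \<rightarrow>\<^sub>M borel"
proof -
  have "(\<lambda>x. x) \<in> restrict_space borel (sphere (0::real^'n) 1) \<rightarrow>\<^sub>M borel"
    by (rule measurable_restrict_space1) simp
  then have "(\<lambda>p. snd p) \<in> (borel :: real measure) \<Otimes>\<^sub>M restrict_space borel (sphere (0::real^'n) 1) \<rightarrow>\<^sub>M borel"
    by (rule measurable_compose[OF measurable_snd])
  then show ?thesis unfolding case_prod_beta by (intro borel_measurable_scaleR) auto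
qed

lemma measurable_polar_map_cong:
  "(\<lambda>(r, z). r *\<^sub>R z) \<in> radial_measure m \<Otimes>\<^sub>M (sphere_measure :: (real^'n) measure) \<rightarrow>\<^sub>M borel"
  using measurable_polar_map
  by (simp add: measurable_cong_sets[OF sets_pair_measure_cong[OF sets_radial_measure sets_sphere_measure] refl])

lemma nn_integral_polar:
  fixes f :: "real^'n \<Rightarrow> ennreal"
  assumes [measurable]: "f \<in> borel_measurable borel"
  shows "(\<integral>\<^sup>+x. f x \<partial>lborel) = (\<integral>\<^sup>+r. \<integral>\<^sup>+z. f (r *\<^sub>R z) \<partial>sphere_measure \<partial>radial_measure CARD('n))"
proof -
  interpret P: pair_sigma_finite "radial_measure CARD('n)" "sphere_measure :: (real^'n) measure"
    by (rule pair_sigma_finite_polar)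
  have m: "(\<lambda>x. (norm x, sgn x)) \<in> restrict_space lborel (- {0::real^'n}) \<rightarrow>\<^sub>M borel \<Otimes>\<^sub>M restrict_space borel (sphere 0 1)"
    by (intro measurable_Pair sgn_measurable_sphere measurable_restrict_space1) auto
  have "(\<integral>\<^sup>+x. f x \<partial>lborel) = (\<integral>\<^sup>+x. f x * indicator (- {0}) x \<partial>lborel)"
    using AE_lborel_singleton[of "0 :: real^'n"] by (intro nn_integral_cong_AE) (auto elim!: eventually_mono)
  also have "\<dots> = (\<integral>\<^sup>+x. f x \<partial>restrict_space lborel (- {0}))"
    by (rule nn_integral_restrict_space[symmetric]) simp
  also have "\<dots> = (\<integral>\<^sup>+x. (\<lambda>p. f (case p of (r, z) \<Rightarrow> r *\<^sub>R z)) (norm x, sgn x) \<partial>restrict_space lborel (- {0}))"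
    by (intro nn_integral_cong) (simp add: sgn_div_norm space_restrict_space)
  also have "\<dots> = (\<integral>\<^sup>+p. f (case p of (r, z) \<Rightarrow> r *\<^sub>R z) \<partial>(radial_measure CARD('n) \<Otimes>\<^sub>M sphere_measure))"
    unfolding polar_measure_eq
    by (subst nn_integral_distr[OF m]) (simp_all add: measurable_compose[OF measurable_polar_map])
  also have "\<dots> = (\<integral>\<^sup>+r. \<integral>\<^sup>+z. f (case (r, z) of (r, z) \<Rightarrow> r *\<^sub>R z) \<partial>sphere_measure \<partial>radial_measure CARD('n))"
    by (rule P.M2.nn_integral_fst[symmetric, OF measurable_compose[OF measurable_polar_map_cong]]) simp
  finally show ?thesis by simp
qed

lemma integral_polar:
  fixes f :: "real^'n \<Rightarrow> 'b::{banach, second_countable_topology}"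
  assumes f: "integrable lborel f"
  shows "(\<integral>x. f x \<partial>lborel) = (\<integral>r. (\<integral>z. f (r *\<^sub>R z) \<partial>sphere_measure) \<partial>radial_measure CARD('n))"
proof -
  interpret P: pair_sigma_finite "radial_measure CARD('n)" "sphere_measure :: (real^'n) measure"
    by (rule pair_sigma_finite_polar)
  have [measurable]: "f \<in> borel_measurable borel" using f by auto
  have m: "(\<lambda>x. (norm x, sgn x)) \<in> restrict_space lborel (- {0::real^'n}) \<rightarrow>\<^sub>M borel \<Otimes>\<^sub>M restrict_space borel (sphere 0 1)"
    by (intro measurable_Pair sgn_measurable_sphere measurable_restrict_space1) auto
  have m2: "(\<lambda>p. f (case p of (r, z) \<Rightarrow> r *\<^sub>R z)) \<in> borel_measurable (borel \<Otimes>\<^sub>M restrict_space borel (sphere 0 1))"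
    by (rule measurable_compose[OF measurable_polar_map]) simp
  have int0: "integrable (restrict_space lborel (- {0})) f"
    using f by (subst integrable_restrict_space) (auto intro: integrable_mult_indicator)
  have cong: "norm x *\<^sub>R sgn x = x" for x :: "real^'n"
    by (cases "x = 0") (simp_all add: sgn_div_norm)
  have int: "integrable (radial_measure CARD('n) \<Otimes>\<^sub>M sphere_measure) (\<lambda>p. f (case p of (r, z) \<Rightarrow> r *\<^sub>R z))"
    unfolding polar_measure_eq
    by (subst integrable_distr_eq[OF m m2])
       (simp add: int0 cong)
  have "(\<integral>x. f x \<partial>lborel) = (\<integral>x. indicator (- {0}) x *\<^sub>R f x \<partial>lborel)"
    using AE_lborel_singleton[of "0 :: real^'n"] by (intro integral_cong_AE) (auto elim!: eventually_mono)
  also have "\<dots> = (\<integral>x. f x \<partial>restrict_space lborel (- {0}))"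
    by (rule integral_restrict_space[symmetric]) simp
  also have "\<dots> = (\<integral>x. (\<lambda>p. f (case p of (r, z) \<Rightarrow> r *\<^sub>R z)) (norm x, sgn x) \<partial>restrict_space lborel (- {0}))"
    by (simp add: cong)
  also have "\<dots> = (\<integral>p. f (case p of (r, z) \<Rightarrow> r *\<^sub>R z) \<partial>(radial_measure CARD('n) \<Otimes>\<^sub>M sphere_measure))"
    unfolding polar_measure_eq by (rule integral_distr[symmetric, OF m m2])
  also have "\<dots> = (\<integral>r. (\<integral>z. f (case (r, z) of (r, z) \<Rightarrow> r *\<^sub>R z) \<partial>sphere_measure) \<partial>radial_measure CARD('n))"
    by (rule P.integral_fst'[OF int, symmetric])
  finally show ?thesis by simp
qed

section \<open>Gaussian moments\<close>

text \<open>A single integrable majorant for all products of powers, exponentials and Gaussians that occur.\<close>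

lemma polynomial_gaussian_le_exp:
  fixes a b c :: real
  assumes "c > 0"
  obtains C where "C > 0" "\<And>r. r \<ge> 0 \<Longrightarrow> (1 + r) powr a * exp (b * r - c * r\<^sup>2) \<le> C * exp (- r)"
proof -
  let ?f = "\<lambda>r::real. (1 + r) powr a * exp ((b + 1) * r - c * r\<^sup>2)"
  have "(?f \<longlongrightarrow> 0) at_top" using assms by real_asymp
  then have "eventually (\<lambda>r. ?f r < 1) at_top" by (rule order_tendstoD) simp
  then obtain K where K: "\<And>r. r \<ge> K \<Longrightarrow> ?f r < 1" by (auto simp: eventually_at_top_linorder)
  have "compact (?f ` {0..max 0 K})"
    by (intro compact_continuous_image continuous_intros) auto
  then have "bdd_above (?f ` {0..max 0 K})"
    by (intro bounded_imp_bdd_above compact_imp_bounded)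
  then obtain B where B: "\<And>r. r \<in> {0..max 0 K} \<Longrightarrow> ?f r \<le> B"
    unfolding bdd_above_def by blast
  have "?f r \<le> max 1 B" if "r \<ge> 0" for r
    using K[of r] B[of r] that by (cases "r \<ge> K") (auto simp: max_def)
  then have "(1 + r) powr a * exp (b * r - c * r\<^sup>2) \<le> max 1 B * exp (- r)" if "r \<ge> 0" for r
  proof -
    have "exp (b * r - c * r\<^sup>2) = exp ((b + 1) * r - c * r\<^sup>2) * exp (- r)"
      by (simp add: algebra_simps flip: exp_add)
    then have "(1 + r) powr a * exp (b * r - c * r\<^sup>2) = ?f r * exp (- r)" by simp
    also have "\<dots> \<le> max 1 B * exp (- r)"
      using \<open>\<And>r. 0 \<le> r \<Longrightarrow> ?f r \<le> max 1 B\<close>[OF that] by (rule mult_right_mono) simp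
    finally show ?thesis .
  qed
  then show ?thesis using that[of "max 1 B"] by (simp add: less_max_iff_disj)
qed

lemma integrable_exp_neg_norm: "integrable lborel (\<lambda>x :: real^'n. exp (- norm x))"
proof (rule integrableI_nonneg)
  let ?n = "CARD('n)"
  have "(\<integral>\<^sup>+x. ennreal (exp (- norm x)) \<partial>(lborel :: (real^'n) measure))
     = (\<integral>\<^sup>+r. \<integral>\<^sup>+z. ennreal (exp (- norm (r *\<^sub>R z))) \<partial>(sphere_measure :: (real^'n) measure) \<partial>radial_measure ?n)"
    by (rule nn_integral_polar) simp
  also have "\<dots> = (\<integral>\<^sup>+r. ennreal (exp (- \<bar>r\<bar>)) * emeasure (sphere_measure :: (real^'n) measure) (sphere 0 1) \<partial>radial_measure ?n)"
  proof (rule nn_integral_cong)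
    fix r
    have "(\<integral>\<^sup>+z. ennreal (exp (- norm (r *\<^sub>R z))) \<partial>(sphere_measure :: (real^'n) measure))
      = (\<integral>\<^sup>+z. ennreal (exp (- \<bar>r\<bar>)) \<partial>(sphere_measure :: (real^'n) measure))"
      by (intro nn_integral_cong) (simp add: space_sphere_measure)
    then show "(\<integral>\<^sup>+z. ennreal (exp (- norm (r *\<^sub>R z))) \<partial>(sphere_measure :: (real^'n) measure))
      = ennreal (exp (- \<bar>r\<bar>)) * emeasure (sphere_measure :: (real^'n) measure) (sphere 0 1)"
      by (simp add: space_sphere_measure)
  qed
  also have "\<dots> = (\<integral>\<^sup>+r. ennreal (exp (- \<bar>r\<bar>)) \<partial>radial_measure ?n) * emeasure (sphere_measure :: (real^'n) measure) (sphere 0 1)"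
    by (rule nn_integral_multc) simp
  also have "(\<integral>\<^sup>+r. ennreal (exp (- \<bar>r\<bar>)) \<partial>radial_measure ?n)
      = (\<integral>\<^sup>+t. ennreal (indicator {0..} t * t powr (real ?n - 1) / exp t) \<partial>lborel)"
    unfolding radial_measure_def
  proof (subst nn_integral_density, simp, simp, rule nn_integral_cong_AE)
    have "ennreal (r ^ (?n - 1)) * indicator {0<..} r * ennreal (exp (- \<bar>r\<bar>))
        = ennreal (indicator {0..} r * r powr (real ?n - 1) / exp r)" if "r \<noteq> 0" for r
    proof (cases "r > 0")
      case True
      have e: "real ?n - 1 = real (?n - 1)" using zero_less_card_finite[where 'a = 'n] by (simp add: of_nat_diff)
      have "r powr (real ?n - 1) = r ^ (?n - 1)" unfolding e by (rule powr_realpow[OF True])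
      then show ?thesis using True by (simp add: exp_minus field_simps flip: ennreal_mult')
    qed (use that in auto)
    then show "AE r in lborel. ennreal (r ^ (?n - 1)) * indicator {0<..} r * ennreal (exp (- \<bar>r\<bar>))
        = ennreal (indicator {0..} r * r powr (real ?n - 1) / exp r)"
      using AE_lborel_singleton[of "0::real"] by (auto elim!: eventually_mono)
  qed
  also have "\<dots> = ennreal (Gamma (real ?n))"
    by (rule Gamma_conv_nn_integral_real[symmetric]) simp
  also have "\<dots> * emeasure (sphere_measure :: (real^'n) measure) (sphere 0 1) < \<infinity>"
    using finite_measure.emeasure_finite[OF finite_sphere_measure, of "sphere (0 :: real^'n) 1"]
    by (simp add: ennreal_mult_less_top less_top)
  finally show "(\<integral>\<^sup>+x. ennreal (exp (- norm x)) \<partial>(lborel :: (real^'n) measure)) < \<infinity>" .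
qed auto

lemma integrable_gaussian_bound:
  fixes f :: "real^'n \<Rightarrow> 'b::{banach, second_countable_topology}"
  assumes "c > 0" and [measurable]: "f \<in> borel_measurable borel"
    and bound: "\<And>x. norm (f x) \<le> K * (1 + norm x) powr a * exp (b * norm x - c * (norm x)\<^sup>2)"
  shows "integrable lborel f"
proof -
  obtain C where C: "C > 0" "\<And>r. r \<ge> 0 \<Longrightarrow> (1 + r) powr a * exp (b * r - c * r\<^sup>2) \<le> C * exp (- r)"
    using polynomial_gaussian_le_exp[OF assms(1)] by blast
  have "norm (f x) \<le> norm (\<bar>K\<bar> * C * exp (- norm x))" for x
  proof -
    have "norm (f x) \<le> K * ((1 + norm x) powr a * exp (b * norm x - c * (norm x)\<^sup>2))"
      using bound[of x] by (simp add: mult.assoc)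
    also have "\<dots> \<le> \<bar>K\<bar> * ((1 + norm x) powr a * exp (b * norm x - c * (norm x)\<^sup>2))"
      by (intro mult_right_mono) auto
    also have "\<dots> \<le> \<bar>K\<bar> * (C * exp (- norm x))"
      by (intro mult_left_mono C(2)) auto
    finally show ?thesis using C(1) by (simp add: mult.assoc abs_mult)
  qed
  then show ?thesis
    by (intro Bochner_Integration.integrable_bound[OF integrable_mult_right[OF integrable_exp_neg_norm, of "\<bar>K\<bar> * C"]])
       auto
qed

text \<open>The substitution \<open>r = sqrt (2 u)\<close> in Euler's integral for the Gamma function.\<close>

lemma radial_gaussian_moment:
  fixes s :: real
  assumes "s > -1"
  shows "set_integrable lborel {0<..} (\<lambda>r. r powr s * exp (- r\<^sup>2 / 2))"
    and "(LBINT r:{0<..}. r powr s * exp (- r\<^sup>2 / 2)) = 2 powr ((s - 1) / 2) * Gamma ((s + 1) / 2)"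
proof -
  let ?f = "\<lambda>r::real. r powr s * exp (- r\<^sup>2 / 2)"
  let ?g = "\<lambda>u::real. sqrt (2 * u)"
  let ?g' = "\<lambda>u::real. 1 / sqrt (2 * u)"
  let ?a = "(s + 1) / 2"
  have a: "?a > 0" using assms by simp
  have "has_bochner_integral lborel (\<lambda>t. indicator {0..} t * t powr (?a - 1) / exp t) (Gamma ?a)"
    using a Gamma_real_pos[OF a]
    by (intro has_bochner_integral_nn_integral Gamma_conv_nn_integral_real[symmetric]) auto
  then have gam1: "set_integrable lborel {0..} (\<lambda>t. t powr (?a - 1) / exp t)"
    and gam2: "(LBINT t:{0..}. t powr (?a - 1) / exp t) = Gamma ?a"
    by (simp_all add: set_integrable_def set_lebesgue_integral_def has_bochner_integral_iff)
  have eq: "?f (?g u) * ?g' u = 2 powr ((s - 1) / 2) * (u powr (?a - 1) / exp u)" if "u > 0" for u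
  proof -
    have "?g u = (2 * u) powr (1/2)" using that by (simp add: powr_half_sqrt)
    then have "?f (?g u) * ?g' u = ((2 * u) powr (1/2)) powr s * exp (- u) / (2 * u) powr (1/2)"
      using that by (simp add: powr_half_sqrt flip: power2_eq_square)
    also have "\<dots> = (2 * u) powr ((s - 1) / 2) * exp (- u)"
      by (simp add: powr_powr diff_divide_distrib powr_diff)
    also have "\<dots> = 2 powr ((s - 1) / 2) * (u powr ((s - 1) / 2) * exp (- u))"
      using that by (simp add: powr_mult)
    also have "(s - 1) / 2 = ?a - 1" by (simp add: field_simps)
    finally show ?thesis by (simp add: exp_minus field_simps)
  qed
  have ein: "einterval 0 \<infinity> = {0<..}" by (auto simp: einterval_def zero_ereal_def)
  have int: "set_integrable lborel {0<..} (\<lambda>u. ?f (?g u) * ?g' u)"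
  proof -
    have "set_integrable lborel {0<..} (\<lambda>u. 2 powr ((s - 1) / 2) * (u powr (?a - 1) / exp u))"
      by (rule set_integrable_mult_right, rule set_integrable_subset[OF gam1]) auto
    moreover have "set_integrable lborel {0<..} (\<lambda>u. ?f (?g u) * ?g' u)
        = set_integrable lborel {0<..} (\<lambda>u. 2 powr ((s - 1) / 2) * (u powr (?a - 1) / exp u))"
      by (rule set_integrable_cong[OF refl refl eq]) simp
    ultimately show ?thesis by blast
  qed
  note sub = interval_integral_substitution_nonneg[where a = 0 and b = \<infinity> and f = ?f and g = ?g and g' = ?g'
      and A = 0 and B = \<infinity>]
  have A: "((ereal \<circ> ?g \<circ> real_of_ereal) \<longlongrightarrow> 0) (at_right 0)"
    unfolding zero_ereal_def comp_def ereal_tendsto_simps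
    by (rule tendsto_eq_intros | simp)+
  have B: "((ereal \<circ> ?g \<circ> real_of_ereal) \<longlongrightarrow> \<infinity>) (at_left \<infinity>)"
    unfolding ereal_tendsto_simps by real_asymp
  have "DERIV ?g x :> ?g' x" if "0 < ereal x" for x
    using that by (auto intro!: derivative_eq_intros simp: zero_ereal_def field_simps)
  moreover have "isCont ?f (?g x)" if "0 < ereal x" for x
    using that by (auto intro!: continuous_intros simp: zero_ereal_def)
  moreover have "isCont ?g' x" if "0 < ereal x" for x
    using that by (auto intro!: continuous_intros simp: zero_ereal_def)
  ultimately have s1: "set_integrable lborel (einterval 0 \<infinity>) ?f"
    and s2: "(LBINT x=0..\<infinity>. ?f x) = (LBINT x=0..\<infinity>. (?f (?g x) * ?g' x))"
    using int A B by (intro sub; simp add: ein zero_ereal_def)+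
  show "set_integrable lborel {0<..} ?f" using s1 by (simp add: ein)
  have "(LBINT r:{0<..}. ?f r) = (LBINT u:{0<..}. ?f (?g u) * ?g' u)"
    using s2 by (simp add: interval_lebesgue_integral_def ein)
  also have "\<dots> = (LBINT u:{0<..}. 2 powr ((s - 1) / 2) * (u powr (?a - 1) / exp u))"
    by (rule set_lebesgue_integral_cong, simp, intro allI impI eq) simp
  also have "\<dots> = 2 powr ((s - 1) / 2) * (LBINT u:{0<..}. u powr (?a - 1) / exp u)"
    by (rule set_integral_mult_right)
  also have "(LBINT u:{0<..}. u powr (?a - 1) / exp u) = (LBINT u:{0..}. u powr (?a - 1) / exp u)"
    unfolding set_lebesgue_integral_def
    using AE_lborel_singleton[of "0::real"]
    by (intro integral_cong_AE) (auto elim!: eventually_mono split: split_indicator)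
  finally show "(LBINT r:{0<..}. ?f r) = 2 powr ((s - 1) / 2) * Gamma ?a" unfolding gam2 .
qed

section \<open>Gaussian integration by parts\<close>

definition gauss :: "real^'n \<Rightarrow> real" where "gauss y = exp (- (norm y)\<^sup>2 / 2)"

lemma gauss_measurable [measurable]: "gauss \<in> borel_measurable borel"
  unfolding gauss_def[abs_def] by measurable

lemma gauss_pos: "gauss y > 0" by (simp add: gauss_def)

text \<open>Measurability is part of the notion, so that functions in this class are integrable against the
  Gaussian without further conditions.\<close>

definition poly_growth :: "(real^'n \<Rightarrow> complex) \<Rightarrow> bool" where
  "poly_growth f \<longleftrightarrow> f \<in> borel_measurable borel \<and> (\<exists>K a. \<forall>y. cmod (f y) \<le> K * (1 + norm y) powr a)"

lemma poly_growthI: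
  "f \<in> borel_measurable borel \<Longrightarrow> (\<And>y. cmod (f y) \<le> K * (1 + norm y) powr a) \<Longrightarrow> poly_growth f"
  unfolding poly_growth_def by blast

lemma poly_growth_measurable: "poly_growth f \<Longrightarrow> f \<in> borel_measurable borel"
  by (simp add: poly_growth_def)

lemma poly_growthE:
  assumes "poly_growth f"
  obtains K a where "K \<ge> 0" "a \<ge> 0" "\<And>y. cmod (f y) \<le> K * (1 + norm y) powr a"
proof -
  obtain K a where Ka: "\<And>y. cmod (f y) \<le> K * (1 + norm y) powr a"
    using assms by (auto simp: poly_growth_def)
  have "0 \<le> cmod (f 0)" by simp
  also have "\<dots> \<le> K" using Ka[of 0] by simp
  finally have K: "K \<ge> 0" .
  have "cmod (f y) \<le> K * (1 + norm y) powr (max 0 a)" for y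
    by (rule order_trans[OF Ka mult_left_mono[OF powr_mono]]) (use K in auto)
  then show ?thesis using that[of K "max 0 a"] K by simp
qed

lemma poly_growth_const: "poly_growth (\<lambda>y. c)"
  by (rule poly_growthI[where K = "cmod c" and a = 0]) (auto simp: add_nonneg_eq_0_iff)

lemma poly_growth_bounded:
  "f \<in> borel_measurable borel \<Longrightarrow> (\<And>y. cmod (f y) \<le> K) \<Longrightarrow> poly_growth f"
  by (rule poly_growthI[where K = K and a = 0]) (auto simp: add_nonneg_eq_0_iff)

lemma poly_growth_of_real_bounded:
  "f \<in> borel_measurable borel \<Longrightarrow> (\<And>y. \<bar>f y\<bar> \<le> K) \<Longrightarrow> poly_growth (\<lambda>y. complex_of_real (f y))"
  by (rule poly_growth_bounded[where K = K]) simp_all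

lemma poly_growth_mult:
  assumes "poly_growth f" "poly_growth g" shows "poly_growth (\<lambda>y. f y * g y)"
proof -
  obtain K a where 1: "K \<ge> 0" "\<And>y. cmod (f y) \<le> K * (1 + norm y) powr a"
    using poly_growthE[OF assms(1)] by metis
  obtain L b where 2: "L \<ge> 0" "\<And>y. cmod (g y) \<le> L * (1 + norm y) powr b"
    using poly_growthE[OF assms(2)] by metis
  show ?thesis
  proof (rule poly_growthI)
    show "(\<lambda>y. f y * g y) \<in> borel_measurable borel"
      using assms by (intro borel_measurable_times poly_growth_measurable)
    fix y
    have "cmod (f y * g y) \<le> (K * (1 + norm y) powr a) * (L * (1 + norm y) powr b)"
      unfolding norm_mult using 1 2 by (intro mult_mono) auto
    then show "cmod (f y * g y) \<le> (K * L) * (1 + norm y) powr (a + b)"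
      by (simp add: powr_add algebra_simps)
  qed
qed

lemma poly_growth_add:
  assumes "poly_growth f" "poly_growth g" shows "poly_growth (\<lambda>y. f y + g y)"
proof -
  obtain K a where 1: "K \<ge> 0" "\<And>y. cmod (f y) \<le> K * (1 + norm y) powr a"
    using poly_growthE[OF assms(1)] by metis
  obtain L b where 2: "L \<ge> 0" "\<And>y. cmod (g y) \<le> L * (1 + norm y) powr b"
    using poly_growthE[OF assms(2)] by metis
  show ?thesis
  proof (rule poly_growthI)
    show "(\<lambda>y. f y + g y) \<in> borel_measurable borel"
      using assms by (intro borel_measurable_add poly_growth_measurable)
    fix y
    have "cmod (f y + g y) \<le> K * (1 + norm y) powr a + L * (1 + norm y) powr b"
      using norm_triangle_ineq[of "f y" "g y"] 1(2)[of y] 2(2)[of y] by linarith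
    also have "\<dots> \<le> K * (1 + norm y) powr max a b + L * (1 + norm y) powr max a b"
      using 1 2 by (intro add_mono mult_left_mono powr_mono) auto
    finally show "cmod (f y + g y) \<le> (K + L) * (1 + norm y) powr max a b"
      by (simp add: distrib_right)
  qed
qed

lemma poly_growth_sum:
  "finite I \<Longrightarrow> (\<And>i. i \<in> I \<Longrightarrow> poly_growth (f i)) \<Longrightarrow> poly_growth (\<lambda>y. \<Sum>i\<in>I. f i y)"
  by (induction I rule: finite_induct) (auto intro: poly_growth_const poly_growth_add)

lemma poly_growth_linear:
  assumes "f \<in> borel_measurable borel" "\<And>y. cmod (f y) \<le> K * norm y" "K \<ge> 0"
  shows "poly_growth f"
proof (rule poly_growthI[where K = K and a = 1])
  show "cmod (f y) \<le> K * (1 + norm y) powr 1" for y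
    using assms(2)[of y] assms(3) by (simp add: distrib_left)
qed fact

lemma poly_growth_inner: "poly_growth (\<lambda>y. complex_of_real (\<xi> \<bullet> y))"
  by (rule poly_growth_linear[where K = "norm \<xi>"]) (auto simp: Cauchy_Schwarz_ineq2)

lemma poly_growth_cpoly: "cpoly p \<Longrightarrow> poly_growth (\<lambda>y. p (cvec y))"
proof (induction rule: cpoly.induct)
  case (cpoly_coord p i)
  have "poly_growth (\<lambda>y. cvec y $ i)"
  proof (rule poly_growth_linear[where K = 1])
    show "cmod (cvec y $ i) \<le> 1 * norm y" for y
      using component_le_norm_cart[of y i] by (simp add: cvec_def)
    have "(\<lambda>y. cvec y $ i) = (\<lambda>y. complex_of_real (y $ i))" by (simp add: cvec_def)
    then show "(\<lambda>y. cvec y $ i) \<in> borel_measurable borel"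
      by (simp add: borel_measurable_continuous_onI continuous_intros)
  qed simp
  then show ?case using cpoly_coord.IH by (rule poly_growth_mult)
qed (auto intro: poly_growth_const poly_growth_add)

lemma poly_growth_integrable:
  assumes "poly_growth f" shows "integrable lborel (\<lambda>y. complex_of_real (gauss y) * f y)"
proof -
  have [measurable]: "f \<in> borel_measurable borel" by (rule poly_growth_measurable[OF assms])
  obtain K a where 1: "\<And>y. cmod (f y) \<le> K * (1 + norm y) powr a"
    using poly_growthE[OF assms] by metis
  show ?thesis
  proof (rule integrable_gaussian_bound[where c = "1/2" and b = 0 and K = K and a = a])
    show "cmod (complex_of_real (gauss y) * f y)
        \<le> K * (1 + norm y) powr a * exp (0 * norm y - 1 / 2 * (norm y)\<^sup>2)" for y
      using mult_left_mono[OF 1[of y], of "gauss y"]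
      by (simp add: norm_mult gauss_def algebra_simps)
  qed auto
qed

lemma integral_lborel_translation:
  fixes f :: "'a::euclidean_space \<Rightarrow> 'b::{banach, second_countable_topology}"
  assumes [measurable]: "f \<in> borel_measurable borel"
  shows "(\<integral>x. f (c + x) \<partial>lborel) = (\<integral>x. f x \<partial>lborel)"
proof -
  have "(\<integral>x. f x \<partial>lborel) = (\<integral>x. f x \<partial>distr lborel borel ((+) c))"
    by (simp add: lborel_distr_plus)
  also have "\<dots> = (\<integral>x. f (c + x) \<partial>lborel)" by (rule integral_distr) simp_all
  finally show ?thesis by simp
qed

text \<open>By translation invariance the integrals of the difference quotients vanish, and the bound on short
  segments lets them converge to the integral of the derivative. This avoids iterated
  integrals along lines.\<close>

lemma integral_directional_derivative:
  fixes F :: "real^'n \<Rightarrow> complex"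
  assumes D: "\<And>y. (F has_derivative F' y) (at y)"
    and F: "integrable lborel F" and G: "integrable lborel G"
    and bound: "\<And>y s. 0 \<le> s \<Longrightarrow> s \<le> 1 \<Longrightarrow> cmod (F' (y + s *\<^sub>R \<xi>) \<xi>) \<le> G y"
  shows "(\<integral>y. F' y \<xi> \<partial>lborel) = 0"
proof -
  define e where "e n = 1 / real (Suc n)" for n
  have e: "0 < e n" "e n \<le> 1" for n by (simp_all add: e_def)
  define Q where "Q n y = (F (y + e n *\<^sub>R \<xi>) - F y) /\<^sub>R e n" for n y
  have Fm [measurable]: "F \<in> borel_measurable borel" using F by auto
  have line: "((\<lambda>s. F (y + s *\<^sub>R \<xi>)) has_derivative (\<lambda>h. h *\<^sub>R F' (y + s *\<^sub>R \<xi>) \<xi>)) (at s)" for y s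
  proof -
    have "((\<lambda>s. F (y + s *\<^sub>R \<xi>)) has_derivative (\<lambda>h. F' (y + s *\<^sub>R \<xi>) (h *\<^sub>R \<xi>))) (at s)"
      by (rule has_derivative_compose[OF _ D]) (auto intro!: derivative_eq_intros)
    then show ?thesis using linear_scale[OF has_derivative_linear[OF D]] by simp
  qed
  have conv: "(\<lambda>n. Q n y) \<longlonglongrightarrow> F' y \<xi>" for y
  proof -
    have "((\<lambda>s. norm (F (y + s *\<^sub>R \<xi>) - F y - s *\<^sub>R F' y \<xi>) / norm s) \<longlongrightarrow> 0) (at 0)"
      using line[of y 0] by (simp add: has_derivative_at)
    moreover have "filterlim e (at 0) sequentially"
      unfolding filterlim_at using LIMSEQ_Suc[OF lim_1_over_n] e by (auto simp: e_def[abs_def])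
    ultimately have lim: "(\<lambda>n. norm (F (y + e n *\<^sub>R \<xi>) - F y - e n *\<^sub>R F' y \<xi>) / norm (e n)) \<longlonglongrightarrow> 0"
      by (rule filterlim_compose)
    have "norm (F (y + e n *\<^sub>R \<xi>) - F y - e n *\<^sub>R F' y \<xi>) / norm (e n) = norm (Q n y - F' y \<xi>)" for n
    proof -
      have "Q n y - F' y \<xi> = (F (y + e n *\<^sub>R \<xi>) - F y - e n *\<^sub>R F' y \<xi>) /\<^sub>R e n"
        using e(1)[of n] by (simp add: Q_def scaleR_diff_right)
      then show ?thesis by (simp add: divide_inverse mult.commute)
    qed
    then have "(\<lambda>n. Q n y - F' y \<xi>) \<longlonglongrightarrow> 0" using lim by (simp add: tendsto_norm_zero_iff)
    then show ?thesis by (rule LIM_zero_cancel)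
  qed
  have le: "cmod (Q n y) \<le> G y" for n y
  proof -
    have "cmod (F (y + e n *\<^sub>R \<xi>) - F (y + 0 *\<^sub>R \<xi>)) \<le> G y * norm (e n - 0)"
    proof (rule differentiable_bound[where S = "{0..e n}"])
      fix s assume s: "s \<in> {0..e n}"
      show "((\<lambda>s. F (y + s *\<^sub>R \<xi>)) has_derivative (\<lambda>h. h *\<^sub>R F' (y + s *\<^sub>R \<xi>) \<xi>)) (at s within {0..e n})"
        by (rule has_derivative_at_withinI[OF line])
      have "cmod (F' (y + s *\<^sub>R \<xi>) \<xi>) \<le> G y" using s e[of n] by (intro bound) auto
      then show "onorm (\<lambda>h. h *\<^sub>R F' (y + s *\<^sub>R \<xi>) \<xi>) \<le> G y"
        by (intro onorm_le) (metis abs_ge_zero mult.commute mult_left_mono norm_scaleR real_norm_def)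
    qed (use e[of n] in auto)
    moreover have "cmod (Q n y) = cmod (F (y + e n *\<^sub>R \<xi>) - F y) / e n"
      using e[of n] by (simp add: Q_def divide_inverse mult.commute)
    ultimately show ?thesis using e[of n] by (simp add: divide_le_eq)
  qed
  have "(\<lambda>n. \<integral>y. Q n y \<partial>lborel) \<longlonglongrightarrow> (\<integral>y. F' y \<xi> \<partial>lborel)"
  proof (rule integral_dominated_convergence[where w = G])
    have Q [measurable]: "Q n \<in> borel_measurable lborel" for n unfolding Q_def by measurable
    show "Q n \<in> borel_measurable lborel" for n by (rule Q)
    show "(\<lambda>y. F' y \<xi>) \<in> borel_measurable lborel"
      by (rule borel_measurable_LIMSEQ_metric[OF Q conv])
  qed (use G conv le in auto)
  moreover have Q0: "(\<integral>y. Q n y \<partial>lborel) = 0" for n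
  proof -
    have "integrable lborel (\<lambda>y. F (e n *\<^sub>R \<xi> + y))"
      using F lborel_distr_plus[of "e n *\<^sub>R \<xi>"] integrable_distr_eq[of "(+) (e n *\<^sub>R \<xi>)" lborel borel F] by simp
    then have "(\<integral>y. Q n y \<partial>lborel) = ((\<integral>y. F (e n *\<^sub>R \<xi> + y) \<partial>lborel) - (\<integral>y. F y \<partial>lborel)) /\<^sub>R e n"
      using F by (simp add: Q_def add.commute)
    then show ?thesis by (simp add: integral_lborel_translation)
  qed
  ultimately have "(\<lambda>n. 0) \<longlonglongrightarrow> (\<integral>y. F' y \<xi> \<partial>lborel)" by (simp only: Q0)
  then show ?thesis by (rule LIMSEQ_unique[OF _ tendsto_const])
qed

lemma gaussian_by_parts:
  fixes H :: "real^'n \<Rightarrow> complex"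
  assumes H: "poly_growth H" and D: "\<And>y. (H has_derivative H' y) (at y)"
    and H': "poly_growth (\<lambda>y. H' y \<xi>)"
  shows "(\<integral>y. complex_of_real (gauss y) * (complex_of_real (\<xi> \<bullet> y) * H y) \<partial>lborel)
    = (\<integral>y. complex_of_real (gauss y) * H' y \<xi> \<partial>lborel)"
proof -
  define P where "P y = H' y \<xi> - complex_of_real (\<xi> \<bullet> y) * H y" for y
  have xH: "poly_growth (\<lambda>y. complex_of_real (\<xi> \<bullet> y) * H y)"
    by (rule poly_growth_mult[OF poly_growth_inner H])
  have P: "poly_growth P"
    using poly_growth_add[OF H' poly_growth_mult[OF poly_growth_const[of "-1"] xH]] by (simp add: P_def[abs_def])
  obtain K a where Ka: "K \<ge> 0" "a \<ge> 0" "\<And>y. cmod (P y) \<le> K * (1 + norm y) powr a"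
    using poly_growthE[OF P] by metis
  define F' where "F' y v = complex_of_real (gauss y) * (H' y v - complex_of_real (v \<bullet> y) * H y)" for y v
  have gaussD: "(gauss has_derivative (\<lambda>v. - (v \<bullet> y) * gauss y)) (at y)" for y :: "real^'n"
    unfolding gauss_def[abs_def] power2_norm_eq_inner
    by (auto intro!: derivative_eq_intros simp: inner_commute algebra_simps)
  have FD: "((\<lambda>y. complex_of_real (gauss y) * H y) has_derivative F' y) (at y)" for y
    unfolding F'_def
    by (rule has_derivative_eq_rhs[OF has_derivative_mult[OF has_derivative_of_real[OF gaussD] D]])
       (auto simp: algebra_simps)
  \<comment> \<open>Bounds the derivative along the whole segment from \<open>y\<close> to \<open>y + \<xi>\<close>.\<close>
  define G where "G y = K * (1 + norm \<xi>) powr a * (1 + norm y) powr a * exp (norm \<xi> * norm y - 1/2 * (norm y)\<^sup>2)" for y :: "real^'n"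
  have [measurable]: "G \<in> borel_measurable borel" unfolding G_def[abs_def] by measurable
  have "(\<integral>y. F' y \<xi> \<partial>lborel) = 0"
  proof (rule integral_directional_derivative[OF FD poly_growth_integrable[OF H]])
    show "integrable lborel G"
      by (rule integrable_gaussian_bound[where c = "1/2" and b = "norm \<xi>" and K = "K * (1 + norm \<xi>) powr a" and a = a])
         (auto simp: G_def Ka(1) abs_mult)
    fix y and s :: real assume s: "0 \<le> s" "s \<le> 1"
    let ?z = "y + s *\<^sub>R \<xi>"
    have s\<xi>: "norm (s *\<^sub>R \<xi>) \<le> norm \<xi>" using s by (simp add: mult_left_le_one_le)
    have "cmod (F' ?z \<xi>) = gauss ?z * cmod (P ?z)"
      by (simp add: F'_def P_def norm_mult gauss_pos less_imp_le)
    also have "\<dots> \<le> gauss ?z * (K * (1 + norm ?z) powr a)"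
      using gauss_pos by (intro mult_left_mono Ka less_imp_le)
    also have "\<dots> \<le> exp (norm \<xi> * norm y - 1/2 * (norm y)\<^sup>2) * (K * ((1 + norm \<xi>) * (1 + norm y)) powr a)"
    proof (intro mult_mono)
      have "norm y - norm \<xi> \<le> norm ?z"
        using norm_triangle_ineq2[of y "- (s *\<^sub>R \<xi>)"] s\<xi> by simp
      moreover have "norm ?z \<ge> 0" by simp
      ultimately have "(norm ?z)\<^sup>2 \<ge> (norm y)\<^sup>2 - 2 * norm \<xi> * norm y"
      proof (cases "norm y \<ge> norm \<xi>")
        case True
        then have "(norm y - norm \<xi>)\<^sup>2 \<le> (norm ?z)\<^sup>2"
          using \<open>norm y - norm \<xi> \<le> norm ?z\<close> by (intro power_mono) auto
        moreover have "(norm y)\<^sup>2 - 2 * norm \<xi> * norm y \<le> (norm y - norm \<xi>)\<^sup>2"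
          by (simp add: power2_diff mult.commute)
        ultimately show ?thesis by linarith
      next
        case False
        then have "norm y * norm y \<le> norm \<xi> * norm y" by (intro mult_right_mono) auto
        moreover have "0 \<le> norm \<xi> * norm y" by simp
        ultimately have "(norm y)\<^sup>2 - 2 * norm \<xi> * norm y \<le> 0"
          unfolding power2_eq_square mult.assoc by linarith
        also have "\<dots> \<le> (norm ?z)\<^sup>2" by simp
        finally show ?thesis .
      qed
      then show "gauss ?z \<le> exp (norm \<xi> * norm y - 1/2 * (norm y)\<^sup>2)"
        by (simp add: gauss_def)
      have "1 + norm ?z \<le> (1 + norm \<xi>) * (1 + norm y)"
      proof -
        have "(1 + norm \<xi>) * (1 + norm y) = 1 + norm \<xi> + norm y + norm \<xi> * norm y"
          by (simp add: algebra_simps)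
        moreover have "0 \<le> norm \<xi> * norm y" by simp
        ultimately show ?thesis using norm_triangle_ineq[of y "s *\<^sub>R \<xi>"] s\<xi> by linarith
      qed
      then show "(1 + norm ?z) powr a \<le> ((1 + norm \<xi>) * (1 + norm y)) powr a"
        using Ka by (intro powr_mono2) (auto intro: add_nonneg_nonneg)
    qed (use Ka in auto)
    also have "\<dots> = G y" by (simp add: G_def powr_mult)
    finally show "cmod (F' ?z \<xi>) \<le> G y" .
  qed
  moreover have "(\<integral>y. F' y \<xi> \<partial>lborel) = (\<integral>y. complex_of_real (gauss y) * H' y \<xi> \<partial>lborel)
      - (\<integral>y. complex_of_real (gauss y) * (complex_of_real (\<xi> \<bullet> y) * H y) \<partial>lborel)"
    unfolding F'_def right_diff_distrib
    by (rule Bochner_Integration.integral_diff) (intro poly_growth_integrable H' xH)+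
  ultimately show ?thesis by simp
qed

lemma integral_lborel_orthogonal:
  fixes h :: "real^'n \<Rightarrow> complex" and g :: "real^'n \<Rightarrow> real^'n"
  assumes "orthogonal_transformation g" "h \<in> borel_measurable borel"
  shows "(\<integral>y. h (g y) \<partial>lborel) = (\<integral>y. h y \<partial>lborel)"
proof -
  have "g \<in> lborel \<rightarrow>\<^sub>M borel"
    using orthogonal_transformation_linear[OF assms(1)]
    by (simp add: borel_measurable_continuous_onI linear_continuous_on linear_conv_bounded_linear)
  then show ?thesis
    using integral_distr[of g lborel borel h] distr_lborel_orthogonal[OF assms(1)] assms(2) by simp
qed

lemma AE_not_hyperplane:
  fixes \<alpha> :: "real^'n" assumes "\<alpha> \<noteq> 0" shows "AE y in lborel. \<alpha> \<bullet> y \<noteq> 0"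
proof -
  have "negligible {y. \<alpha> \<bullet> y = 0}" by (rule negligible_hyperplane) (simp add: assms)
  then have "{y. \<alpha> \<bullet> y = 0} \<in> null_sets lborel"
    by (simp add: negligible_iff_null_sets null_sets_completion_iff)
  then show ?thesis by (rule AE_I') auto
qed

section \<open>The weight and its smooth approximations\<close>

context dunkl_data
begin

abbreviation "wt \<equiv> dunkl_weight Rp k"

text \<open>The weight with every \<open>\<langle>\<alpha>, y\<rangle>\<^sup>2\<close> replaced by \<open>e + \<langle>\<alpha>, y\<rangle>\<^sup>2\<close>. For small multiplicities the weight itself
  is not differentiable on the mirrors; this one is smooth for \<open>e > 0\<close>, still invariant under the group,
  and decreases to the weight off the mirrors as \<open>e\<close> tends to \<open>0\<close>.\<close>

definition smooth_weight :: "real \<Rightarrow> real^'n \<Rightarrow> real" where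
  "smooth_weight e y = exp (\<Sum>\<alpha>\<in>Rp. k \<alpha> * ln (e + (\<alpha> \<bullet> y)\<^sup>2))"

lemma smooth_weight_refl:
  assumes "\<beta> \<in> R" shows "smooth_weight e (refl_root \<beta> y) = smooth_weight e y"
proof -
  have b0: "\<beta> \<noteq> 0" using assms root_nonzero by blast
  let ?F = "\<lambda>\<alpha>. (if \<alpha> \<in> R then k \<alpha> else 0) * ln (e + (\<alpha> \<bullet> y)\<^sup>2)"
  have "(\<Sum>\<alpha>\<in>Rp. k \<alpha> * ln (e + (\<alpha> \<bullet> refl_root \<beta> y)\<^sup>2)) = (\<Sum>\<alpha>\<in>Rp. ?F \<alpha>)"
  proof (rule sum_Rp_refl[OF assms])
    show "?F (- \<alpha>) = ?F \<alpha>" for \<alpha>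
      using minus_root[of \<alpha>] minus_root[of "- \<alpha>"] k_minus[of \<alpha>] by auto
    show "k \<alpha> * ln (e + (\<alpha> \<bullet> refl_root \<beta> y)\<^sup>2) = ?F (refl_root \<beta> \<alpha>)" if "\<alpha> \<in> Rp" for \<alpha>
      using inner_refl_root[OF b0, of "refl_root \<beta> \<alpha>" y] refl_root_invol[OF b0, of y]
        inner_refl_root[OF b0, of \<alpha> "refl_root \<beta> y"]
      by (simp add: assms that Rp_R refl_root_mem k_refl)
  qed
  also have "\<dots> = (\<Sum>\<alpha>\<in>Rp. k \<alpha> * ln (e + (\<alpha> \<bullet> y)\<^sup>2))"
    by (rule sum.cong) (auto simp: Rp_R)
  finally show ?thesis by (simp add: smooth_weight_def)
qed

lemma weight_measurable [measurable]: "wt \<in> borel_measurable borel"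
  unfolding dunkl_weight_def[abs_def] rpow_def by measurable

lemma weight_nonneg: "wt y \<ge> 0"
  unfolding dunkl_weight_def rpow_def by (intro prod_nonneg) auto

lemma rpow_eq_exp: "s \<noteq> 0 \<Longrightarrow> rpow \<bar>s\<bar> (2 * c) = exp (c * ln (s\<^sup>2))"
proof -
  assume s: "s \<noteq> 0"
  have "ln (s\<^sup>2) = 2 * ln \<bar>s\<bar>"
    using s ln_realpow[of "\<bar>s\<bar>" 2] by simp
  then show ?thesis using s by (simp add: rpow_def powr_def)
qed

lemma weight_eq_exp:
  assumes "\<And>\<alpha>. \<alpha> \<in> Rp \<Longrightarrow> \<alpha> \<bullet> y \<noteq> 0"
  shows "wt y = smooth_weight 0 y"
  unfolding dunkl_weight_def smooth_weight_def by (simp add: exp_sum rpow_eq_exp assms)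

lemma weight_refl:
  assumes "\<beta> \<in> R" shows "wt (refl_root \<beta> y) = wt y"
proof -
  have b0: "\<beta> \<noteq> 0" using assms root_nonzero by blast
  obtain \<tau> where t: "bij_betw \<tau> Rp Rp"
    "\<And>\<alpha>. \<alpha> \<in> Rp \<Longrightarrow> \<tau> \<alpha> = refl_root \<beta> \<alpha> \<or> \<tau> \<alpha> = - refl_root \<beta> \<alpha>"
    "\<And>\<alpha>. \<alpha> \<in> Rp \<Longrightarrow> k (\<tau> \<alpha>) = k \<alpha>"
    using positive_roots_permuted[OF assms] by metis
  have "\<bar>\<tau> \<alpha> \<bullet> y\<bar> = \<bar>\<alpha> \<bullet> refl_root \<beta> y\<bar>" if "\<alpha> \<in> Rp" for \<alpha>
    using t(2)[OF that] inner_refl_root[OF b0, of \<alpha> "refl_root \<beta> y"] refl_root_invol[OF b0, of y] by auto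
  then have "wt (refl_root \<beta> y) = (\<Prod>\<alpha>\<in>Rp. rpow \<bar>\<tau> \<alpha> \<bullet> y\<bar> (2 * k (\<tau> \<alpha>)))"
    unfolding dunkl_weight_def using t(3) by (intro prod.cong) auto
  also have "\<dots> = wt y"
    unfolding dunkl_weight_def
    by (rule prod.reindex_bij_betw[OF t(1), where g = "\<lambda>\<alpha>. rpow \<bar>\<alpha> \<bullet> y\<bar> (2 * k \<alpha>)"])
  finally show ?thesis .
qed

lemma weight_scale:
  assumes "r > 0" shows "wt (r *\<^sub>R y) = r powr (2 * \<gamma>) * wt y"
proof -
  have "rpow \<bar>\<alpha> \<bullet> (r *\<^sub>R y)\<bar> (2 * k \<alpha>) = r powr (2 * k \<alpha>) * rpow \<bar>\<alpha> \<bullet> y\<bar> (2 * k \<alpha>)" for \<alpha>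
    using assms by (simp add: rpow_def abs_mult powr_mult)
  then have "wt (r *\<^sub>R y) = (\<Prod>\<alpha>\<in>Rp. r powr (2 * k \<alpha>)) * wt y"
    by (simp add: dunkl_weight_def prod.distrib)
  also have "(\<Prod>\<alpha>\<in>Rp. r powr (2 * k \<alpha>)) = r powr (2 * \<gamma>)"
    using assms by (simp add: powr_sum mult_gamma_def sum_distrib_left)
  finally show ?thesis .
qed

lemma smooth_weight_bound:
  obtains K where "\<And>y e. 0 < e \<Longrightarrow> e \<le> 1 \<Longrightarrow> smooth_weight e y \<le> K * (1 + norm y) powr (2 * \<gamma>)"
proof -
  define K where "K = exp (\<Sum>\<alpha>\<in>Rp. k \<alpha> * (2 * ln (1 + norm \<alpha>)))"
  have "smooth_weight e y \<le> K * (1 + norm y) powr (2 * \<gamma>)" if e: "0 < e" "e \<le> 1" for y e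
  proof -
    have "k \<alpha> * ln (e + (\<alpha> \<bullet> y)\<^sup>2) \<le> k \<alpha> * (2 * ln (1 + norm \<alpha>)) + k \<alpha> * (2 * ln (1 + norm y))"
      if a: "\<alpha> \<in> Rp" for \<alpha>
    proof -
      have "\<bar>\<alpha> \<bullet> y\<bar> \<le> norm \<alpha> * norm y" by (rule Cauchy_Schwarz_ineq2)
      then have "(\<alpha> \<bullet> y)\<^sup>2 \<le> (norm \<alpha> * norm y)\<^sup>2" by (simp add: abs_le_square_iff[symmetric])
      also have "e + (norm \<alpha> * norm y)\<^sup>2 \<le> ((1 + norm \<alpha>) * (1 + norm y))\<^sup>2"
      proof -
        have "1 + norm \<alpha> * norm y \<le> (1 + norm \<alpha>) * (1 + norm y)" by (simp add: algebra_simps)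
        then have "(1 + norm \<alpha> * norm y)\<^sup>2 \<le> ((1 + norm \<alpha>) * (1 + norm y))\<^sup>2"
          by (intro power_mono) auto
        moreover have "1 + (norm \<alpha> * norm y)\<^sup>2 \<le> (1 + norm \<alpha> * norm y)\<^sup>2"
          by (simp add: power2_sum)
        ultimately show ?thesis using e by linarith
      qed
      finally have le: "e + (\<alpha> \<bullet> y)\<^sup>2 \<le> ((1 + norm \<alpha>) * (1 + norm y))\<^sup>2" by simp
      have "ln (e + (\<alpha> \<bullet> y)\<^sup>2) \<le> ln (((1 + norm \<alpha>) * (1 + norm y))\<^sup>2)"
        using e by (intro ln_mono le) (auto intro: add_pos_nonneg)
      also have "\<dots> = 2 * ln (1 + norm \<alpha>) + 2 * ln (1 + norm y)"
        by (simp add: ln_realpow ln_mult add_pos_nonneg add_nonneg_eq_0_iff)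
      finally show ?thesis using k_nonneg[OF a] by (metis distrib_left mult_left_mono)
    qed
    then have "smooth_weight e y \<le> exp (\<Sum>\<alpha>\<in>Rp. k \<alpha> * (2 * ln (1 + norm \<alpha>)) + k \<alpha> * (2 * ln (1 + norm y)))"
      unfolding smooth_weight_def exp_le_cancel_iff by (rule sum_mono)
    also have "\<dots> = K * exp (\<gamma> * (2 * ln (1 + norm y)))"
      by (simp add: sum.distrib K_def exp_add mult_gamma_def sum_distrib_right)
    also have "exp (\<gamma> * (2 * ln (1 + norm y))) = (1 + norm y) powr (2 * \<gamma>)"
      by (simp add: powr_def add_nonneg_eq_0_iff mult.assoc)
    finally show ?thesis .
  qed
  then show ?thesis by (rule that)
qed

lemma smooth_weight_mono:
  assumes "0 < e" "e \<le> 1" shows "smooth_weight e y \<le> smooth_weight 1 y"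
  unfolding smooth_weight_def exp_le_cancel_iff
  by (intro sum_mono mult_left_mono ln_mono add_mono k_nonneg) (use assms in \<open>auto intro: add_pos_nonneg\<close>)

lemma weight_le_smooth: "wt y \<le> smooth_weight 1 y"
  unfolding dunkl_weight_def smooth_weight_def exp_sum[OF finite_Rp]
proof (rule prod_mono, intro conjI)
  fix \<alpha> assume a: "\<alpha> \<in> Rp"
  show "0 \<le> rpow \<bar>\<alpha> \<bullet> y\<bar> (2 * k \<alpha>)" by (simp add: rpow_def)
  show "rpow \<bar>\<alpha> \<bullet> y\<bar> (2 * k \<alpha>) \<le> exp (k \<alpha> * ln (1 + (\<alpha> \<bullet> y)\<^sup>2))"
  proof (cases "\<alpha> \<bullet> y = 0")
    case False
    then show ?thesis
      using k_nonneg[OF a] by (auto simp: rpow_eq_exp intro!: mult_left_mono ln_mono)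
  qed (auto simp: rpow_def)
qed

lemma smooth_weight_measurable [measurable]: "smooth_weight e \<in> borel_measurable borel"
  unfolding smooth_weight_def[abs_def] by measurable

lemma poly_growth_smooth_weight:
  assumes "0 < e" "e \<le> 1" shows "poly_growth (\<lambda>y. complex_of_real (smooth_weight e y))"
proof -
  obtain K where K: "\<And>y e. 0 < e \<Longrightarrow> e \<le> 1 \<Longrightarrow> smooth_weight e y \<le> K * (1 + norm y) powr (2 * \<gamma>)"
    using smooth_weight_bound by blast
  show ?thesis
  proof (rule poly_growthI)
    show "cmod (complex_of_real (smooth_weight e y)) \<le> K * (1 + norm y) powr (2 * \<gamma>)" for y
      using K[OF assms, of y] by (simp add: smooth_weight_def)
  qed simp
qed

lemma poly_growth_weight: "poly_growth (\<lambda>y. complex_of_real (wt y))"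
proof -
  obtain K a where K: "\<And>y. cmod (complex_of_real (smooth_weight 1 y)) \<le> K * (1 + norm y) powr a"
    using poly_growthE[OF poly_growth_smooth_weight[of 1]] by (metis order_refl zero_less_one)
  show ?thesis
  proof (rule poly_growthI)
    show "cmod (complex_of_real (wt y)) \<le> K * (1 + norm y) powr a" for y
      using K[of y] weight_le_smooth[of y] weight_nonneg[of y] by (simp add: smooth_weight_def)
  qed simp
qed

lemma AE_regular: "AE y in lborel. \<forall>\<alpha>\<in>Rp. \<alpha> \<bullet> y \<noteq> 0"
  by (intro AE_finite_allI finite_Rp AE_not_hyperplane Rp_nonzero)

lemma smooth_weight_derivative:
  assumes "e > 0"
  shows "(smooth_weight e has_derivative (\<lambda>v. smooth_weight e y *
    (\<Sum>\<alpha>\<in>Rp. 2 * k \<alpha> * (\<alpha> \<bullet> v) * ((\<alpha> \<bullet> y) / (e + (\<alpha> \<bullet> y)\<^sup>2))))) (at y)"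
proof -
  have pos: "e + (\<alpha> \<bullet> y)\<^sup>2 > 0" for \<alpha> using assms by (simp add: add_pos_nonneg)
  have "((\<lambda>y. k \<alpha> * ln (e + (\<alpha> \<bullet> y)\<^sup>2)) has_derivative
      (\<lambda>v. 2 * k \<alpha> * (\<alpha> \<bullet> v) * ((\<alpha> \<bullet> y) / (e + (\<alpha> \<bullet> y)\<^sup>2)))) (at y)" for \<alpha>
    using pos[of \<alpha>] by (auto intro!: derivative_eq_intros simp: divide_simps)
  then have "((\<lambda>y. \<Sum>\<alpha>\<in>Rp. k \<alpha> * ln (e + (\<alpha> \<bullet> y)\<^sup>2)) has_derivative
      (\<lambda>v. \<Sum>\<alpha>\<in>Rp. 2 * k \<alpha> * (\<alpha> \<bullet> v) * ((\<alpha> \<bullet> y) / (e + (\<alpha> \<bullet> y)\<^sup>2)))) (at y)"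
    by (intro has_derivative_sum)
  then show ?thesis
    unfolding smooth_weight_def[abs_def]
    by (rule has_derivative_eq_rhs[OF has_derivative_exp]) (simp add: mult.commute)
qed

lemma ratio_bound: "0 < e \<Longrightarrow> e \<le> 1 \<Longrightarrow> \<bar>s / (e + s\<^sup>2)\<bar> \<le> 1 / (e :: real)"
proof -
  assume e: "0 < e" "e \<le> 1"
  have pos: "e + s\<^sup>2 > 0" using e by (simp add: add_pos_nonneg)
  have "0 \<le> (\<bar>s\<bar> - 1)\<^sup>2" by simp
  then have "\<bar>s\<bar> \<le> 1 + s\<^sup>2" by (simp add: power2_diff)
  then have "e * \<bar>s\<bar> \<le> e * (1 + s\<^sup>2)" using e by (intro mult_left_mono) auto
  also have "\<dots> \<le> e + s\<^sup>2" using e by (simp add: distrib_left mult_left_le_one_le)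
  finally show ?thesis using e pos by (simp add: abs_divide divide_simps mult.commute)
qed

text \<open>The logarithmic derivative of the smooth weight is odd under the reflection while everything else is
  even, so averaging over the reflection replaces the polynomial by half the difference
  of its values at the point and the mirror image, and thus by a difference quotient.\<close>

lemma symmetrize:
  assumes p: "cpoly p" and a: "\<alpha> \<in> Rp" and e: "0 < e" "e \<le> 1"
  shows "2 * (\<integral>y. complex_of_real (gauss y) * (complex_of_real (smooth_weight e y * ((\<alpha> \<bullet> y) / (e + (\<alpha> \<bullet> y)\<^sup>2))) * p (cvec y)) \<partial>lborel)
    = (\<integral>y. complex_of_real (gauss y) * (complex_of_real (smooth_weight e y * ((\<alpha> \<bullet> y)\<^sup>2 / (e + (\<alpha> \<bullet> y)\<^sup>2)))
          * dunkl_quotient \<alpha> p (cvec y)) \<partial>lborel)"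
proof -
  have a0: "\<alpha> \<noteq> 0" using a Rp_nonzero by blast
  define u where "u y = complex_of_real (smooth_weight e y * ((\<alpha> \<bullet> y) / (e + (\<alpha> \<bullet> y)\<^sup>2)))" for y
  define I where "I f = (\<integral>y. complex_of_real (gauss y) * (u y * f (cvec y)) \<partial>lborel)" for f
  have u: "poly_growth u"
    unfolding u_def of_real_mult
    by (intro poly_growth_mult poly_growth_smooth_weight e poly_growth_of_real_bounded[where K = "1 / e"]
        ratio_bound[OF e]) measurable
  have crefl: "cpoly (\<lambda>x. p (crefl_root \<alpha> x))" by (rule cpoly_crefl[OF p a0])
  have int: "integrable lborel (\<lambda>y. complex_of_real (gauss y) * (u y * f (cvec y)))" if "cpoly f" for f
    by (intro poly_growth_integrable poly_growth_mult u poly_growth_cpoly that)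
  have odd: "u (refl_root \<alpha> y) = - u y" for y
  proof -
    have "\<alpha> \<bullet> refl_root \<alpha> y = - (\<alpha> \<bullet> y)"
      using inner_refl_root[OF a0, of \<alpha> y] by (simp add: refl_root_self a0)
    then show ?thesis by (simp add: u_def smooth_weight_refl[OF Rp_R[OF a]])
  qed
  have g: "gauss (refl_root \<alpha> y) = gauss y" for y
    using orthogonal_transformation_norm[OF orthogonal_refl_root[OF a0]] by (simp add: gauss_def)
  have "I p = (\<integral>y. complex_of_real (gauss (refl_root \<alpha> y)) * (u (refl_root \<alpha> y) * p (cvec (refl_root \<alpha> y))) \<partial>lborel)"
    unfolding I_def
    by (rule integral_lborel_orthogonal[OF orthogonal_refl_root[OF a0], symmetric,
          where h = "\<lambda>y. complex_of_real (gauss y) * (u y * p (cvec y))"])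
       (use int[OF p] in auto)
  also have "\<dots> = - I (\<lambda>x. p (crefl_root \<alpha> x))"
    by (simp add: I_def odd g crefl_root_cvec)
  finally have "2 * I p = I p - I (\<lambda>x. p (crefl_root \<alpha> x))" by simp
  also have "\<dots> = (\<integral>y. complex_of_real (gauss y) * (u y * p (cvec y))
      - complex_of_real (gauss y) * (u y * p (crefl_root \<alpha> (cvec y))) \<partial>lborel)"
    unfolding I_def by (rule Bochner_Integration.integral_diff[symmetric]) (intro int p crefl)+
  also have "\<dots> = (\<integral>y. complex_of_real (gauss y) * (complex_of_real (smooth_weight e y * ((\<alpha> \<bullet> y)\<^sup>2 / (e + (\<alpha> \<bullet> y)\<^sup>2)))
          * dunkl_quotient \<alpha> p (cvec y)) \<partial>lborel)"
  proof (rule Bochner_Integration.integral_cong[OF refl])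
    fix y
    have "complex_of_real (gauss y) * (u y * p (cvec y)) - complex_of_real (gauss y) * (u y * p (crefl_root \<alpha> (cvec y)))
        = complex_of_real (gauss y) * (u y * (p (cvec y) - p (crefl_root \<alpha> (cvec y))))"
      by (simp add: algebra_simps)
    also have "\<dots> = complex_of_real (gauss y) * (u y * (complex_of_real (\<alpha> \<bullet> y) * dunkl_quotient \<alpha> p (cvec y)))"
      by (simp add: cpoly_quotient(2)[OF a0 p] cdot_cvec)
    finally show "complex_of_real (gauss y) * (u y * p (cvec y)) - complex_of_real (gauss y) * (u y * p (crefl_root \<alpha> (cvec y)))
       = complex_of_real (gauss y) * (complex_of_real (smooth_weight e y * ((\<alpha> \<bullet> y)\<^sup>2 / (e + (\<alpha> \<bullet> y)\<^sup>2)))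
          * dunkl_quotient \<alpha> p (cvec y))"
      by (simp add: u_def power2_eq_square)
  qed
  finally show ?thesis by (simp add: I_def u_def)
qed

lemma smooth_by_parts:
  assumes p: "cpoly p" and e: "0 < e" "e \<le> 1"
  shows "(\<integral>y. complex_of_real (gauss y) * (complex_of_real (smooth_weight e y) * (complex_of_real (\<xi> \<bullet> y) * p (cvec y))) \<partial>lborel)
    = (\<integral>y. complex_of_real (gauss y) * (complex_of_real (smooth_weight e y) * frechet_derivative p (at (cvec y)) (cvec \<xi>)) \<partial>lborel)
    + (\<Sum>\<alpha>\<in>Rp. complex_of_real (k \<alpha> * (\<alpha> \<bullet> \<xi>)) *
        (\<integral>y. complex_of_real (gauss y) * (complex_of_real (smooth_weight e y * ((\<alpha> \<bullet> y)\<^sup>2 / (e + (\<alpha> \<bullet> y)\<^sup>2)))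
          * dunkl_quotient \<alpha> p (cvec y)) \<partial>lborel))"
proof -
  define s where "s \<alpha> y = (\<alpha> \<bullet> y) / (e + (\<alpha> \<bullet> y)\<^sup>2)" for \<alpha> y :: "real^'n"
  define H where "H y = complex_of_real (smooth_weight e y) * p (cvec y)" for y
  define H' where "H' y v = complex_of_real (smooth_weight e y) * frechet_derivative p (at (cvec y)) (cvec v)
     + complex_of_real (smooth_weight e y * (\<Sum>\<alpha>\<in>Rp. 2 * k \<alpha> * (\<alpha> \<bullet> v) * s \<alpha> y)) * p (cvec y)" for y v
  have D: "(H has_derivative H' y) (at y)" for y
    unfolding H_def H'_def s_def
    by (rule has_derivative_mult[OF has_derivative_of_real[OF smooth_weight_derivative[OF e(1)]]
          has_derivative_compose[OF bounded_linear_imp_has_derivative[OF bounded_linear_cvec] cpoly_has_derivative[OF p]]])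
  have sg: "poly_growth (\<lambda>y. complex_of_real (s \<alpha> y))" for \<alpha>
    unfolding s_def
    by (rule poly_growth_of_real_bounded[where K = "1 / e", OF _ ratio_bound[OF e]]) measurable
  have D1: "poly_growth (\<lambda>y. complex_of_real (smooth_weight e y) * frechet_derivative p (at (cvec y)) (cvec \<xi>))"
    by (rule poly_growth_mult[OF poly_growth_smooth_weight[OF e] poly_growth_cpoly[OF cpoly_derivative_props(2)[OF p]]])
  have D2: "poly_growth (\<lambda>y. complex_of_real (smooth_weight e y * s \<alpha> y) * p (cvec y))" for \<alpha>
    unfolding of_real_mult by (intro poly_growth_mult poly_growth_smooth_weight e sg poly_growth_cpoly p)
  have H'_eq: "H' y \<xi> = complex_of_real (smooth_weight e y) * frechet_derivative p (at (cvec y)) (cvec \<xi>)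
      + (\<Sum>\<alpha>\<in>Rp. complex_of_real (2 * k \<alpha> * (\<alpha> \<bullet> \<xi>)) * (complex_of_real (smooth_weight e y * s \<alpha> y) * p (cvec y)))" for y
    by (simp add: H'_def sum_distrib_left sum_distrib_right algebra_simps)
  have "poly_growth (\<lambda>y. H' y \<xi>)"
    unfolding H'_eq by (intro poly_growth_add D1 poly_growth_sum poly_growth_mult[OF poly_growth_const] D2) simp
  moreover have "poly_growth H"
    unfolding H_def by (intro poly_growth_mult poly_growth_smooth_weight e poly_growth_cpoly p)
  ultimately have "(\<integral>y. complex_of_real (gauss y) * (complex_of_real (\<xi> \<bullet> y) * H y) \<partial>lborel)
      = (\<integral>y. complex_of_real (gauss y) * H' y \<xi> \<partial>lborel)"
    using D by (intro gaussian_by_parts)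
  also have "\<dots> = (\<integral>y. complex_of_real (gauss y) * (complex_of_real (smooth_weight e y) * frechet_derivative p (at (cvec y)) (cvec \<xi>))
      + (\<Sum>\<alpha>\<in>Rp. complex_of_real (2 * k \<alpha> * (\<alpha> \<bullet> \<xi>)) * (complex_of_real (gauss y) * (complex_of_real (smooth_weight e y * s \<alpha> y) * p (cvec y)))) \<partial>lborel)"
    unfolding H'_eq by (simp add: distrib_left sum_distrib_left mult_ac)
  also have "\<dots> = (\<integral>y. complex_of_real (gauss y) * (complex_of_real (smooth_weight e y) * frechet_derivative p (at (cvec y)) (cvec \<xi>)) \<partial>lborel)
      + (\<Sum>\<alpha>\<in>Rp. complex_of_real (2 * k \<alpha> * (\<alpha> \<bullet> \<xi>)) * (\<integral>y. complex_of_real (gauss y) * (complex_of_real (smooth_weight e y * s \<alpha> y) * p (cvec y)) \<partial>lborel))"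
  proof -
    have iB: "integrable lborel (\<lambda>y. complex_of_real (2 * k \<alpha> * (\<alpha> \<bullet> \<xi>)) * (complex_of_real (gauss y) * (complex_of_real (smooth_weight e y * s \<alpha> y) * p (cvec y))))" for \<alpha>
      by (intro integrable_mult_right poly_growth_integrable D2)
    show ?thesis
      by (subst Bochner_Integration.integral_add[OF poly_growth_integrable[OF D1] Bochner_Integration.integrable_sum[OF iB]],
          subst Bochner_Integration.integral_sum[OF iB]) (simp only: integral_mult_right_zero)
  qed
  also have "(\<Sum>\<alpha>\<in>Rp. complex_of_real (2 * k \<alpha> * (\<alpha> \<bullet> \<xi>)) * (\<integral>y. complex_of_real (gauss y) * (complex_of_real (smooth_weight e y * s \<alpha> y) * p (cvec y)) \<partial>lborel))
    = (\<Sum>\<alpha>\<in>Rp. complex_of_real (k \<alpha> * (\<alpha> \<bullet> \<xi>)) *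
        (\<integral>y. complex_of_real (gauss y) * (complex_of_real (smooth_weight e y * ((\<alpha> \<bullet> y)\<^sup>2 / (e + (\<alpha> \<bullet> y)\<^sup>2)))
          * dunkl_quotient \<alpha> p (cvec y)) \<partial>lborel))"
  proof (rule sum.cong[OF refl])
    fix \<alpha> assume a: "\<alpha> \<in> Rp"
    show "complex_of_real (2 * k \<alpha> * (\<alpha> \<bullet> \<xi>)) * (\<integral>y. complex_of_real (gauss y) * (complex_of_real (smooth_weight e y * s \<alpha> y) * p (cvec y)) \<partial>lborel)
      = complex_of_real (k \<alpha> * (\<alpha> \<bullet> \<xi>)) *
        (\<integral>y. complex_of_real (gauss y) * (complex_of_real (smooth_weight e y * ((\<alpha> \<bullet> y)\<^sup>2 / (e + (\<alpha> \<bullet> y)\<^sup>2)))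
          * dunkl_quotient \<alpha> p (cvec y)) \<partial>lborel)"
      unfolding symmetrize[OF p a e, symmetric] s_def by simp
  qed
  finally show ?thesis by (simp add: H_def mult_ac)
qed

text \<open>The smooth weight with parameter \<open>1\<close> dominates; the extra factors \<^term>\<open>u\<close> are the ratios
  \<open>\<langle>\<alpha>, y\<rangle>\<^sup>2 / (e + \<langle>\<alpha>, y\<rangle>\<^sup>2)\<close> that symmetrization leaves behind.\<close>

lemma smooth_weight_limit:
  assumes P: "poly_growth P" and [measurable]: "\<And>n. u n \<in> borel_measurable borel"
    and u: "\<And>n y. 0 \<le> u n y" "\<And>n y. u n y \<le> 1"
    and lim: "AE y in lborel. (\<lambda>n. u n y) \<longlonglongrightarrow> 1"
  shows "(\<lambda>n. \<integral>y. complex_of_real (gauss y) * (complex_of_real (smooth_weight (1 / real (Suc n)) y * u n y) * P y) \<partial>lborel)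
    \<longlonglongrightarrow> (\<integral>y. complex_of_real (gauss y) * (complex_of_real (wt y) * P y) \<partial>lborel)"
proof (rule integral_dominated_convergence)
  have [measurable]: "P \<in> borel_measurable borel" by (rule poly_growth_measurable[OF P])
  show "(\<lambda>y. complex_of_real (gauss y) * (complex_of_real (wt y) * P y)) \<in> borel_measurable lborel" by measurable
  show "(\<lambda>y. complex_of_real (gauss y) * (complex_of_real (smooth_weight (1 / real (Suc n)) y * u n y) * P y)) \<in> borel_measurable lborel" for n
    by measurable
  show "integrable lborel (\<lambda>y. cmod (complex_of_real (gauss y) * (complex_of_real (smooth_weight 1 y) * P y)))"
    by (intro integrable_norm poly_growth_integrable poly_growth_mult P poly_growth_smooth_weight) auto
  show "AE y in lborel. cmod (complex_of_real (gauss y) * (complex_of_real (smooth_weight (1 / real (Suc n)) y * u n y) * P y))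
      \<le> cmod (complex_of_real (gauss y) * (complex_of_real (smooth_weight 1 y) * P y))" for n
  proof (rule AE_I2)
    fix y
    have "smooth_weight (1 / real (Suc n)) y * u n y \<le> smooth_weight 1 y * 1"
      using u by (intro mult_mono smooth_weight_mono) (auto simp: smooth_weight_def)
    moreover have "0 \<le> smooth_weight (1 / real (Suc n)) y * u n y" "0 \<le> smooth_weight 1 y"
      using u by (auto simp: smooth_weight_def)
    ultimately have "cmod (complex_of_real (smooth_weight (1 / real (Suc n)) y * u n y)) \<le> cmod (complex_of_real (smooth_weight 1 y))"
      by (simp only: norm_of_real abs_of_nonneg)
    then show "cmod (complex_of_real (gauss y) * (complex_of_real (smooth_weight (1 / real (Suc n)) y * u n y) * P y))
      \<le> cmod (complex_of_real (gauss y) * (complex_of_real (smooth_weight 1 y) * P y))"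
      unfolding norm_mult[of "complex_of_real (gauss y)"] norm_mult[of _ "P y"]
      by (intro mult_left_mono mult_right_mono) auto
  qed
  show "AE y in lborel. (\<lambda>n. complex_of_real (gauss y) * (complex_of_real (smooth_weight (1 / real (Suc n)) y * u n y) * P y))
     \<longlonglongrightarrow> complex_of_real (gauss y) * (complex_of_real (wt y) * P y)"
    using AE_regular lim
  proof eventually_elim
    case (elim y)
    have "(\<lambda>n. smooth_weight (1 / real (Suc n)) y) \<longlonglongrightarrow> smooth_weight 0 y"
      unfolding smooth_weight_def
      by (intro tendsto_intros LIMSEQ_Suc[OF lim_1_over_n]) (use elim in auto)
    then have "(\<lambda>n. smooth_weight (1 / real (Suc n)) y * u n y) \<longlonglongrightarrow> wt y * 1"
      using elim by (intro tendsto_mult) (auto simp: weight_eq_exp)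
    then show ?case by (intro tendsto_intros) simp
  qed
qed

text \<open>In the Gaussian space with the weight, the adjoint of the Dunkl operator sends the constant \<open>1\<close> to
  the linear form. The identity passes to the limit from the smooth weights, for which the
  boundary terms on the mirrors do not arise.\<close>

theorem dunkl_by_parts:
  assumes p: "cpoly p"
  shows "(\<integral>y. complex_of_real (gauss y) * (complex_of_real (wt y) * (complex_of_real (\<xi> \<bullet> y) * p (cvec y))) \<partial>lborel)
    = (\<integral>y. complex_of_real (gauss y) * (complex_of_real (wt y) * T (cvec \<xi>) p (cvec y)) \<partial>lborel)"
proof -
  let ?I = "\<lambda>P. \<integral>y. complex_of_real (gauss y) * (complex_of_real (wt y) * P y) \<partial>lborel"
  let ?e = "\<lambda>n. 1 / real (Suc n)"
  have xp: "poly_growth (\<lambda>y. complex_of_real (\<xi> \<bullet> y) * p (cvec y))"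
    by (intro poly_growth_mult poly_growth_inner poly_growth_cpoly p)
  have Dp: "poly_growth (\<lambda>y. frechet_derivative p (at (cvec y)) (cvec \<xi>))"
    by (intro poly_growth_cpoly cpoly_derivative_props p)
  have Qp: "poly_growth (\<lambda>y. dunkl_quotient \<alpha> p (cvec y))" if "\<alpha> \<in> Rp" for \<alpha>
    by (intro poly_growth_cpoly cpoly_quotient p Rp_nonzero that)
  have l1: "(\<lambda>n. \<integral>y. complex_of_real (gauss y) * (complex_of_real (smooth_weight (?e n) y) * (complex_of_real (\<xi> \<bullet> y) * p (cvec y))) \<partial>lborel)
      \<longlonglongrightarrow> ?I (\<lambda>y. complex_of_real (\<xi> \<bullet> y) * p (cvec y))"
    using smooth_weight_limit[OF xp, of "\<lambda>n y. 1"] by simp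
  have l2: "(\<lambda>n. \<integral>y. complex_of_real (gauss y) * (complex_of_real (smooth_weight (?e n) y) * frechet_derivative p (at (cvec y)) (cvec \<xi>)) \<partial>lborel)
      \<longlonglongrightarrow> ?I (\<lambda>y. frechet_derivative p (at (cvec y)) (cvec \<xi>))"
    using smooth_weight_limit[OF Dp, of "\<lambda>n y. 1"] by simp
  have l3: "(\<lambda>n. \<integral>y. complex_of_real (gauss y) * (complex_of_real (smooth_weight (?e n) y * ((\<alpha> \<bullet> y)\<^sup>2 / (?e n + (\<alpha> \<bullet> y)\<^sup>2)))
          * dunkl_quotient \<alpha> p (cvec y)) \<partial>lborel) \<longlonglongrightarrow> ?I (\<lambda>y. dunkl_quotient \<alpha> p (cvec y))" if a: "\<alpha> \<in> Rp" for \<alpha>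
  proof (rule smooth_weight_limit[OF Qp[OF a]])
    show "AE y in lborel. (\<lambda>n. (\<alpha> \<bullet> y)\<^sup>2 / (?e n + (\<alpha> \<bullet> y)\<^sup>2)) \<longlonglongrightarrow> 1"
      using AE_not_hyperplane[OF Rp_nonzero[OF a]]
    proof eventually_elim
      case (elim y)
      have "(\<lambda>n. (\<alpha> \<bullet> y)\<^sup>2 / (?e n + (\<alpha> \<bullet> y)\<^sup>2)) \<longlonglongrightarrow> (\<alpha> \<bullet> y)\<^sup>2 / (0 + (\<alpha> \<bullet> y)\<^sup>2)"
        by (intro tendsto_intros LIMSEQ_Suc[OF lim_1_over_n]) (use elim in auto)
      then show ?case using elim by simp
    qed
    show "(\<alpha> \<bullet> y)\<^sup>2 / (?e n + (\<alpha> \<bullet> y)\<^sup>2) \<le> 1" for n y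
      by (rule divide_le_eq_1[THEN iffD2]) (auto intro!: disjI1 add_pos_nonneg)
  qed (auto intro!: divide_nonneg_nonneg)
  have "?I (\<lambda>y. complex_of_real (\<xi> \<bullet> y) * p (cvec y)) = ?I (\<lambda>y. frechet_derivative p (at (cvec y)) (cvec \<xi>))
      + (\<Sum>\<alpha>\<in>Rp. complex_of_real (k \<alpha> * (\<alpha> \<bullet> \<xi>)) * ?I (\<lambda>y. dunkl_quotient \<alpha> p (cvec y)))"
  proof (rule LIMSEQ_unique[OF l1])
    have e: "0 < ?e n" "?e n \<le> 1" for n by auto
    show "(\<lambda>n. \<integral>y. complex_of_real (gauss y) * (complex_of_real (smooth_weight (?e n) y) * (complex_of_real (\<xi> \<bullet> y) * p (cvec y))) \<partial>lborel)
      \<longlonglongrightarrow> ?I (\<lambda>y. frechet_derivative p (at (cvec y)) (cvec \<xi>))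
      + (\<Sum>\<alpha>\<in>Rp. complex_of_real (k \<alpha> * (\<alpha> \<bullet> \<xi>)) * ?I (\<lambda>y. dunkl_quotient \<alpha> p (cvec y)))"
      unfolding smooth_by_parts[OF p e] by (intro tendsto_intros l2 l3)
  qed
  also have "\<dots> = (\<integral>y. complex_of_real (gauss y) * (complex_of_real (wt y) * frechet_derivative p (at (cvec y)) (cvec \<xi>))
      + (\<Sum>\<alpha>\<in>Rp. complex_of_real (k \<alpha> * (\<alpha> \<bullet> \<xi>)) * (complex_of_real (gauss y) * (complex_of_real (wt y) * dunkl_quotient \<alpha> p (cvec y)))) \<partial>lborel)"
    by (subst Bochner_Integration.integral_add)
       (auto intro!: poly_growth_integrable poly_growth_mult poly_growth_weight Dp Qp
          Bochner_Integration.integrable_sum integrable_mult_right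
         simp: Bochner_Integration.integral_sum poly_growth_integrable poly_growth_mult poly_growth_weight Qp)
  also have "\<dots> = ?I (\<lambda>y. T (cvec \<xi>) p (cvec y))"
    by (rule Bochner_Integration.integral_cong) (simp_all add: dunkl_op_def cdot_cvec distrib_left sum_distrib_left mult_ac)
  finally show ?thesis .
qed

end

section \<open>Spherical Bessel functions at imaginary arguments\<close>

definition bessel_coeff :: "real \<Rightarrow> nat \<Rightarrow> real" where
  "bessel_coeff a n = Gamma (a + 1) / (4 ^ n * fact n * Gamma (real n + a + 1))"

text \<open>The normalized modified Bessel function \<open>u \<mapsto> j\<^sub>a(i u)\<close>, which is the form in which
  all Bessel functions enter here.\<close>

definition bessel_I :: "real \<Rightarrow> real \<Rightarrow> real" where
  "bessel_I a u = (\<Sum>n. bessel_coeff a n * u ^ (2 * n))"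

context
  fixes a :: real
  assumes a: "a \<ge> - 1/2"
begin

lemma bessel_coeff_pos: "bessel_coeff a n > 0"
  unfolding bessel_coeff_def using a
  by (intro divide_pos_pos mult_pos_pos Gamma_real_pos) auto

lemma bessel_coeff_0: "bessel_coeff a 0 = 1"
proof -
  have "Gamma (a + 1) > 0" by (rule Gamma_real_pos) (use a in simp)
  then show ?thesis by (simp add: bessel_coeff_def)
qed

lemma bessel_coeff_Suc:
  "bessel_coeff a (Suc n) = bessel_coeff a n / (4 * real (Suc n) * (real n + a + 1))"
proof -
  have "real n + a + 1 > 0" using a by simp
  then have "Gamma (real n + a + 1 + 1) = (real n + a + 1) * Gamma (real n + a + 1)"
    by (intro Gamma_plus1) (auto simp: nonpos_Ints_def)
  then have "Gamma (real (Suc n) + a + 1) = (real n + a + 1) * Gamma (real n + a + 1)"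
    by (simp add: add_ac)
  then show ?thesis by (simp add: bessel_coeff_def mult_ac)
qed

text \<open>Comparison with the coefficients of the hyperbolic cosine, which is the case of index \<open>-1/2\<close>.\<close>

lemma bessel_coeff_le: "bessel_coeff a n \<le> 1 / fact (2 * n)"
proof (induction n)
  case (Suc n)
  have "(2 * real n + 1) * (2 * real n + 2) \<le> 4 * real (Suc n) * (real n + a + 1)"
    using mult_left_mono[of "real n + 1 / 2" "real n + a + 1" "4 * real (Suc n)"] a
    by (simp add: algebra_simps)
  then have "bessel_coeff a n / (4 * real (Suc n) * (real n + a + 1))
      \<le> (1 / fact (2 * n)) / ((2 * real n + 1) * (2 * real n + 2))"
    using Suc bessel_coeff_pos[of n] by (intro frac_le) auto
  then show ?case by (simp add: bessel_coeff_Suc field_simps)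
qed (simp add: bessel_coeff_0)

lemma bessel_term_le: "\<bar>bessel_coeff a n * u ^ (2 * n)\<bar> \<le> (u\<^sup>2) ^ n / fact n"
proof -
  have "bessel_coeff a n \<le> 1 / fact n"
    using bessel_coeff_le[of n] fact_mono[of n "2 * n", where 'a = real]
    by (smt (verit) frac_le fact_gt_zero le_add2 mult_2)
  then have "bessel_coeff a n * (u\<^sup>2) ^ n \<le> 1 / fact n * (u\<^sup>2) ^ n"
    by (intro mult_right_mono) auto
  then show ?thesis
    using bessel_coeff_pos[of n] by (simp add: power_mult abs_mult)
qed

lemma bessel_summable: "summable (\<lambda>n. bessel_coeff a n * u ^ (2 * n))"
  by (rule summable_comparison_test'[OF summable_power_fact[of "u\<^sup>2"], where N = 0])
     (simp add: bessel_term_le del: abs_mult)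

lemma bessel_I_ge_1: "bessel_I a u \<ge> 1"
proof -
  have "(\<Sum>n<1. bessel_coeff a n * u ^ (2 * n)) \<le> bessel_I a u"
    unfolding bessel_I_def
    by (intro sum_le_suminf bessel_summable)
       (auto simp: power_mult intro!: mult_nonneg_nonneg less_imp_le[OF bessel_coeff_pos])
  then show ?thesis by (simp add: bessel_coeff_0)
qed

lemma bessel_I_pos: "bessel_I a u > 0"
  using bessel_I_ge_1[of u] by simp

lemma bessel_I_le_exp: "bessel_I a u \<le> exp \<bar>u\<bar>"
  unfolding bessel_I_def
proof (rule suminf_le_const[OF bessel_summable])
  fix N
  have e: "exp \<bar>u\<bar> = (\<Sum>n. \<bar>u\<bar> ^ n / fact n)" by (simp add: exp_def divide_inverse mult.commute)
  have "(\<Sum>n<N. bessel_coeff a n * u ^ (2 * n)) \<le> (\<Sum>n<N. \<bar>u\<bar> ^ (2 * n) / fact (2 * n))"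
  proof (rule sum_mono)
    fix n
    have "bessel_coeff a n * u ^ (2 * n) \<le> 1 / fact (2 * n) * u ^ (2 * n)"
      by (intro mult_right_mono bessel_coeff_le) (simp add: power_mult)
    then show "bessel_coeff a n * u ^ (2 * n) \<le> \<bar>u\<bar> ^ (2 * n) / fact (2 * n)"
      by (simp add: power_mult)
  qed
  also have "\<dots> = (\<Sum>m\<in>(\<lambda>n. 2 * n) ` {..<N}. \<bar>u\<bar> ^ m / fact m)"
    by (subst sum.reindex) (auto simp: inj_on_def)
  also have "\<dots> \<le> exp \<bar>u\<bar>"
    unfolding e by (rule sum_le_suminf[OF summable_power_fact]) auto
  finally show "(\<Sum>n<N. bessel_coeff a n * u ^ (2 * n)) \<le> exp \<bar>u\<bar>" .
qed

lemma bessel_I_continuous: "continuous_on S (bessel_I a)"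
proof -
  have "continuous_on UNIV (\<lambda>u. \<Sum>n. bessel_coeff a n * u ^ (2 * n))"
  proof (rule continuous_on_UNIV_balls, rule continuous_on_suminf_balls)
    show "norm (bessel_coeff a n * u ^ (2 * n)) \<le> (\<lambda>r n. (r\<^sup>2) ^ n / fact n) r n" if "norm u < r" for r n u
    proof -
      have "u\<^sup>2 \<le> r\<^sup>2" using that by (intro abs_le_square_iff[THEN iffD1]) simp
      then have "(u\<^sup>2) ^ n / fact n \<le> (r\<^sup>2) ^ n / fact n"
        by (intro divide_right_mono power_mono[of "u\<^sup>2" "r\<^sup>2"]) simp_all
      then show ?thesis using bessel_term_le[of n u] by simp
    qed
  qed (auto intro!: continuous_intros summable_power_fact)
  then show ?thesis
    unfolding bessel_I_def[abs_def] by (rule continuous_on_subset) simp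
qed

lemma bessel_j_imaginary: "bessel_j a (\<i> * complex_of_real u) = complex_of_real (bessel_I a u)"
proof -
  have term_eq: "(-1) ^ n * (\<i> * complex_of_real u / 2) ^ (2 * n) / complex_of_real (fact n * Gamma (real n + a + 1))
      = complex_of_real (bessel_coeff a n * u ^ (2 * n) / Gamma (a + 1))" for n
  proof -
    have "(\<i> * complex_of_real u / 2)\<^sup>2 = (-1) * complex_of_real (u\<^sup>2 / 4)"
      by (simp add: power_divide power_mult_distrib)
    then have "(\<i> * complex_of_real u / 2) ^ (2 * n) = (-1) ^ n * complex_of_real (u ^ (2 * n) / 4 ^ n)"
      by (simp only: power_mult power_mult_distrib power_divide flip: of_real_power)
    then have "(-1) ^ n * (\<i> * complex_of_real u / 2) ^ (2 * n) = complex_of_real (u ^ (2 * n) / 4 ^ n)"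
      by (simp flip: mult.assoc power_mult_distrib)
    moreover have "Gamma (a + 1) \<noteq> 0" using Gamma_real_pos[of "a + 1", THEN less_imp_neq] a by force
    then have "bessel_coeff a n * u ^ (2 * n) / Gamma (a + 1) = (u ^ (2 * n) / 4 ^ n) / (fact n * Gamma (real n + a + 1))"
      by (simp add: bessel_coeff_def)
    ultimately show ?thesis by (simp only: of_real_divide[of "u ^ (2 * n) / 4 ^ n"])
  qed
  have "(\<Sum>n. complex_of_real (bessel_coeff a n * u ^ (2 * n) / Gamma (a + 1)))
      = complex_of_real (bessel_I a u / Gamma (a + 1))"
    unfolding bessel_I_def
    by (subst suminf_of_real[symmetric, OF summable_divide[OF bessel_summable]])
       (simp add: suminf_divide[OF bessel_summable])
  moreover have "Gamma (a + 1) \<noteq> 0" using Gamma_real_pos[of "a + 1", THEN less_imp_neq] a by force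
  ultimately show ?thesis unfolding bessel_j_def term_eq by simp
qed

end

lemma bessel_I_measurable [measurable (raw)]:
  assumes "a \<ge> - 1/2" and f: "f \<in> borel_measurable M"
  shows "(\<lambda>x. bessel_I a (f x)) \<in> borel_measurable M"
  by (rule measurable_compose[OF f borel_measurable_continuous_onI[OF bessel_I_continuous[OF assms(1)]]])

section \<open>Spherical means of the Dunkl kernel\<close>

lemma integral_radial_measure:
  assumes [measurable]: "h \<in> borel_measurable borel"
  shows "(\<integral>r. h r \<partial>radial_measure n) = (LBINT r:{0<..}. r ^ (n - 1) * (h r :: real))"
proof -
  have "radial_measure n = density lborel (\<lambda>r. ennreal (r ^ (n - 1) * indicator {0<..} r))"
    unfolding radial_measure_def by (intro arg_cong[where f = "density lborel"]) (auto simp: indicator_def)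
  moreover have "(\<integral>r. h r \<partial>density lborel (\<lambda>r. ennreal (r ^ (n - 1) * indicator {0<..} r)))
      = (\<integral>r. (r ^ (n - 1) * indicator {0<..} r) *\<^sub>R h r \<partial>lborel)"
    by (rule integral_density) (auto simp: indicator_def)
  ultimately show ?thesis by (simp add: set_lebesgue_integral_def mult_ac)
qed

lemma borel_measurable_sphere:
  assumes "f \<in> borel \<rightarrow>\<^sub>M N" shows "f \<in> (sphere_measure :: (real^'n) measure) \<rightarrow>\<^sub>M N"
  using measurable_restrict_space1[OF assms, of "sphere 0 1"]
  by (simp add: measurable_cong_sets[OF sets_sphere_measure refl])

context dunkl_data
begin

text \<open>Half the homogeneous dimension: the weighted volume of a ball grows like its radius to the power
  \<open>2 \<kappa>\<close>. The Bessel index is \<open>\<kappa> - 1\<close> and the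
  multiplicity of the radial process is \<open>\<kappa> - 1/2\<close>.\<close>

definition "\<kappa> = \<gamma> + real CARD('n) / 2"

lemma kappa_ge: "\<kappa> \<ge> 1/2"
proof -
  have "real CARD('n) \<ge> 1" using zero_less_card_finite[where 'a = 'n] by (simp add: Suc_le_eq)
  then show ?thesis using gamma_nonneg unfolding \<kappa>_def by linarith
qed

lemma kappa_index: "\<kappa> - 1 \<ge> - 1/2" using kappa_ge by simp

definition gauss_moment :: "nat \<Rightarrow> real^'n \<Rightarrow> real" where
  "gauss_moment n x = (\<integral>y. gauss y * (wt y * real_En n y x) \<partial>lborel)"

definition sphere_moment :: "nat \<Rightarrow> real^'n \<Rightarrow> real" where
  "sphere_moment n x = (\<integral>z. wt z * real_En n z x \<partial>sphere_measure)"

lemma gauss_moment_complex: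
  "complex_of_real (gauss_moment n x)
    = (\<integral>y. complex_of_real (gauss y) * (complex_of_real (wt y) * dunkl_En n (cvec y) (cvec x)) \<partial>lborel)"
  unfolding gauss_moment_def by (subst integral_complex_of_real[symmetric]) (simp add: of_real_En)

lemma poly_growth_En: "poly_growth (\<lambda>y. dunkl_En n (cvec y) w)"
  by (rule poly_growth_cpoly[OF cpoly_En])

lemma gauss_moment_integrable: "integrable lborel (\<lambda>y. gauss y * (wt y * real_En n y x))"
proof -
  have "integrable lborel (\<lambda>y. complex_of_real (gauss y) * (complex_of_real (wt y) * dunkl_En n (cvec y) (cvec x)))"
    by (intro poly_growth_integrable poly_growth_mult poly_growth_weight poly_growth_En)
  then have "integrable lborel (\<lambda>y. complex_of_real (gauss y * (wt y * real_En n y x)))"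
    by (simp add: of_real_En)
  then show ?thesis by (simp only: complex_of_real_integrable_eq)
qed

text \<open>Gaussian and weight are invariant, so in the integrated Euler recursion the reflection terms
  cancel. What remains is the component of one degree less times a linear form, and integration by parts
  turns this into a Dunkl operator that lowers the degree once more.\<close>

lemma gauss_moment_Suc:
  "real (Suc n) * gauss_moment (Suc n) x = (if n = 0 then 0 else (norm x)\<^sup>2 * gauss_moment (n - 1) x)"
proof -
  let ?I = "\<lambda>P. \<integral>y. complex_of_real (gauss y) * (complex_of_real (wt y) * P y) \<partial>lborel"
  let ?E = "\<lambda>n y. dunkl_En n (cvec y) (cvec x)"
  have int: "integrable lborel (\<lambda>y. complex_of_real (gauss y) * (complex_of_real (wt y) * P y))"
    if "poly_growth P" for P
    by (intro poly_growth_integrable poly_growth_mult poly_growth_weight that)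
  have refl_int: "?I (\<lambda>y. dunkl_En (Suc n) (crefl_root \<alpha> (cvec y)) (cvec x)) = ?I (?E (Suc n))" if a: "\<alpha> \<in> Rp" for \<alpha>
  proof -
    have o: "orthogonal_transformation (refl_root \<alpha>)" by (rule orthogonal_refl_root[OF Rp_nonzero[OF a]])
    have "?I (?E (Suc n)) = (\<integral>y. complex_of_real (gauss (refl_root \<alpha> y)) * (complex_of_real (wt (refl_root \<alpha> y))
        * ?E (Suc n) (refl_root \<alpha> y)) \<partial>lborel)"
      by (rule integral_lborel_orthogonal[OF o, symmetric,
            where h = "\<lambda>y. complex_of_real (gauss y) * (complex_of_real (wt y) * ?E (Suc n) y)"])
         (use int[OF poly_growth_En[of "Suc n" "cvec x"]] in \<open>auto simp del: dunkl_En.simps\<close>)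
    then show ?thesis
      using orthogonal_transformation_norm[OF o]
      by (simp add: gauss_def weight_refl Rp_R a crefl_root_cvec del: dunkl_En.simps)
  qed
  have creflg: "poly_growth (\<lambda>y. dunkl_En (Suc n) (crefl_root \<alpha> (cvec y)) (cvec x))" if "\<alpha> \<in> Rp" for \<alpha>
    by (rule poly_growth_cpoly[OF cpoly_crefl[OF cpoly_En Rp_nonzero[OF that]]])
  have diff0: "?I (\<lambda>y. ?E (Suc n) y - dunkl_En (Suc n) (crefl_root \<alpha> (cvec y)) (cvec x)) = 0" if a: "\<alpha> \<in> Rp" for \<alpha>
    unfolding right_diff_distrib
    by (subst Bochner_Integration.integral_diff[OF int[OF poly_growth_En] int[OF creflg[OF a]]])
       (simp only: refl_int[OF a] diff_self)
  have diffi: "integrable lborel (\<lambda>y. complex_of_real (gauss y) * (complex_of_real (wt y) *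
      (?E (Suc n) y - dunkl_En (Suc n) (crefl_root \<alpha> (cvec y)) (cvec x))))" if a: "\<alpha> \<in> Rp" for \<alpha>
    unfolding right_diff_distrib
    by (intro Bochner_Integration.integrable_diff int poly_growth_En creflg a)
  have "?I (\<lambda>y. complex_of_real (x \<bullet> y) * ?E n y)
      = (\<integral>y. of_nat (Suc n) * (complex_of_real (gauss y) * (complex_of_real (wt y) * ?E (Suc n) y))
        + (\<Sum>\<alpha>\<in>Rp. complex_of_real (k \<alpha>) * (complex_of_real (gauss y) * (complex_of_real (wt y) *
            (?E (Suc n) y - dunkl_En (Suc n) (crefl_root \<alpha> (cvec y)) (cvec x))))) \<partial>lborel)"
  proof (rule Bochner_Integration.integral_cong[OF refl])
    fix y
    have "complex_of_real (x \<bullet> y) * ?E n y = euler_op (Suc n) (\<lambda>z. dunkl_En (Suc n) z (cvec x)) (cvec y)"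
      unfolding euler_op_En by (simp add: cdot_cvec inner_commute)
    then show "complex_of_real (gauss y) * (complex_of_real (wt y) * (complex_of_real (x \<bullet> y) * ?E n y))
      = of_nat (Suc n) * (complex_of_real (gauss y) * (complex_of_real (wt y) * ?E (Suc n) y))
        + (\<Sum>\<alpha>\<in>Rp. complex_of_real (k \<alpha>) * (complex_of_real (gauss y) * (complex_of_real (wt y) *
            (?E (Suc n) y - dunkl_En (Suc n) (crefl_root \<alpha> (cvec y)) (cvec x)))))"
      unfolding euler_op_def by (simp only: distrib_left sum_distrib_left mult_ac)
  qed
  also have "\<dots> = of_nat (Suc n) * ?I (?E (Suc n))"
  proof -
    have "(\<integral>y. (\<Sum>\<alpha>\<in>Rp. complex_of_real (k \<alpha>) * (complex_of_real (gauss y) * (complex_of_real (wt y) *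
            (?E (Suc n) y - dunkl_En (Suc n) (crefl_root \<alpha> (cvec y)) (cvec x))))) \<partial>lborel)
       = (\<Sum>\<alpha>\<in>Rp. complex_of_real (k \<alpha>) * ?I (\<lambda>y. ?E (Suc n) y - dunkl_En (Suc n) (crefl_root \<alpha> (cvec y)) (cvec x)))"
      by (subst Bochner_Integration.integral_sum[OF integrable_mult_right[OF diffi]])
         (simp_all only: integral_mult_right_zero)
    also have "\<dots> = 0" by (rule sum.neutral, rule ballI) (simp only: diff0 mult_zero_right)
    finally show ?thesis
      by (subst Bochner_Integration.integral_add[OF integrable_mult_right[OF int[OF poly_growth_En]]
            Bochner_Integration.integrable_sum[OF integrable_mult_right[OF diffi]]])
         (simp_all only: integral_mult_right_zero add_0_right)
  qed
  finally have "of_nat (Suc n) * ?I (?E (Suc n)) = ?I (\<lambda>y. complex_of_real (x \<bullet> y) * ?E n y)" ..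
  also have "\<dots> = ?I (\<lambda>y. T (cvec x) (\<lambda>z. dunkl_En n z (cvec x)) (cvec y))"
    by (rule dunkl_by_parts[OF cpoly_En])
  also have "\<dots> = ?I (\<lambda>y. complex_of_real (if n = 0 then 0 else (norm x)\<^sup>2) * ?E (n - 1) y)"
    by (simp add: T_En cdot_cvec dot_square_norm)
  also have "\<dots> = complex_of_real (if n = 0 then 0 else (norm x)\<^sup>2) * ?I (?E (n - 1))"
    by (subst integral_mult_right_zero[symmetric]) (simp only: mult_ac)
  finally have "complex_of_real (real (Suc n) * gauss_moment (Suc n) x)
      = complex_of_real ((if n = 0 then 0 else (norm x)\<^sup>2) * gauss_moment (n - 1) x)"
    by (simp only: of_real_mult of_real_of_nat_eq gauss_moment_complex)
  then show ?thesis by (simp only: of_real_eq_iff) simp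
qed

lemma gauss_moment_odd: "gauss_moment (Suc (2 * m)) x = 0"
proof (induction m)
  case 0
  show ?case using gauss_moment_Suc[of 0 x] by simp
next
  case (Suc m)
  have "real (Suc (2 * Suc m)) * gauss_moment (Suc (2 * Suc m)) x = (norm x)\<^sup>2 * gauss_moment (Suc (2 * m)) x"
    using gauss_moment_Suc[of "2 * Suc m" x] by simp
  then show ?case using Suc by (simp del: of_nat_Suc)
qed

lemma gauss_moment_even: "gauss_moment (2 * m) x = (norm x) ^ (2 * m) / (2 ^ m * fact m) * gauss_moment 0 x"
proof (induction m)
  case (Suc m)
  have "real (Suc (Suc (2 * m))) * gauss_moment (2 * Suc m) x = (norm x)\<^sup>2 * gauss_moment (2 * m) x"
    using gauss_moment_Suc[of "Suc (2 * m)" x] by simp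
  then have "gauss_moment (2 * Suc m) x = (norm x)\<^sup>2 / (2 * real (Suc m)) * gauss_moment (2 * m) x"
    by (simp add: field_simps)
  moreover have "norm x ^ (2 * Suc m) / (2 ^ Suc m * fact (Suc m))
      = (norm x)\<^sup>2 / (2 * real (Suc m)) * (norm x ^ (2 * m) / (2 ^ m * fact m))"
    by (simp add: power2_eq_square mult_ac del: of_nat_Suc)
  ultimately show ?case by (simp only: Suc mult.assoc)
qed simp

lemma gauss_moment_polar:
  "gauss_moment n x = 2 powr (\<kappa> + real n / 2 - 1) * Gamma (\<kappa> + real n / 2) * sphere_moment n x"
proof -
  define s where "s = real CARD('n) - 1 + real n + 2 * \<gamma>"
  have N: "real CARD('n) \<ge> 1" using zero_less_card_finite[where 'a = 'n] by (simp add: Suc_le_eq)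
  have s: "s > -1" using N gamma_nonneg unfolding s_def by linarith
  have "gauss_moment n x = (\<integral>r. (\<integral>z. gauss (r *\<^sub>R z) * (wt (r *\<^sub>R z) * real_En n (r *\<^sub>R z) x) \<partial>sphere_measure) \<partial>radial_measure CARD('n))"
    unfolding gauss_moment_def by (rule integral_polar[OF gauss_moment_integrable])
  also have "\<dots> = (\<integral>r. (if r > 0 then exp (- r\<^sup>2 / 2) * (r powr (2 * \<gamma>) * r ^ n) * sphere_moment n x else 0) \<partial>radial_measure CARD('n))"
  proof (rule integral_cong_AE)
    show "(\<lambda>r. \<integral>z. gauss (r *\<^sub>R z) * (wt (r *\<^sub>R z) * real_En n (r *\<^sub>R z) x) \<partial>sphere_measure) \<in> borel_measurable (radial_measure CARD('n))"
    proof -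
      interpret finite_measure "sphere_measure :: (real^'n) measure" by (rule finite_sphere_measure)
      have "(\<lambda>p. (\<lambda>y. gauss y * (wt y * real_En n y x)) ((\<lambda>(r, z). r *\<^sub>R z) p)) \<in> borel_measurable (radial_measure CARD('n) \<Otimes>\<^sub>M (sphere_measure :: (real^'n) measure))"
        by (rule measurable_compose[OF measurable_polar_map_cong]) measurable
      then show ?thesis by (intro borel_measurable_lebesgue_integral) (simp add: case_prod_beta)
    qed
    have "AE r in radial_measure CARD('n). r > 0"
      unfolding radial_measure_def by (subst AE_density) (auto simp: indicator_def)
    then show "AE r in radial_measure CARD('n). (\<integral>z. gauss (r *\<^sub>R z) * (wt (r *\<^sub>R z) * real_En n (r *\<^sub>R z) x) \<partial>sphere_measure)
      = (if r > 0 then exp (- r\<^sup>2 / 2) * (r powr (2 * \<gamma>) * r ^ n) * sphere_moment n x else 0)"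
    proof eventually_elim
      case (elim r)
      have "(\<integral>z. gauss (r *\<^sub>R z) * (wt (r *\<^sub>R z) * real_En n (r *\<^sub>R z) x) \<partial>sphere_measure)
        = (\<integral>z. exp (- r\<^sup>2 / 2) * (r powr (2 * \<gamma>) * r ^ n) * (wt z * real_En n z x) \<partial>sphere_measure)"
        by (rule Bochner_Integration.integral_cong[OF refl])
           (simp add: gauss_def space_sphere_measure weight_scale elim real_En_scale_left)
      then show ?case using elim by (simp add: sphere_moment_def)
    qed
  qed simp
  also have "\<dots> = (LBINT r:{0<..}. r ^ (CARD('n) - 1) * (if r > 0 then exp (- r\<^sup>2 / 2) * (r powr (2 * \<gamma>) * r ^ n) * sphere_moment n x else 0))"
    by (rule integral_radial_measure) simp
  also have "\<dots> = (LBINT r:{0<..}. sphere_moment n x * (r powr s * exp (- r\<^sup>2 / 2)))"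
  proof (rule set_lebesgue_integral_cong, simp, intro allI impI)
    fix r :: real assume r: "r \<in> {0<..}"
    have "s = real (CARD('n) - 1) + (real n + 2 * \<gamma>)"
      using N by (simp add: s_def of_nat_diff)
    then have "r powr s = r powr (real (CARD('n) - 1)) * (r powr real n * r powr (2 * \<gamma>))"
      by (simp only: powr_add)
    also have "\<dots> = r ^ (CARD('n) - 1) * (r ^ n * r powr (2 * \<gamma>))"
      using r by (simp only: powr_realpow greaterThan_iff)
    finally show "r ^ (CARD('n) - 1) * (if r > 0 then exp (- r\<^sup>2 / 2) * (r powr (2 * \<gamma>) * r ^ n) * sphere_moment n x else 0)
        = sphere_moment n x * (r powr s * exp (- r\<^sup>2 / 2))"
      using r by simp
  qed
  also have "\<dots> = sphere_moment n x * (LBINT r:{0<..}. r powr s * exp (- r\<^sup>2 / 2))"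
    by (rule set_integral_mult_right)
  also have "(LBINT r:{0<..}. r powr s * exp (- r\<^sup>2 / 2)) = 2 powr ((s - 1) / 2) * Gamma ((s + 1) / 2)"
    by (rule radial_gaussian_moment(2)[OF s])
  also have "(s - 1) / 2 = \<kappa> + real n / 2 - 1" by (simp add: s_def \<kappa>_def field_simps)
  also have "(s + 1) / 2 = \<kappa> + real n / 2" by (simp add: s_def \<kappa>_def field_simps)
  finally show ?thesis by (simp add: mult_ac)
qed

lemma real_En_0 [simp]: "real_En 0 x y = 1" by (simp add: real_En_def)

abbreviation "dd \<equiv> dunkl_d Rp k"

lemma sphere_moment_0: "sphere_moment 0 x = dd"
  by (simp add: sphere_moment_def dunkl_d_def)

lemma dunkl_c_eq: "dunkl_c Rp k = 1 / (2 powr (\<kappa> - 1) * Gamma \<kappa> * dd)"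
proof -
  have "gauss_moment 0 0 = (LINT y|lborel. exp (- (norm y)\<^sup>2 / 2) * wt y)"
    by (simp add: gauss_moment_def gauss_def)
  then show ?thesis
    using gauss_moment_polar[of 0 0] by (simp add: dunkl_c_def sphere_moment_0)
qed

lemma sphere_moment_odd: "sphere_moment (Suc (2 * m)) x = 0"
proof -
  have "Gamma (\<kappa> + real (Suc (2 * m)) / 2) > 0"
    using kappa_ge by (intro Gamma_real_pos) (simp add: add_pos_nonneg)
  then show ?thesis
    using gauss_moment_polar[of "Suc (2 * m)" x] gauss_moment_odd[of m x] by (auto simp del: of_nat_Suc)
qed

lemma sphere_moment_even: "sphere_moment (2 * m) x = dd * (bessel_coeff (\<kappa> - 1) m * norm x ^ (2 * m))"
proof -
  have G: "Gamma (\<kappa> + real m) > 0" using kappa_ge by (intro Gamma_real_pos) (simp add: add_pos_nonneg)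
  have "\<kappa> + real m - 1 = (\<kappa> - 1) + real m" by simp
  then have "2 powr (\<kappa> + real m - 1) = 2 powr (\<kappa> - 1) * 2 powr real m"
    by (simp only: powr_add)
  then have p: "2 powr (\<kappa> + real m - 1) = 2 powr (\<kappa> - 1) * 2 ^ m" by (simp add: powr_realpow)
  have "2 powr (\<kappa> + real m - 1) * Gamma (\<kappa> + real m) * sphere_moment (2 * m) x
      = norm x ^ (2 * m) / (2 ^ m * fact m) * (2 powr (\<kappa> - 1) * Gamma \<kappa> * dd)"
    using gauss_moment_polar[of "2 * m" x] gauss_moment_even[of m x] gauss_moment_polar[of 0 x]
    by (simp add: sphere_moment_0)
  then have "2 powr (\<kappa> - 1) * (2 ^ m * Gamma (\<kappa> + real m) * sphere_moment (2 * m) x)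
      = 2 powr (\<kappa> - 1) * (norm x ^ (2 * m) / (2 ^ m * fact m) * (Gamma \<kappa> * dd))"
    unfolding p by (simp only: mult_ac)
  then have "2 ^ m * Gamma (\<kappa> + real m) * sphere_moment (2 * m) x
      = norm x ^ (2 * m) / (2 ^ m * fact m) * (Gamma \<kappa> * dd)"
    by (subst (asm) mult_left_cancel) simp_all
  then have "sphere_moment (2 * m) x = norm x ^ (2 * m) * (Gamma \<kappa> * dd) / (2 ^ m * (2 ^ m * fact m) * Gamma (\<kappa> + real m))"
    using G by (simp add: field_simps)
  also have "(2::real) ^ m * (2 ^ m * fact m) = 4 ^ m * fact m"
    by (simp flip: mult.assoc power_mult_distrib)
  finally show ?thesis by (simp add: bessel_coeff_def add.commute mult_ac)
qed

lemma weight_sphere_bounded: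
  obtains K where "\<And>z :: real^'n. norm z = 1 \<Longrightarrow> wt z \<le> K"
proof -
  obtain K a where K: "\<And>y. cmod (complex_of_real (wt y)) \<le> K * (1 + norm y) powr a"
    using poly_growthE[OF poly_growth_weight] by metis
  have "wt z \<le> K * 2 powr a" if "norm z = 1" for z
    using K[of z] that weight_nonneg[of z] by simp
  then show ?thesis by (rule that)
qed

lemma sphere_integrable:
  fixes f :: "real^'n \<Rightarrow> real"
  assumes "f \<in> borel_measurable borel" "\<And>z. norm z = 1 \<Longrightarrow> \<bar>f z\<bar> \<le> B"
  shows "integrable sphere_measure (\<lambda>z. wt z * f z)"
proof -
  interpret finite_measure "sphere_measure :: (real^'n) measure" by (rule finite_sphere_measure)
  obtain K where K: "\<And>z :: real^'n. norm z = 1 \<Longrightarrow> wt z \<le> K" using weight_sphere_bounded by blast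
  show ?thesis
  proof (rule integrable_const_bound[where B = "K * B"])
    show "AE z in sphere_measure. norm (wt z * f z) \<le> K * B"
    proof (rule AE_I2)
      fix z :: "real^'n" assume "z \<in> space sphere_measure"
      then have z: "norm z = 1" by (simp add: space_sphere_measure)
      show "norm (wt z * f z) \<le> K * B"
        using K[OF z] assms(2)[OF z] weight_nonneg[of z] by (auto simp: abs_mult intro!: mult_mono)
    qed
    show "(\<lambda>z. wt z * f z) \<in> borel_measurable sphere_measure"
      using assms(1) by (intro borel_measurable_sphere) measurable
  qed
qed

lemma sphere_integrable_E: "integrable sphere_measure (\<lambda>z. wt z * real_E (r *\<^sub>R z) x)"
proof (rule sphere_integrable)
  show "\<bar>real_E (r *\<^sub>R z) x\<bar> \<le> exp (\<bar>r\<bar> * norm x)" if "norm z = 1" for z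
    using real_E_bound[of "r *\<^sub>R z" x] that by simp
qed measurable

text \<open>Gaussian moments and moments over the sphere differ by Gamma factors that depend on the degree only,
  so the recursion for the former determines the latter. The series may be integrated
  termwise since the sphere is compact.\<close>

theorem spherical_mean:
  "(\<integral>z. wt z * real_E (r *\<^sub>R z) x \<partial>sphere_measure) = dd * bessel_I (\<kappa> - 1) (r * norm x)"
proof -
  have base: "(\<integral>z. wt z * real_E z x \<partial>sphere_measure) = dd * bessel_I (\<kappa> - 1) (norm x)" for x
  proof -
    have En1: "\<bar>real_En n z x\<bar> \<le> norm x ^ n / fact n" if "norm z = 1" for n z
      using real_En_bound[of n z x] that by simp
    have int: "integrable sphere_measure (\<lambda>z. wt z * real_En n z x)" for n
      by (rule sphere_integrable[OF _ En1]) measurable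
    have "(\<integral>z. wt z * real_E z x \<partial>sphere_measure) = (\<integral>z. (\<Sum>n. wt z * real_En n z x) \<partial>sphere_measure)"
      by (simp add: real_E_def suminf_mult[OF summable_rabs_cancel[OF real_En_summable]])
    also have "\<dots> = (\<Sum>n. \<integral>z. wt z * real_En n z x \<partial>sphere_measure)"
    proof (rule integral_suminf[OF int])
      show "AE z in sphere_measure. summable (\<lambda>n. norm (wt z * real_En n z x))"
        by (simp add: abs_mult summable_mult real_En_summable)
      show "summable (\<lambda>n. \<integral>z. norm (wt z * real_En n z x) \<partial>sphere_measure)"
      proof (rule summable_comparison_test'[OF summable_mult[OF summable_power_fact[of "norm x"], of dd], where N = 0])
        fix n
        have "(\<integral>z. norm (wt z * real_En n z x) \<partial>sphere_measure) \<le> (\<integral>z. wt z * (norm x ^ n / fact n) \<partial>sphere_measure)"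
        proof (rule integral_mono_AE)
          show "integrable sphere_measure (\<lambda>z :: real^'n. wt z * (norm x ^ n / fact n))"
            by (rule sphere_integrable) auto
          show "AE z in sphere_measure. norm (wt z * real_En n z x) \<le> wt z * (norm x ^ n / fact n)"
          proof (rule AE_I2)
            fix z :: "real^'n" assume "z \<in> space sphere_measure"
            then have "norm z = 1" by (simp add: space_sphere_measure)
            from mult_left_mono[OF En1[OF this] weight_nonneg[of z]]
            show "norm (wt z * real_En n z x) \<le> wt z * (norm x ^ n / fact n)"
              by (simp only: real_norm_def abs_mult abs_of_nonneg[OF weight_nonneg])
          qed
        qed (intro integrable_norm int)
        then show "norm (\<integral>z. norm (wt z * real_En n z x) \<partial>sphere_measure) \<le> dd * (norm x ^ n / fact n)"
          by (simp add: dunkl_d_def)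
      qed
    qed
    also have "\<dots> = (\<Sum>n. sphere_moment n x)" by (simp add: sphere_moment_def)
    also have "\<dots> = (\<Sum>m. sphere_moment (2 * m) x)"
    proof (rule suminf_mono_reindex[symmetric])
      show "strict_mono (\<lambda>m::nat. 2 * m)" by (simp add: strict_mono_def)
      show "sphere_moment n x = 0" if n: "n \<notin> range ((*) 2)" for n
      proof -
        have "odd n" using n by (auto elim: evenE)
        then obtain m where "n = Suc (2 * m)" by (auto elim: oddE)
        then show ?thesis by (simp add: sphere_moment_odd)
      qed
    qed
    also have "\<dots> = (\<Sum>m. dd * (bessel_coeff (\<kappa> - 1) m * norm x ^ (2 * m)))" by (simp add: sphere_moment_even)
    also have "\<dots> = dd * bessel_I (\<kappa> - 1) (norm x)"
      unfolding bessel_I_def by (rule suminf_mult[OF bessel_summable[OF kappa_index]])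
    finally show ?thesis .
  qed
  have "bessel_I (\<kappa> - 1) \<bar>u\<bar> = bessel_I (\<kappa> - 1) u" for u
    by (simp add: bessel_I_def power_mult)
  from this[of "r * norm x"] base[of "r *\<^sub>R x"] show ?thesis
    by (simp add: real_E_scale abs_mult)
qed

end

section \<open>Markov functions of Markov processes\<close>

lemma measurable_restrict_UNIV: "f \<in> M \<rightarrow>\<^sub>M restrict_space borel UNIV \<longleftrightarrow> f \<in> M \<rightarrow>\<^sub>M borel"
  by (simp add: measurable_cong_sets[OF refl, of "restrict_space borel UNIV" borel])

lemma natural_filtration_sets:
  "sets (natural_filtration M S X s) = sigma_sets (space M)
     {X u -` A \<inter> space M | u A. 0 \<le> u \<and> u \<le> s \<and> A \<in> sets (restrict_space borel S)}"
  unfolding natural_filtration_def by (rule sets_measure_of) auto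

lemma natural_filtration_mono: "s \<le> t \<Longrightarrow> sets (natural_filtration M S X s) \<subseteq> sets (natural_filtration M S X t)"
  unfolding natural_filtration_sets by (rule sigma_sets_mono') (auto intro: order_trans)

lemma natural_filtration_space [simp]: "space (natural_filtration M S X s) = space M"
  unfolding natural_filtration_def by (rule space_measure_of) auto

lemma subalgebra_natural_filtration:
  assumes "\<And>t. t \<ge> 0 \<Longrightarrow> X t \<in> M \<rightarrow>\<^sub>M restrict_space borel S"
  shows "subalgebra M (natural_filtration M S X s)"
proof -
  have "{X u -` A \<inter> space M | u A. 0 \<le> u \<and> u \<le> s \<and> A \<in> sets (restrict_space borel S)} \<subseteq> sets M"
    using assms measurable_sets by blast
  then show ?thesis
    by (simp add: subalgebra_def natural_filtration_sets sets.sigma_sets_subset)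
qed

lemma natural_filtration_measurable:
  assumes "0 \<le> s" "X s \<in> space M \<rightarrow> S"
  shows "X s \<in> natural_filtration M S X s \<rightarrow>\<^sub>M restrict_space borel S"
proof (rule measurableI)
  show "X s -` A \<inter> space (natural_filtration M S X s) \<in> sets (natural_filtration M S X s)"
    if "A \<in> sets (restrict_space borel S)" for A
    unfolding natural_filtration_sets natural_filtration_space using that assms(1) by (intro sigma_sets.Basic) auto
qed (use assms in \<open>auto simp: space_restrict_space\<close>)

text \<open>Conditional expectations of indicators are replaced by integrals over past events, which is the
  form that extends to all nonnegative functions and composes with kernels.\<close>

lemma markov_process_nn_integral:
  fixes X :: "real \<Rightarrow> 'w \<Rightarrow> 'a::euclidean_space"
  assumes mp: "markov_process M UNIV K X" and K: "K t \<in> borel \<rightarrow>\<^sub>M prob_algebra borel"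
    and st: "0 \<le> s" "0 \<le> t" and B: "B \<in> sets (natural_filtration M UNIV X s)"
    and g [measurable]: "g \<in> borel_measurable borel"
  shows "(\<integral>\<^sup>+\<omega>. g (X (s + t) \<omega>) * indicator B \<omega> \<partial>M)
    = (\<integral>\<^sup>+\<omega>. (\<integral>\<^sup>+y. g y \<partial>K t (X s \<omega>)) * indicator B \<omega> \<partial>M)"
proof -
  interpret prob_space M using mp by (simp add: markov_process_def)
  have Xm: "X u \<in> M \<rightarrow>\<^sub>M borel" if "u \<ge> 0" for u using mp that by (simp add: markov_process_def measurable_restrict_UNIV)
  have [measurable]: "X s \<in> M \<rightarrow>\<^sub>M borel" "X (s + t) \<in> M \<rightarrow>\<^sub>M borel" using Xm st by auto
  let ?F = "natural_filtration M UNIV X s"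
  have sub: "subalgebra M ?F" by (rule subalgebra_natural_filtration) (simp add: Xm measurable_restrict_UNIV)
  interpret finite_measure_subalgebra M ?F
    by (simp add: finite_measure_subalgebra_def finite_measure_subalgebra_axioms_def sub finite_measure_axioms)
  have BM [measurable]: "B \<in> sets M" using B sub by (auto simp: subalgebra_def)
  have [measurable]: "K t \<in> borel \<rightarrow>\<^sub>M subprob_algebra borel" by (rule measurable_prob_algebraD[OF K])
  have Kp: "prob_space (K t x)" for x using K measurable_space[OF K, of x] by (simp add: space_prob_algebra)
  define N where "N = density M (indicator B)"
  have [measurable_cong, simp]: "sets N = sets M" by (simp add: N_def)
  have ind: "emeasure M (X (s + t) -` A \<inter> space M \<inter> B) = (\<integral>\<^sup>+\<omega>. emeasure (K t (X s \<omega>)) A * indicator B \<omega> \<partial>M)"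
    if [measurable]: "A \<in> sets borel" for A
  proof -
    let ?f = "indicator (X (s + t) -` A \<inter> space M) :: 'w \<Rightarrow> real"
    have intf: "integrable M ?f" by (rule integrable_real_indicator) (auto simp: emeasure_eq_measure)
    have meas: "(\<lambda>\<omega>. measure (K t (X s \<omega>)) A) \<in> borel_measurable M"
      by (rule measurable_compose[OF _ measurable_compose[OF K measurable_measure_prob_algebra]]) auto
    have "measure M (X (s + t) -` A \<inter> space M \<inter> B) = (\<integral>\<omega>\<in>B. ?f \<omega> \<partial>M)"
      by (simp add: set_lebesgue_integral_def indicator_inter_arith[symmetric] Int_commute mult.commute
          Int_absorb1 sets.sets_into_space flip: indicator_inter_arith)
    also have "\<dots> = (\<integral>\<omega>\<in>B. real_cond_exp M ?F ?f \<omega> \<partial>M)"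
      by (rule real_cond_exp_intA[OF intf B])
    also have "\<dots> = (\<integral>\<omega>\<in>B. measure (K t (X s \<omega>)) A \<partial>M)"
    proof (rule set_lebesgue_integral_cong_AE)
      have "AE \<omega> in M. real_cond_exp M ?F ?f \<omega> = measure (K t (X s \<omega>)) A"
        using mp st that unfolding markov_process_def by simp
      then show "AE \<omega>\<in>B in M. real_cond_exp M ?F ?f \<omega> = measure (K t (X s \<omega>)) A"
        by eventually_elim simp
    qed (auto intro: meas borel_measurable_cond_exp2)
    finally have eq: "measure M (X (s + t) -` A \<inter> space M \<inter> B) = (\<integral>\<omega>. measure (K t (X s \<omega>)) A * indicator B \<omega> \<partial>M)"
      by (simp add: set_lebesgue_integral_def mult.commute)
    have "integrable M (\<lambda>\<omega>. measure (K t (X s \<omega>)) A * indicator B \<omega>)"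
    proof (rule integrable_const_bound[where B = 1])
      show "AE \<omega> in M. norm (measure (K t (X s \<omega>)) A * indicator B \<omega>) \<le> 1"
        by (rule AE_I2) (use prob_space.prob_le_1[OF Kp] in \<open>auto simp: indicator_def\<close>)
    qed (use meas in measurable)
    then have "ennreal (\<integral>\<omega>. measure (K t (X s \<omega>)) A * indicator B \<omega> \<partial>M)
        = (\<integral>\<^sup>+\<omega>. ennreal (measure (K t (X s \<omega>)) A * indicator B \<omega>) \<partial>M)"
      by (intro nn_integral_eq_integral[symmetric]) auto
    also have "\<dots> = (\<integral>\<^sup>+\<omega>. emeasure (K t (X s \<omega>)) A * indicator B \<omega> \<partial>M)"
      by (intro nn_integral_cong)
         (simp add: finite_measure.emeasure_eq_measure[OF prob_space.finite_measure[OF Kp]] indicator_def)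
    finally show ?thesis by (simp add: emeasure_eq_measure eq)
  qed
  have eqm: "distr N borel (X (s + t)) = distr N borel (X s) \<bind> K t"
  proof (rule measure_eqI)
    have sp: "space (distr N borel (X s)) \<noteq> {}" by simp
    show sets: "sets (distr N borel (X (s + t))) = sets (distr N borel (X s) \<bind> K t)"
      by (subst sets_bind[OF sets_kernel[of "K t" borel borel]]) auto
    fix A assume "A \<in> sets (distr N borel (X (s + t)))"
    then have [measurable]: "A \<in> sets borel" by simp
    have "emeasure (distr N borel (X (s + t))) A = emeasure N (X (s + t) -` A \<inter> space M)"
      by (subst emeasure_distr) (auto simp: N_def)
    also have "\<dots> = emeasure M (X (s + t) -` A \<inter> space M \<inter> B)"
      unfolding N_def by (subst emeasure_density)
        (auto simp: nn_integral_indicator Int_ac simp flip: indicator_inter_arith intro!: arg_cong2[where f = emeasure])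
    also have "\<dots> = (\<integral>\<^sup>+\<omega>. emeasure (K t (X s \<omega>)) A \<partial>N)"
      unfolding ind[OF \<open>A \<in> sets borel\<close>] N_def by (subst nn_integral_density) (auto simp: mult.commute)
    also have "\<dots> = (\<integral>\<^sup>+x. emeasure (K t x) A \<partial>distr N borel (X s))"
      by (rule nn_integral_distr[symmetric]) auto
    also have "\<dots> = emeasure (distr N borel (X s) \<bind> K t) A"
      by (rule emeasure_bind[OF sp, symmetric, where N = borel]) auto
    finally show "emeasure (distr N borel (X (s + t))) A = emeasure (distr N borel (X s) \<bind> K t) A" .
  qed
  have "(\<integral>\<^sup>+\<omega>. g (X (s + t) \<omega>) * indicator B \<omega> \<partial>M) = (\<integral>\<^sup>+y. g y \<partial>distr N borel (X (s + t)))"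
    by (subst nn_integral_distr) (auto simp: N_def nn_integral_density mult.commute)
  also have "\<dots> = (\<integral>\<^sup>+x. \<integral>\<^sup>+y. g y \<partial>K t x \<partial>distr N borel (X s))"
    unfolding eqm by (rule nn_integral_bind[where B = borel]) auto
  also have "\<dots> = (\<integral>\<^sup>+\<omega>. (\<integral>\<^sup>+y. g y \<partial>K t (X s \<omega>)) * indicator B \<omega> \<partial>M)"
    by (subst nn_integral_distr) (auto simp: N_def nn_integral_density mult.commute)
  finally show ?thesis .
qed

text \<open>The setting of the Rogers-Pitman criterion. The map \<^term>\<open>\<phi>\<close> forgets part of the state, and
  \<^term>\<open>L\<close> restores it at random: \<^term>\<open>L r\<close> lives on the fibre over \<^term>\<open>r\<close>. The assumption
  \<open>intertwine\<close> says that from \<^term>\<open>L r\<close> the law at a later time is again the mixture of \<^term>\<open>L\<close> over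
  the image of the state, and \<open>initial\<close> demands this at time zero. All assumptions are
  expressed by integrals of nonnegative functions, which keeps integrability out of the argument.\<close>

locale rogers_pitman =
  fixes M :: "'w measure" and X :: "real \<Rightarrow> 'w \<Rightarrow> 'a::euclidean_space"
    and K :: "real \<Rightarrow> 'a \<Rightarrow> 'a measure" and \<phi> :: "'a \<Rightarrow> 'b::euclidean_space"
    and S :: "'b set" and L :: "'b \<Rightarrow> 'a measure"
  assumes mp: "markov_process M UNIV K X"
    and K: "\<And>t. t \<ge> 0 \<Longrightarrow> K t \<in> borel \<rightarrow>\<^sub>M prob_algebra borel"
    and K_0: "\<And>x. K 0 x = return borel x"
    and K_add: "\<And>s t x. s \<ge> 0 \<Longrightarrow> t \<ge> 0 \<Longrightarrow> K (s + t) x = K s x \<bind> K t"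
    and \<phi> [measurable]: "\<phi> \<in> borel \<rightarrow>\<^sub>M borel" and \<phi>_S: "\<And>x. \<phi> x \<in> S" and S: "S \<in> sets borel"
    and L: "L \<in> borel \<rightarrow>\<^sub>M prob_algebra borel"
    and fibre: "\<And>r. r \<in> S \<Longrightarrow> AE x in L r. \<phi> x = r"
    and intertwine: "\<And>r t g. r \<in> S \<Longrightarrow> t \<ge> 0 \<Longrightarrow> g \<in> borel_measurable borel \<Longrightarrow>
      (\<integral>\<^sup>+x. \<integral>\<^sup>+y. g y \<partial>K t x \<partial>L r) = (\<integral>\<^sup>+x. \<integral>\<^sup>+y. \<integral>\<^sup>+z. g z \<partial>L (\<phi> y) \<partial>K t x \<partial>L r)"
    and initial: "\<And>g. g \<in> borel_measurable borel \<Longrightarrow>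
      (\<integral>\<^sup>+\<omega>. g (X 0 \<omega>) \<partial>M) = (\<integral>\<^sup>+\<omega>. \<integral>\<^sup>+x. g x \<partial>L (\<phi> (X 0 \<omega>)) \<partial>M)"
begin

definition Q :: "real \<Rightarrow> 'b \<Rightarrow> 'b measure" where
  "Q t r = distr (L r \<bind> K t) (restrict_space borel S) \<phi>"

lemma X_measurable: "t \<ge> 0 \<Longrightarrow> X t \<in> M \<rightarrow>\<^sub>M borel"
  using mp by (simp add: markov_process_def measurable_restrict_UNIV)

lemma L_sub [measurable]: "L \<in> borel \<rightarrow>\<^sub>M subprob_algebra borel"
  by (rule measurable_prob_algebraD[OF L])

lemma K_sub: "t \<ge> 0 \<Longrightarrow> K t \<in> borel \<rightarrow>\<^sub>M subprob_algebra borel"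
  by (rule measurable_prob_algebraD[OF K])

lemma sets_L [simp]: "sets (L r) = sets borel" and prob_L: "prob_space (L r)"
  using measurable_space[OF L, of r] by (simp_all add: space_prob_algebra)

lemma space_L [simp]: "space (L r) = UNIV"
  using sets_eq_imp_space_eq[OF sets_L] by simp

lemma K_sub_L: "t \<ge> 0 \<Longrightarrow> K t \<in> L r \<rightarrow>\<^sub>M subprob_algebra borel"
  using K_sub by (simp add: measurable_cong_sets[OF sets_L refl])

lemma sets_LK: "t \<ge> 0 \<Longrightarrow> sets (L r \<bind> K t) = sets borel"
  by (rule sets_bind[OF sets_kernel[OF K_sub]]) auto

lemma \<phi>_restrict: "\<phi> \<in> borel \<rightarrow>\<^sub>M restrict_space borel S"
  by (rule measurable_restrict_space2) (auto simp: \<phi>_S)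

lemma measurable_K_integral:
  assumes "t \<ge> 0" "g \<in> borel_measurable borel"
  shows "(\<lambda>x. \<integral>\<^sup>+y. g y \<partial>K t x) \<in> borel_measurable borel"
  by (rule measurable_compose[OF K_sub[OF assms(1)] nn_integral_measurable_subprob_algebra[OF assms(2)]])

lemma measurable_L_integral:
  assumes "g \<in> borel_measurable borel"
  shows "(\<lambda>x. \<integral>\<^sup>+y. g y \<partial>L x) \<in> borel_measurable borel"
  by (rule measurable_compose[OF L_sub nn_integral_measurable_subprob_algebra[OF assms]])

lemma measurable_L_integral_\<phi>:
  assumes "g \<in> borel_measurable borel"
  shows "(\<lambda>x. \<integral>\<^sup>+y. g y \<partial>L (\<phi> x)) \<in> borel_measurable borel"
  by (rule measurable_compose[OF \<phi> measurable_L_integral[OF assms]])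

lemma nn_integral_Q:
  assumes t: "t \<ge> 0" and f: "f \<in> borel_measurable (restrict_space borel S)"
  shows "(\<integral>\<^sup>+u. f u \<partial>Q t r) = (\<integral>\<^sup>+x. \<integral>\<^sup>+y. f (\<phi> y) \<partial>K t x \<partial>L r)"
proof -
  have m: "\<phi> \<in> (L r \<bind> K t) \<rightarrow>\<^sub>M restrict_space borel S"
    using \<phi>_restrict by (simp add: measurable_cong_sets[OF sets_LK[OF t] refl])
  have "(\<integral>\<^sup>+u. f u \<partial>Q t r) = (\<integral>\<^sup>+y. f (\<phi> y) \<partial>(L r \<bind> K t))"
    unfolding Q_def by (rule nn_integral_distr[OF m]) (simp add: f)
  also have "\<dots> = (\<integral>\<^sup>+x. \<integral>\<^sup>+y. f (\<phi> y) \<partial>K t x \<partial>L r)"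
    by (rule nn_integral_bind[OF measurable_compose[OF \<phi>_restrict f] K_sub_L[OF t]])
  finally show ?thesis .
qed

lemma sets_Q [simp]: "sets (Q t r) = sets (restrict_space borel S)" by (simp add: Q_def)

lemma emeasure_Q:
  assumes t: "t \<ge> 0" and A: "A \<in> sets (restrict_space borel S)"
  shows "emeasure (Q t r) A = (\<integral>\<^sup>+x. \<integral>\<^sup>+y. indicator A (\<phi> y) \<partial>K t x \<partial>L r)"
proof -
  have "emeasure (Q t r) A = (\<integral>\<^sup>+u. indicator A u \<partial>Q t r)" using A by simp
  also have "\<dots> = (\<integral>\<^sup>+x. \<integral>\<^sup>+y. indicator A (\<phi> y) \<partial>K t x \<partial>L r)" by (rule nn_integral_Q[OF t]) (use A in simp)
  finally show ?thesis .
qed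

lemma Q_measurable:
  assumes t: "t \<ge> 0"
  shows "Q t \<in> borel \<rightarrow>\<^sub>M prob_algebra (restrict_space borel S)"
proof -
  have "(\<lambda>r. L r \<bind> K t) \<in> borel \<rightarrow>\<^sub>M prob_algebra borel"
    by (rule measurable_bind_prob_space[OF L K[OF t]])
  then show ?thesis unfolding Q_def[abs_def]
    by (rule measurable_compose[OF _ measurable_distr_prob_space[OF \<phi>_restrict]])
qed

lemma Q_measurable_S: "t \<ge> 0 \<Longrightarrow> Q t \<in> restrict_space borel S \<rightarrow>\<^sub>M prob_algebra (restrict_space borel S)"
  by (rule measurable_restrict_space1[OF Q_measurable])

lemma prob_Q: "t \<ge> 0 \<Longrightarrow> prob_space (Q t r)"
  using measurable_space[OF Q_measurable, of t r] by (simp add: space_prob_algebra)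

lemma L_fibre_integral:
  assumes r: "r \<in> S" and f: "f \<in> borel_measurable borel" and g: "g \<in> borel_measurable borel"
  shows "(\<integral>\<^sup>+x. g x * f (\<phi> x) \<partial>L r) = (\<integral>\<^sup>+x. g x \<partial>L r) * f r"
proof -
  have "(\<integral>\<^sup>+x. g x * f (\<phi> x) \<partial>L r) = (\<integral>\<^sup>+x. g x * f r \<partial>L r)"
    using fibre[OF r] by (intro nn_integral_cong_AE) (auto elim!: eventually_mono)
  then show ?thesis using g by (simp add: nn_integral_multc)
qed

lemma Q_0:
  assumes r: "r \<in> S" shows "Q 0 r = return (restrict_space borel S) r"
proof (rule measure_eqI)
  fix A assume "A \<in> sets (Q 0 r)"
  then have A: "A \<in> sets (restrict_space borel S)" by simp
  have Ab [measurable]: "A \<in> sets borel" using A S by (simp add: sets_restrict_space_iff)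
  have "emeasure (Q 0 r) A = (\<integral>\<^sup>+x. indicator A (\<phi> x) \<partial>L r)"
    unfolding emeasure_Q[OF order_refl A] K_0 by (intro nn_integral_cong nn_integral_return) auto
  also have "\<dots> = indicator A r"
    using L_fibre_integral[OF r, of "indicator A" "\<lambda>x. 1"] prob_space.emeasure_space_1[OF prob_L] by simp
  finally show "emeasure (Q 0 r) A = emeasure (return (restrict_space borel S) r) A" using A by simp
qed simp

text \<open>The semigroup property for \<^term>\<open>K\<close> gives an intermediate state, which by intertwining may be
  resampled from its fibre; what is left is a product of two kernels on the image.\<close>

theorem Q_add:
  assumes st: "s \<ge> 0" "t \<ge> 0" and r: "r \<in> S"
  shows "Q (s + t) r = Q s r \<bind> Q t"
proof (rule measure_eqI)
  have Qm: "Q t \<in> Q s r \<rightarrow>\<^sub>M subprob_algebra (restrict_space borel S)"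
    using measurable_prob_algebraD[OF Q_measurable_S[OF st(2)]] by (simp add: measurable_cong_sets[OF sets_Q refl])
  have ne: "space (Q s r) \<noteq> {}" by (rule prob_space.not_empty[OF prob_Q[OF st(1)]])
  show "sets (Q (s + t) r) = sets (Q s r \<bind> Q t)"
    by (subst sets_bind[OF sets_kernel[OF Qm] ne]) simp_all
  fix A assume "A \<in> sets (Q (s + t) r)"
  then have A: "A \<in> sets (restrict_space borel S)" by simp
  have Ai: "(\<lambda>y. indicator A (\<phi> y)) \<in> borel_measurable borel"
    by (rule measurable_compose[OF \<phi>_restrict]) (use A in simp)
  define g where "g x = (\<integral>\<^sup>+y. indicator A (\<phi> y) \<partial>K t x)" for x
  have gm: "g \<in> borel_measurable borel" unfolding g_def[abs_def] by (rule measurable_K_integral[OF st(2) Ai])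
  have st0: "s + t \<ge> 0" using st by simp
  have "emeasure (Q (s + t) r) A = (\<integral>\<^sup>+x. \<integral>\<^sup>+y. indicator A (\<phi> y) \<partial>(K s x \<bind> K t) \<partial>L r)"
    unfolding emeasure_Q[OF st0 A] K_add[OF st] ..
  also have "\<dots> = (\<integral>\<^sup>+x. \<integral>\<^sup>+y. g y \<partial>K s x \<partial>L r)"
  proof (rule nn_integral_cong)
    fix x
    have "K t \<in> K s x \<rightarrow>\<^sub>M subprob_algebra borel"
      using K_sub[OF st(2)] sets_kernel[OF K_sub[OF st(1)], of x] by (simp cong: measurable_cong_sets)
    then show "(\<integral>\<^sup>+y. indicator A (\<phi> y) \<partial>(K s x \<bind> K t)) = (\<integral>\<^sup>+y. g y \<partial>K s x)"
      unfolding g_def by (rule nn_integral_bind[OF Ai])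
  qed
  also have "\<dots> = (\<integral>\<^sup>+x. \<integral>\<^sup>+y. \<integral>\<^sup>+z. g z \<partial>L (\<phi> y) \<partial>K s x \<partial>L r)"
    by (rule intertwine[OF r st(1) gm])
  also have "\<dots> = (\<integral>\<^sup>+x. \<integral>\<^sup>+y. emeasure (Q t (\<phi> y)) A \<partial>K s x \<partial>L r)"
    unfolding emeasure_Q[OF st(2) A] g_def ..
  also have "\<dots> = (\<integral>\<^sup>+u. emeasure (Q t u) A \<partial>Q s r)"
    by (rule nn_integral_Q[OF st(1), symmetric])
       (rule measurable_emeasure_kernel[OF measurable_prob_algebraD[OF Q_measurable_S[OF st(2)]] A])
  also have "\<dots> = emeasure (Q s r \<bind> Q t) A"
    by (rule emeasure_bind[OF ne Qm A, symmetric])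
  finally show "emeasure (Q (s + t) r) A = emeasure (Q s r \<bind> Q t) A" .
qed

text \<open>Given a good event, the image of the state carries all information on the state itself: the fibre
  coordinate is still distributed according to \<^term>\<open>L\<close>. Time evolution preserves this by intertwining
  (\<open>good_step\<close>), and so does observing the image, as \<^term>\<open>L\<close> lives on fibres
  (\<open>good_Int\<close>). All events that only observe the image at finitely many times are therefore good.\<close>

definition good :: "real \<Rightarrow> 'w set \<Rightarrow> bool" where
  "good s B \<longleftrightarrow> B \<in> sets (natural_filtration M UNIV X s) \<and>
     (\<forall>g. g \<in> borel_measurable borel \<longrightarrow>
       (\<integral>\<^sup>+\<omega>. g (X s \<omega>) * indicator B \<omega> \<partial>M) = (\<integral>\<^sup>+\<omega>. (\<integral>\<^sup>+x. g x \<partial>L (\<phi> (X s \<omega>))) * indicator B \<omega> \<partial>M))"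

lemma goodD: "good s B \<Longrightarrow> g \<in> borel_measurable borel \<Longrightarrow>
    (\<integral>\<^sup>+\<omega>. g (X s \<omega>) * indicator B \<omega> \<partial>M) = (\<integral>\<^sup>+\<omega>. (\<integral>\<^sup>+x. g x \<partial>L (\<phi> (X s \<omega>))) * indicator B \<omega> \<partial>M)"
  by (simp add: good_def)

lemma good_space: "good 0 (space M)"
proof -
  have "(\<integral>\<^sup>+\<omega>. f \<omega> * indicator (space M) \<omega> \<partial>M) = (\<integral>\<^sup>+\<omega>. f \<omega> \<partial>M)" for f
    by (intro nn_integral_cong) simp
  then show ?thesis using initial sets.top[of "natural_filtration M UNIV X 0"] by (simp add: good_def)
qed

lemma good_step:
  assumes B: "good s B" and st: "s \<ge> 0" "t \<ge> 0" shows "good (s + t) B"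
proof -
  have BF: "B \<in> sets (natural_filtration M UNIV X s)" using B by (simp add: good_def)
  have "(\<integral>\<^sup>+\<omega>. g (X (s + t) \<omega>) * indicator B \<omega> \<partial>M)
      = (\<integral>\<^sup>+\<omega>. (\<integral>\<^sup>+x. g x \<partial>L (\<phi> (X (s + t) \<omega>))) * indicator B \<omega> \<partial>M)" if g: "g \<in> borel_measurable borel" for g
  proof -
    define h where "h x = (\<integral>\<^sup>+y. g y \<partial>L (\<phi> x))" for x
    have h: "h \<in> borel_measurable borel" unfolding h_def[abs_def] by (rule measurable_L_integral_\<phi>[OF g])
    have past: "(\<integral>\<^sup>+\<omega>. f (X (s + t) \<omega>) * indicator B \<omega> \<partial>M)
        = (\<integral>\<^sup>+\<omega>. (\<integral>\<^sup>+x. \<integral>\<^sup>+y. f y \<partial>K t x \<partial>L (\<phi> (X s \<omega>))) * indicator B \<omega> \<partial>M)"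
      if f: "f \<in> borel_measurable borel" for f
      using markov_process_nn_integral[OF mp K[OF st(2)] st BF f] goodD[OF B measurable_K_integral[OF st(2) f]]
      by simp
    show ?thesis
      using past[OF g] past[OF h] intertwine[OF \<phi>_S st(2) g] by (simp add: h_def)
  qed
  then show ?thesis using BF natural_filtration_mono[of s "s + t" M UNIV X] st by (auto simp: good_def)
qed

lemma good_Int:
  assumes B: "good s B" and s: "s \<ge> 0" and C: "C \<in> sets borel"
  shows "good s (B \<inter> {\<omega> \<in> space M. \<phi> (X s \<omega>) \<in> C})"
proof -
  have BF: "B \<in> sets (natural_filtration M UNIV X s)" using B by (simp add: good_def)
  have Bs: "B \<subseteq> space M" using sets.sets_into_space[OF BF] by simp
  have C\<phi>: "\<phi> -` C \<in> sets borel" using measurable_sets[OF \<phi> C] by simp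
  have "{\<omega> \<in> space M. \<phi> (X s \<omega>) \<in> C} = X s -` (\<phi> -` C) \<inter> space (natural_filtration M UNIV X s)" by auto
  also have "\<dots> \<in> sets (natural_filtration M UNIV X s)"
    by (rule measurable_sets[OF natural_filtration_measurable[OF s]]) (use C\<phi> in auto)
  finally have CF: "{\<omega> \<in> space M. \<phi> (X s \<omega>) \<in> C} \<in> sets (natural_filtration M UNIV X s)" .
  have "(\<integral>\<^sup>+\<omega>. g (X s \<omega>) * indicator (B \<inter> {\<omega> \<in> space M. \<phi> (X s \<omega>) \<in> C}) \<omega> \<partial>M)
     = (\<integral>\<^sup>+\<omega>. (\<integral>\<^sup>+x. g x \<partial>L (\<phi> (X s \<omega>))) * indicator (B \<inter> {\<omega> \<in> space M. \<phi> (X s \<omega>) \<in> C}) \<omega> \<partial>M)"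
    if g: "g \<in> borel_measurable borel" for g
  proof -
    have split: "indicator (B \<inter> {\<omega> \<in> space M. \<phi> (X s \<omega>) \<in> C}) \<omega> = indicator C (\<phi> (X s \<omega>)) * (indicator B \<omega> :: ennreal)"
      if "\<omega> \<in> space M" for \<omega> using that by (auto simp: indicator_def)
    have gC: "(\<lambda>x. g x * indicator C (\<phi> x)) \<in> borel_measurable borel"
      by (intro borel_measurable_times_ennreal g measurable_compose[OF \<phi>] borel_measurable_indicator C)
    have "(\<integral>\<^sup>+\<omega>. g (X s \<omega>) * indicator (B \<inter> {\<omega> \<in> space M. \<phi> (X s \<omega>) \<in> C}) \<omega> \<partial>M)
        = (\<integral>\<^sup>+\<omega>. (g (X s \<omega>) * indicator C (\<phi> (X s \<omega>))) * indicator B \<omega> \<partial>M)"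
      by (intro nn_integral_cong) (simp add: split mult.assoc)
    also have "\<dots> = (\<integral>\<^sup>+\<omega>. (\<integral>\<^sup>+x. g x * indicator C (\<phi> x) \<partial>L (\<phi> (X s \<omega>))) * indicator B \<omega> \<partial>M)"
      by (rule goodD[OF B gC])
    also have "\<dots> = (\<integral>\<^sup>+\<omega>. ((\<integral>\<^sup>+x. g x \<partial>L (\<phi> (X s \<omega>))) * indicator C (\<phi> (X s \<omega>))) * indicator B \<omega> \<partial>M)"
      using C by (subst L_fibre_integral[OF \<phi>_S _ g]) auto
    also have "\<dots> = (\<integral>\<^sup>+\<omega>. (\<integral>\<^sup>+x. g x \<partial>L (\<phi> (X s \<omega>))) * indicator (B \<inter> {\<omega> \<in> space M. \<phi> (X s \<omega>) \<in> C}) \<omega> \<partial>M)"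
      by (intro nn_integral_cong) (simp add: split mult.assoc)
    finally show ?thesis .
  qed
  then show ?thesis using BF CF by (auto simp: good_def)
qed

definition cylinder :: "real set \<Rightarrow> (real \<Rightarrow> 'b set) \<Rightarrow> 'w set" where
  "cylinder J C = {\<omega> \<in> space M. \<forall>u\<in>J. \<phi> (X u \<omega>) \<in> C u}"

lemma good_cylinder:
  assumes "finite J" and C: "\<And>u. C u \<in> sets borel"
  shows "s \<ge> 0 \<Longrightarrow> J \<subseteq> {0..s} \<Longrightarrow> good s (cylinder J C)"
  using assms(1)
proof (induction J arbitrary: s rule: finite_linorder_max_induct)
  case empty
  then show ?case using good_step[OF good_space, of s] by (simp add: cylinder_def)
next
  case (insert b A)
  have b: "0 \<le> b" "b \<le> s" using insert.prems by auto
  have "A \<subseteq> {0..b}"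
  proof
    fix u assume u: "u \<in> A"
    then have "u < b" "u \<in> {0..s}" using insert.hyps insert.prems by blast+
    then show "u \<in> {0..b}" by simp
  qed
  then have "good b (cylinder A C \<inter> {\<omega> \<in> space M. \<phi> (X b \<omega>) \<in> C b})"
    using insert.IH[of b] b C by (intro good_Int) auto
  moreover have "cylinder A C \<inter> {\<omega> \<in> space M. \<phi> (X b \<omega>) \<in> C b} = cylinder (insert b A) C"
    by (auto simp: cylinder_def)
  ultimately show ?case using good_step[of b _ "s - b"] b by simp
qed

theorem law_is_mixture:
  assumes t: "t \<ge> 0" and g: "g \<in> borel_measurable borel"
  shows "(\<integral>\<^sup>+\<omega>. g (X t \<omega>) \<partial>M) = (\<integral>\<^sup>+\<omega>. \<integral>\<^sup>+x. g x \<partial>L (\<phi> (X t \<omega>)) \<partial>M)"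
proof -
  have "(\<integral>\<^sup>+\<omega>. f \<omega> * indicator (space M) \<omega> \<partial>M) = (\<integral>\<^sup>+\<omega>. f \<omega> \<partial>M)" for f
    by (intro nn_integral_cong) simp
  then show ?thesis using good_step[OF good_space, of t] t g by (simp add: good_def)
qed

lemma measurable_image_process: "t \<ge> 0 \<Longrightarrow> (\<lambda>\<omega>. \<phi> (X t \<omega>)) \<in> M \<rightarrow>\<^sub>M restrict_space borel S"
  by (rule measurable_compose[OF X_measurable \<phi>_restrict])

lemma image_filtration_generated:
  assumes s: "s \<ge> 0"
  defines "E \<equiv> {cylinder J C | J C. finite J \<and> J \<subseteq> {0..s} \<and> (\<forall>u. C u \<in> sets borel)}"
  shows "sets (natural_filtration M S (\<lambda>t \<omega>. \<phi> (X t \<omega>)) s) = sigma_sets (space M) E"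
proof -
  let ?Y = "\<lambda>t \<omega>. \<phi> (X t \<omega>)"
  let ?G = "{?Y u -` A \<inter> space M | u A. 0 \<le> u \<and> u \<le> s \<and> A \<in> sets (restrict_space borel S)}"
  have 1: "?G \<subseteq> E"
  proof
    fix B assume "B \<in> ?G"
    then obtain u A where u: "B = ?Y u -` A \<inter> space M" "0 \<le> u" "u \<le> s" "A \<in> sets (restrict_space borel S)" by auto
    have "A \<in> sets borel" using u(4) S by (simp add: sets_restrict_space_iff)
    moreover have "B = cylinder {u} (\<lambda>_. A)" using u by (auto simp: cylinder_def)
    ultimately show "B \<in> E" unfolding E_def
      using u by (intro CollectI exI[of _ "{u}"] exI[of _ "\<lambda>_. A"]) auto
  qed
  have 2: "E \<subseteq> sigma_sets (space M) ?G"
  proof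
    fix B assume "B \<in> E"
    then obtain J C where J: "B = cylinder J C" "finite J" "J \<subseteq> {0..s}" "\<And>u. C u \<in> sets borel"
      unfolding E_def by auto
    have gen: "{\<omega> \<in> space M. \<phi> (X u \<omega>) \<in> C u} \<in> sigma_sets (space M) ?G" if "u \<in> J" for u
    proof -
      have "C u \<inter> S \<in> sets (restrict_space borel S)" using J(4) S by (simp add: sets_restrict_space_iff)
      moreover have "{\<omega> \<in> space M. \<phi> (X u \<omega>) \<in> C u} = ?Y u -` (C u \<inter> S) \<inter> space M"
        by (rule set_eqI) (simp add: \<phi>_S conj_commute)
      moreover have "0 \<le> u" "u \<le> s" using that J(3) by auto
      ultimately show ?thesis by (intro sigma_sets.Basic CollectI exI[of _ u] exI[of _ "C u \<inter> S"]) simp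
    qed
    have sig: "sigma_sets (space M) ?G = sets (natural_filtration M S ?Y s)"
      by (simp only: natural_filtration_sets)
    show "B \<in> sigma_sets (space M) ?G"
    proof (cases "J = {}")
      case True
      then have "B = space M" using J(1) by (simp add: cylinder_def)
      then show ?thesis by (simp only: sigma_sets_top)
    next
      case False
      have "B = (\<Inter>u\<in>J. {\<omega> \<in> space M. \<phi> (X u \<omega>) \<in> C u})" using False J(1) by (auto simp: cylinder_def)
      also have "\<dots> \<in> sets (natural_filtration M S ?Y s)"
        by (rule sets.finite_INT[OF J(2) False]) (rule gen[unfolded sig])
      finally show ?thesis by (simp only: sig)
    qed
  qed
  show ?thesis
    unfolding natural_filtration_sets by (rule sigma_sets_eqI) (use 1 2 in blast)+
qed

lemma Int_stable_cylinders:
  "Int_stable {cylinder J C | J C. finite J \<and> J \<subseteq> {0..s} \<and> (\<forall>u. C u \<in> sets borel)}"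
proof (rule Int_stableI)
  fix a b
  assume "a \<in> {cylinder J C | J C. finite J \<and> J \<subseteq> {0..s} \<and> (\<forall>u. C u \<in> sets borel)}"
    "b \<in> {cylinder J C | J C. finite J \<and> J \<subseteq> {0..s} \<and> (\<forall>u. C u \<in> sets borel)}"
  then obtain J C J' C' where J: "a = cylinder J C" "finite J" "J \<subseteq> {0..s}" "\<And>u. C u \<in> sets borel"
    and J': "b = cylinder J' C'" "finite J'" "J' \<subseteq> {0..s}" "\<And>u. C' u \<in> sets borel"
    by blast
  define C'' where "C'' u = (if u \<in> J then C u else UNIV) \<inter> (if u \<in> J' then C' u else UNIV)" for u
  have "a \<inter> b = cylinder (J \<union> J') C''" unfolding J(1) J'(1) by (auto simp: cylinder_def C''_def)
  moreover have "C'' u \<in> sets borel" for u using J(4) J'(4) by (auto simp: C''_def)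
  ultimately show "a \<inter> b \<in> {cylinder J C | J C. finite J \<and> J \<subseteq> {0..s} \<and> (\<forall>u. C u \<in> sets borel)}"
    using J J' by blast
qed

lemma good_transition:
  assumes B: "good s B" and s: "s \<ge> 0" and t: "t \<ge> 0" and A: "A \<in> sets (restrict_space borel S)"
  shows "(\<integral>\<^sup>+\<omega>. indicator A (\<phi> (X (s + t) \<omega>)) * indicator B \<omega> \<partial>M)
    = (\<integral>\<^sup>+\<omega>. emeasure (Q t (\<phi> (X s \<omega>))) A * indicator B \<omega> \<partial>M)"
proof -
  have Ai: "(\<lambda>y. indicator A (\<phi> y) :: ennreal) \<in> borel_measurable borel"
    by (rule measurable_compose[OF \<phi>_restrict]) (use A in simp)
  have "(\<integral>\<^sup>+\<omega>. indicator A (\<phi> (X (s + t) \<omega>)) * indicator B \<omega> \<partial>M)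
      = (\<integral>\<^sup>+\<omega>. (\<integral>\<^sup>+y. indicator A (\<phi> y) \<partial>K t (X s \<omega>)) * indicator B \<omega> \<partial>M)"
    using B by (intro markov_process_nn_integral[OF mp K[OF t] s t _ Ai]) (simp add: good_def)
  also have "\<dots> = (\<integral>\<^sup>+\<omega>. (\<integral>\<^sup>+x. \<integral>\<^sup>+y. indicator A (\<phi> y) \<partial>K t x \<partial>L (\<phi> (X s \<omega>))) * indicator B \<omega> \<partial>M)"
    by (rule goodD[OF B measurable_K_integral[OF t Ai]])
  finally show ?thesis unfolding emeasure_Q[OF t A] .
qed

text \<open>On good events the Markov property of the original process passes to the image. Cylinders are good, are
  stable under intersection and generate the past of the image, so both sides of the conditional
  expectation agree on the whole past.\<close>

theorem markov_image: "markov_process M S Q (\<lambda>t \<omega>. \<phi> (X t \<omega>))"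
  unfolding markov_process_def
proof (intro conjI allI impI ballI)
  show "prob_space M" using mp by (simp add: markov_process_def)
  then interpret prob_space M .
  let ?Y = "\<lambda>t \<omega>. \<phi> (X t \<omega>)"
  show "?Y t \<in> M \<rightarrow>\<^sub>M restrict_space borel S" if "0 \<le> t" for t by (rule measurable_image_process[OF that])
  fix s t :: real and A assume s: "0 \<le> s" and t: "0 \<le> t" and A: "A \<in> sets (restrict_space borel S)"
  let ?G = "natural_filtration M S ?Y s"
  have sub: "subalgebra M ?G" by (rule subalgebra_natural_filtration) (rule measurable_image_process)
  interpret finite_measure_subalgebra M ?G
    by (simp add: finite_measure_subalgebra_def finite_measure_subalgebra_axioms_def sub finite_measure_axioms)
  have Y_G: "?Y s \<in> ?G \<rightarrow>\<^sub>M restrict_space borel S"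
    by (rule natural_filtration_measurable[OF s]) (simp add: \<phi>_S)
  have Ai: "(\<lambda>y. indicator A (\<phi> y) :: ennreal) \<in> borel_measurable borel"
    by (rule measurable_compose[OF \<phi>_restrict]) (use A in simp)
  define f1 where "f1 \<omega> = (indicator A (?Y (s + t) \<omega>) :: ennreal)" for \<omega>
  define f2 where "f2 \<omega> = emeasure (Q t (?Y s \<omega>)) A" for \<omega>
  have f1m: "f1 \<in> borel_measurable M"
    unfolding f1_def[abs_def] using s t by (intro measurable_compose[OF X_measurable Ai]) auto
  have f2G: "f2 \<in> borel_measurable ?G"
    unfolding f2_def[abs_def]
    by (rule measurable_compose[OF Y_G measurable_emeasure_kernel[OF measurable_prob_algebraD[OF Q_measurable_S[OF t]] A]])
  then have f2m: "f2 \<in> borel_measurable M" by (rule measurable_from_subalg[OF sub])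
  have key: "(\<integral>\<^sup>+\<omega>. f1 \<omega> * indicator B \<omega> \<partial>M) = (\<integral>\<^sup>+\<omega>. f2 \<omega> * indicator B \<omega> \<partial>M)" if "good s B" for B
    unfolding f1_def f2_def by (rule good_transition[OF that s t A])
  have subd: "subalgebra (density M f) ?G" for f using sub by (simp add: subalgebra_def)
  let ?E = "{cylinder J C | J C. finite J \<and> J \<subseteq> {0..s} \<and> (\<forall>u. C u \<in> sets borel)}"
  have em: "emeasure (restr_to_subalg (density M f) ?G) B = (\<integral>\<^sup>+\<omega>. f \<omega> * indicator B \<omega> \<partial>M)"
    if "B \<in> sets ?G" "f \<in> borel_measurable M" for B f
    using that sub by (subst emeasure_restr_to_subalg[OF subd]) (auto simp: emeasure_density subalgebra_def)
  have f1_le: "f1 \<omega> \<le> 1" for \<omega> by (simp add: f1_def indicator_def)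
  have "restr_to_subalg (density M f1) ?G = restr_to_subalg (density M f2) ?G"
  proof (rule measure_eqI_generator_eq[OF Int_stable_cylinders, where \<Omega> = "space M" and A = "\<lambda>_. space M"])
    show E: "?E \<subseteq> Pow (space M)" by (auto simp: cylinder_def)
    show "sets (restr_to_subalg (density M f1) ?G) = sigma_sets (space M) ?E"
      "sets (restr_to_subalg (density M f2) ?G) = sigma_sets (space M) ?E"
      by (simp_all add: sets_restr_to_subalg[OF subd] image_filtration_generated[OF s])
    fix B assume B: "B \<in> ?E"
    then have "B \<in> sets ?G" unfolding image_filtration_generated[OF s] by (rule sigma_sets.Basic)
    moreover have "good s B" using B good_cylinder[OF _ _ s] by blast
    ultimately show "emeasure (restr_to_subalg (density M f1) ?G) B = emeasure (restr_to_subalg (density M f2) ?G) B"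
      by (simp add: em f1m f2m key)
  next
    have "space M = cylinder {} (\<lambda>_. UNIV)" by (auto simp: cylinder_def)
    moreover have "cylinder {} (\<lambda>_. UNIV) \<in> ?E"
      by (intro CollectI exI[of _ "{}"] exI[of _ "\<lambda>_. UNIV"]) simp
    ultimately show "range (\<lambda>_. space M) \<subseteq> ?E" by (simp only: image_subset_iff) simp
    have "emeasure (restr_to_subalg (density M f1) ?G) (space M) = (\<integral>\<^sup>+\<omega>. f1 \<omega> * indicator (space M) \<omega> \<partial>M)"
      using sets.top[of ?G] by (intro em f1m) simp
    also have "\<dots> \<le> (\<integral>\<^sup>+\<omega>. 1 \<partial>M)" by (intro nn_integral_mono) (simp add: f1_le indicator_def)
    also have "\<dots> < \<infinity>" by (simp add: emeasure_space_1)
    finally show "emeasure (restr_to_subalg (density M f1) ?G) (space M) \<noteq> \<infinity>" by simp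
  qed auto
  then have eq: "(\<integral>\<^sup>+\<omega>. f1 \<omega> * indicator B \<omega> \<partial>M) = (\<integral>\<^sup>+\<omega>. f2 \<omega> * indicator B \<omega> \<partial>M)" if "B \<in> sets ?G" for B
    using em[OF that f1m] em[OF that f2m] by simp
  define q where "q \<omega> = measure (Q t (?Y s \<omega>)) A" for \<omega>
  have f2q: "f2 \<omega> = ennreal (q \<omega>)" for \<omega>
    unfolding f2_def q_def
    by (rule finite_measure.emeasure_eq_measure[OF prob_space.finite_measure[OF prob_Q[OF t]]])
  have q_eq: "q \<omega> = enn2real (f2 \<omega>)" for \<omega> by (simp add: f2q q_def)
  have qG: "q \<in> borel_measurable ?G"
    using f2G unfolding q_eq[abs_def] by measurable
  have qm: "q \<in> borel_measurable M" by (rule measurable_from_subalg[OF sub qG])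
  have q01: "0 \<le> q \<omega>" "q \<omega> \<le> 1" for \<omega>
    using prob_space.prob_le_1[OF prob_Q[OF t]] by (simp_all add: q_def)
  let ?f = "indicator (?Y (s + t) -` A \<inter> space M) :: 'w \<Rightarrow> real"
  have setA: "?Y (s + t) -` A \<inter> space M \<in> sets M"
    using s t by (intro measurable_sets[OF measurable_image_process A]) auto
  have intf: "integrable M ?f" by (rule integrable_real_indicator) (use setA in \<open>auto simp: emeasure_eq_measure\<close>)
  have intq: "integrable M q"
    by (rule integrable_const_bound[where B = 1]) (use q01 qm in auto)
  have "AE \<omega> in M. real_cond_exp M ?G ?f \<omega> = q \<omega>"
  proof (rule real_cond_exp_charact[OF _ intf intq qG])
    fix B assume B: "B \<in> sets ?G"
    then have BM: "B \<in> sets M" using sub by (auto simp: subalgebra_def)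
    have "ennreal (\<integral>\<omega>\<in>B. ?f \<omega> \<partial>M) = (\<integral>\<^sup>+\<omega>. f1 \<omega> * indicator B \<omega> \<partial>M)"
    proof -
      have "ennreal (\<integral>\<omega>\<in>B. ?f \<omega> \<partial>M) = (\<integral>\<^sup>+\<omega>. ennreal (indicator B \<omega> * ?f \<omega>) \<partial>M)"
        unfolding set_lebesgue_integral_def real_scaleR_def
        using integrable_mult_indicator[OF BM intf]
        by (intro nn_integral_eq_integral[symmetric]) auto
      also have "\<dots> = (\<integral>\<^sup>+\<omega>. f1 \<omega> * indicator B \<omega> \<partial>M)"
        by (intro nn_integral_cong) (auto simp: f1_def indicator_def)
      finally show ?thesis .
    qed
    also have "\<dots> = (\<integral>\<^sup>+\<omega>. f2 \<omega> * indicator B \<omega> \<partial>M)" by (rule eq[OF B])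
    also have "\<dots> = ennreal (\<integral>\<omega>\<in>B. q \<omega> \<partial>M)"
    proof -
      have "ennreal (\<integral>\<omega>\<in>B. q \<omega> \<partial>M) = (\<integral>\<^sup>+\<omega>. ennreal (indicator B \<omega> * q \<omega>) \<partial>M)"
        unfolding set_lebesgue_integral_def real_scaleR_def
        using integrable_mult_indicator[OF BM intq] q01
        by (intro nn_integral_eq_integral[symmetric]) auto
      also have "\<dots> = (\<integral>\<^sup>+\<omega>. f2 \<omega> * indicator B \<omega> \<partial>M)"
        by (intro nn_integral_cong) (auto simp: f2q indicator_def)
      finally show ?thesis by simp
    qed
    finally have "ennreal (\<integral>\<omega>\<in>B. ?f \<omega> \<partial>M) = ennreal (\<integral>\<omega>\<in>B. q \<omega> \<partial>M)" .
    moreover have "0 \<le> (\<integral>\<omega>\<in>B. ?f \<omega> \<partial>M)" "0 \<le> (\<integral>\<omega>\<in>B. q \<omega> \<partial>M)"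
      unfolding set_lebesgue_integral_def using q01 by (auto intro!: Bochner_Integration.integral_nonneg)
    ultimately show "(\<integral>\<omega>\<in>B. ?f \<omega> \<partial>M) = (\<integral>\<omega>\<in>B. q \<omega> \<partial>M)" by simp
  qed
  then show "AE \<omega> in M. real_cond_exp M ?G ?f \<omega> = measure (Q t (?Y s \<omega>)) A" by (simp add: q_def)
qed

end

lemma restrict_space_borel_UNIV: "restrict_space borel UNIV = (borel :: 'a::topological_space measure)"
  by (rule measure_eqI) (auto simp: emeasure_restrict_space)

text \<open>Passes from mixtures tested on nonnegative functions to bounded functions, by adding the bound.\<close>

lemma bounded_integral_mixture:
  fixes f :: "'b \<Rightarrow> real"
  assumes P: "prob_space P" and P': "prob_space P'" and sets: "sets P = sets N"
    and kern: "kern \<in> P' \<rightarrow>\<^sub>M prob_algebra N"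
    and eq: "\<And>g. g \<in> borel_measurable N \<Longrightarrow> (\<integral>\<^sup>+y. g y \<partial>P) = (\<integral>\<^sup>+x. \<integral>\<^sup>+y. g y \<partial>kern x \<partial>P')"
    and f: "f \<in> borel_measurable N" and bound: "\<And>y. y \<in> space N \<Longrightarrow> \<bar>f y\<bar> \<le> B"
  shows "(\<integral>y. f y \<partial>P) = (\<integral>x. \<integral>y. f y \<partial>kern x \<partial>P')"
    and "(\<lambda>x. \<integral>y. f y \<partial>kern x) \<in> borel_measurable P'"
    and "x \<in> space P' \<Longrightarrow> \<bar>\<integral>y. f y \<partial>kern x\<bar> \<le> B"
proof -
  have pk: "prob_space (kern x)" "sets (kern x) = sets N" if "x \<in> space P'" for x
    using measurable_space[OF kern that] by (simp_all add: space_prob_algebra)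
  have int: "integrable D f" and nonneg: "ennreal ((\<integral>y. f y \<partial>D) + B) = (\<integral>\<^sup>+y. ennreal (f y + B) \<partial>D)"
    and le: "\<bar>\<integral>y. f y \<partial>D\<bar> \<le> B"
    if D: "prob_space D" "sets D = sets N" for D
  proof -
    interpret prob_space D by (rule D)
    have fD: "f \<in> borel_measurable D" using f D by (simp cong: measurable_cong_sets)
    have sp: "space D = space N" by (rule sets_eq_imp_space_eq[OF D(2)])
    show int: "integrable D f"
      by (rule integrable_const_bound[where B = B]) (auto simp: fD sp bound)
    have "(\<integral>\<^sup>+y. ennreal (f y + B) \<partial>D) = ennreal (\<integral>y. f y + B \<partial>D)"
    proof (rule nn_integral_eq_integral)
      show "AE y in D. 0 \<le> f y + B"
        by (rule AE_I2) (use bound sp in \<open>fastforce simp: abs_le_iff\<close>)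
    qed (use int in simp)
    then show "ennreal ((\<integral>y. f y \<partial>D) + B) = (\<integral>\<^sup>+y. ennreal (f y + B) \<partial>D)"
      using int by (simp add: prob_space)
    have "\<bar>\<integral>y. f y \<partial>D\<bar> \<le> (\<integral>y. \<bar>f y\<bar> \<partial>D)" using integral_norm_bound[of D f] by simp
    also have "\<dots> \<le> (\<integral>y. B \<partial>D)"
      using int by (intro integral_mono) (auto simp: sp bound)
    finally show "\<bar>\<integral>y. f y \<partial>D\<bar> \<le> B" by (simp add: prob_space)
  qed
  interpret P: prob_space P by (rule P)
  interpret P': prob_space P' by (rule P')
  have B: "B \<ge> 0" using le[OF P sets] by linarith
  have gm: "(\<lambda>y. ennreal (f y + B)) \<in> borel_measurable N" using f by simp
  define h where "h x = (\<integral>\<^sup>+y. ennreal (f y + B) \<partial>kern x)" for x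
  have hm: "h \<in> borel_measurable P'"
    unfolding h_def[abs_def]
    by (rule measurable_compose[OF measurable_prob_algebraD[OF kern] nn_integral_measurable_subprob_algebra[OF gm]])
  have h: "ennreal ((\<integral>y. f y \<partial>kern x) + B) = h x" if "x \<in> space P'" for x
    unfolding h_def by (rule nonneg[OF pk[OF that]])
  have pos: "0 \<le> (\<integral>y. f y \<partial>kern x) + B" if "x \<in> space P'" for x using le[OF pk[OF that]] by linarith
  have val: "(\<integral>y. f y \<partial>kern x) = enn2real (h x) - B" if "x \<in> space P'" for x
    using h[OF that, symmetric] pos[OF that] by simp
  show Im: "(\<lambda>x. \<integral>y. f y \<partial>kern x) \<in> borel_measurable P'"
    by (subst measurable_cong[OF val]) (use hm in auto)
  show "x \<in> space P' \<Longrightarrow> \<bar>\<integral>y. f y \<partial>kern x\<bar> \<le> B" for x by (rule le[OF pk])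
  then have Iint: "integrable P' (\<lambda>x. \<integral>y. f y \<partial>kern x)"
    by (intro P'.integrable_const_bound[where B = B] AE_I2 Im) simp
  have "ennreal ((\<integral>y. f y \<partial>P) + B) = (\<integral>\<^sup>+x. h x \<partial>P')"
    unfolding nonneg[OF P sets] h_def by (rule eq[OF gm])
  also have "\<dots> = (\<integral>\<^sup>+x. ennreal ((\<integral>y. f y \<partial>kern x) + B) \<partial>P')"
    by (intro nn_integral_cong) (simp add: h)
  also have "\<dots> = ennreal (\<integral>x. (\<integral>y. f y \<partial>kern x) + B \<partial>P')"
    using Iint pos by (intro nn_integral_eq_integral AE_I2) auto
  also have "(\<integral>x. (\<integral>y. f y \<partial>kern x) + B \<partial>P') = (\<integral>x. \<integral>y. f y \<partial>kern x \<partial>P') + B"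
    using Iint by (simp add: P'.prob_space)
  finally have eq1: "ennreal ((\<integral>y. f y \<partial>P) + B) = ennreal ((\<integral>x. \<integral>y. f y \<partial>kern x \<partial>P') + B)" .
  have "0 \<le> (\<integral>x. (\<integral>y. f y \<partial>kern x) + B \<partial>P')"
    using pos by (intro integral_nonneg_AE AE_I2)
  then have "0 \<le> (\<integral>x. \<integral>y. f y \<partial>kern x \<partial>P') + B" using Iint by (simp add: P'.prob_space)
  moreover have "0 \<le> (\<integral>y. f y \<partial>P) + B" using le[OF P sets] by linarith
  ultimately show "(\<integral>y. f y \<partial>P) = (\<integral>x. \<integral>y. f y \<partial>kern x \<partial>P')" using eq1 by simp
qed

lemma continuous_AE_nonneg:
  fixes h :: "'a::euclidean_space \<Rightarrow> real"
  assumes "continuous_on UNIV h" "AE y in lborel. 0 \<le> h y"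
  shows "0 \<le> h y"
proof (rule ccontr)
  assume "\<not> 0 \<le> h y"
  then have "h y < 0" by simp
  then have ne: "{y. h y < 0} \<noteq> {}" by blast
  have op: "open {y. h y < 0}" by (rule open_Collect_less[OF assms(1) continuous_on_const])
  then have "{y. h y < 0} \<in> null_sets lborel"
    using assms(2) by (subst AE_iff_null_sets) (auto simp: not_less)
  then have "negligible {y. h y < 0}"
    by (simp add: negligible_iff_null_sets null_sets_completionI)
  then show False using open_not_negligible[OF op ne] by blast
qed

section \<open>Dunkl processes started from radial laws\<close>

locale dunkl_motion = dunkl_data R Rp k
  for R Rp :: "(real^'n) set" and k :: "real^'n \<Rightarrow> real" +
  fixes lam :: "real^'n" and M :: "'w measure" and X :: "real \<Rightarrow> 'w \<Rightarrow> real^'n"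
    and K :: "real \<Rightarrow> real^'n \<Rightarrow> (real^'n) measure"
  assumes feller: "feller_semigroup UNIV K"
    and markov: "markov_process M UNIV K X"
    and transition: "\<And>t x A. t > 0 \<Longrightarrow> A \<in> sets borel \<Longrightarrow>
      complex_of_real (measure (K t x) A) = dunkl_transition Rp k lam t x A"
    and rcll: "rcll_paths M X"
    and radial_0: "dunkl_radial Rp k lam (distr M borel (X 0))"
begin

abbreviation "\<rho> \<equiv> norm lam"
abbreviation "I \<equiv> bessel_I (\<kappa> - 1)"

lemma K_measurable: "t \<ge> 0 \<Longrightarrow> K t \<in> borel \<rightarrow>\<^sub>M prob_algebra borel"
  using feller by (simp add: feller_semigroup_def restrict_space_borel_UNIV)

lemma K_0: "K 0 x = return borel x"
  using feller by (simp add: feller_semigroup_def restrict_space_borel_UNIV)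

lemma K_add: "s \<ge> 0 \<Longrightarrow> t \<ge> 0 \<Longrightarrow> K (s + t) x = K s x \<bind> K t"
  using feller by (simp add: feller_semigroup_def)

lemma prob_K: "t \<ge> 0 \<Longrightarrow> prob_space (K t x)" and sets_K: "t \<ge> 0 \<Longrightarrow> sets (K t x) = sets borel"
  using measurable_space[OF K_measurable, of t x] by (simp_all add: space_prob_algebra)

lemma I_ge_1: "I u \<ge> 1" by (rule bessel_I_ge_1[OF kappa_index])

lemma I_pos: "I u > 0" by (rule bessel_I_pos[OF kappa_index])

lemma I_measurable [measurable (raw)]: "f \<in> borel_measurable N \<Longrightarrow> (\<lambda>x. I (f x)) \<in> borel_measurable N"
  by (rule bessel_I_measurable[OF kappa_index])

definition dens :: "real \<Rightarrow> real^'n \<Rightarrow> real^'n \<Rightarrow> real" where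
  "dens t x y = dunkl_c Rp k * exp (- \<rho>\<^sup>2 * t / 2) / t powr \<kappa> *
     (exp (- ((norm x)\<^sup>2 + (norm y)\<^sup>2) / (2 * t)) *
      (real_E ((1 / sqrt t) *\<^sub>R x) ((1 / sqrt t) *\<^sub>R y) * real_E y lam / real_E x lam) * wt y)"

lemma dens_measurable [measurable]: "(\<lambda>p. dens t (fst p) (snd p)) \<in> borel_measurable (borel \<Otimes>\<^sub>M borel)"
  unfolding dens_def by measurable

lemma dens_measurable_2 [measurable]: "dens t x \<in> borel_measurable borel"
  unfolding dens_def[abs_def] by measurable

lemma dens_integrable: assumes t: "t > 0" shows "integrable lborel (dens t x)"
proof -
  obtain Kw a where Kw: "Kw \<ge> 0" "\<And>y. cmod (complex_of_real (wt y)) \<le> Kw * (1 + norm y) powr a"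
    using poly_growthE[OF poly_growth_weight] by metis
  define c where "c = \<bar>dunkl_c Rp k * exp (- \<rho>\<^sup>2 * t / 2) / t powr \<kappa>\<bar> * (1 / \<bar>real_E x lam\<bar>)"
  have c: "c \<ge> 0" by (simp add: c_def)
  have "norm (dens t x y) \<le> (c * Kw) * (1 + norm y) powr a * exp ((norm x / t + \<rho>) * norm y - (1 / (2 * t)) * (norm y)\<^sup>2)" for y
  proof -
    have e: "exp (- ((norm x)\<^sup>2 + (norm y)\<^sup>2) / (2 * t)) \<le> exp (- (1 / (2 * t)) * (norm y)\<^sup>2)"
      using t by (simp add: divide_simps)
    have E1: "\<bar>real_E ((1 / sqrt t) *\<^sub>R x) ((1 / sqrt t) *\<^sub>R y)\<bar> \<le> exp (norm x / t * norm y)"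
      using real_E_bound[of "(1 / sqrt t) *\<^sub>R x" "(1 / sqrt t) *\<^sub>R y"] t by simp
    have E2: "\<bar>real_E y lam\<bar> \<le> exp (\<rho> * norm y)" using real_E_bound[of y lam] by (simp add: mult.commute)
    have w: "wt y \<le> Kw * (1 + norm y) powr a" using Kw(2)[of y] weight_nonneg[of y] by simp
    have "norm (dens t x y) = c * (exp (- ((norm x)\<^sup>2 + (norm y)\<^sup>2) / (2 * t)) *
        (\<bar>real_E ((1 / sqrt t) *\<^sub>R x) ((1 / sqrt t) *\<^sub>R y)\<bar> * \<bar>real_E y lam\<bar>) * wt y)"
      by (simp add: dens_def c_def abs_mult abs_divide weight_nonneg)
    also have "\<dots> \<le> c * (exp (- (1 / (2 * t)) * (norm y)\<^sup>2) *
        (exp (norm x / t * norm y) * exp (\<rho> * norm y)) * (Kw * (1 + norm y) powr a))"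
      by (intro mult_left_mono[OF _ c] mult_mono e E1 E2 w) (auto simp: weight_nonneg)
    also have "\<dots> = (c * Kw) * (1 + norm y) powr a * exp ((norm x / t + \<rho>) * norm y - (1 / (2 * t)) * (norm y)\<^sup>2)"
      by (simp add: algebra_simps flip: exp_add)
    finally show ?thesis .
  qed
  then show ?thesis using t by (intro integrable_gaussian_bound[where c = "1 / (2 * t)"]) auto
qed

lemma measure_K:
  assumes t: "t > 0" and A: "A \<in> sets borel"
  shows "measure (K t x) A = (\<integral>y. indicator A y * dens t x y \<partial>lborel)"
proof -
  let ?c = "dunkl_c Rp k * exp (- \<rho>\<^sup>2 * t / 2) / t powr \<kappa>"
  let ?d = "\<lambda>y. exp (- ((norm x)\<^sup>2 + (norm y)\<^sup>2) / (2 * t)) *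
      (real_E ((1 / sqrt t) *\<^sub>R x) ((1 / sqrt t) *\<^sub>R y) * real_E y lam / real_E x lam) * wt y"
  have "complex_of_real (measure (K t x) A)
      = complex_of_real ?c * (\<integral>y. indicator A y *\<^sub>R complex_of_real (?d y) \<partial>lborel)"
    unfolding transition[OF t A] dunkl_transition_def dunkl_E_eq set_lebesgue_integral_def \<kappa>_def[symmetric]
    by simp
  also have "(\<integral>y. indicator A y *\<^sub>R complex_of_real (?d y) \<partial>lborel)
      = (\<integral>y. complex_of_real (indicator A y * ?d y) \<partial>lborel)"
    by (intro Bochner_Integration.integral_cong refl) (simp add: indicator_def)
  also have "\<dots> = complex_of_real (\<integral>y. indicator A y * ?d y \<partial>lborel)" by (rule integral_complex_of_real)
  finally have "complex_of_real (measure (K t x) A) = complex_of_real (?c * (\<integral>y. indicator A y * ?d y \<partial>lborel))"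
    by (simp only: of_real_mult)
  then have "measure (K t x) A = ?c * (\<integral>y. indicator A y * ?d y \<partial>lborel)" by (simp only: of_real_eq_iff)
  also have "\<dots> = (\<integral>y. ?c * (indicator A y * ?d y) \<partial>lborel)" by (rule integral_mult_right_zero[symmetric])
  also have "\<dots> = (\<integral>y. indicator A y * dens t x y \<partial>lborel)"
    by (intro Bochner_Integration.integral_cong refl) (simp add: dens_def mult_ac)
  finally show ?thesis .
qed

text \<open>Division by zero yields zero, so a zero of the kernel would make the transition density vanish
  identically and contradict total mass one.\<close>

lemma real_E_lam_nonzero: "real_E x lam \<noteq> 0"
proof
  assume "real_E x lam = 0"
  then have "measure (K 1 x) UNIV = 0" by (simp add: measure_K dens_def)
  moreover have "measure (K 1 x) UNIV = 1"
    using prob_space.prob_space[OF prob_K, of 1 x] sets_eq_imp_space_eq[OF sets_K, of 1 x] by simp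
  ultimately show False by simp
qed

text \<open>The kernel equals one at the origin and has no zeros along the segment to \<^term>\<open>x\<close>.\<close>

lemma real_E_lam_pos: "real_E x lam > 0"
proof (rule ccontr)
  assume "\<not> real_E x lam > 0"
  then have neg: "real_E x lam \<le> 0" by simp
  have "continuous_on {0..1} (\<lambda>s. - real_E (s *\<^sub>R x) lam)" by (intro continuous_intros)
  moreover have "- real_E (0 *\<^sub>R x) lam \<le> 0" "0 \<le> - real_E (1 *\<^sub>R x) lam" using neg by simp_all
  ultimately obtain s where "- real_E (s *\<^sub>R x) lam = 0"
    using IVT'[of "\<lambda>s. - real_E (s *\<^sub>R x) lam" 0 0 1] by auto
  then show False using real_E_lam_nonzero by simp
qed

text \<open>Radiality of the initial law already implies it: otherwise the factor \<open>1/0 = 0\<close> in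
  the definition would make its total mass vanish.\<close>

lemma dd_pos: "dd > 0"
proof -
  have "dd \<ge> 0" unfolding dunkl_d_def by (rule integral_nonneg_AE) (simp add: weight_nonneg)
  moreover have "dd \<noteq> 0"
  proof
    assume dd0: "dd = 0"
    have pM: "prob_space (distr M borel (X 0))" using radial_0 by (simp add: dunkl_radial_def)
    obtain \<nu> :: "real measure" where "\<forall>f :: real^'n \<Rightarrow> real. f \<in> borel_measurable borel \<longrightarrow> bounded (range f) \<longrightarrow>
           complex_of_real (LINT x|distr M borel (X 0). f x) =
           1 / complex_of_real dd *
           (LINT r|\<nu>. LINT z|sphere_measure.
              complex_of_real (f (r *\<^sub>R z)) * dunkl_E Rp k lam (r *\<^sub>R z) /
              bessel_j (mult_gamma Rp k + real CARD('n) / 2 - 1)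
                (\<i> * complex_of_real (norm lam * r)) *
              complex_of_real (dunkl_weight Rp k z))"
      using radial_0 unfolding dunkl_radial_def by blast
    from this[rule_format, of "\<lambda>x. 1"] have "complex_of_real (LINT x|distr M borel (X 0). 1) = 0"
      by (simp add: dd0)
    then show False using prob_space.prob_space[OF pM] by simp
  qed
  ultimately show ?thesis by simp
qed

lemma Gamma_kappa_pos: "Gamma \<kappa> > 0" using kappa_ge by (intro Gamma_real_pos) simp

lemma c_pos: "dunkl_c Rp k > 0"
  unfolding dunkl_c_eq using dd_pos Gamma_kappa_pos by simp

lemma dens_AE_nonneg: assumes t: "t > 0" shows "AE y in lborel. 0 \<le> dens t x y"
proof -
  let ?A = "{y. dens t x y < 0}"
  have A [measurable]: "?A \<in> sets borel" by measurable
  have int: "integrable lborel (\<lambda>y. indicator ?A y * dens t x y)"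
    using integrable_mult_indicator[OF _ dens_integrable[OF t], of ?A] by simp
  have le: "AE y in lborel. 0 \<le> - (indicator ?A y * dens t x y)" by (simp add: indicator_def)
  have "(\<integral>y. - (indicator ?A y * dens t x y) \<partial>lborel) = - measure (K t x) ?A"
    by (simp add: measure_K[OF t A])
  moreover have "0 \<le> (\<integral>y. - (indicator ?A y * dens t x y) \<partial>lborel)" by (rule integral_nonneg_AE[OF le])
  ultimately have "(\<integral>y. - (indicator ?A y * dens t x y) \<partial>lborel) = 0"
    using measure_nonneg[of "K t x" ?A] by linarith
  then have "AE y in lborel. - (indicator ?A y * dens t x y) = 0"
    using integral_nonneg_eq_0_iff_AE[OF Bochner_Integration.integrable_minus[OF int] le] by blast
  then show ?thesis by eventually_elim (auto simp: indicator_def split: if_splits)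
qed

lemma weight_pos: "(\<And>\<alpha>. \<alpha> \<in> Rp \<Longrightarrow> \<alpha> \<bullet> y \<noteq> 0) \<Longrightarrow> wt y > 0"
  by (simp add: weight_eq_exp smooth_weight_def)

text \<open>At time one the transition density is the kernel times a factor that is positive off the mirrors.
  As the transition kernels are measures, the kernel is nonnegative almost everywhere, hence everywhere.\<close>

lemma real_E_nonneg: "real_E x y \<ge> 0"
proof (rule continuous_AE_nonneg[of "real_E x"])
  show "continuous_on UNIV (real_E x)" by (intro continuous_intros)
  show "AE y in lborel. 0 \<le> real_E x y"
    using dens_AE_nonneg[OF zero_less_one, of x] AE_regular
  proof eventually_elim
    case (elim y)
    define q where "q = dunkl_c Rp k * exp (- \<rho>\<^sup>2 * 1 / 2) / 1 powr \<kappa> *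
      (exp (- ((norm x)\<^sup>2 + (norm y)\<^sup>2) / (2 * 1)) * (real_E y lam / real_E x lam) * wt y)"
    have "0 < q"
      unfolding q_def using elim(2)
      by (intro mult_pos_pos divide_pos_pos c_pos real_E_lam_pos weight_pos) auto
    moreover have "dens 1 x y = real_E x y * q"
      by (simp add: dens_def q_def)
    ultimately show ?case using elim(1) by (simp add: zero_le_mult_iff)
  qed
qed

lemma dens_nonneg: "t > 0 \<Longrightarrow> dens t x y \<ge> 0"
  unfolding dens_def
  by (intro mult_nonneg_nonneg divide_nonneg_nonneg real_E_nonneg weight_nonneg less_imp_le[OF c_pos]) auto

lemma K_density: assumes t: "t > 0" shows "K t x = density lborel (\<lambda>y. ennreal (dens t x y))"
proof (rule measure_eqI)
  fix A assume "A \<in> sets (K t x)"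
  then have A [measurable]: "A \<in> sets borel" using sets_K t by simp
  have "emeasure (K t x) A = ennreal (measure (K t x) A)"
    using t by (intro finite_measure.emeasure_eq_measure prob_space.finite_measure prob_K) simp
  also have "\<dots> = (\<integral>\<^sup>+y. ennreal (indicator A y * dens t x y) \<partial>lborel)"
    unfolding measure_K[OF t A]
    by (rule nn_integral_eq_integral[symmetric])
       (use integrable_mult_indicator[OF _ dens_integrable[OF t], of A] dens_nonneg[OF t] in auto)
  also have "\<dots> = (\<integral>\<^sup>+y. ennreal (dens t x y) * indicator A y \<partial>lborel)"
    by (intro nn_integral_cong) (simp add: indicator_def)
  also have "\<dots> = emeasure (density lborel (\<lambda>y. ennreal (dens t x y))) A"
    by (rule emeasure_density[symmetric]) auto
  finally show "emeasure (K t x) A = emeasure (density lborel (\<lambda>y. ennreal (dens t x y))) A" .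
qed (use sets_K t in simp)

lemma nn_integral_K:
  assumes "t > 0" "g \<in> borel_measurable borel"
  shows "(\<integral>\<^sup>+y. g y \<partial>K t x) = (\<integral>\<^sup>+y. ennreal (dens t x y) * g y \<partial>lborel)"
  unfolding K_density[OF assms(1)] by (rule nn_integral_density) (use assms in auto)

subsection \<open>The law on a sphere\<close>

text \<open>Density on the unit sphere of the angular part at radius \<^term>\<open>r\<close>, normalized by the spherical mean.\<close>

definition sdens :: "real \<Rightarrow> real^'n \<Rightarrow> real" where
  "sdens r z = wt z * real_E (r *\<^sub>R z) lam / (dd * I (r * \<rho>))"

definition L :: "real \<Rightarrow> (real^'n) measure" where
  "L r = distr (density sphere_measure (\<lambda>z. ennreal (sdens r z))) borel (\<lambda>z. r *\<^sub>R z)"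

lemma sdens_nonneg: "sdens r z \<ge> 0"
  unfolding sdens_def
  by (intro divide_nonneg_pos mult_nonneg_nonneg mult_pos_pos weight_nonneg real_E_nonneg dd_pos I_pos)

lemma sdens_measurable: "sdens r \<in> borel_measurable borel"
  unfolding sdens_def[abs_def] by measurable

lemma sdens_measurable_sphere [measurable]: "sdens r \<in> borel_measurable (sphere_measure :: (real^'n) measure)"
  by (rule borel_measurable_sphere[OF sdens_measurable])

lemma scale_measurable_sphere [measurable]: "(\<lambda>z. r *\<^sub>R z) \<in> (sphere_measure :: (real^'n) measure) \<rightarrow>\<^sub>M borel"
  by (rule borel_measurable_sphere) measurable

lemma sdens_integrable: "integrable sphere_measure (sdens r)"
  unfolding sdens_def[abs_def] using sphere_integrable_E[of r lam] by (rule integrable_divide)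

lemma sdens_integral: "(\<integral>z. sdens r z \<partial>sphere_measure) = 1"
proof -
  have "(\<integral>z. sdens r z \<partial>sphere_measure) = (\<integral>z. wt z * real_E (r *\<^sub>R z) lam \<partial>sphere_measure) / (dd * I (r * \<rho>))"
    unfolding sdens_def by simp
  then show ?thesis using dd_pos I_pos[of "r * \<rho>"] by (simp add: spherical_mean)
qed

lemma nn_integral_L:
  assumes [measurable]: "g \<in> borel_measurable borel"
  shows "(\<integral>\<^sup>+x. g x \<partial>L r) = (\<integral>\<^sup>+z. ennreal (sdens r z) * g (r *\<^sub>R z) \<partial>sphere_measure)"
  unfolding L_def by (subst nn_integral_distr) (auto simp: nn_integral_density)

lemma sets_L: "sets (L r) = sets borel" by (simp add: L_def)

lemma space_L: "space (L r) = UNIV" by (simp add: L_def)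

lemma prob_L: "prob_space (L r)"
proof
  have sp: "space (L r) = UNIV" by (simp add: L_def)
  have "emeasure (L r) (space (L r)) = (\<integral>\<^sup>+x. 1 \<partial>L r)" by simp
  also have "\<dots> = (\<integral>\<^sup>+z. ennreal (sdens r z) \<partial>sphere_measure)"
    by (subst nn_integral_L) auto
  also have "\<dots> = ennreal (\<integral>z. sdens r z \<partial>sphere_measure)"
    by (rule nn_integral_eq_integral[OF sdens_integrable]) (simp add: sdens_nonneg)
  finally show "emeasure (L r) (space (L r)) = 1" by (simp add: sdens_integral)
qed

lemma polar_pair_measurable:
  assumes "f \<in> borel_measurable (borel \<Otimes>\<^sub>M borel)"
  shows "(\<lambda>p. f (fst p, snd p)) \<in> borel_measurable ((borel :: real measure) \<Otimes>\<^sub>M (sphere_measure :: (real^'n) measure))"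
proof -
  have "snd \<in> (borel :: real measure) \<Otimes>\<^sub>M (sphere_measure :: (real^'n) measure) \<rightarrow>\<^sub>M borel"
    by (rule measurable_compose[OF measurable_snd borel_measurable_sphere]) simp
  then have "(\<lambda>p. (fst p, snd p)) \<in> (borel :: real measure) \<Otimes>\<^sub>M (sphere_measure :: (real^'n) measure) \<rightarrow>\<^sub>M borel \<Otimes>\<^sub>M borel"
    by (intro measurable_Pair measurable_fst)
  then show ?thesis by (rule measurable_compose[OF _ assms])
qed

lemma L_measurable: "L \<in> borel \<rightarrow>\<^sub>M prob_algebra borel"
proof (rule measurable_prob_algebraI[OF prob_L], rule measurable_subprob_algebra)
  show "subprob_space (L r)" for r by (rule prob_space_imp_subprob_space[OF prob_L])
  fix A :: "(real^'n) set" assume A: "A \<in> sets borel"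
  interpret sphere: finite_measure "sphere_measure :: (real^'n) measure" by (rule finite_sphere_measure)
  have "(\<lambda>p. ennreal (sdens (fst p) (snd p)) * indicator A (fst p *\<^sub>R snd p)) \<in> borel_measurable (borel \<Otimes>\<^sub>M borel)"
    using A unfolding sdens_def by measurable
  from polar_pair_measurable[OF this]
  have "(\<lambda>r. \<integral>\<^sup>+z. ennreal (sdens r z) * indicator A (r *\<^sub>R z) \<partial>(sphere_measure :: (real^'n) measure)) \<in> borel_measurable borel"
    by (intro sphere.borel_measurable_nn_integral) (simp add: case_prod_beta)
  moreover have "emeasure (L r) A = (\<integral>\<^sup>+z. ennreal (sdens r z) * indicator A (r *\<^sub>R z) \<partial>sphere_measure)" for r
  proof -
    have "emeasure (L r) A = (\<integral>\<^sup>+x. indicator A x \<partial>L r)" using A by (simp add: sets_L)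
    also have "\<dots> = (\<integral>\<^sup>+z. ennreal (sdens r z) * indicator A (r *\<^sub>R z) \<partial>sphere_measure)"
      by (rule nn_integral_L) (use A in simp)
    finally show ?thesis .
  qed
  ultimately show "(\<lambda>r. emeasure (L r) A) \<in> borel_measurable borel" by simp
qed (simp add: sets_L)

lemma L_fibre: assumes "r \<ge> 0" shows "AE x in L r. norm x = r"
proof -
  have "AE z in density sphere_measure (\<lambda>z. ennreal (sdens r z)). norm (r *\<^sub>R z) = r"
    by (subst AE_density) (auto simp: space_sphere_measure assms intro!: AE_I2)
  then show ?thesis unfolding L_def by (subst AE_distr_iff) auto
qed

lemma L_fibre_const:
  assumes r: "r \<ge> 0" and [measurable]: "h \<in> borel_measurable borel"
  shows "(\<integral>\<^sup>+x. h (norm x) \<partial>L r) = h r"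
proof -
  have "(\<integral>\<^sup>+x. h (norm x) \<partial>L r) = (\<integral>\<^sup>+x. h r \<partial>L r)"
    using L_fibre[OF r] by (intro nn_integral_cong_AE) (auto elim!: eventually_mono)
  then show ?thesis using prob_space.emeasure_space_1[OF prob_L] by simp
qed

lemma measurable_L_integral:
  assumes "g \<in> borel_measurable borel" shows "(\<lambda>r. \<integral>\<^sup>+x. g x \<partial>L r) \<in> borel_measurable borel"
  by (rule measurable_compose[OF measurable_prob_algebraD[OF L_measurable] nn_integral_measurable_subprob_algebra[OF assms]])

text \<open>In polar coordinates the part of the transition density that depends on the endpoint only is a multiple
  of the density of \<^term>\<open>L\<close> on every sphere, and the multiple is the normalizing factor of
  \<^term>\<open>L\<close>.\<close>

lemma nn_integral_disintegrate:
  assumes b [measurable]: "b \<in> borel_measurable borel" and g [measurable]: "g \<in> borel_measurable borel"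
  shows "(\<integral>\<^sup>+y. b (norm y) * ennreal (wt y * real_E y lam) * g y \<partial>lborel)
    = (\<integral>\<^sup>+s. b s * ennreal (s powr (2 * \<gamma>) * (dd * I (s * \<rho>))) * (\<integral>\<^sup>+x. g x \<partial>L s) \<partial>radial_measure CARD('n))"
proof -
  have "(\<integral>\<^sup>+y. b (norm y) * ennreal (wt y * real_E y lam) * g y \<partial>lborel)
    = (\<integral>\<^sup>+s. \<integral>\<^sup>+z. b (norm (s *\<^sub>R z)) * ennreal (wt (s *\<^sub>R z) * real_E (s *\<^sub>R z) lam) * g (s *\<^sub>R z)
        \<partial>sphere_measure \<partial>radial_measure CARD('n))"
    by (rule nn_integral_polar) measurable
  also have "\<dots> = (\<integral>\<^sup>+s. b s * ennreal (s powr (2 * \<gamma>) * (dd * I (s * \<rho>))) * (\<integral>\<^sup>+x. g x \<partial>L s) \<partial>radial_measure CARD('n))"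
  proof (rule nn_integral_cong_AE)
    have "AE s in radial_measure CARD('n). s > 0"
      unfolding radial_measure_def by (subst AE_density) (auto simp: indicator_def)
    then show "AE s in radial_measure CARD('n).
      (\<integral>\<^sup>+z. b (norm (s *\<^sub>R z)) * ennreal (wt (s *\<^sub>R z) * real_E (s *\<^sub>R z) lam) * g (s *\<^sub>R z) \<partial>sphere_measure)
      = b s * ennreal (s powr (2 * \<gamma>) * (dd * I (s * \<rho>))) * (\<integral>\<^sup>+x. g x \<partial>L s)"
    proof eventually_elim
      case (elim s)
      have "(\<integral>\<^sup>+z. b (norm (s *\<^sub>R z)) * ennreal (wt (s *\<^sub>R z) * real_E (s *\<^sub>R z) lam) * g (s *\<^sub>R z) \<partial>sphere_measure)
        = (\<integral>\<^sup>+z. (b s * ennreal (s powr (2 * \<gamma>) * (dd * I (s * \<rho>)))) * (ennreal (sdens s z) * g (s *\<^sub>R z)) \<partial>sphere_measure)"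
      proof (rule nn_integral_cong)
        fix z :: "real^'n" assume "z \<in> space sphere_measure"
        then have z: "norm (s *\<^sub>R z) = s" using elim by (simp add: space_sphere_measure)
        have eq: "wt (s *\<^sub>R z) * real_E (s *\<^sub>R z) lam = (s powr (2 * \<gamma>) * (dd * I (s * \<rho>))) * sdens s z"
          using dd_pos I_pos[of "s * \<rho>"] elim by (simp add: sdens_def weight_scale)
        have "ennreal (wt (s *\<^sub>R z) * real_E (s *\<^sub>R z) lam) = ennreal (s powr (2 * \<gamma>) * (dd * I (s * \<rho>))) * ennreal (sdens s z)"
          unfolding eq using dd_pos I_pos[of "s * \<rho>"] by (intro ennreal_mult') simp
        then show "b (norm (s *\<^sub>R z)) * ennreal (wt (s *\<^sub>R z) * real_E (s *\<^sub>R z) lam) * g (s *\<^sub>R z)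
          = (b s * ennreal (s powr (2 * \<gamma>) * (dd * I (s * \<rho>)))) * (ennreal (sdens s z) * g (s *\<^sub>R z))"
          unfolding z by (simp only: mult_ac)
      qed
      also have "\<dots> = (b s * ennreal (s powr (2 * \<gamma>) * (dd * I (s * \<rho>)))) * (\<integral>\<^sup>+z. ennreal (sdens s z) * g (s *\<^sub>R z) \<partial>sphere_measure)"
        by (rule nn_integral_cmult) (use measurable_compose[OF scale_measurable_sphere g] in measurable)
      finally show ?case by (simp add: nn_integral_L)
    qed
  qed
  finally show ?thesis .
qed

text \<open>What the transition density becomes after averaging over the starting sphere: a function of the two radii,
  relative to \<^term>\<open>wt y * real_E y lam\<close>.\<close>

definition rdens :: "real \<Rightarrow> real \<Rightarrow> real \<Rightarrow> real" where
  "rdens t r s = dunkl_c Rp k * exp (- \<rho>\<^sup>2 * t / 2) / t powr \<kappa> * exp (- (r\<^sup>2 + s\<^sup>2) / (2 * t)) * I (r * s / t) / I (r * \<rho>)"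

lemma rdens_nonneg: "rdens t r s \<ge> 0"
  unfolding rdens_def
  by (intro divide_nonneg_pos mult_nonneg_nonneg I_pos less_imp_le[OF c_pos] less_imp_le[OF I_pos] divide_nonneg_nonneg) auto

lemma rdens_measurable [measurable]: "rdens t r \<in> borel_measurable borel"
  unfolding rdens_def[abs_def] by measurable

text \<open>The density of the starting law cancels the denominator of the transition density. The integral over
  starting points then only sees the kernel and the weight, so the spherical mean replaces
  it by a Bessel function of the norm of the endpoint.\<close>

lemma nn_integral_LK:
  assumes t: "t > 0" and r: "r \<ge> 0" and g [measurable]: "g \<in> borel_measurable borel"
  shows "(\<integral>\<^sup>+x. \<integral>\<^sup>+y. g y \<partial>K t x \<partial>L r)
    = (\<integral>\<^sup>+y. ennreal (rdens t r (norm y)) * ennreal (wt y * real_E y lam) * g y \<partial>lborel)"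
proof -
  interpret sphere: finite_measure "sphere_measure :: (real^'n) measure" by (rule finite_sphere_measure)
  interpret pair: pair_sigma_finite "lborel :: (real^'n) measure" "sphere_measure :: (real^'n) measure" ..
  let ?S = "sphere_measure :: (real^'n) measure"
  have joint: "(\<lambda>p. dens t (r *\<^sub>R snd p) (fst p)) \<in> borel_measurable (lborel \<Otimes>\<^sub>M ?S)"
  proof -
    have "(\<lambda>p. (r *\<^sub>R snd p, fst p)) \<in> lborel \<Otimes>\<^sub>M ?S \<rightarrow>\<^sub>M borel \<Otimes>\<^sub>M borel"
      by (intro measurable_Pair measurable_compose[OF measurable_snd scale_measurable_sphere])
         (simp add: measurable_fst'')
    from measurable_compose[OF this dens_measurable] show ?thesis by simp
  qed
  have "(\<integral>\<^sup>+x. \<integral>\<^sup>+y. g y \<partial>K t x \<partial>L r) = (\<integral>\<^sup>+z. ennreal (sdens r z) * (\<integral>\<^sup>+y. g y \<partial>K t (r *\<^sub>R z)) \<partial>?S)"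
    by (rule nn_integral_L)
       (rule measurable_compose[OF measurable_prob_algebraD[OF K_measurable] nn_integral_measurable_subprob_algebra[OF g]], use t in simp)
  also have "\<dots> = (\<integral>\<^sup>+z. \<integral>\<^sup>+y. ennreal (sdens r z) * (ennreal (dens t (r *\<^sub>R z) y) * g y) \<partial>lborel \<partial>?S)"
    by (intro nn_integral_cong) (simp add: nn_integral_K[OF t g] nn_integral_cmult)
  also have "\<dots> = (\<integral>\<^sup>+y. \<integral>\<^sup>+z. ennreal (sdens r z) * (ennreal (dens t (r *\<^sub>R z) y) * g y) \<partial>?S \<partial>lborel)"
  proof (rule pair.Fubini'[of "\<lambda>y z. ennreal (sdens r z) * (ennreal (dens t (r *\<^sub>R z) y) * g y)"])
    show "(\<lambda>(y, z). ennreal (sdens r z) * (ennreal (dens t (r *\<^sub>R z) y) * g y)) \<in> borel_measurable (lborel \<Otimes>\<^sub>M ?S)"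
      unfolding case_prod_beta using joint by measurable
  qed
  also have "\<dots> = (\<integral>\<^sup>+y. ennreal (rdens t r (norm y)) * ennreal (wt y * real_E y lam) * g y \<partial>lborel)"
  proof (rule nn_integral_cong)
    fix y :: "real^'n"
    define q where "q = dunkl_c Rp k * exp (- \<rho>\<^sup>2 * t / 2) / t powr \<kappa> * exp (- (r\<^sup>2 + (norm y)\<^sup>2) / (2 * t))
        * (wt y * real_E y lam) / (dd * I (r * \<rho>))"
    have q: "q \<ge> 0"
      unfolding q_def
      by (intro divide_nonneg_pos mult_nonneg_nonneg mult_pos_pos dd_pos I_pos less_imp_le[OF c_pos]
          divide_nonneg_nonneg weight_nonneg real_E_nonneg) auto
    let ?E = "\<lambda>z. wt z * real_E ((r / sqrt t) *\<^sub>R z) ((1 / sqrt t) *\<^sub>R y)"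
    have E0: "?E z \<ge> 0" for z by (intro mult_nonneg_nonneg weight_nonneg real_E_nonneg)
    have Em: "(\<lambda>z. ?E z) \<in> borel_measurable ?S"
      by (rule borel_measurable_sphere) measurable
    have "(\<integral>\<^sup>+z. ennreal (sdens r z) * (ennreal (dens t (r *\<^sub>R z) y) * g y) \<partial>?S)
        = (\<integral>\<^sup>+z. (ennreal q * g y) * ennreal (?E z) \<partial>?S)"
    proof (rule nn_integral_cong)
      fix z assume "z \<in> space ?S"
      then have z: "norm z = 1" by (simp add: space_sphere_measure)
      have "sdens r z * dens t (r *\<^sub>R z) y = q * ?E z"
        using real_E_lam_pos[of "r *\<^sub>R z"] z r by (simp add: sdens_def dens_def q_def mult_ac)
      moreover have "ennreal (sdens r z) * (ennreal (dens t (r *\<^sub>R z) y) * g y) = ennreal (sdens r z * dens t (r *\<^sub>R z) y) * g y"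
        using sdens_nonneg dens_nonneg[OF t] by (simp add: ennreal_mult mult.assoc)
      ultimately show "ennreal (sdens r z) * (ennreal (dens t (r *\<^sub>R z) y) * g y) = (ennreal q * g y) * ennreal (?E z)"
        using q E0 by (simp add: ennreal_mult mult_ac)
    qed
    also have "\<dots> = (ennreal q * g y) * (\<integral>\<^sup>+z. ennreal (?E z) \<partial>?S)"
      by (rule nn_integral_cmult) (use Em in simp)
    also have "(\<integral>\<^sup>+z. ennreal (?E z) \<partial>?S) = ennreal (\<integral>z. ?E z \<partial>?S)"
      by (rule nn_integral_eq_integral[OF sphere_integrable_E]) (simp add: E0)
    also have "(\<integral>z. ?E z \<partial>?S) = dd * I (r * norm y / t)"
      using t spherical_mean[of "r / sqrt t" "(1 / sqrt t) *\<^sub>R y"] by (simp add: mult.commute)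
    also have "(ennreal q * g y) * ennreal (dd * I (r * norm y / t)) = ennreal (q * (dd * I (r * norm y / t))) * g y"
      using q dd_pos I_pos[of "r * norm y / t"] by (simp add: ennreal_mult' mult_ac)
    also have "q * (dd * I (r * norm y / t)) = rdens t r (norm y) * (wt y * real_E y lam)"
      using dd_pos by (simp add: q_def rdens_def)
    also have "ennreal (rdens t r (norm y) * (wt y * real_E y lam)) = ennreal (rdens t r (norm y)) * ennreal (wt y * real_E y lam)"
      by (intro ennreal_mult rdens_nonneg mult_nonneg_nonneg weight_nonneg real_E_nonneg)
    finally show "(\<integral>\<^sup>+z. ennreal (sdens r z) * (ennreal (dens t (r *\<^sub>R z) y) * g y) \<partial>?S)
      = ennreal (rdens t r (norm y)) * ennreal (wt y * real_E y lam) * g y" .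
  qed
  finally show ?thesis .
qed

lemma nn_integral_LK_radial:
  assumes "t > 0" "r \<ge> 0" and g: "g \<in> borel_measurable borel"
  shows "(\<integral>\<^sup>+x. \<integral>\<^sup>+y. g y \<partial>K t x \<partial>L r)
    = (\<integral>\<^sup>+s. ennreal (rdens t r s) * ennreal (s powr (2 * \<gamma>) * (dd * I (s * \<rho>))) * (\<integral>\<^sup>+x. g x \<partial>L s) \<partial>radial_measure CARD('n))"
  unfolding nn_integral_LK[OF assms]
  by (rule nn_integral_disintegrate[of "\<lambda>s. ennreal (rdens t r s)" g]) (use g in auto)

text \<open>The averaged density is radial relative to \<^term>\<open>wt y * real_E y lam\<close>, so by disintegration the integral sees
  \<^term>\<open>g\<close> only through its means over the laws \<^term>\<open>L s\<close>.\<close>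

theorem intertwining:
  assumes r: "r \<ge> 0" and t: "t \<ge> 0" and g: "g \<in> borel_measurable borel"
  shows "(\<integral>\<^sup>+x. \<integral>\<^sup>+y. g y \<partial>K t x \<partial>L r) = (\<integral>\<^sup>+x. \<integral>\<^sup>+y. \<integral>\<^sup>+z. g z \<partial>L (norm y) \<partial>K t x \<partial>L r)"
proof -
  define h where "h s = (\<integral>\<^sup>+z. g z \<partial>L s)" for s
  have h [measurable]: "h \<in> borel_measurable borel" unfolding h_def[abs_def] by (rule measurable_L_integral[OF g])
  have hn: "(\<lambda>y::real^'n. h (norm y)) \<in> borel_measurable borel" by measurable
  have "(\<integral>\<^sup>+x. \<integral>\<^sup>+y. g y \<partial>K t x \<partial>L r) = (\<integral>\<^sup>+x. \<integral>\<^sup>+y. h (norm y) \<partial>K t x \<partial>L r)"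
  proof (cases "t = 0")
    case True
    have ret: "(\<integral>\<^sup>+y. f y \<partial>K 0 x) = f x" if "f \<in> borel_measurable borel" for f x
      unfolding K_0 by (rule nn_integral_return) (use that in auto)
    show ?thesis unfolding True ret[OF g] ret[OF hn] L_fibre_const[OF r h] by (simp add: h_def)
  next
    case False
    then have t: "t > 0" using t by simp
    show ?thesis
      unfolding nn_integral_LK_radial[OF t r g] nn_integral_LK_radial[OF t r hn]
    proof (rule nn_integral_cong_AE)
      have "AE s in radial_measure CARD('n). s > 0"
        unfolding radial_measure_def by (subst AE_density) (auto simp: indicator_def)
      then show "AE s in radial_measure CARD('n).
          ennreal (rdens t r s) * ennreal (s powr (2 * \<gamma>) * (dd * I (s * \<rho>))) * (\<integral>\<^sup>+x. g x \<partial>L s)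
        = ennreal (rdens t r s) * ennreal (s powr (2 * \<gamma>) * (dd * I (s * \<rho>))) * (\<integral>\<^sup>+x. h (norm x) \<partial>L s)"
        by eventually_elim (simp add: L_fibre_const h_def[symmetric] less_imp_le)
    qed
  qed
  then show ?thesis by (simp add: h_def)
qed

subsection \<open>Radial laws as mixtures\<close>

lemma integral_L:
  assumes "f \<in> borel_measurable borel"
  shows "(\<integral>x. f x \<partial>L r) = (\<integral>z. sdens r z * f (r *\<^sub>R z) \<partial>sphere_measure)"
  unfolding L_def
  using assms sdens_nonneg
  by (subst integral_distr) (auto intro!: integral_density[where 'b = real, simplified] measurable_compose[OF scale_measurable_sphere])

lemma sphere_integral_eq:
  fixes f :: "real^'n \<Rightarrow> real"
  assumes "f \<in> borel_measurable borel"
  shows "(LINT z|sphere_measure. complex_of_real (f (r *\<^sub>R z)) * dunkl_E Rp k lam (r *\<^sub>R z) /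
      bessel_j (mult_gamma Rp k + real CARD('n) / 2 - 1) (\<i> * complex_of_real (\<rho> * r)) * complex_of_real (wt z))
    = complex_of_real (dd * (\<integral>x. f x \<partial>L r))"
proof -
  have "(LINT z|sphere_measure. complex_of_real (f (r *\<^sub>R z)) * dunkl_E Rp k lam (r *\<^sub>R z) /
      bessel_j (mult_gamma Rp k + real CARD('n) / 2 - 1) (\<i> * complex_of_real (\<rho> * r)) * complex_of_real (wt z))
    = (LINT z|sphere_measure. complex_of_real (dd * (sdens r z * f (r *\<^sub>R z))))"
  proof (rule Bochner_Integration.integral_cong[OF refl])
    fix z :: "real^'n"
    have "mult_gamma Rp k + real CARD('n) / 2 - 1 = \<kappa> - 1" by (simp add: \<kappa>_def)
    then have "bessel_j (mult_gamma Rp k + real CARD('n) / 2 - 1) (\<i> * complex_of_real (\<rho> * r)) = complex_of_real (I (r * \<rho>))"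
      using bessel_j_imaginary[OF kappa_index, of "\<rho> * r"] by (simp only: mult.commute)
    then show "complex_of_real (f (r *\<^sub>R z)) * dunkl_E Rp k lam (r *\<^sub>R z) /
      bessel_j (mult_gamma Rp k + real CARD('n) / 2 - 1) (\<i> * complex_of_real (\<rho> * r)) * complex_of_real (wt z)
      = complex_of_real (dd * (sdens r z * f (r *\<^sub>R z)))"
      using dd_pos by (simp add: dunkl_E_eq sdens_def real_E_symmetric[of lam])
  qed
  also have "\<dots> = complex_of_real (\<integral>z. dd * (sdens r z * f (r *\<^sub>R z)) \<partial>sphere_measure)"
    by (rule integral_complex_of_real)
  also have "(\<integral>z. dd * (sdens r z * f (r *\<^sub>R z)) \<partial>sphere_measure) = dd * (\<integral>x. f x \<partial>L r)"
    by (simp add: integral_L[OF assms])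
  finally show ?thesis .
qed

lemma dunkl_radial_iff:
  assumes \<mu>: "prob_space \<mu>" "sets \<mu> = sets borel"
  shows "dunkl_radial Rp k lam \<mu> \<longleftrightarrow> (\<exists>\<nu> :: real measure. prob_space \<nu> \<and> sets \<nu> = sets (restrict_space borel {0..}) \<and>
     (\<forall>f :: real^'n \<Rightarrow> real. f \<in> borel_measurable borel \<longrightarrow> bounded (range f) \<longrightarrow>
       (\<integral>x. f x \<partial>\<mu>) = (\<integral>r. \<integral>x. f x \<partial>L r \<partial>\<nu>)))"
proof -
  have "complex_of_real (LINT x|\<mu>. f x) = 1 / complex_of_real dd *
         (LINT r|\<nu>. LINT z|sphere_measure.
            complex_of_real (f (r *\<^sub>R z)) * dunkl_E Rp k lam (r *\<^sub>R z) /
            bessel_j (mult_gamma Rp k + real CARD('n) / 2 - 1) (\<i> * complex_of_real (\<rho> * r)) * complex_of_real (wt z))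
      \<longleftrightarrow> (\<integral>x. f x \<partial>\<mu>) = (\<integral>r. \<integral>x. f x \<partial>L r \<partial>\<nu>)" if "f \<in> borel_measurable borel" for f and \<nu> :: "real measure"
  proof -
    have "1 / complex_of_real dd * (LINT r|\<nu>. complex_of_real (dd * (\<integral>x. f x \<partial>L r)))
        = complex_of_real (\<integral>r. \<integral>x. f x \<partial>L r \<partial>\<nu>)"
      using dd_pos by (subst integral_complex_of_real) simp
    then show ?thesis unfolding sphere_integral_eq[OF that] by (simp only: of_real_eq_iff)
  qed
  then show ?thesis unfolding dunkl_radial_def using \<mu> by auto
qed

lemma X_measurable [measurable]: "t \<ge> 0 \<Longrightarrow> X t \<in> M \<rightarrow>\<^sub>M borel"
  using markov by (simp add: markov_process_def measurable_restrict_UNIV)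

lemma prob_M: "prob_space M" using markov by (simp add: markov_process_def)

text \<open>The mixing measure is the law of the norm, since \<^term>\<open>L r\<close> sits on the sphere of radius \<^term>\<open>r\<close>.\<close>

lemma initial_mixture:
  assumes g: "g \<in> borel_measurable borel"
  shows "(\<integral>\<^sup>+\<omega>. g (X 0 \<omega>) \<partial>M) = (\<integral>\<^sup>+\<omega>. \<integral>\<^sup>+x. g x \<partial>L (norm (X 0 \<omega>)) \<partial>M)"
proof -
  let ?\<mu> = "distr M borel (X 0)"
  have X0: "X 0 \<in> M \<rightarrow>\<^sub>M borel" by simp
  interpret \<mu>: prob_space ?\<mu> by (rule prob_space.prob_space_distr[OF prob_M X0])
  obtain \<nu> :: "real measure" where \<nu>: "prob_space \<nu>" "sets \<nu> = sets (restrict_space borel {0..})"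
    and mix: "\<And>f :: real^'n \<Rightarrow> real. f \<in> borel_measurable borel \<Longrightarrow> bounded (range f) \<Longrightarrow>
       (\<integral>x. f x \<partial>?\<mu>) = (\<integral>r. \<integral>x. f x \<partial>L r \<partial>\<nu>)"
    using radial_0 dunkl_radial_iff[OF \<mu>.prob_space_axioms] by auto
  interpret \<nu>: prob_space \<nu> by (rule \<nu>)
  have sp\<nu>: "space \<nu> = {0..}" using sets_eq_imp_space_eq[OF \<nu>(2)] by (simp add: space_restrict_space)
  have L\<nu>: "L \<in> \<nu> \<rightarrow>\<^sub>M subprob_algebra borel"
    using measurable_restrict_space1[OF measurable_prob_algebraD[OF L_measurable], of "{0..}"]
    by (simp add: measurable_cong_sets[OF \<nu>(2) refl])
  have eq: "?\<mu> = \<nu> \<bind> L"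
  proof (rule measure_eqI)
    show "sets ?\<mu> = sets (\<nu> \<bind> L)" by (subst sets_bind[of _ _ borel]) (auto simp: sets_L \<nu>.not_empty)
    fix A assume "A \<in> sets ?\<mu>"
    then have A [measurable]: "A \<in> sets borel" by simp
    have mL: "(\<lambda>r. measure (L r) A) \<in> borel_measurable \<nu>"
      by (rule measurable_compose[OF L\<nu> measurable_measure_subprob_algebra[OF A]])
    have le1: "measure (L r) A \<le> 1" for r by (rule prob_space.prob_le_1[OF prob_L])
    have "bounded (range (indicator A :: real^'n \<Rightarrow> real))"
      by (rule boundedI[where B = 1]) (auto simp: indicator_def)
    then have "measure ?\<mu> A = (\<integral>r. measure (L r) A \<partial>\<nu>)"
      using mix[of "indicator A"] A by (simp add: space_L)
    then have "emeasure ?\<mu> A = ennreal (\<integral>r. measure (L r) A \<partial>\<nu>)" by (simp add: \<mu>.emeasure_eq_measure)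
    also have "\<dots> = (\<integral>\<^sup>+r. ennreal (measure (L r) A) \<partial>\<nu>)"
      by (rule nn_integral_eq_integral[symmetric])
         (auto intro!: \<nu>.integrable_const_bound[where B = 1] mL simp: le1)
    also have "\<dots> = (\<integral>\<^sup>+r. emeasure (L r) A \<partial>\<nu>)"
      by (intro nn_integral_cong) (simp add: finite_measure.emeasure_eq_measure[OF prob_space.finite_measure[OF prob_L]])
    also have "\<dots> = emeasure (\<nu> \<bind> L) A" by (rule emeasure_bind[OF \<nu>.not_empty L\<nu> A, symmetric])
    finally show "emeasure ?\<mu> A = emeasure (\<nu> \<bind> L) A" .
  qed
  have int: "(\<integral>\<^sup>+\<omega>. f (X 0 \<omega>) \<partial>M) = (\<integral>\<^sup>+r. \<integral>\<^sup>+x. f x \<partial>L r \<partial>\<nu>)" if f: "f \<in> borel_measurable borel" for f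
  proof -
    have "(\<integral>\<^sup>+\<omega>. f (X 0 \<omega>) \<partial>M) = (\<integral>\<^sup>+x. f x \<partial>?\<mu>)" by (rule nn_integral_distr[symmetric]) (use f in auto)
    then show ?thesis unfolding eq nn_integral_bind[OF f L\<nu>] .
  qed
  define h where "h s = (\<integral>\<^sup>+z. g z \<partial>L s)" for s
  have h [measurable]: "h \<in> borel_measurable borel" unfolding h_def[abs_def] by (rule measurable_L_integral[OF g])
  have "(\<integral>\<^sup>+\<omega>. h (norm (X 0 \<omega>)) \<partial>M) = (\<integral>\<^sup>+r. \<integral>\<^sup>+x. h (norm x) \<partial>L r \<partial>\<nu>)"
    by (rule int) measurable
  also have "\<dots> = (\<integral>\<^sup>+r. h r \<partial>\<nu>)"
    by (intro nn_integral_cong L_fibre_const h) (simp add: sp\<nu>)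
  also have "\<dots> = (\<integral>\<^sup>+\<omega>. g (X 0 \<omega>) \<partial>M)" unfolding int[OF g] h_def ..
  finally show ?thesis by (simp add: h_def)
qed

sublocale RP: rogers_pitman M X K norm "{0..}" L
proof
  show "markov_process M UNIV K X" by (rule markov)
  show "L \<in> borel \<rightarrow>\<^sub>M prob_algebra borel" by (rule L_measurable)
qed (auto intro: K_measurable K_0 K_add L_fibre intertwining initial_mixture)

text \<open>The transition kernels of the radial part, here still only known as images of the Dunkl kernels.\<close>

abbreviation "B \<equiv> RP.Q"

text \<open>With the law of the norm as the radial measure.\<close>

theorem law_dunkl_radial:
  assumes t: "t \<ge> 0" shows "dunkl_radial Rp k lam (distr M borel (X t))"
proof -
  interpret M: prob_space M by (rule prob_M)
  let ?\<mu> = "distr M borel (X t)"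
  let ?Y = "\<lambda>\<omega>. norm (X t \<omega>)"
  have Xt: "X t \<in> M \<rightarrow>\<^sub>M borel" using t by simp
  have \<mu>: "prob_space ?\<mu>" by (rule M.prob_space_distr[OF Xt])
  have Yt: "?Y \<in> M \<rightarrow>\<^sub>M restrict_space borel {0..}" by (rule RP.measurable_image_process[OF t])
  define \<nu> where "\<nu> = distr M (restrict_space borel {0..}) ?Y"
  have \<nu>: "prob_space \<nu>" "sets \<nu> = sets (restrict_space borel {0..})"
    unfolding \<nu>_def using M.prob_space_distr[OF Yt] by simp_all
  have LY: "(\<lambda>\<omega>. L (?Y \<omega>)) \<in> M \<rightarrow>\<^sub>M prob_algebra borel"
    by (rule measurable_compose[OF _ L_measurable]) (use Xt in simp)
  have "(\<integral>x. f x \<partial>?\<mu>) = (\<integral>r. \<integral>x. f x \<partial>L r \<partial>\<nu>)"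
    if f: "f \<in> borel_measurable borel" and b: "bounded (range f)" for f :: "real^'n \<Rightarrow> real"
  proof -
    obtain C where C: "\<And>x. \<bar>f x\<bar> \<le> C" using b by (auto simp: bounded_iff)
    have mix: "(\<integral>\<^sup>+y. g y \<partial>?\<mu>) = (\<integral>\<^sup>+\<omega>. \<integral>\<^sup>+y. g y \<partial>L (?Y \<omega>) \<partial>M)" if "g \<in> borel_measurable borel" for g
      using RP.law_is_mixture[OF t that] nn_integral_distr[OF Xt, of g] that by simp
    have "(\<integral>x. f x \<partial>?\<mu>) = (\<integral>\<omega>. \<integral>x. f x \<partial>L (?Y \<omega>) \<partial>M)"
      by (rule bounded_integral_mixture(1)[OF \<mu> prob_M _ LY mix f]) (use C in auto)
    also have "\<dots> = (\<integral>r. \<integral>x. f x \<partial>L r \<partial>\<nu>)"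
      unfolding \<nu>_def
    proof (rule integral_distr[symmetric, OF Yt])
      have "(\<lambda>r. \<integral>x. f x \<partial>L r) \<in> borel_measurable borel"
        by (rule measurable_compose[OF measurable_prob_algebraD[OF L_measurable] integral_measurable_subprob_algebra[OF f]])
      then show "(\<lambda>r. \<integral>x. f x \<partial>L r) \<in> borel_measurable (restrict_space borel {0..})"
        by (rule measurable_restrict_space1)
    qed
    finally show ?thesis .
  qed
  then show ?thesis using \<nu> by (subst dunkl_radial_iff[OF \<mu>]) auto
qed

section \<open>The Bessel semigroup\<close>

definition bessel_dens :: "real \<Rightarrow> real \<Rightarrow> real \<Rightarrow> real" where
  "bessel_dens t r s = exp (- \<rho>\<^sup>2 * t / 2) / (2 powr (\<kappa> - 1) * Gamma \<kappa> * t powr \<kappa>) *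
     (exp (- (r\<^sup>2 + s\<^sup>2) / (2 * t)) * (I (r * s / t) * I (s * \<rho>) / I (r * \<rho>)) * rpow s (2 * \<kappa> - 1))"

lemma bessel_dens_nonneg: "bessel_dens t r s \<ge> 0"
  unfolding bessel_dens_def rpow_def
  by (intro mult_nonneg_nonneg divide_nonneg_nonneg divide_nonneg_pos I_pos less_imp_le[OF I_pos]
      less_imp_le[OF Gamma_kappa_pos]) auto

lemma bessel_dens_measurable [measurable]: "bessel_dens t r \<in> borel_measurable borel"
  unfolding bessel_dens_def[abs_def] rpow_def by measurable

text \<open>The powers of the radius from polar coordinates and from the weight combine to \<open>s\<^sup>2\<^sup>\<kappa>\<^sup>-\<^sup>1\<close>, and the
  normalization of the weight cancels against \<^term>\<open>dd\<close>.\<close>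

lemma emeasure_B:
  assumes t: "t > 0" and r: "r \<ge> 0" and A: "A \<in> sets (restrict_space borel {0..})"
  shows "emeasure (B t r) A = (\<integral>\<^sup>+s. ennreal (bessel_dens t r s) * indicator A s \<partial>lborel)"
proof -
  have Ab [measurable]: "A \<in> sets borel" and A0: "A \<subseteq> {0..}" using A by (auto simp: sets_restrict_space_iff)
  let ?N = "CARD('n)"
  have N: "real ?N - 1 = real (?N - 1)" using zero_less_card_finite[where 'a = 'n] by (simp add: of_nat_diff)
  let ?h = "\<lambda>s. ennreal (rdens t r s) * ennreal (s powr (2 * \<gamma>) * (dd * I (s * \<rho>)))"
  have "emeasure (B t r) A = (\<integral>\<^sup>+x. \<integral>\<^sup>+y. indicator A (norm y) \<partial>K t x \<partial>L r)"
    by (rule RP.emeasure_Q[OF less_imp_le[OF t] A])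
  also have "\<dots> = (\<integral>\<^sup>+s. ?h s * (\<integral>\<^sup>+x. indicator A (norm x) \<partial>L s) \<partial>radial_measure ?N)"
    by (rule nn_integral_LK_radial[OF t r]) simp
  also have "\<dots> = (\<integral>\<^sup>+s. ennreal (s ^ (?N - 1)) * indicator {0<..} s * (?h s * (\<integral>\<^sup>+x. indicator A (norm x) \<partial>L s)) \<partial>lborel)"
  proof -
    have "(\<lambda>s. ?h s * (\<integral>\<^sup>+x. indicator A (norm x) \<partial>L s)) \<in> borel_measurable borel"
      by (intro borel_measurable_times_ennreal measurable_L_integral) measurable
    then show ?thesis unfolding radial_measure_def by (subst nn_integral_density) auto
  qed
  also have "\<dots> = (\<integral>\<^sup>+s. ennreal (bessel_dens t r s) * indicator A s \<partial>lborel)"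
  proof (rule nn_integral_cong_AE)
    show "AE s in lborel. ennreal (s ^ (?N - 1)) * indicator {0<..} s * (?h s * (\<integral>\<^sup>+x. indicator A (norm x) \<partial>L s))
        = ennreal (bessel_dens t r s) * indicator A s"
      using AE_lborel_singleton[of "0::real"]
    proof eventually_elim
      case (elim s)
      show ?case
      proof (cases "s > 0")
        case True
        have "s ^ (?N - 1) * s powr (2 * \<gamma>) = s powr (2 * \<kappa> - 1)"
        proof -
          have "2 * \<kappa> - 1 = real (?N - 1) + 2 * \<gamma>" using N by (simp add: \<kappa>_def)
          then show ?thesis using True by (simp only: powr_add powr_realpow)
        qed
        then have p: "s ^ (?N - 1) * s powr (2 * \<gamma>) = rpow s (2 * \<kappa> - 1)" using True by (simp add: rpow_def)
        have cd: "dunkl_c Rp k * dd = 1 / (2 powr (\<kappa> - 1) * Gamma \<kappa>)"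
          using dd_pos by (simp add: dunkl_c_eq)
        have "s ^ (?N - 1) * (rdens t r s * (s powr (2 * \<gamma>) * (dd * I (s * \<rho>))))
          = (dunkl_c Rp k * dd) * (exp (- \<rho>\<^sup>2 * t / 2) / t powr \<kappa>) * (exp (- (r\<^sup>2 + s\<^sup>2) / (2 * t)) *
             (I (r * s / t) * I (s * \<rho>) / I (r * \<rho>)) * (s ^ (?N - 1) * s powr (2 * \<gamma>)))"
          by (simp add: rdens_def)
        also have "\<dots> = bessel_dens t r s" unfolding p cd bessel_dens_def by simp
        finally have eq: "bessel_dens t r s = s ^ (?N - 1) * (rdens t r s * (s powr (2 * \<gamma>) * (dd * I (s * \<rho>))))" ..
        have "ennreal (bessel_dens t r s) = ennreal (s ^ (?N - 1)) * ?h s"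
          unfolding eq using True rdens_nonneg by (simp add: ennreal_mult' del: times_divide_eq_right)
        moreover have "(\<integral>\<^sup>+x. indicator A (norm x) \<partial>L s) = indicator A s"
          using True by (intro L_fibre_const) auto
        ultimately show ?thesis using True by (simp add: mult.assoc)
      next
        case False
        then have "s \<notin> A" using A0 elim by auto
        then show ?thesis using False by simp
      qed
    qed
  qed
  finally show ?thesis .
qed

lemma bessel_transition_B:
  assumes t: "t > 0" and r: "r \<ge> 0" and A: "A \<in> sets (restrict_space borel {0..})"
  shows "complex_of_real (measure (B t r) A)
    = bessel_transition (mult_gamma Rp k + real CARD('n) / 2 - 1 / 2) \<rho> t r A"
proof -
  have [measurable]: "A \<in> sets borel" using A by (auto simp: sets_restrict_space_iff)
  let ?c = "exp (- \<rho>\<^sup>2 * t / 2) / (2 powr (\<kappa> - 1) * Gamma \<kappa> * t powr \<kappa>)"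
  let ?d = "\<lambda>s. exp (- (r\<^sup>2 + s\<^sup>2) / (2 * t)) * (I (r * s / t) * I (s * \<rho>) / I (r * \<rho>)) * rpow s (2 * \<kappa> - 1)"
  define \<eta> where "\<eta> = mult_gamma Rp k + real CARD('n) / 2 - 1 / 2"
  have e: "\<eta> - 1/2 = \<kappa> - 1" "\<eta> + 1/2 = \<kappa>" "2 * \<eta> = 2 * \<kappa> - 1" by (simp_all add: \<eta>_def \<kappa>_def)
  have "bessel_transition \<eta> \<rho> t r A = complex_of_real ?c * (\<integral>s. indicator A s *\<^sub>R complex_of_real (?d s) \<partial>lborel)"
    unfolding bessel_transition_def e set_lebesgue_integral_def bessel_j_imaginary[OF kappa_index] by simp
  also have "(\<integral>s. indicator A s *\<^sub>R complex_of_real (?d s) \<partial>lborel) = (\<integral>s. complex_of_real (indicator A s * ?d s) \<partial>lborel)"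
    by (intro Bochner_Integration.integral_cong refl) (simp add: indicator_def)
  also have "\<dots> = complex_of_real (\<integral>s. indicator A s * ?d s \<partial>lborel)" by (rule integral_complex_of_real)
  also have "complex_of_real ?c * \<dots> = complex_of_real (\<integral>s. ?c * (indicator A s * ?d s) \<partial>lborel)"
    by (simp only: integral_mult_right_zero of_real_mult)
  also have "(\<integral>s. ?c * (indicator A s * ?d s) \<partial>lborel) = (\<integral>s. bessel_dens t r s * indicator A s \<partial>lborel)"
    by (intro Bochner_Integration.integral_cong refl) (simp add: bessel_dens_def mult_ac)
  also have "\<dots> = enn2real (\<integral>\<^sup>+s. ennreal (bessel_dens t r s * indicator A s) \<partial>lborel)"
    by (rule integral_eq_nn_integral) (auto simp: bessel_dens_nonneg)
  also have "(\<integral>\<^sup>+s. ennreal (bessel_dens t r s * indicator A s) \<partial>lborel) = emeasure (B t r) A"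
    unfolding emeasure_B[OF assms] by (intro nn_integral_cong) (simp add: indicator_def)
  finally show ?thesis unfolding \<eta>_def by (simp add: measure_def)
qed

lemma C0_bounded:
  fixes F :: "real^'n \<Rightarrow> real"
  assumes "F \<in> C0 UNIV" obtains C where "\<And>x. \<bar>F x\<bar> \<le> C"
proof -
  have cont: "continuous_on UNIV F" and lim: "(F \<longlongrightarrow> 0) at_infinity" using assms by (auto simp: C0_def)
  have "eventually (\<lambda>x. dist (F x) 0 < 1) at_infinity" using lim by (rule tendstoD) simp
  then obtain b where b: "\<And>x. norm x \<ge> b \<Longrightarrow> \<bar>F x\<bar> < 1" by (auto simp: eventually_at_infinity)
  have "bounded (F ` cball 0 b)"
    by (intro compact_imp_bounded compact_continuous_image continuous_on_subset[OF cont]) auto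
  then obtain C where C: "\<And>x. x \<in> cball 0 b \<Longrightarrow> \<bar>F x\<bar> \<le> C" unfolding bounded_iff real_norm_def by blast
  have "\<bar>F x\<bar> \<le> max 1 C" for x
    using b[of x] C[of x] by (cases "norm x \<ge> b") auto
  then show ?thesis by (rule that)
qed

lemma C0_norm:
  assumes "f \<in> C0 {0..}" shows "(\<lambda>x :: real^'n. f (norm x)) \<in> C0 UNIV"
proof -
  have cont: "continuous_on {0..} f" and lim: "(f \<longlongrightarrow> 0) (inf at_infinity (principal {0..}))"
    using assms by (auto simp: C0_def)
  have "continuous_on UNIV (\<lambda>x :: real^'n. f (norm x))"
    by (rule continuous_on_compose2[OF cont]) (auto intro: continuous_intros)
  moreover have "filterlim (norm :: real^'n \<Rightarrow> real) (inf at_infinity (principal {0..})) at_infinity"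
    unfolding filterlim_inf filterlim_principal
    using filterlim_mono[OF filterlim_norm_at_top at_top_le_at_infinity order_refl] by auto
  then have "((\<lambda>x :: real^'n. f (norm x)) \<longlongrightarrow> 0) at_infinity" by (rule filterlim_compose[OF lim])
  ultimately show ?thesis by (simp add: C0_def)
qed

lemma C0_borel: "F \<in> C0 UNIV \<Longrightarrow> F \<in> borel_measurable borel"
  by (auto simp: C0_def intro: borel_measurable_continuous_onI)

lemma integrable_L:
  fixes h :: "real^'n \<Rightarrow> real"
  assumes "h \<in> borel_measurable borel" "\<And>x. \<bar>h x\<bar> \<le> C"
  shows "integrable (L r) h"
proof -
  interpret prob_space "L r" by (rule prob_L)
  show ?thesis
    by (rule integrable_const_bound[where B = C]) (use assms in \<open>auto simp: measurable_cong_sets[OF sets_L refl]\<close>)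
qed

lemma integral_L_bound:
  fixes h :: "real^'n \<Rightarrow> real"
  assumes r: "r \<ge> 0" and h: "h \<in> borel_measurable borel" "\<And>x. \<bar>h x\<bar> \<le> C"
    and e: "\<And>x. norm x = r \<Longrightarrow> \<bar>h x\<bar> \<le> e"
  shows "\<bar>\<integral>x. h x \<partial>L r\<bar> \<le> e"
proof -
  interpret prob_space "L r" by (rule prob_L)
  have "\<bar>\<integral>x. h x \<partial>L r\<bar> \<le> (\<integral>x. \<bar>h x\<bar> \<partial>L r)" using integral_norm_bound[of "L r" h] by simp
  also have "\<dots> \<le> (\<integral>x. e \<partial>L r)"
  proof (rule integral_mono_AE)
    show "AE x in L r. \<bar>h x\<bar> \<le> e" using L_fibre[OF r] by eventually_elim (rule e)
  qed (use integrable_L[OF h] in auto)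
  also have "(\<integral>x. e \<partial>L r) = e" using prob_space by simp
  finally show ?thesis .
qed

text \<open>All the laws are images of densities on one unit sphere, which depend continuously on the radius
  and are bounded for bounded radii.\<close>

lemma L_continuous:
  fixes h :: "real^'n \<Rightarrow> real"
  assumes h: "continuous_on UNIV h" "\<And>x. \<bar>h x\<bar> \<le> C"
  shows "continuous_on S (\<lambda>r. \<integral>x. h x \<partial>L r)"
proof -
  have hm [measurable]: "h \<in> borel_measurable borel" by (rule borel_measurable_continuous_onI[OF h(1)])
  have C: "C \<ge> 0" using h(2)[of 0] by linarith
  interpret sphere: finite_measure "sphere_measure :: (real^'n) measure" by (rule finite_sphere_measure)
  obtain Kw where Kw: "\<And>z :: real^'n. norm z = 1 \<Longrightarrow> wt z \<le> Kw" using weight_sphere_bounded by blast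
  have "isCont (\<lambda>r. \<integral>z. sdens r z * h (r *\<^sub>R z) \<partial>sphere_measure) r" for r
  proof (rule continuous_at_sequentiallyI)
    fix u :: "nat \<Rightarrow> real" assume u: "u \<longlonglongrightarrow> r"
    then obtain Rb where Rb: "\<And>n. \<bar>u n\<bar> \<le> Rb"
      using convergent_imp_Bseq[OF convergentI[OF u]] by (auto simp: Bseq_def)
    let ?w = "Kw * exp (Rb * \<rho>) / dd * C"
    show "(\<lambda>n. \<integral>z. sdens (u n) z * h (u n *\<^sub>R z) \<partial>sphere_measure) \<longlonglongrightarrow> (\<integral>z. sdens r z * h (r *\<^sub>R z) \<partial>sphere_measure)"
    proof (rule integral_dominated_convergence[where w = "\<lambda>z. ?w"])
      show "(\<lambda>z. sdens r z * h (r *\<^sub>R z)) \<in> borel_measurable sphere_measure" for r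
        by (intro borel_measurable_times sdens_measurable_sphere measurable_compose[OF scale_measurable_sphere hm])
      then show "(\<lambda>z. sdens (u n) z * h (u n *\<^sub>R z)) \<in> borel_measurable sphere_measure" for n .
      show "AE z in sphere_measure. (\<lambda>n. sdens (u n) z * h (u n *\<^sub>R z)) \<longlonglongrightarrow> sdens r z * h (r *\<^sub>R z)"
      proof (rule AE_I2)
        fix z :: "real^'n"
        have "continuous_on UNIV (\<lambda>r. sdens r z * h (r *\<^sub>R z))"
          unfolding sdens_def using I_pos dd_pos
          by (intro continuous_intros continuous_on_compose2[OF h(1)] continuous_on_compose2[OF bessel_I_continuous[OF kappa_index, of UNIV]])
             (auto simp: less_imp_neq[THEN not_sym] intro!: continuous_intros)
        then have "isCont (\<lambda>r. sdens r z * h (r *\<^sub>R z)) r" by (simp add: continuous_on_eq_continuous_at)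
        then show "(\<lambda>n. sdens (u n) z * h (u n *\<^sub>R z)) \<longlonglongrightarrow> sdens r z * h (r *\<^sub>R z)"
          by (rule isCont_tendsto_compose[OF _ u])
      qed
      show "AE z in sphere_measure. norm (sdens (u n) z * h (u n *\<^sub>R z)) \<le> ?w" for n
      proof (rule AE_I2)
        fix z :: "real^'n" assume "z \<in> space sphere_measure"
        then have z: "norm z = 1" by (simp add: space_sphere_measure)
        have "real_E (u n *\<^sub>R z) lam \<le> exp (norm (u n *\<^sub>R z) * \<rho>)" using real_E_bound[of "u n *\<^sub>R z" lam] by simp
        also have "\<dots> \<le> exp (Rb * \<rho>)" using Rb[of n] z by (simp add: mult_right_mono)
        finally have "wt z * real_E (u n *\<^sub>R z) lam \<le> Kw * exp (Rb * \<rho>)"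
          using Kw[OF z] weight_nonneg[of z] real_E_nonneg by (intro mult_mono) (auto intro: order_trans)
        then have "sdens (u n) z \<le> Kw * exp (Rb * \<rho>) / (dd * 1)"
          unfolding sdens_def using dd_pos I_ge_1[of "u n * \<rho>"] weight_nonneg[of z] Kw[OF z]
          by (intro frac_le mult_left_mono mult_nonneg_nonneg) auto
        then have "sdens (u n) z * \<bar>h (u n *\<^sub>R z)\<bar> \<le> Kw * exp (Rb * \<rho>) / dd * C"
          using h(2) sdens_nonneg[of "u n" z] by (intro mult_mono) (auto intro: order_trans)
        then show "norm (sdens (u n) z * h (u n *\<^sub>R z)) \<le> ?w"
          by (simp add: abs_mult sdens_nonneg)
      qed
    qed simp
  qed
  then show ?thesis by (simp add: integral_L[OF hm] continuous_at_imp_continuous_on)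
qed

lemma L_C0:
  assumes h: "h \<in> C0 UNIV" shows "(\<lambda>r. \<integral>x. h x \<partial>L r) \<in> C0 {0..}"
proof -
  have cont: "continuous_on UNIV h" and lim: "(h \<longlongrightarrow> 0) at_infinity" using h by (auto simp: C0_def)
  obtain C where C: "\<And>x. \<bar>h x\<bar> \<le> C" using C0_bounded[OF h] by blast
  have "((\<lambda>r. \<integral>x. h x \<partial>L r) \<longlongrightarrow> 0) (inf at_infinity (principal {0..}))"
  proof (rule tendstoI)
    fix e :: real assume e: "e > 0"
    have "eventually (\<lambda>x. dist (h x) 0 < e / 2) at_infinity" using lim by (rule tendstoD) (use e in simp)
    then obtain b where b: "\<And>x. norm x \<ge> b \<Longrightarrow> \<bar>h x\<bar> < e / 2" by (auto simp: eventually_at_infinity)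
    have "dist (\<integral>x. h x \<partial>L r) 0 < e" if r: "r \<ge> 0" "norm r \<ge> b" for r
    proof -
      have "\<bar>\<integral>x. h x \<partial>L r\<bar> \<le> e / 2"
        by (rule integral_L_bound[OF r(1) C0_borel[OF h] C]) (use b r in \<open>auto intro: less_imp_le\<close>)
      then show ?thesis using e by simp
    qed
    then show "\<forall>\<^sub>F r in inf at_infinity (principal {0..}). dist (\<integral>x. h x \<partial>L r) 0 < e"
      unfolding eventually_inf_principal eventually_at_infinity by (intro exI[of _ b]) auto
  qed
  then show ?thesis using L_continuous[OF cont C] by (simp add: C0_def)
qed

lemma integral_B:
  assumes t: "t \<ge> 0" and f: "f \<in> C0 {0..}"
  shows "(\<integral>u. f u \<partial>B t r) = (\<integral>x. \<integral>y. f (norm y) \<partial>K t x \<partial>L r)"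
proof -
  let ?S = "restrict_space borel {0::real..}"
  let ?kern = "\<lambda>x. distr (K t x) ?S norm"
  have F: "(\<lambda>x :: real^'n. f (norm x)) \<in> C0 UNIV" by (rule C0_norm[OF f])
  obtain C where C: "\<And>x :: real^'n. \<bar>f (norm x)\<bar> \<le> C" using C0_bounded[OF F] by blast
  have fm: "f \<in> borel_measurable ?S"
    using f by (auto simp: C0_def intro: borel_measurable_continuous_on_restrict)
  have nS: "norm \<in> K t x \<rightarrow>\<^sub>M ?S" for x
    using RP.\<phi>_restrict by (simp add: measurable_cong_sets[OF sets_K[OF t] refl])
  have "(\<lambda>x. ?kern x) \<in> borel \<rightarrow>\<^sub>M prob_algebra ?S"
    by (rule measurable_compose[OF K_measurable[OF t] measurable_distr_prob_space[OF RP.\<phi>_restrict]])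
  then have kern: "?kern \<in> L r \<rightarrow>\<^sub>M prob_algebra ?S" by (simp add: measurable_cong_sets[OF sets_L refl])
  have "(\<integral>u. f u \<partial>B t r) = (\<integral>x. \<integral>u. f u \<partial>?kern x \<partial>L r)"
  proof (rule bounded_integral_mixture(1)[OF RP.prob_Q[OF t] prob_L RP.sets_Q kern _ fm])
    show "(\<integral>\<^sup>+u. g u \<partial>B t r) = (\<integral>\<^sup>+x. \<integral>\<^sup>+u. g u \<partial>?kern x \<partial>L r)" if g: "g \<in> borel_measurable ?S" for g
      unfolding RP.nn_integral_Q[OF t g] by (intro nn_integral_cong nn_integral_distr[OF nS, symmetric]) (use g in simp)
    show "\<bar>f u\<bar> \<le> C" if "u \<in> space ?S" for u
    proof -
      have "0 \<le> u" using that by (simp add: space_restrict_space)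
      then obtain x :: "real^'n" where "norm x = u" by (rule vector_choose_size)
      then show ?thesis using C[of x] by simp
    qed
  qed
  also have "\<dots> = (\<integral>x. \<integral>y. f (norm y) \<partial>K t x \<partial>L r)"
    by (intro Bochner_Integration.integral_cong refl integral_distr[OF nS fm])
  finally show ?thesis .
qed

text \<open>For a radial function, the Bessel semigroup is the Dunkl semigroup followed by averaging with
  \<^term>\<open>L\<close>. Averaging preserves continuity and decay at infinity, does not increase uniform distances, and leaves
  radial functions unchanged.\<close>

theorem feller_B: "feller_semigroup {0..} B"
  unfolding feller_semigroup_def
proof (intro conjI allI impI ballI)
  fix t :: real assume t: "t \<ge> 0"
  show "B t \<in> restrict_space borel {0..} \<rightarrow>\<^sub>M prob_algebra (restrict_space borel {0..})"
    by (rule RP.Q_measurable_S[OF t])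
next
  fix x :: real assume "x \<in> {0..}"
  then show "B 0 x = return (restrict_space borel {0..}) x" by (rule RP.Q_0)
next
  fix s t x :: real assume "s \<ge> 0" "t \<ge> 0" "x \<in> {0..}"
  then show "B (s + t) x = B s x \<bind> B t" by (rule RP.Q_add)
next
  fix f :: "real \<Rightarrow> real" and t :: real assume f: "f \<in> C0 {0..}" and t: "t \<ge> 0"
  have "(\<lambda>x. \<integral>y. f (norm y) \<partial>K t x) \<in> C0 UNIV"
    using feller C0_norm[OF f] t unfolding feller_semigroup_def by blast
  from L_C0[OF this] show "(\<lambda>x. \<integral>y. f y \<partial>B t x) \<in> C0 {0..}" by (simp add: integral_B[OF t f])
next
  fix f :: "real \<Rightarrow> real" assume f: "f \<in> C0 {0..}"
  have F: "(\<lambda>x :: real^'n. f (norm x)) \<in> C0 UNIV" by (rule C0_norm[OF f])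
  obtain C where C: "\<And>x :: real^'n. \<bar>f (norm x)\<bar> \<le> C" using C0_bounded[OF F] by blast
  have unif: "uniform_limit UNIV (\<lambda>t x. \<integral>y. f (norm y) \<partial>K t x) (\<lambda>x. f (norm x)) (at_right 0)"
    using feller F unfolding feller_semigroup_def by blast
  show "uniform_limit {0..} (\<lambda>t x. \<integral>y. f y \<partial>B t x) f (at_right 0)"
  proof (rule uniform_limitI)
    fix e :: real assume e: "e > 0"
    have "\<forall>\<^sub>F t in at_right 0. \<forall>x\<in>UNIV. dist (\<integral>y. f (norm y) \<partial>K t x) (f (norm x)) < e / 2"
      using uniform_limitD[OF unif, of "e / 2"] e by simp
    moreover have "\<forall>\<^sub>F t :: real in at_right 0. t > 0" by (simp add: eventually_at_right_less)
    ultimately show "\<forall>\<^sub>F t in at_right 0. \<forall>r\<in>{0..}. dist (\<integral>y. f y \<partial>B t r) (f r) < e"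
    proof eventually_elim
      case (elim t)
      define h where "h x = (\<integral>y. f (norm y) \<partial>K t x)" for x
      have h: "h \<in> C0 UNIV"
        using feller F elim(2) unfolding feller_semigroup_def h_def[abs_def] by (simp add: less_imp_le)
      obtain C' where C': "\<And>x. \<bar>h x\<bar> \<le> C'" using C0_bounded[OF h] by blast
      show ?case
      proof
        fix r :: real assume r: "r \<in> {0..}"
        have "(\<integral>x. f (norm x) \<partial>L r) = (\<integral>x. f r \<partial>L r)"
          using L_fibre[of r] r integrable_L[OF C0_borel[OF F] C, of r]
          by (intro integral_cong_AE) (auto elim!: eventually_mono)
        also have "\<dots> = f r" using prob_space.prob_space[OF prob_L, of r] by simp
        finally have fr: "(\<integral>x. f (norm x) \<partial>L r) = f r" .
        have "(\<integral>y. f y \<partial>B t r) - f r = (\<integral>x. h x \<partial>L r) - (\<integral>x. f (norm x) \<partial>L r)"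
          unfolding fr h_def using elim(2) by (simp add: integral_B[OF _ f])
        also have "\<dots> = (\<integral>x. h x - f (norm x) \<partial>L r)"
          by (rule Bochner_Integration.integral_diff[symmetric])
             (rule integrable_L[OF C0_borel[OF h] C'], rule integrable_L[OF C0_borel[OF F] C])
        finally have eq: "(\<integral>y. f y \<partial>B t r) - f r = (\<integral>x. h x - f (norm x) \<partial>L r)" .
        have "\<bar>\<integral>x. h x - f (norm x) \<partial>L r\<bar> \<le> e / 2"
        proof (rule integral_L_bound)
          show "(\<lambda>x. h x - f (norm x)) \<in> borel_measurable borel"
            by (intro borel_measurable_diff C0_borel[OF h] C0_borel[OF F])
          show d: "\<bar>h x - f (norm x)\<bar> \<le> e / 2" for x
            using elim(1)[rule_format, of x] by (simp add: h_def dist_real_def)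
          then show "\<bar>h x - f (norm x)\<bar> \<le> e / 2" for x .
        qed (use r in simp)
        then show "dist (\<integral>y. f y \<partial>B t r) (f r) < e" unfolding dist_real_def eq using e by linarith
      qed
    qed
  qed
qed

section \<open>Continuity of the radial part\<close>

text \<open>The exponents of the Gaussian and of the Bessel function complete to \<open>-(s - r)\<^sup>2 / (2 h)\<close>. One half
  pays for the distance \<^term>\<open>e\<close>; as \<open>h \<le> 1\<close>, the other half still decays like a Gaussian in
  \<^term>\<open>s\<close>, uniformly in \<^term>\<open>h\<close> and in \<open>r \<le> m\<close>.\<close>

lemma bessel_dens_bound:
  assumes h: "0 < h" "h \<le> 1" and r: "0 \<le> r" "r \<le> m" and s: "s \<ge> 0" and e: "e \<ge> 0" "e \<le> \<bar>s - r\<bar>"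
  shows "bessel_dens h r s \<le> (1 / (2 powr (\<kappa> - 1) * Gamma \<kappa>)) * (h powr - \<kappa> * exp (- e\<^sup>2 / (4 * h)))
    * ((1 + s) powr (2 * \<kappa> - 1) * exp ((m / 2 + \<rho>) * s - 1 / 4 * s\<^sup>2))"
proof -
  have I1: "I (r * s / h) \<le> exp (r * s / h)" using bessel_I_le_exp[OF kappa_index, of "r * s / h"] r s h by simp
  have I2: "I (s * \<rho>) \<le> exp (s * \<rho>)" using bessel_I_le_exp[OF kappa_index, of "s * \<rho>"] s by simp
  have w: "rpow s (2 * \<kappa> - 1) \<le> (1 + s) powr (2 * \<kappa> - 1)"
    using s kappa_ge by (auto simp: rpow_def intro!: powr_mono2)
  have q: "I (r * s / h) * I (s * \<rho>) / I (r * \<rho>) \<le> exp (r * s / h) * exp (s * \<rho>) / 1"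
    using I1 I2 I_pos I_ge_1 by (intro frac_le mult_mono) (auto intro: less_imp_le)
  have main: "exp (- (r\<^sup>2 + s\<^sup>2) / (2 * h)) * (exp (r * s / h) * exp (s * \<rho>))
      \<le> exp (- e\<^sup>2 / (4 * h)) * exp ((m / 2 + \<rho>) * s - 1 / 4 * s\<^sup>2)"
  proof -
    have "e\<^sup>2 \<le> (s - r)\<^sup>2" using e by (metis abs_le_square_iff abs_of_nonneg)
    then have a: "e\<^sup>2 / (4 * h) \<le> (s - r)\<^sup>2 / (4 * h)" using h by (intro divide_right_mono) auto
    have "s\<^sup>2 - 2 * m * s \<le> (s - r)\<^sup>2"
    proof -
      have "r * s \<le> m * s" using r s by (intro mult_right_mono) auto
      moreover have "0 \<le> r\<^sup>2" by simp
      ultimately show ?thesis unfolding power2_diff by (simp add: algebra_simps, linarith)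
    qed
    also have "(s - r)\<^sup>2 \<le> (s - r)\<^sup>2 / h" using h by (simp add: divide_simps mult_left_le)
    finally have b: "1 / 4 * s\<^sup>2 - m / 2 * s \<le> (s - r)\<^sup>2 / (4 * h)" using h by (simp add: field_simps)
    have "- (r\<^sup>2 + s\<^sup>2) / (2 * h) + r * s / h = - ((s - r)\<^sup>2 / (4 * h)) - (s - r)\<^sup>2 / (4 * h)"
      using h by (simp add: power2_diff field_simps)
    then have "- (r\<^sup>2 + s\<^sup>2) / (2 * h) + (r * s / h + s * \<rho>) \<le> - e\<^sup>2 / (4 * h) + ((m / 2 + \<rho>) * s - 1 / 4 * s\<^sup>2)"
      using a b by (simp add: algebra_simps)
    then show ?thesis by (simp only: exp_add[symmetric] exp_le_cancel_iff)
  qed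
  have c: "0 \<le> 1 / (2 powr (\<kappa> - 1) * Gamma \<kappa>)" using Gamma_kappa_pos by simp
  have "bessel_dens h r s = (1 / (2 powr (\<kappa> - 1) * Gamma \<kappa>)) * (h powr - \<kappa> * (exp (- \<rho>\<^sup>2 * h / 2) *
      (exp (- (r\<^sup>2 + s\<^sup>2) / (2 * h)) * (I (r * s / h) * I (s * \<rho>) / I (r * \<rho>)) * rpow s (2 * \<kappa> - 1))))"
    unfolding bessel_dens_def powr_minus by (simp add: field_simps)
  also have "\<dots> \<le> (1 / (2 powr (\<kappa> - 1) * Gamma \<kappa>)) * (h powr - \<kappa> * (1 *
      (exp (- (r\<^sup>2 + s\<^sup>2) / (2 * h)) * (exp (r * s / h) * exp (s * \<rho>) / 1) * (1 + s) powr (2 * \<kappa> - 1))))"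
    by (intro mult_left_mono[OF _ c] mult_left_mono mult_mono q w)
       (use h I_pos in \<open>auto simp: rpow_def intro!: mult_nonneg_nonneg divide_nonneg_nonneg less_imp_le[OF I_pos]\<close>)
  also have "\<dots> = (1 / (2 powr (\<kappa> - 1) * Gamma \<kappa>)) * (h powr - \<kappa> *
      ((exp (- (r\<^sup>2 + s\<^sup>2) / (2 * h)) * (exp (r * s / h) * exp (s * \<rho>))) * (1 + s) powr (2 * \<kappa> - 1)))"
    by simp
  also have "\<dots> \<le> (1 / (2 powr (\<kappa> - 1) * Gamma \<kappa>)) * (h powr - \<kappa> *
      ((exp (- e\<^sup>2 / (4 * h)) * exp ((m / 2 + \<rho>) * s - 1 / 4 * s\<^sup>2)) * (1 + s) powr (2 * \<kappa> - 1)))"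
    by (intro mult_left_mono[OF _ c] mult_left_mono mult_right_mono main) auto
  finally show ?thesis by (simp add: mult_ac)
qed

text \<open>Moving a fixed distance from a bounded set in a short time is exponentially unlikely. The constant
  does not depend on the distance, on the starting point or on the time.\<close>

lemma B_escape:
  obtains C where "C \<ge> 0" "\<And>h r e A. 0 < h \<Longrightarrow> h \<le> 1 \<Longrightarrow> 0 \<le> r \<Longrightarrow> r \<le> m \<Longrightarrow> e \<ge> 0 \<Longrightarrow>
    A \<in> sets (restrict_space borel {0..}) \<Longrightarrow> (\<And>s. s \<in> A \<Longrightarrow> e \<le> \<bar>s - r\<bar>) \<Longrightarrow>
    emeasure (B h r) A \<le> ennreal (C * (h powr - \<kappa> * exp (- e\<^sup>2 / (4 * h))))"
proof -
  obtain C where C: "C > 0" "\<And>s. s \<ge> 0 \<Longrightarrow> (1 + s) powr (2 * \<kappa> - 1) * exp ((m / 2 + \<rho>) * s - 1 / 4 * s\<^sup>2) \<le> C * exp (- s)"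
    using polynomial_gaussian_le_exp[of "1/4" "2 * \<kappa> - 1" "m / 2 + \<rho>"] by auto
  define D where "D = (1 / (2 powr (\<kappa> - 1) * Gamma \<kappa>)) * C"
  have D: "D \<ge> 0" using C(1) Gamma_kappa_pos by (simp add: D_def)
  have "emeasure (B h r) A \<le> ennreal (D * (h powr - \<kappa> * exp (- e\<^sup>2 / (4 * h))))"
    if h: "0 < h" "h \<le> 1" and r: "0 \<le> r" "r \<le> m" and e: "e \<ge> 0" and A: "A \<in> sets (restrict_space borel {0..})"
      and sep: "\<And>s. s \<in> A \<Longrightarrow> e \<le> \<bar>s - r\<bar>" for h r e A
  proof -
    let ?q = "D * (h powr - \<kappa> * exp (- e\<^sup>2 / (4 * h)))"
    have A0: "A \<subseteq> {0..}" using A by (auto simp: sets_restrict_space_iff)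
    have q: "?q \<ge> 0" using D by simp
    have "emeasure (B h r) A = (\<integral>\<^sup>+s. ennreal (bessel_dens h r s) * indicator A s \<partial>lborel)"
      by (rule emeasure_B[OF h(1) r(1) A])
    also have "\<dots> \<le> (\<integral>\<^sup>+s. ennreal ?q * (ennreal (s ^ 0 * exp (- s)) * indicator {0..} s) \<partial>lborel)"
    proof (rule nn_integral_mono)
      fix s
      show "ennreal (bessel_dens h r s) * indicator A s \<le> ennreal ?q * (ennreal (s ^ 0 * exp (- s)) * indicator {0..} s)"
      proof (cases "s \<in> A")
        case True
        then have s: "s \<ge> 0" using A0 by auto
        have "bessel_dens h r s \<le> (1 / (2 powr (\<kappa> - 1) * Gamma \<kappa>)) * (h powr - \<kappa> * exp (- e\<^sup>2 / (4 * h)))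
            * ((1 + s) powr (2 * \<kappa> - 1) * exp ((m / 2 + \<rho>) * s - 1 / 4 * s\<^sup>2))"
          by (rule bessel_dens_bound[OF h r s e sep[OF True]])
        also have "\<dots> \<le> (1 / (2 powr (\<kappa> - 1) * Gamma \<kappa>)) * (h powr - \<kappa> * exp (- e\<^sup>2 / (4 * h))) * (C * exp (- s))"
          using Gamma_kappa_pos by (intro mult_left_mono C(2)[OF s]) auto
        also have "\<dots> = ?q * exp (- s)" by (simp add: D_def mult_ac)
        finally have "ennreal (bessel_dens h r s) \<le> ennreal (?q * exp (- s))" by (rule ennreal_leI)
        also have "\<dots> = ennreal ?q * ennreal (exp (- s))" by (rule ennreal_mult'[OF q])
        finally show ?thesis using True s by simp
      qed simp
    qed
    also have "\<dots> = ennreal ?q * (\<integral>\<^sup>+s. ennreal (s ^ 0 * exp (- s)) * indicator {0..} s \<partial>lborel)"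
      by (rule nn_integral_cmult) simp
    also have "\<dots> = ennreal ?q" unfolding nn_intergal_power_times_exp_Ici by simp
    finally show ?thesis .
  qed
  then show ?thesis using that[OF D] by blast
qed

abbreviation "Y \<equiv> \<lambda>t \<omega>. norm (X t \<omega>)"

lemma Y_measurable: "t \<ge> 0 \<Longrightarrow> Y t \<in> M \<rightarrow>\<^sub>M restrict_space borel {0..}"
  by (rule RP.measurable_image_process)

text \<open>What a jump from \<^term>\<open>U\<close> to \<^term>\<open>V\<close> leaves visible on a time grid; unlike the jump itself it only
  involves finitely many times.\<close>

definition hops :: "real \<Rightarrow> real set \<Rightarrow> real set \<Rightarrow> nat \<Rightarrow> 'w set" where
  "hops \<tau> U V n = (\<Union>i\<in>{..<n}. {\<omega> \<in> space M. Y (real i * (\<tau> / real n)) \<omega> \<in> U \<and> Y (real i * (\<tau> / real n) + \<tau> / real n) \<omega> \<in> V})"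

lemma hops_measurable:
  assumes "\<tau> > 0" "U \<in> sets borel" "V \<in> sets borel" shows "hops \<tau> U V n \<in> sets M"
proof -
  have "{\<omega> \<in> space M. Y s \<omega> \<in> U \<and> Y s' \<omega> \<in> V} \<in> sets M" if s: "s \<ge> 0" "s' \<ge> 0" for s s'
  proof -
    have [measurable]: "X s \<in> M \<rightarrow>\<^sub>M borel" "X s' \<in> M \<rightarrow>\<^sub>M borel" using s by simp_all
    have [measurable]: "U \<in> sets borel" "V \<in> sets borel" using assms by auto
    show ?thesis by measurable
  qed
  then show ?thesis unfolding hops_def using assms(1) by (intro sets.finite_UN) auto
qed

text \<open>There are \<open>n\<close> steps, and each of them has probability at most a power of \<open>n\<close> times
  \<open>exp (- e\<^sup>2 n / (4 \<tau>))\<close>.\<close>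

lemma hops_vanish:
  assumes \<tau>: "\<tau> > 0" and U: "U \<in> sets borel" "\<And>u. u \<in> U \<Longrightarrow> u \<le> m" and V: "V \<in> sets borel"
    and e: "e > 0" and sep: "\<And>u v. u \<in> U \<Longrightarrow> v \<in> V \<Longrightarrow> e \<le> \<bar>v - u\<bar>"
  shows "(\<lambda>n. measure M (hops \<tau> U V n)) \<longlonglongrightarrow> 0"
proof -
  interpret M: prob_space M by (rule prob_M)
  obtain C where C: "C \<ge> 0" "\<And>h r e A. 0 < h \<Longrightarrow> h \<le> 1 \<Longrightarrow> 0 \<le> r \<Longrightarrow> r \<le> m \<Longrightarrow> e \<ge> 0 \<Longrightarrow>
    A \<in> sets (restrict_space borel {0..}) \<Longrightarrow> (\<And>s. s \<in> A \<Longrightarrow> e \<le> \<bar>s - r\<bar>) \<Longrightarrow>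
    emeasure (B h r) A \<le> ennreal (C * (h powr - \<kappa> * exp (- e\<^sup>2 / (4 * h))))"
    using B_escape by blast
  have V0: "V \<inter> {0..} \<in> sets (restrict_space borel {0..})" using V by (simp add: sets_restrict_space_iff)
  have one: "measure M {\<omega> \<in> space M. Y s \<omega> \<in> U \<and> Y (s + h) \<omega> \<in> V} \<le> C * (h powr - \<kappa> * exp (- e\<^sup>2 / (4 * h)))"
    if s: "s \<ge> 0" and h: "0 < h" "h \<le> 1" for s h
  proof -
    let ?q = "C * (h powr - \<kappa> * exp (- e\<^sup>2 / (4 * h)))"
    let ?B = "RP.cylinder {s} (\<lambda>_. U)"
    have good: "RP.good s ?B" by (rule RP.good_cylinder) (use s U in auto)
    have [measurable]: "X s \<in> M \<rightarrow>\<^sub>M borel" "X (s + h) \<in> M \<rightarrow>\<^sub>M borel" "U \<in> sets borel" "V \<in> sets borel"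
      using s h U V by simp_all
    have meas: "{\<omega> \<in> space M. Y s \<omega> \<in> U \<and> Y (s + h) \<omega> \<in> V} \<in> sets M" by measurable
    have "emeasure M {\<omega> \<in> space M. Y s \<omega> \<in> U \<and> Y (s + h) \<omega> \<in> V}
        = (\<integral>\<^sup>+\<omega>. indicator {\<omega> \<in> space M. Y s \<omega> \<in> U \<and> Y (s + h) \<omega> \<in> V} \<omega> \<partial>M)"
      using meas by simp
    also have "\<dots> = (\<integral>\<^sup>+\<omega>. indicator (V \<inter> {0..}) (Y (s + h) \<omega>) * indicator ?B \<omega> \<partial>M)"
      by (intro nn_integral_cong) (auto simp: RP.cylinder_def indicator_def)
    also have "\<dots> = (\<integral>\<^sup>+\<omega>. emeasure (B h (Y s \<omega>)) (V \<inter> {0..}) * indicator ?B \<omega> \<partial>M)"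
      by (rule RP.good_transition[OF good s less_imp_le[OF h(1)] V0])
    also have "\<dots> \<le> (\<integral>\<^sup>+\<omega>. ennreal ?q \<partial>M)"
    proof (rule nn_integral_mono)
      fix \<omega>
      show "emeasure (B h (Y s \<omega>)) (V \<inter> {0..}) * indicator ?B \<omega> \<le> ennreal ?q"
      proof (cases "\<omega> \<in> ?B")
        case True
        then have "Y s \<omega> \<in> U" by (simp add: RP.cylinder_def)
        then have "emeasure (B h (Y s \<omega>)) (V \<inter> {0..}) \<le> ennreal ?q"
          using U(2) sep e by (intro C(2)[OF h _ _ _ V0]) auto
        then show ?thesis using True by simp
      qed simp
    qed
    also have "\<dots> = ennreal ?q" by (simp add: M.emeasure_space_1)
    finally show ?thesis using C(1) by (simp add: M.emeasure_eq_measure)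
  qed
  have le: "measure M (hops \<tau> U V n) \<le> real n * (C * ((\<tau> / real n) powr - \<kappa> * exp (- e\<^sup>2 / (4 * (\<tau> / real n)))))"
    if n: "real n \<ge> \<tau>" for n
  proof -
    have n0: "real n > 0" using n \<tau> by simp
    let ?h = "\<tau> / real n"
    have h: "0 < ?h" "?h \<le> 1" using \<tau> n n0 by simp_all
    have [measurable]: "U \<in> sets borel" "V \<in> sets borel" using U V by auto
    have "measure M (hops \<tau> U V n) \<le> (\<Sum>i<n. measure M {\<omega> \<in> space M. Y (real i * ?h) \<omega> \<in> U \<and> Y (real i * ?h + ?h) \<omega> \<in> V})"
      unfolding hops_def
    proof (rule M.finite_measure_subadditive_finite)
      show "(\<lambda>i. {\<omega> \<in> space M. Y (real i * ?h) \<omega> \<in> U \<and> Y (real i * ?h + ?h) \<omega> \<in> V}) ` {..<n} \<subseteq> sets M"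
      proof (rule image_subsetI)
        fix i
        have "0 \<le> real i * ?h" using h by (intro mult_nonneg_nonneg) simp_all
        moreover from this have "0 \<le> real i * ?h + ?h" using h by linarith
        ultimately
        have [measurable]: "X (real i * ?h) \<in> M \<rightarrow>\<^sub>M borel" "X (real i * ?h + ?h) \<in> M \<rightarrow>\<^sub>M borel"
          by (auto intro: X_measurable)
        show "{\<omega> \<in> space M. Y (real i * ?h) \<omega> \<in> U \<and> Y (real i * ?h + ?h) \<omega> \<in> V} \<in> sets M" by measurable
      qed
    qed simp
    also have "\<dots> \<le> (\<Sum>i<n. C * (?h powr - \<kappa> * exp (- e\<^sup>2 / (4 * ?h))))"
    proof (rule sum_mono)
      fix i
      have "0 \<le> real i * ?h" using h by (intro mult_nonneg_nonneg) simp_all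
      then show "measure M {\<omega> \<in> space M. Y (real i * ?h) \<omega> \<in> U \<and> Y (real i * ?h + ?h) \<omega> \<in> V}
          \<le> C * (?h powr - \<kappa> * exp (- e\<^sup>2 / (4 * ?h)))" by (rule one[OF _ h])
    qed
    finally show ?thesis by simp
  qed
  define b where "b = e\<^sup>2 / (4 * \<tau>)"
  have b: "b > 0" using \<tau> e by (simp add: b_def)
  have "((\<lambda>n. real n powr a * exp (- b * real n)) \<longlongrightarrow> 0) sequentially" if "a > 0" for a :: real
    using b that by real_asymp
  from this[of "1 + \<kappa>"]
  have "((\<lambda>n. real n powr (1 + \<kappa>) * exp (- b * real n)) \<longlongrightarrow> 0) sequentially"
    using kappa_ge by simp
  then have "((\<lambda>n. C * \<tau> powr - \<kappa> * (real n powr (1 + \<kappa>) * exp (- b * real n))) \<longlongrightarrow> 0) sequentially"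
    by (rule tendsto_mult_right_zero)
  moreover have "\<forall>\<^sub>F n in sequentially. C * \<tau> powr - \<kappa> * (real n powr (1 + \<kappa>) * exp (- b * real n))
      = real n * (C * ((\<tau> / real n) powr - \<kappa> * exp (- e\<^sup>2 / (4 * (\<tau> / real n)))))"
    using eventually_gt_at_top[of 0]
  proof eventually_elim
    case (elim n)
    have "(\<tau> / real n) powr - \<kappa> = \<tau> powr - \<kappa> * real n powr \<kappa>"
      using \<tau> elim by (simp add: powr_divide powr_minus_divide)
    moreover have "real n powr (1 + \<kappa>) = real n * real n powr \<kappa>" using elim by (simp add: powr_add)
    moreover have "- e\<^sup>2 / (4 * (\<tau> / real n)) = - b * real n" by (simp add: b_def)
    ultimately show ?case by simp
  qed
  ultimately have "((\<lambda>n. real n * (C * ((\<tau> / real n) powr - \<kappa> * exp (- e\<^sup>2 / (4 * (\<tau> / real n)))))) \<longlongrightarrow> 0) sequentially"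
    by (rule Lim_transform_eventually)
  then show ?thesis
  proof (rule Lim_null_comparison[rotated])
    show "\<forall>\<^sub>F n in sequentially. norm (measure M (hops \<tau> U V n)) \<le> real n * (C * ((\<tau> / real n) powr - \<kappa> * exp (- e\<^sup>2 / (4 * (\<tau> / real n)))))"
      using eventually_ge_at_top[of "nat \<lceil>\<tau>\<rceil>"]
    proof eventually_elim
      case (elim n)
      then have "\<tau> \<le> real n" by linarith
      then show ?case using le by simp
    qed
  qed
qed

definition persistent_hops :: "real \<Rightarrow> real set \<Rightarrow> real set \<Rightarrow> 'w set" where
  "persistent_hops \<tau> U V = (\<Union>n0. \<Inter>n\<in>{n0..}. hops \<tau> U V n)"

lemma persistent_hops_null:
  assumes \<tau>: "\<tau> > 0" and U: "U \<in> sets borel" "\<And>u. u \<in> U \<Longrightarrow> u \<le> m" and V: "V \<in> sets borel"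
    and e: "e > 0" and sep: "\<And>u v. u \<in> U \<Longrightarrow> v \<in> V \<Longrightarrow> e \<le> \<bar>v - u\<bar>"
  shows "persistent_hops \<tau> U V \<in> null_sets M"
  unfolding persistent_hops_def
proof (rule null_sets_UN)
  fix n0
  interpret M: prob_space M by (rule prob_M)
  have sets: "hops \<tau> U V n \<in> sets M" for n by (rule hops_measurable[OF \<tau> U(1) V])
  have inter: "(\<Inter>n\<in>{n0..}. hops \<tau> U V n) \<in> sets M" by (intro sets.countable_INT') (auto simp: sets)
  have "measure M (\<Inter>n\<in>{n0..}. hops \<tau> U V n) \<le> 0"
  proof (rule tendsto_lowerbound)
    show "(\<lambda>n. measure M (hops \<tau> U V n)) \<longlonglongrightarrow> 0" by (rule hops_vanish[OF assms])
    show "\<forall>\<^sub>F n in sequentially. measure M (\<Inter>n\<in>{n0..}. hops \<tau> U V n) \<le> measure M (hops \<tau> U V n)"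
      using eventually_ge_at_top[of n0]
      by eventually_elim (intro M.finite_measure_mono sets, auto)
  qed (rule trivial_limit_sequentially)
  then have "measure M (\<Inter>n\<in>{n0..}. hops \<tau> U V n) = 0" using measure_nonneg[of M "\<Inter>n\<in>{n0..}. hops \<tau> U V n"] by linarith
  then show "(\<Inter>n\<in>{n0..}. hops \<tau> U V n) \<in> null_sets M" using inter by (intro null_setsI) (simp_all add: M.emeasure_eq_measure)
qed

text \<open>On a fine grid the last point before the jump time lies where the path is close to its left limit, and
  the next point, by right-continuity, where the path is close to its value after the jump.\<close>

lemma jump_persistent:
  assumes \<omega>: "\<omega> \<in> space M" and t: "0 < t" "t \<le> \<tau>"
    and left: "((\<lambda>s. Y s \<omega>) \<longlongrightarrow> l) (at_left t)" and right: "continuous (at_right t) (\<lambda>s. Y s \<omega>)"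
    and U: "open U" "l \<in> U" and V: "open V" "Y t \<omega> \<in> V"
  shows "\<omega> \<in> persistent_hops \<tau> U V"
proof -
  have "\<forall>\<^sub>F s in at_left t. Y s \<omega> \<in> U" using topological_tendstoD[OF left U] .
  then obtain a where a: "a < t" "\<And>s. a < s \<Longrightarrow> s < t \<Longrightarrow> Y s \<omega> \<in> U"
    unfolding eventually_at_left_field by blast
  have "((\<lambda>s. Y s \<omega>) \<longlongrightarrow> Y t \<omega>) (at_right t)" using right by (simp add: continuous_within)
  then have "\<forall>\<^sub>F s in at_right t. Y s \<omega> \<in> V" using topological_tendstoD[OF _ V] by blast
  then obtain b where b: "t < b" "\<And>s. t < s \<Longrightarrow> s < b \<Longrightarrow> Y s \<omega> \<in> V"
    unfolding eventually_at_right_field by blast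
  have b': "Y s \<omega> \<in> V" if "t \<le> s" "s < b" for s using that b(2)[of s] V(2) by (cases "s = t") auto
  have \<tau>: "\<tau> > 0" using t by linarith
  define d where "d = min (t - a) (b - t)"
  have d: "d > 0" using a b by (simp add: d_def)
  obtain n0 :: nat where n0: "real n0 > \<tau> / d" "n0 > 0"
    using reals_Archimedean2[of "max 1 (\<tau> / d)"] by (metis (mono_tags) less_trans max_less_iff_conj of_nat_0_less_iff zero_less_one)
  have "\<omega> \<in> hops \<tau> U V n" if n: "n \<ge> n0" for n
  proof -
    have n_pos: "real n > 0" using n n0 by simp
    let ?h = "\<tau> / real n"
    have h: "0 < ?h" using \<tau> n_pos by simp
    have "\<tau> / d < real n" using n n0 by linarith
    then have hd: "?h < d" using d n_pos by (simp add: field_simps)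
    \<comment> \<open>The grid point strictly before \<open>t\<close> whose successor is at or after \<open>t\<close>.\<close>
    define i where "i = nat (\<lceil>t / ?h\<rceil> - 1)"
    have th: "t / ?h > 0" by (rule divide_pos_pos[OF t(1) h])
    then have ri: "real i = of_int \<lceil>t / ?h\<rceil> - 1" unfolding i_def by (simp add: of_nat_nat) 
    have i1: "real i < t / ?h" using ri ceiling_correct[of "t / ?h"] by linarith
    have i2: "t / ?h \<le> real i + 1" using ri ceiling_correct[of "t / ?h"] by linarith
    have "t / ?h \<le> real n" using t n_pos \<tau> by (simp add: field_simps)
    then have "i < n" using i1 by linarith
    have lo: "real i * ?h < t" using i1 h by (simp only: pos_less_divide_eq)
    have hi: "t \<le> real i * ?h + ?h" using i2 h by (simp only: pos_divide_le_eq distrib_right mult_1)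
    have "a < real i * ?h" using hi hd by (simp add: d_def)
    then have "Y (real i * ?h) \<omega> \<in> U" using a(2) lo by blast
    moreover have "real i * ?h + ?h < b" using lo hd by (simp add: d_def)
    then have "Y (real i * ?h + ?h) \<omega> \<in> V" using b' hi by blast
    ultimately show ?thesis unfolding hops_def using \<open>i < n\<close> \<omega> by blast
  qed
  then show ?thesis unfolding persistent_hops_def by blast
qed

text \<open>Rational balls make the union countable; the condition on the centres keeps the balls at
  distance at least the radius from each other.\<close>

definition jump_set :: "'w set" where
  "jump_set = (\<Union>(p, q, d, \<tau>) \<in> {(p, q, d, \<tau> :: nat). p \<in> \<rat> \<and> q \<in> \<rat> \<and> d \<in> \<rat> \<and> 0 < d \<and> 3 * d \<le> \<bar>p - q\<bar> \<and> 0 < \<tau>}.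
     persistent_hops (real \<tau>) (ball p d) (ball q d))"

lemma jump_set_null: "jump_set \<in> null_sets M"
  unfolding jump_set_def
proof (rule null_sets_UN')
  have "{(p, q, d, \<tau> :: nat). p \<in> \<rat> \<and> q \<in> \<rat> \<and> d \<in> \<rat> \<and> 0 < d \<and> 3 * d \<le> \<bar>p - q\<bar> \<and> 0 < \<tau>}
      \<subseteq> (\<rat> :: real set) \<times> (\<rat> :: real set) \<times> (\<rat> :: real set) \<times> (UNIV :: nat set)" by auto
  moreover have "countable ((\<rat> :: real set) \<times> (\<rat> :: real set) \<times> (\<rat> :: real set) \<times> (UNIV :: nat set))"
    by (intro countable_SIGMA countable_rat) auto
  ultimately show "countable {(p :: real, q :: real, d :: real, \<tau> :: nat). p \<in> \<rat> \<and> q \<in> \<rat> \<and> d \<in> \<rat> \<and> 0 < d \<and> 3 * d \<le> \<bar>p - q\<bar> \<and> 0 < \<tau>}"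
    by (rule countable_subset)
  fix x :: "real \<times> real \<times> real \<times> nat"
  assume "x \<in> {(p, q, d, \<tau> :: nat). p \<in> \<rat> \<and> q \<in> \<rat> \<and> d \<in> \<rat> \<and> 0 < d \<and> 3 * d \<le> \<bar>p - q\<bar> \<and> 0 < \<tau>}"
  then obtain p q d \<tau> where x: "x = (p, q, d, \<tau>)" and d: "0 < d" "3 * d \<le> \<bar>p - q\<bar>" and \<tau>: "0 < \<tau>" by auto
  have "persistent_hops (real \<tau>) (ball p d) (ball q d) \<in> null_sets M"
  proof (rule persistent_hops_null[where m = "p + d" and e = d])
    show "d \<le> \<bar>v - u\<bar>" if "u \<in> ball p d" "v \<in> ball q d" for u v
      using that d by (auto simp: dist_real_def abs_if split: if_splits)
  qed (use \<tau> d in \<open>auto simp: dist_real_def\<close>)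
  then show "(case x of (p, q, d, \<tau>) \<Rightarrow> persistent_hops (real \<tau>) (ball p d) (ball q d)) \<in> null_sets M" by (simp add: x)
qed

lemma continuous_off_jump_set:
  assumes \<omega>: "\<omega> \<in> space M" "\<omega> \<notin> jump_set" shows "continuous_on {0..} (\<lambda>t. Y t \<omega>)"
proof -
  have right: "continuous (at_right t) (\<lambda>s. Y s \<omega>)" if "t \<ge> 0" for t
  proof -
    have "continuous (at_right t) (\<lambda>s. X s \<omega>)" using rcll \<omega>(1) that by (simp add: rcll_paths_def)
    then show ?thesis by (rule continuous_norm)
  qed
  have left: "((\<lambda>s. Y s \<omega>) \<longlongrightarrow> Y t \<omega>) (at_left t)" if t: "t > 0" for t
  proof -
    obtain x where "((\<lambda>s. X s \<omega>) \<longlongrightarrow> x) (at_left t)" using rcll \<omega>(1) t unfolding rcll_paths_def by blast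
    then have lim: "((\<lambda>s. Y s \<omega>) \<longlongrightarrow> norm x) (at_left t)" by (rule tendsto_norm)
    have "norm x = Y t \<omega>"
    proof (rule ccontr)
      assume ne: "norm x \<noteq> Y t \<omega>"
      \<comment> \<open>Centres within \<open>d\<close> of the two values are then still \<open>3 d\<close> apart.\<close>
      then have "0 < \<bar>norm x - Y t \<omega>\<bar> / 5" by simp
      then obtain d where d: "d \<in> \<rat>" "0 < d" "d < \<bar>norm x - Y t \<omega>\<bar> / 5" using Rats_dense_in_real by blast
      obtain p where p: "p \<in> \<rat>" "norm x - d < p" "p < norm x + d" using Rats_dense_in_real[of "norm x - d" "norm x + d"] d(2) by auto
      obtain q where q: "q \<in> \<rat>" "Y t \<omega> - d < q" "q < Y t \<omega> + d" using Rats_dense_in_real[of "Y t \<omega> - d" "Y t \<omega> + d"] d(2) by auto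
      obtain \<tau> :: nat where \<tau>: "t \<le> real \<tau>" using real_arch_simple by blast
      then have T0: "0 < \<tau>" using t by (cases \<tau>) auto
      have "\<omega> \<in> persistent_hops (real \<tau>) (ball p d) (ball q d)"
        by (rule jump_persistent[OF \<omega>(1) t \<tau> lim right]) (use t p q in \<open>auto simp: dist_real_def\<close>)
      moreover have "3 * d \<le> \<bar>p - q\<bar>" using p q d by (auto simp: abs_if split: if_splits)
      ultimately have "\<omega> \<in> jump_set" unfolding jump_set_def using p(1) q(1) d T0 by blast
      then show False using \<omega>(2) by simp
    qed
    then show ?thesis using lim by simp
  qed
  show ?thesis
    unfolding continuous_on_eq_continuous_within
  proof
    fix t :: real assume "t \<in> {0..}"
    then consider "t = 0" | "t > 0" by fastforce
    then show "continuous (at t within {0..}) (\<lambda>t. Y t \<omega>)"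
    proof cases
      case 1
      have "continuous (at_right 0) (\<lambda>s. Y s \<omega>)" by (rule right) simp
      then show ?thesis
        using 1 by (simp add: continuous_within at_within_Ici_at_right)
    next
      case 2
      then have "isCont (\<lambda>s. Y s \<omega>) t"
        using left[OF 2] right[of t] by (simp add: continuous_at_split) (simp add: continuous_within)
      then show ?thesis by (rule continuous_at_imp_continuous_at_within)
    qed
  qed
qed

theorem radial_part_continuous: "has_continuous_modification M {0..} Y"
  unfolding has_continuous_modification_def
proof (intro exI conjI allI impI ballI)
  let ?Z = "\<lambda>t \<omega>. if \<omega> \<in> jump_set then 0 else Y t \<omega>"
  have J: "jump_set \<in> sets M" using jump_set_null by auto
  show "?Z t \<in> M \<rightarrow>\<^sub>M restrict_space borel {0..}" if "t \<ge> 0" for t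
    using Y_measurable[OF that] J
    by (intro measurable_If_set) (auto simp: space_restrict_space sets.Int_space_eq2)
  show "AE \<omega> in M. ?Z t \<omega> = Y t \<omega>" for t
    using AE_not_in[OF jump_set_null] by eventually_elim simp
  show "continuous_on {0..} (\<lambda>t. ?Z t \<omega>)" if "\<omega> \<in> space M" for \<omega>
    using continuous_off_jump_set[OF that] by (cases "\<omega> \<in> jump_set") simp_all
qed

theorem radial_part_bessel: "bessel_process (mult_gamma Rp k + real CARD('n) / 2 - 1 / 2) \<rho> M Y"
  unfolding bessel_process_def
proof (intro conjI exI)
  show "0 \<le> mult_gamma Rp k + real CARD('n) / 2 - 1 / 2" using kappa_ge by (simp add: \<kappa>_def)
  show "feller_process M {0..} B Y"
    unfolding feller_process_def using feller_B RP.markov_image by blast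
  show "\<forall>t>0. \<forall>x\<ge>0. \<forall>A\<in>sets (restrict_space borel {0..}). complex_of_real (measure (B t x) A)
      = bessel_transition (mult_gamma Rp k + real CARD('n) / 2 - 1 / 2) \<rho> t x A"
    using bessel_transition_B by blast
  show "has_continuous_modification M {0..} Y" by (rule radial_part_continuous)
qed simp

end

theorem proposition3p7:
  fixes R Rp :: "(real^'n) set" and k :: "real^'n \<Rightarrow> real" and lam :: "real^'n"
    and M :: "'w measure" and X :: "real \<Rightarrow> 'w \<Rightarrow> real^'n"
  assumes "root_system R" and "positive_subsystem R Rp" and "multiplicity_fun R k"
    and "dunkl_process Rp k lam M X"
    and "dunkl_radial Rp k lam (distr M borel (X 0))"
  shows "(\<forall>t\<ge>0. dunkl_radial Rp k lam (distr M borel (X t))) \<and>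
         bessel_process (mult_gamma Rp k + real CARD('n) / 2 - 1 / 2) (norm lam) M
           (\<lambda>t \<omega>. norm (X t \<omega>))"
proof -
  obtain K where K: "feller_process M UNIV K X"
    "\<forall>t>0. \<forall>x. \<forall>A\<in>sets borel. complex_of_real (measure (K t x) A) = dunkl_transition Rp k lam t x A"
    "rcll_paths M X"
    using assms(4) unfolding dunkl_process_def by blast
  interpret dunkl_motion R Rp k lam M X K
    by unfold_locales (use assms K in \<open>auto simp: feller_process_def\<close>)
  show ?thesis using law_dunkl_radial radial_part_bessel by blast
qed

end
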